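(* Let $n\ge2$. The combinatorial $n+n$ symbic trees form a simplicial complex $\Delta_n$: its vertices are the symmetry classes of splits occurring in symbic trees, and its faces are the collections of symmetry classes of splits of combinatorial symbic trees. The tropical variety of symmetric real $n\times n$ matrices of symmetric tropical rank $2$ has a simplicial fan structure (modulo the linear space $L=\{(X_i+X_j)_{i,j}\mid X\in\mathbb{R}^n\}$) with this simplicial complex: its cones are the closures $\overline{C_{\mathcal T}}$, where $\mathcal T$ ranges over the combinatorial $n+n$ symbic trees, and $\mathcal T\mapsto\overline{C_{\mathcal T}}$ is a bijection respecting the face structure of $\Delta_n$.
   Context: **Symmetric tropical rank.** Let $x_{ij}=x_{ji}$, $1\le i\le j\le n$, be the variables of a generic symmetric matrix. A symmetric real $n\times n$ matrix $A$ has symmetric tropical rank $2$ if for every $3\times3$ minor of the generic symmetric matrix, regarded as a polynomial in the $\binom{n+1}{2}$ variables $x_{ij}$ ($i\le j$) (in characteristic $0$, trivial valuation), the minimum over its distinct monomials $\prod x_{ij}^{m_{ij}}$ of $\sum m_{ij}A_{ij}$ is attained by at least two distinct monomials (so this means rank at most 2). The set of such matrices is the tropicalization of the variety of symmetric matrices of rank at most $2$ in characteristic $0$ (a theorem of Zwick). **Symbic trees.** A split of a tree is a partition of the leaf labels obtained by removing an internal (non-leaf) edge. An $n+n$ symbic tree is a metric tree on leaves labelled $1,\dots,n,1',\dots,n'$ (unprimed and primed labels are two colors; no unlabelled vertices of degree 2; lengths of leaf edges disregarded) such that (1) each split contains both colors on both sides; (2) internal edges have positive lengths; (3) the metric tree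 is symmetric with respect to the involution swapping $i$ and $i'$ for all $i$; (4) the fixed points of the involution form a path (possibly a single point, possibly the midpoint of an edge). A combinatorial symbic tree is a symbic tree without the metric data; it is determined by its set of splits, which is invariant under the involution. A symmetry class of splits is an orbit of splits under the involution. **The tree $T_A$ and the cones $C_{\mathcal T}$.** Use tropical arithmetic $\oplus=\min$, $\odot=+$. For a symmetric $n\times n$ matrix $A$ of symmetric tropical rank $2$, let $P$ be the tropical convex hull of its columns (all tropical linear combinations) in $\mathbb{R}^n/\mathbb{R}(1,\dots,1)$; it is a tree made of line segments, with lengths measured by $d(x,y)=\max_i(x_i-y_i)-\min_i(x_i-y_i)$. There is a unique way to attach to $P$ one infinite ray in each coordinate direction $\mathbf e_1,\dots,\mathbf e_n$ making it balanced (at each vertex the primitive lattice directions of emanating edges sum into $\mathbb{R}(1,\dots,1)$). $T_A$ is obtained from $P$ by attaching a leaf $i$ at the location of the $i$-th column and a leaf $j'$ where the ray $\mathbf e_j$ is attached; it is a symbic tree. For a combinatorial symbic tree $\mathcal T$, $C_{\mathcal T}$ is the set of symmetric matrices $A$ of symmetric tropical rank $2$ such that $T_A$ has combinatorial type $\mathcal T$. *)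

theory Defs
  imports "HOL-Analysis.Analysis" "HOL-Library.Poly_Mapping" "HOL-Library.Uprod"
begin

section \<open>Symmetric tropical rank two\<close>

text \<open>Multivariate polynomials are finitely supported functions from monomials (exponent
  functions of finite support) to coefficients. The variables \<open>x_ij = x_ji\<close> are indexed by
  unordered pairs \<open>Upair i j\<close> (with \<open>i = j\<close> allowed). Distinct permutations may contribute to
  the same monomial; by taking the support \<open>keys\<close> of the determinant, such monomials count once.\<close>

type_synonym 'n sym_monomial = "'n uprod \<Rightarrow>\<^sub>0 nat"
type_synonym 'n sym_poly = "'n sym_monomial \<Rightarrow>\<^sub>0 rat"

definition sym_var :: "'n \<Rightarrow> 'n \<Rightarrow> 'n sym_poly" where
  "sym_var i j = Poly_Mapping.single (Poly_Mapping.single (Upair i j) 1) 1"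

definition generic_sym_minor :: "(3 \<Rightarrow> 'n) \<Rightarrow> (3 \<Rightarrow> 'n) \<Rightarrow> 'n sym_poly" where
  "generic_sym_minor r c = det ((\<chi> a b. sym_var (r a) (c b)) :: 'n sym_poly ^ 3 ^ 3)"

text \<open>Well defined only for symmetric \<open>A\<close>.\<close>
definition sym_entry :: "real ^ 'n ^ 'n \<Rightarrow> 'n uprod \<Rightarrow> real" where
  "sym_entry A e = (THE a. \<exists>i j. e = Upair i j \<and> a = A $ i $ j)"

definition monomial_weight :: "real ^ 'n ^ 'n \<Rightarrow> 'n sym_monomial \<Rightarrow> real" where
  "monomial_weight A m = (\<Sum>e\<in>Poly_Mapping.keys m. real (Poly_Mapping.lookup m e) * sym_entry A e)"

definition min_attained_twice :: "('m \<Rightarrow> real) \<Rightarrow> 'm set \<Rightarrow> bool" where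
  "min_attained_twice w M \<longleftrightarrow>
     (\<exists>m\<in>M. \<exists>m'\<in>M. m \<noteq> m' \<and> (\<forall>k\<in>M. w m \<le> w k \<and> w m' \<le> w k))"

definition sym_trop_rank2 :: "(real ^ 'n::finite ^ 'n) set" where
  "sym_trop_rank2 = {A. transpose A = A \<and>
     (\<forall>r c. inj r \<longrightarrow> inj c \<longrightarrow>
        min_attained_twice (monomial_weight A) (Poly_Mapping.keys (generic_sym_minor r c)))}"

section \<open>Leaf-labelled metric trees\<close>

definition simple_path :: "'v set set \<Rightarrow> 'v list \<Rightarrow> bool" where
  "simple_path E p \<longleftrightarrow> p \<noteq> [] \<and> distinct p \<and> successively (\<lambda>u v. {u, v} \<in> E) p"

definition is_tree :: "'v set \<Rightarrow> 'v set set \<Rightarrow> bool" where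
  "is_tree V E \<longleftrightarrow> finite V \<and> V \<noteq> {} \<and>
     (\<forall>e\<in>E. \<exists>u\<in>V. \<exists>v\<in>V. u \<noteq> v \<and> e = {u, v}) \<and>
     (\<forall>u\<in>V. \<forall>v\<in>V. \<exists>!p. simple_path E p \<and> hd p = u \<and> last p = v)"

text \<open>\<open>Inl i\<close> is the unprimed label \<open>i\<close> and \<open>Inr i\<close> is the primed label \<open>i'\<close>. Since trees are
  finite, taking vertices in \<open>nat\<close> loses no generality. Only the values of \<open>len\<close> on internal edges
  matter.\<close>

record 'n mtree =
  verts :: "nat set"
  edges :: "nat set set"
  leaf :: "'n + 'n \<Rightarrow> nat"
  len :: "nat set \<Rightarrow> real"

definition degree_in :: "'n mtree \<Rightarrow> nat \<Rightarrow> nat" where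
  "degree_in T v = card {e \<in> edges T. v \<in> e}"

definition labelled_tree :: "'n mtree \<Rightarrow> bool" where
  "labelled_tree T \<longleftrightarrow> is_tree (verts T) (edges T) \<and>
     bij_betw (leaf T) UNIV {v \<in> verts T. degree_in T v = 1} \<and>
     (\<forall>v\<in>verts T. degree_in T v \<noteq> 2)"

definition inner_verts :: "'n mtree \<Rightarrow> nat set" where
  "inner_verts T = verts T - range (leaf T)"

definition internal_edges :: "'n mtree \<Rightarrow> nat set set" where
  "internal_edges T = {e \<in> edges T. e \<subseteq> inner_verts T}"

type_synonym 'n split = "('n + 'n) set set"

definition same_component :: "'n mtree \<Rightarrow> nat set \<Rightarrow> (('n + 'n) \<times> ('n + 'n)) set" where
  "same_component T e = {(k, l). (leaf T k, leaf T l) \<in> {(u, v). {u, v} \<in> edges T - {e}}\<^sup>*}"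

definition split_of :: "'n mtree \<Rightarrow> nat set \<Rightarrow> 'n split" where
  "split_of T e = UNIV // same_component T e"

definition splits :: "'n mtree \<Rightarrow> 'n split set" where
  "splits T = split_of T ` internal_edges T"

section \<open>Symbic trees\<close>

definition swap_label :: "'n + 'n \<Rightarrow> 'n + 'n" where
  "swap_label = case_sum Inr Inl"

text \<open>The involution as an isometry of the tree. It is determined on \<open>verts T\<close> by the leaf
  labels.\<close>
definition swap_automorphism :: "'n mtree \<Rightarrow> (nat \<Rightarrow> nat) \<Rightarrow> bool" where
  "swap_automorphism T \<tau> \<longleftrightarrow> bij_betw \<tau> (verts T) (verts T) \<and>
     (\<lambda>e. \<tau> ` e) ` edges T = edges T \<and>
     (\<forall>l. \<tau> (leaf T l) = leaf T (swap_label l)) \<and>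
     (\<forall>e\<in>internal_edges T. len T (\<tau> ` e) = len T e)"

text \<open>The fixed points of \<open>\<tau>\<close> in the metric tree are the fixed vertices, all points of the edges
  with two fixed end points, and the midpoints of the edges whose end points are exchanged. They
  form a path iff either there are no midpoints and the fixed vertices are the vertices of a path,
  or there is only a single midpoint.\<close>
definition fixed_points_path :: "'n mtree \<Rightarrow> (nat \<Rightarrow> nat) \<Rightarrow> bool" where
  "fixed_points_path T \<tau> \<longleftrightarrow>
     (let Fix = {v \<in> verts T. \<tau> v = v};
          Flip = {e \<in> edges T. \<tau> ` e = e \<and> (\<forall>v\<in>e. \<tau> v \<noteq> v)}
      in (Flip = {} \<and> (\<exists>p. simple_path (edges T) p \<and> set p = Fix)) \<or>
         (Fix = {} \<and> (\<exists>e. Flip = {e})))"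

definition symbic_tree :: "'n mtree \<Rightarrow> bool" where
  "symbic_tree T \<longleftrightarrow> labelled_tree T \<and>
     (\<forall>S\<in>splits T. \<forall>X\<in>S. (\<exists>i. Inl i \<in> X) \<and> (\<exists>i. Inr i \<in> X)) \<and>
     (\<forall>e\<in>internal_edges T. len T e > 0) \<and>
     (\<exists>\<tau>. swap_automorphism T \<tau> \<and> fixed_points_path T \<tau>)"

text \<open>A combinatorial tree is identified with its set of splits, which determines it.\<close>
definition combinatorial_symbic_trees :: "'n split set set" where
  "combinatorial_symbic_trees = {splits T | T. symbic_tree T}"

section \<open>The simplicial complex\<close>

definition swap_split :: "'n split \<Rightarrow> 'n split" where
  "swap_split S = (\<lambda>X. swap_label ` X) ` S"

definition symmetry_class :: "'n split \<Rightarrow> 'n split set" where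
  "symmetry_class S = {S, swap_split S}"

definition Delta_face :: "'n split set \<Rightarrow> 'n split set set" where
  "Delta_face \<T> = symmetry_class ` \<T>"

definition Delta_vertices :: "'n split set set" where
  "Delta_vertices = (\<Union>\<T>\<in>combinatorial_symbic_trees. symmetry_class ` \<T>)"

definition Delta_faces :: "'n split set set set" where
  "Delta_faces = Delta_face ` combinatorial_symbic_trees"

text \<open>The empty set counts as a face.\<close>
definition abstract_simplicial_complex :: "'a set \<Rightarrow> 'a set set \<Rightarrow> bool" where
  "abstract_simplicial_complex V F \<longleftrightarrow>
     (\<forall>\<sigma>\<in>F. finite \<sigma> \<and> \<sigma> \<subseteq> V) \<and> (\<forall>\<sigma>\<in>F. \<forall>\<rho>\<subseteq>\<sigma>. \<rho> \<in> F) \<and> {} \<in> F \<and> (\<forall>v\<in>V. {v} \<in> F)"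

section \<open>The tree of a matrix\<close>

text \<open>Here \<open>1 :: real ^ 'n\<close> is the all-ones vector. Subsets of the quotient by its span are
  represented by their preimages, and equality in the quotient by \<open>x - y \<in> span {1}\<close>.\<close>

definition trop_hull :: "real ^ 'n::finite ^ 'n \<Rightarrow> (real ^ 'n) set" where
  "trop_hull A = {x. \<exists>c :: 'n \<Rightarrow> real. \<forall>i. x $ i = Min (range (\<lambda>j. c j + column j A $ i))}"

definition trop_dist :: "real ^ 'n::finite \<Rightarrow> real ^ 'n \<Rightarrow> real" where
  "trop_dist x y = Max (range (\<lambda>i. x $ i - y $ i)) - Min (range (\<lambda>i. x $ i - y $ i))"

text \<open>Primitive vectors of the lattice of integer vectors modulo the all-ones vector, each
  represented by its unique representative with minimal entry \<open>0\<close>; primitivity means that this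
  representative has coprime entries. The set \<open>directions P p\<close> consists of those along which
  a line segment in \<open>P\<close> emanates from \<open>p\<close>. If \<open>P\<close> is a tree then it is finite, and it has the form
  \<open>{u, -u}\<close> up to the all-ones vector at every point in the relative interior of a segment,
  so that demanding balancing at all points of \<open>P\<close> is the same as demanding it at the vertices.\<close>

definition real_vec :: "nat ^ 'n \<Rightarrow> real ^ 'n" where
  "real_vec u = (\<chi> i. real (u $ i))"

definition directions :: "(real ^ 'n::finite) set \<Rightarrow> real ^ 'n \<Rightarrow> (nat ^ 'n) set" where
  "directions P p = {u. (\<exists>i. u $ i = 0) \<and> Gcd (range (\<lambda>i. u $ i)) = 1 \<and>
     (\<exists>\<epsilon>>0. \<forall>t\<in>{0..\<epsilon>}. p + t *\<^sub>R real_vec u \<in> P)}"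

text \<open>\<open>\<rho> j\<close> is the point of \<open>P\<close> to which the ray in direction \<open>e_j\<close> is attached.\<close>
definition balanced_rays :: "(real ^ 'n::finite) set \<Rightarrow> ('n \<Rightarrow> real ^ 'n) \<Rightarrow> bool" where
  "balanced_rays P \<rho> \<longleftrightarrow> (\<forall>j. \<rho> j \<in> P) \<and>
     (\<forall>p\<in>P. (\<Sum>u\<in>directions P p. real_vec u) + (\<Sum>j | \<rho> j - p \<in> span {1}. axis j 1) \<in> span {1})"

text \<open>Preimage of the vertex (\<open>s = {v}\<close>) or segment (\<open>s = {v, w}\<close>) with end points \<open>\<phi> ` s\<close>.\<close>
definition cell :: "('v \<Rightarrow> real ^ 'n) \<Rightarrow> 'v set \<Rightarrow> (real ^ 'n) set" where
  "cell \<phi> s = {x + y | x y. x \<in> convex hull (\<phi> ` s) \<and> y \<in> span {1}}"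

text \<open>\<open>\<phi>\<close> identifies the inner part of \<open>T\<close>, as a metric tree, with \<open>P\<close>.\<close>
definition embeds_onto :: "'n mtree \<Rightarrow> (nat \<Rightarrow> real ^ 'n::finite) \<Rightarrow> (real ^ 'n) set \<Rightarrow> bool" where
  "embeds_onto T \<phi> P \<longleftrightarrow>
     (let K = (\<lambda>v. {v}) ` inner_verts T \<union> internal_edges T
      in P = (\<Union>s\<in>K. cell \<phi> s) \<and> (\<forall>s\<in>K. \<forall>s'\<in>K. cell \<phi> s \<inter> cell \<phi> s' = cell \<phi> (s \<inter> s'))) \<and>
     (\<forall>u v. {u, v} \<in> internal_edges T \<longrightarrow> len T {u, v} = trop_dist (\<phi> u) (\<phi> v))"

text \<open>\<open>T\<close> is the tree \<open>T_A\<close>.\<close>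
definition is_tree_of :: "real ^ 'n::finite ^ 'n \<Rightarrow> 'n mtree \<Rightarrow> bool" where
  "is_tree_of A T \<longleftrightarrow> labelled_tree T \<and>
     (\<exists>\<phi> \<rho>. embeds_onto T \<phi> (trop_hull A) \<and> balanced_rays (trop_hull A) \<rho> \<and>
        (\<forall>i v. {leaf T (Inl i), v} \<in> edges T \<longrightarrow> \<phi> v - column i A \<in> span {1}) \<and>
        (\<forall>j v. {leaf T (Inr j), v} \<in> edges T \<longrightarrow> \<phi> v - \<rho> j \<in> span {1}))"

definition C_cone :: "'n::finite split set \<Rightarrow> (real ^ 'n ^ 'n) set" where
  "C_cone \<T> = {A \<in> sym_trop_rank2. \<exists>T. is_tree_of A T \<and> splits T = \<T>}"

section \<open>Simplicial fans modulo a linear space\<close>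

definition lineality :: "(real ^ 'n ^ 'n) set" where
  "lineality = {A. \<exists>X :: real ^ 'n. \<forall>i j. A $ i $ j = X $ i + X $ j}"

text \<open>The image in the quotient by \<open>L\<close> is generated by linearly independent vectors.\<close>
definition simplicial_cone_mod :: "'a::real_vector set \<Rightarrow> 'a set \<Rightarrow> bool" where
  "simplicial_cone_mod L \<sigma> \<longleftrightarrow>
     (\<exists>R. finite R \<and> independent R \<and> span R \<inter> L = {0} \<and>
          \<sigma> = {l + (\<Sum>r\<in>R. c r *\<^sub>R r) | l c. l \<in> L \<and> (\<forall>r\<in>R. 0 \<le> c r)})"

text \<open>The constant \<open>(face_of)\<close> admits the empty face, which is not a cone.\<close>
definition simplicial_fan_mod :: "'a::real_vector set \<Rightarrow> 'a set set \<Rightarrow> bool" where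
  "simplicial_fan_mod L \<F> \<longleftrightarrow> subspace L \<and> finite \<F> \<and>
     (\<forall>\<sigma>\<in>\<F>. simplicial_cone_mod L \<sigma>) \<and>
     (\<forall>\<sigma>\<in>\<F>. \<forall>F. F face_of \<sigma> \<longrightarrow> F \<noteq> {} \<longrightarrow> F \<in> \<F>) \<and>
     (\<forall>\<sigma>\<in>\<F>. \<forall>\<tau>\<in>\<F>. (\<sigma> \<inter> \<tau>) face_of \<sigma> \<and> (\<sigma> \<inter> \<tau>) face_of \<tau>)"

end

theory Submission
  imports Defs
begin

text \<open>Record a tree by the set \<open>U\<close> of the two sides of all its splits. Up to lineality, the matrix of
  a tree with edge lengths \<open>w\<close> has as entry \<open>(i, j)\<close> half the sum of \<open>w X\<close> over the sides \<open>X\<close> that contain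
  \<open>i\<close> and \<open>j'\<close>. Its cross differences \<open>a_ij + a_kl - a_il - a_kj\<close> determine \<open>U\<close> and \<open>w\<close>, since for each
  side there is a quadruple of labels that is separated by no other side. So positive combinations of
  the generators of different faces never agree modulo lineality, and this alone yields a simplicial fan.

  Every matrix of tropical rank two has such a form: a maximal cross difference exhibits a side,
  which can be subtracted with the largest possible weight. For symmetric matrices the system is
  invariant, and the minors with equal rows and columns forbid three disjoint invariant sides, which
  is the condition that the fixed points form a path. Finally, the tropical hull of such a matrix
  consists of the points of the tree of \<open>U\<close>, and the split of an edge is intrinsic to the hull: it is the
  partition of the labels by the components left when an interior point of the edge is removed.\<close>

section \<open>Weighted systems of sides\<close>

text \<open>Each split is stored by both of its sides, so \<open>U\<close> is closed under
  complement and the comparison of quadruples takes place among finite sets of labels; trees with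
  vertices appear only where the definitions of symbic trees and of \<open>is_tree_of\<close> demand
  them. Two obstacles shape the rest. In a symmetric minor different permutations may share a
  monomial, but only permutations of equal sign, and only if rows and columns are the same indices;
  so symmetric rank two is ordinary tropical rank two together with one condition on principal
  minors. Moreover \<open>is_tree_of\<close> is a relation: vertices and embedding are arbitrary, so
  a tree must be built for each matrix, and any two trees of a matrix must be shown to have the same
  splits. Between the matrix and its hull the link is a slack: the amount by which a shifted column
  exceeds a point in a coordinate is the distance of the point from the path between an unprimed and
  a primed label. The pairs of slack zero reveal the vertex or edge on which the point lies.\<close>

definition compat :: "'a set \<Rightarrow> 'a set \<Rightarrow> bool" where
  "compat X Y \<longleftrightarrow> X \<inter> Y = {} \<or> X \<inter> - Y = {} \<or> - X \<inter> Y = {} \<or> - X \<inter> - Y = {}"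

definition bicoloured :: "('n + 'n) set \<Rightarrow> bool" where
  "bicoloured X \<longleftrightarrow> (\<exists>i. Inl i \<in> X) \<and> (\<exists>i. Inr i \<in> X)"

definition side_system :: "('n + 'n) set set \<Rightarrow> bool" where
  "side_system U \<longleftrightarrow> (\<forall>X\<in>U. - X \<in> U \<and> bicoloured X) \<and> (\<forall>X\<in>U. \<forall>Y\<in>U. compat X Y)"

definition weighting :: "('n + 'n) set set \<Rightarrow> (('n + 'n) set \<Rightarrow> real) \<Rightarrow> bool" where
  "weighting U w \<longleftrightarrow> (\<forall>X\<in>U. w X > 0 \<and> w (- X) = w X)"

text \<open>Both sides of each split belong to \<open>U\<close>, with the same weight; hence the division by \<open>2\<close>.\<close>
definition gram :: "('n + 'n) set set \<Rightarrow> (('n + 'n) set \<Rightarrow> real) \<Rightarrow> 'n \<Rightarrow> 'n \<Rightarrow> real" where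
  "gram U w i j = (\<Sum>X\<in>U. w X * of_bool (Inl i \<in> X) * of_bool (Inr j \<in> X)) / 2"

text \<open>The difference of the two terms of a tropical 2 x 2 minor. Adding a function of the row
  and a function of the column does not change it, so it sees a matrix only modulo such
  shifts.\<close>

definition cross :: "('n \<Rightarrow> 'n \<Rightarrow> real) \<Rightarrow> 'n \<Rightarrow> 'n \<Rightarrow> 'n \<Rightarrow> 'n \<Rightarrow> real" where
  "cross A i j k l = A i j + A k l - A i l - A k j"

text \<open>In a tree these are the sides of the edges that lead from the path between
  \<open>i\<close> and \<open>j'\<close> to the path between \<open>k\<close> and
  \<open>l'\<close>.\<close>

definition separates :: "('n + 'n) set \<Rightarrow> 'n \<Rightarrow> 'n \<Rightarrow> 'n \<Rightarrow> 'n \<Rightarrow> bool" where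
  "separates X i j k l \<longleftrightarrow> Inl i \<in> X \<and> Inr j \<in> X \<and> Inl k \<notin> X \<and> Inr l \<notin> X"

lemma separates_compl: "separates (- X) i j k l = separates X k l i j"
  by (auto simp: separates_def)

lemma compat_sym: "compat X Y \<longleftrightarrow> compat Y X"
  unfolding compat_def by (metis Int_commute)

lemma compat_compl: "compat (- X) Y \<longleftrightarrow> compat X Y" "compat X (- Y) \<longleftrightarrow> compat X Y"
  by (simp_all add: compat_def disj_ac)

lemma compat_self: "compat X X"
  by (simp add: compat_def)

lemma compat_witnesses:
  assumes "compat X Y" "a \<in> X" "a \<in> Y" "b \<in> X" "b \<notin> Y" "c \<notin> X" "c \<in> Y" "d \<notin> X" "d \<notin> Y"
  shows False
  using assms unfolding compat_def by blast

text \<open>The labels \<open>i\<close>, \<open>j'\<close>, \<open>l'\<close>, \<open>k\<close>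
  would lie in the four different intersections of \<open>X\<close> and \<open>Y\<close> with their
  complements.\<close>

lemma compat_separates:
  assumes "compat X Y" "separates X i j k l" "separates Y i l k j" shows False
  using assms unfolding compat_def separates_def by blast

lemma side_systemD:
  assumes "side_system U" "X \<in> U"
  shows "- X \<in> U" "bicoloured X" "Y \<in> U \<Longrightarrow> compat X Y"
  using assms unfolding side_system_def by auto

lemma weightingD: "weighting U w \<Longrightarrow> X \<in> U \<Longrightarrow> w X > 0" "weighting U w \<Longrightarrow> X \<in> U \<Longrightarrow> w (- X) = w X"
  unfolding weighting_def by auto

section \<open>Cross differences of a weighted system\<close>

lemma sum_compl:
  fixes U :: "'a set set"
  assumes "\<And>X. X \<in> U \<Longrightarrow> - X \<in> U"
  shows "(\<Sum>X\<in>U. f (- X)) = (\<Sum>X\<in>U. f X)"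
  by (rule sum.reindex_bij_witness[of _ uminus uminus]) (auto simp: assms)

lemma cross_gram:
  "cross (gram U w) i j k l =
     (\<Sum>X\<in>U. w X * ((of_bool (Inl i \<in> X) - of_bool (Inl k \<in> X)) * (of_bool (Inr j \<in> X) - of_bool (Inr l \<in> X)))) / 2"
  unfolding cross_def gram_def
  by (simp add: add_divide_distrib[symmetric] diff_divide_distrib[symmetric] sum.distrib[symmetric]
      sum_subtractf[symmetric] algebra_simps)

text \<open>A summand is negative only for sides that pair the labels the other way, and these are
  incompatible with \<open>X\<close>. The remaining nonzero summands come in pairs from a side and
  its complement, which cancels the division by 2.\<close>

lemma cross_gram_separated:
  fixes U :: "('n::finite + 'n) set set"
  assumes U: "side_system U" and w: "weighting U w" and X: "X \<in> U" "separates X i j k l"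
  shows "cross (gram U w) i j k l = (\<Sum>Y | Y \<in> U \<and> separates Y i j k l. w Y)"
proof -
  have eq: "w Y * ((of_bool (Inl i \<in> Y) - of_bool (Inl k \<in> Y)) * (of_bool (Inr j \<in> Y) - of_bool (Inr l \<in> Y)))
    = w Y * of_bool (separates Y i j k l) + w (- Y) * of_bool (separates (- Y) i j k l)"
    if Y: "Y \<in> U" for Y
  proof -
    have "\<not> separates Y i l k j" "\<not> separates (- Y) i l k j"
      using compat_separates[OF _ X(2)] side_systemD[OF U X(1)] side_systemD[OF U Y] Y by metis+
    moreover have "w (- Y) = w Y" using w Y by (simp add: weighting_def)
    ultimately show ?thesis by (auto simp: separates_def)
  qed
  have "cross (gram U w) i j k l = (\<Sum>Y\<in>U. w Y * of_bool (separates Y i j k l))"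
    unfolding cross_gram
    using sum_compl[of U "\<lambda>Y. w Y * of_bool (separates Y i j k l)"] side_systemD(1)[OF U]
    by (simp add: eq sum.distrib cong: sum.cong)
  also have "\<dots> = (\<Sum>Y | Y \<in> U \<and> separates Y i j k l. w Y)"
    by (rule sum.mono_neutral_cong_right) auto
  finally show ?thesis .
qed

text \<open>Only sides that separate the quadruple, or whose complements do, contribute with
  positive sign.\<close>

lemma cross_gram_pos_separated:
  fixes U :: "('n::finite + 'n) set set"
  assumes U: "side_system U" and w: "weighting U w" and pos: "cross (gram U w) i j k l > 0"
  shows "\<exists>X\<in>U. separates X i j k l"
proof (rule ccontr)
  assume no: "\<not> ?thesis"
  have "w Y * ((of_bool (Inl i \<in> Y) - of_bool (Inl k \<in> Y)) * (of_bool (Inr j \<in> Y) - of_bool (Inr l \<in> Y))) \<le> 0"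
    if Y: "Y \<in> U" for Y
  proof -
    have "\<not> separates Y i j k l" "\<not> separates (- Y) i j k l"
      using no Y side_systemD(1)[OF U Y] by auto
    moreover have "w Y > 0" using weightingD w Y by blast
    ultimately show ?thesis by (auto simp: separates_def)
  qed
  then have "cross (gram U w) i j k l \<le> 0" unfolding cross_gram by (simp add: sum_nonpos)
  with pos show False by simp
qed

text \<open>Two labels of different colours in \<open>X\<close> that hang on different branches at the near end of
  the edge of \<open>X\<close>: a label outside a maximal side \<open>Y \<subset> X\<close>, and a label of the other colour in \<open>Y\<close>.\<close>
lemma sharp_pair:
  fixes U :: "('n::finite + 'n) set set"
  assumes U: "side_system U" and X: "X \<in> U"
  shows "\<exists>i j. Inl i \<in> X \<and> Inr j \<in> X \<and> (\<forall>Y\<in>U. Y \<subset> X \<longrightarrow> \<not> (Inl i \<in> Y \<and> Inr j \<in> Y))"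
proof (cases "\<exists>Y\<in>U. Y \<subset> X")
  case False
  then show ?thesis using side_systemD(2)[OF U X] unfolding bicoloured_def by blast
next
  case True
  have fin: "finite {Y\<in>U. Y \<subset> X}" by (rule finite_subset[of _ UNIV]) auto
  have "{Y\<in>U. Y \<subset> X} \<noteq> {}" using True by blast
  from finite_has_maximal[OF fin this]
  obtain Y where "Y \<in> {Y\<in>U. Y \<subset> X}" and Ymax: "\<forall>Z\<in>{Y\<in>U. Y \<subset> X}. Y \<le> Z \<longrightarrow> Y = Z" by (elim bexE)
  then have Y: "Y \<in> U" "Y \<subset> X" by simp_all
  have max: "\<And>Z. Z \<in> U \<Longrightarrow> Z \<subset> X \<Longrightarrow> Y \<subseteq> Z \<Longrightarrow> Y = Z" using Ymax by simp
  obtain x where x: "x \<in> X" "x \<notin> Y" using Y by auto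
  \<comment> \<open>\<open>Y\<close> and \<open>Z\<close> both miss a label outside
    \<open>X\<close>, so a \<open>Z\<close> that meets \<open>Y\<close> and contains
    \<open>x\<close> would contain \<open>Y\<close> by compatibility, against the maximality of
    \<open>Y\<close>.\<close>
  have key: "Z \<in> U \<Longrightarrow> Z \<subset> X \<Longrightarrow> x \<in> Z \<Longrightarrow> y \<in> Y \<Longrightarrow> y \<in> Z \<Longrightarrow> False" for Z y
  proof -
    assume Z: "Z \<in> U" "Z \<subset> X" "x \<in> Z" and y: "y \<in> Y" "y \<in> Z"
    have "compat Y Z" using side_systemD(3)[OF U Y(1)] Z by blast
    moreover obtain z where "z \<notin> X"
      using side_systemD(2)[OF U side_systemD(1)[OF U X]] unfolding bicoloured_def by blast
    then have "z \<in> - Y \<inter> - Z" using Y Z by blast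
    then have "- Y \<inter> - Z \<noteq> {}" by blast
    ultimately have "Y \<subseteq> Z" using x y Z unfolding compat_def by blast
    then show False using max Z x by blast
  qed
  obtain i j where ij: "Inl i \<in> Y" "Inr j \<in> Y" using side_systemD(2)[OF U Y(1)] unfolding bicoloured_def by blast
  show ?thesis
  proof (cases x)
    case (Inl a)
    then have "\<forall>Z\<in>U. Z \<subset> X \<longrightarrow> \<not> (Inl a \<in> Z \<and> Inr j \<in> Z)" using key ij by blast
    then show ?thesis using Inl x ij Y by blast
  next
    case (Inr b)
    then have "\<forall>Z\<in>U. Z \<subset> X \<longrightarrow> \<not> (Inl i \<in> Z \<and> Inr b \<in> Z)" using key ij by blast
    then show ?thesis using Inr x ij Y by blast
  qed
qed

text \<open>Combine the pairs of \<open>sharp_pair\<close> at both ends of the edge: a side that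
  separates the quadruple is neither properly inside \<open>X\<close>, nor is its complement
  properly inside \<open>-X\<close>, and compatibility with \<open>X\<close> leaves only
  \<open>X\<close> itself.\<close>

lemma sharp_quadruple:
  fixes U :: "('n::finite + 'n) set set"
  assumes U: "side_system U" and X: "X \<in> U"
  shows "\<exists>i j k l. separates X i j k l \<and> (\<forall>Y\<in>U. separates Y i j k l \<longrightarrow> Y = X)"
proof -
  obtain i j where ij: "Inl i \<in> X" "Inr j \<in> X" and ij': "\<And>Y. Y\<in>U \<Longrightarrow> Y \<subset> X \<Longrightarrow> \<not> (Inl i \<in> Y \<and> Inr j \<in> Y)"
    using sharp_pair[OF U X] by blast
  obtain k l where kl: "Inl k \<in> - X" "Inr l \<in> - X" and kl': "\<And>Y. Y\<in>U \<Longrightarrow> Y \<subset> - X \<Longrightarrow> \<not> (Inl k \<in> Y \<and> Inr l \<in> Y)"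
    using sharp_pair[OF U side_systemD(1)[OF U X]] by blast
  have "Y = X" if Y: "Y \<in> U" "separates Y i j k l" for Y
  proof -
    have "Inl i \<in> Y" "Inr j \<in> Y" "Inl k \<in> - Y" "Inr l \<in> - Y"
      using Y by (auto simp: separates_def)
    then have "\<not> Y \<subset> X" "\<not> - Y \<subset> - X" using ij' kl' Y(1) side_systemD(1)[OF U Y(1)] by blast+
    moreover have "compat X Y" using side_systemD(3)[OF U X] Y by blast
    ultimately show ?thesis using Y ij kl unfolding compat_def separates_def by blast
  qed
  moreover have "separates X i j k l" using ij kl by (auto simp: separates_def)
  ultimately show ?thesis by blast
qed

text \<open>Start from any two labels of different colours in \<open>X\<close>. If \<open>Y\<close>
  does not cut them, exchange one of them for a label of \<open>X\<close> across \<open>Y\<close>,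
  keeping the partner of the opposite colour. Such pairs turn incompatible sides into quadruples
  with two labels of each colour.\<close>

lemma bicoloured_transversal:
  assumes "bicoloured X" "X \<inter> Y \<noteq> {}" "X \<inter> - Y \<noteq> {}"
  shows "\<exists>i j. Inl i \<in> X \<and> Inr j \<in> X \<and> (Inl i \<in> Y \<longleftrightarrow> Inr j \<notin> Y)"
proof -
  obtain i j where ij: "Inl i \<in> X" "Inr j \<in> X" using assms(1) unfolding bicoloured_def by blast
  obtain a b where ab: "a \<in> X" "a \<in> Y" "b \<in> X" "b \<notin> Y" using assms by blast
  show ?thesis
  proof (cases "Inl i \<in> Y \<longleftrightarrow> Inr j \<in> Y")
    case True
    show ?thesis
    proof (cases "Inl i \<in> Y")
      case True
      then show ?thesis using ij ab \<open>Inl i \<in> Y \<longleftrightarrow> Inr j \<in> Y\<close> by (cases b) blast+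
    next
      case False
      then show ?thesis using ij ab \<open>Inl i \<in> Y \<longleftrightarrow> Inr j \<in> Y\<close> by (cases a) blast+
    qed
  qed (use ij in blast)
qed

text \<open>If \<open>Y\<close> cuts both \<open>X\<close> and \<open>-X\<close>, it cuts a pair of
  labels of different colours in each. The member \<open>Z\<close> of \<open>U\<close> that
  separates these two pairs then meets \<open>Y\<close> and \<open>-Y\<close>, and so does
  \<open>-Z\<close>, although \<open>Z\<close> and \<open>Y\<close> are compatible.\<close>

lemma separated_by_compat:
  fixes U :: "('n::finite + 'n) set set"
  assumes U: "side_system U" and X: "bicoloured X" "bicoloured (- X)"
    and sep: "\<And>i j k l. separates X i j k l \<Longrightarrow> \<exists>Y\<in>U. separates Y i j k l"
    and Y: "Y \<in> U"
  shows "compat X Y"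
proof (rule ccontr)
  assume "\<not> compat X Y"
  then have ne: "X \<inter> Y \<noteq> {}" "X \<inter> - Y \<noteq> {}" "- X \<inter> Y \<noteq> {}" "- X \<inter> - Y \<noteq> {}" unfolding compat_def by auto
  from bicoloured_transversal[OF X(1) ne(1,2)] obtain i j where
    1: "Inl i \<in> X" "Inr j \<in> X" "Inl i \<in> Y \<longleftrightarrow> Inr j \<notin> Y" by blast
  from bicoloured_transversal[OF X(2) ne(3,4)] obtain k l where
    2: "Inl k \<in> - X" "Inr l \<in> - X" "Inl k \<in> Y \<longleftrightarrow> Inr l \<notin> Y" by blast
  have "separates X i j k l" using 1 2 by (simp add: separates_def)
  then obtain Z where Z: "Z \<in> U" "separates Z i j k l" using sep by blast
  have "compat Z Y" using side_systemD(3)[OF U Z(1)] Y by blast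
  then show False using Z 1(3) 2(3) unfolding compat_def separates_def by blast
qed

text \<open>By compatibility \<open>X\<close> and its complement can be added to \<open>U\<close>.
  In the enlarged system a quadruple is sharp for \<open>X\<close>, and the member of
  \<open>U\<close> that separates it can only be \<open>X\<close>.\<close>

lemma separated_by_member:
  fixes U :: "('n::finite + 'n) set set"
  assumes U: "side_system U" and X: "bicoloured X" "bicoloured (- X)"
    and sep: "\<And>i j k l. separates X i j k l \<Longrightarrow> \<exists>Y\<in>U. separates Y i j k l"
  shows "X \<in> U"
proof -
  have c: "Y \<in> U \<Longrightarrow> compat X Y" for Y using separated_by_compat[OF U X sep] .
  have "side_system (insert X (insert (- X) U))"
    using U X c unfolding side_system_def by (auto simp: compat_compl compat_self compat_sym[of _ X])
  from sharp_quadruple[OF this insertI1] obtain i j k l where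
    s: "separates X i j k l" and u: "\<forall>Y\<in>insert X (insert (- X) U). separates Y i j k l \<longrightarrow> Y = X"
    by (elim exE conjE)
  show ?thesis using sep[OF s] u by blast
qed

text \<open>Positive cross differences at all quadruples separated by \<open>X\<close> force
  \<open>V\<close> to separate them as well, which is all that membership of \<open>X\<close> in
  \<open>V\<close> requires.\<close>

lemma gram_unique_subset:
  fixes U :: "('n::finite + 'n) set set"
  assumes U: "side_system U" "weighting U w" and V: "side_system V" "weighting V v"
    and eq: "\<And>i j k l. cross (gram U w) i j k l = cross (gram V v) i j k l"
    and X: "X \<in> U"
  shows "X \<in> V"
proof (rule separated_by_member[OF V(1)])
  show "bicoloured X" "bicoloured (- X)" using side_systemD[OF U(1)] X by blast+
  fix i j k l assume s: "separates X i j k l"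
  have "w X \<le> (\<Sum>Y | Y \<in> U \<and> separates Y i j k l. w Y)"
    by (rule member_le_sum) (use X s weightingD[OF U(2)] in \<open>auto intro: less_imp_le finite_subset[of _ "UNIV :: ('n + 'n) set set"]\<close>)
  then have "cross (gram V v) i j k l > 0"
    using cross_gram_separated[OF U X s] weightingD[OF U(2) X] by (simp add: eq)
  then show "\<exists>Y\<in>V. separates Y i j k l" by (rule cross_gram_pos_separated[OF V])
qed

text \<open>At a sharp quadruple of \<open>X\<close> both cross differences reduce to a single
  weight.\<close>

theorem gram_unique:
  fixes U :: "('n::finite + 'n) set set"
  assumes U: "side_system U" "weighting U w" and V: "side_system V" "weighting V v"
    and eq: "\<And>i j k l. cross (gram U w) i j k l = cross (gram V v) i j k l"
  shows "U = V" "X \<in> U \<Longrightarrow> w X = v X"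
proof -
  show UV: "U = V" using gram_unique_subset[OF U V eq] gram_unique_subset[OF V U eq[symmetric]] by blast
  assume X: "X \<in> U"
  from sharp_quadruple[OF U(1) X] obtain i j k l where
    s: "separates X i j k l" and u: "\<forall>Y\<in>U. separates Y i j k l \<longrightarrow> Y = X"
    by (elim exE conjE)
  have 1: "{Y. Y \<in> U \<and> separates Y i j k l} = {X}" using u s X by blast
  have "w X = cross (gram U w) i j k l" unfolding cross_gram_separated[OF U X s] 1 by simp
  also have "\<dots> = cross (gram V v) i j k l" by (rule eq)
  also have "\<dots> = v X" unfolding cross_gram_separated[OF V X[unfolded UV] s] 1[unfolded UV] by simp
  finally show "w X = v X" .
qed

section \<open>Matrices of tropical rank two\<close>

text \<open>Only the identity is forbidden to be the sole minimal permutation, since renaming the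
  columns turns any permutation into the identity. Equal indices do no harm: then a transposition
  has the same value as the identity.\<close>

definition trop_rank_le2 :: "('n \<Rightarrow> 'n \<Rightarrow> real) \<Rightarrow> bool" where
  "trop_rank_le2 A \<longleftrightarrow> (\<forall>i1 i2 i3 j1 j2 j3.
     \<not> (A i1 j1 + A i2 j2 + A i3 j3 < A i1 j1 + A i2 j3 + A i3 j2 \<and>
        A i1 j1 + A i2 j2 + A i3 j3 < A i1 j2 + A i2 j1 + A i3 j3 \<and>
        A i1 j1 + A i2 j2 + A i3 j3 < A i1 j3 + A i2 j2 + A i3 j1 \<and>
        A i1 j1 + A i2 j2 + A i3 j3 < A i1 j2 + A i2 j3 + A i3 j1 \<and>
        A i1 j1 + A i2 j2 + A i3 j3 < A i1 j3 + A i2 j1 + A i3 j2))"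

lemma trop_rank_le2D:
  assumes "trop_rank_le2 A"
    "A i1 j1 + A i2 j2 + A i3 j3 < A i1 j1 + A i2 j3 + A i3 j2"
    "A i1 j1 + A i2 j2 + A i3 j3 < A i1 j2 + A i2 j1 + A i3 j3"
    "A i1 j1 + A i2 j2 + A i3 j3 < A i1 j3 + A i2 j2 + A i3 j1"
    "A i1 j1 + A i2 j2 + A i3 j3 < A i1 j2 + A i2 j3 + A i3 j1"
    "A i1 j1 + A i2 j2 + A i3 j3 < A i1 j3 + A i2 j1 + A i3 j2"
  shows False
  using assms unfolding trop_rank_le2_def by blast

section \<open>Sides with positive cross differences, in analogy to Buneman's splits of a
  metric\<close>

definition positive_sides :: "('n \<Rightarrow> 'n \<Rightarrow> real) \<Rightarrow> ('n + 'n) set set" where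
  "positive_sides A = {X. bicoloured X \<and> bicoloured (- X) \<and>
     (\<forall>i j k l. separates X i j k l \<longrightarrow> cross A i j k l > 0)}"

lemma cross_simps: "cross A k l i j = cross A i j k l" "cross A i l k j = - cross A i j k l"
  by (simp_all add: cross_def)

lemma positive_sidesD:
  assumes "X \<in> positive_sides A"
  shows "bicoloured X" "bicoloured (- X)" "separates X i j k l \<Longrightarrow> cross A i j k l > 0"
  using assms by (auto simp: positive_sides_def)

lemma positive_sides_compl:
  assumes "X \<in> positive_sides A"
  shows "- X \<in> positive_sides A"
proof -
  have "cross A i j k l > 0" if "separates (- X) i j k l" for i j k l
    using positive_sidesD(3)[OF assms, of k l i j] that by (simp add: separates_compl cross_def)
  then show ?thesis using positive_sidesD(1,2)[OF assms] by (simp add: positive_sides_def)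
qed

lemma positive_sides_no_conflict:
  assumes "X \<in> positive_sides A" "Y \<in> positive_sides A" "separates X i j k l" "separates Y i l k j"
  shows False
  using positive_sidesD(3)[OF assms(1,3)] positive_sidesD(3)[OF assms(2,4)] by (simp add: cross_def)

text \<open>Each label is matched with one in the opposite intersection: \<open>i\<close> with
  \<open>l'\<close>, \<open>k\<close> with \<open>q'\<close>, \<open>p\<close> with
  \<open>m'\<close>. The eight cross differences that \<open>X\<close> and \<open>Y\<close> force to
  be positive make this the only minimum of the minor with rows \<open>i\<close>, \<open>k\<close>,
  \<open>p\<close> and columns \<open>l\<close>, \<open>q\<close>, \<open>m\<close>.\<close>

lemma positive_sides_minor:
  assumes A: "trop_rank_le2 A" and X: "X \<in> positive_sides A" and Y: "Y \<in> positive_sides A"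
    and a: "Inl i \<in> X" "Inl i \<in> Y" and d: "Inr l \<notin> X" "Inr l \<notin> Y"
    and b: "Inl k \<in> X" "Inl k \<notin> Y" "Inr m \<in> X" "Inr m \<notin> Y"
    and c: "Inl p \<notin> X" "Inl p \<in> Y" "Inr q \<notin> X" "Inr q \<in> Y"
  shows False
proof -
  have x: "separates X i m p q" "separates X i m p l" "separates X k m p q" "separates X k m p l"
    and y: "separates Y i q k m" "separates Y i q k l" "separates Y p q k m" "separates Y p q k l"
    using a b c d by (auto simp: separates_def)
  note f = x[THEN positive_sidesD(3)[OF X]] y[THEN positive_sidesD(3)[OF Y]]
  show False
    by (rule trop_rank_le2D[OF A, of i l k q p m]; use f in \<open>simp add: cross_def\<close>)
qed

text \<open>The four given labels alone yield no contradiction: \<open>Y\<close> and its complement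
  each show only one colour. Since both are bicoloured, there are a primed label \<open>j2\<close>
  in \<open>Y\<close> and an unprimed label \<open>k2\<close> outside. Depending on their position
  with respect to \<open>X\<close> they produce either a cross difference of two signs or a
  forbidden minor.\<close>

lemma positive_sides_bad_cells:
  assumes A: "trop_rank_le2 A" and X: "X \<in> positive_sides A" and Y: "Y \<in> positive_sides A"
    and q: "Inl i \<in> X" "Inl i \<in> Y" "Inr j \<in> X" "Inr j \<notin> Y" "Inl k \<notin> X" "Inl k \<in> Y" "Inr l \<notin> X" "Inr l \<notin> Y"
  shows False
proof -
  obtain i2 j2 where 2: "Inl i2 \<in> Y" "Inr j2 \<in> Y" "Inl i2 \<in> X \<longleftrightarrow> Inr j2 \<notin> X"
    using bicoloured_transversal[of Y X] positive_sidesD(1)[OF Y] q by blast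
  obtain k2 l2 where 3: "Inl k2 \<notin> Y" "Inr l2 \<notin> Y" "Inl k2 \<in> X \<longleftrightarrow> Inr l2 \<notin> X"
    using bicoloured_transversal[of "- Y" X] positive_sidesD(2)[OF Y] q by blast
  note X' = positive_sides_compl[OF X]
  consider "Inr j2 \<notin> X" "Inl k2 \<notin> X" | "Inr j2 \<in> X" "Inl k2 \<in> X" | "Inr j2 \<notin> X" "Inl k2 \<in> X" | "Inr j2 \<in> X" "Inl k2 \<notin> X"
    by blast
  then show False
  proof cases
    case 1
    show False by (rule positive_sides_no_conflict[OF X Y, of i j k2 j2]) (use 1 2 3 q in \<open>auto simp: separates_def\<close>)
  next
    case 2
    show False by (rule positive_sides_no_conflict[OF X positive_sides_compl[OF Y], of k2 j2 k l])
        (use 2 \<open>Inr j2 \<in> Y\<close> 3 q in \<open>auto simp: separates_def\<close>)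
  next
    case 3
    show False by (rule positive_sides_minor[OF A X Y, of i l k2 j k j2]) (use 2 3 \<open>Inl k2 \<notin> Y\<close> q in auto)
  next
    case 4
    show False by (rule positive_sides_minor[OF A X' Y, of k j k2 l i j2]) (use 2 4 \<open>Inl k2 \<notin> Y\<close> q in auto)
  qed
qed

text \<open>Incompatible sides give one pair in \<open>X\<close> and one outside, both cut by
  \<open>Y\<close>. If \<open>Y\<close> joins \<open>i\<close> with \<open>l'\<close> or
  \<open>j'\<close> with \<open>k\<close>, a cross difference has both signs; otherwise the four
  labels are in the position of \<open>positive_sides_bad_cells\<close> for \<open>Y\<close> or its
  complement.\<close>

lemma positive_sides_compat:
  assumes A: "trop_rank_le2 A" and X: "X \<in> positive_sides A" and Y: "Y \<in> positive_sides A"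
  shows "compat X Y"
proof (rule ccontr)
  assume "\<not> compat X Y"
  then have ne: "X \<inter> Y \<noteq> {}" "X \<inter> - Y \<noteq> {}" "- X \<inter> Y \<noteq> {}" "- X \<inter> - Y \<noteq> {}" unfolding compat_def by auto
  obtain i j where 1: "Inl i \<in> X" "Inr j \<in> X" "Inl i \<in> Y \<longleftrightarrow> Inr j \<notin> Y"
    using bicoloured_transversal[OF positive_sidesD(1)[OF X] ne(1,2)] by blast
  obtain k l where 2: "Inl k \<in> - X" "Inr l \<in> - X" "Inl k \<in> Y \<longleftrightarrow> Inr l \<notin> Y"
    using bicoloured_transversal[OF positive_sidesD(2)[OF X] ne(3,4)] by blast
  have s: "separates X i j k l" using 1 2 by (simp add: separates_def)
  consider "Inl i \<in> Y" "Inl k \<in> Y" | "Inl i \<in> Y" "Inl k \<notin> Y" | "Inl i \<notin> Y" "Inl k \<in> Y" | "Inl i \<notin> Y" "Inl k \<notin> Y"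
    by blast
  then show False
  proof cases
    case 1
    show False by (rule positive_sides_bad_cells[OF A X Y, of i j k l]) (use 1 \<open>Inl i \<in> Y \<longleftrightarrow> Inr j \<notin> Y\<close> \<open>Inl i \<in> X\<close> \<open>Inr j \<in> X\<close> 2 in auto)
  next
    case c: 2
    show False by (rule positive_sides_no_conflict[OF X Y s]) (use 1 2 c in \<open>auto simp: separates_def\<close>)
  next
    case c: 3
    show False by (rule positive_sides_no_conflict[OF X positive_sides_compl[OF Y] s]) (use 1 2 c in \<open>auto simp: separates_def\<close>)
  next
    case c: 4
    show False by (rule positive_sides_bad_cells[OF A X positive_sides_compl[OF Y], of i j k l]) (use 1 2 c in auto)
  qed
qed

text \<open>A quadruple with the largest cross difference joins two ends of the tree, so the labels
  attached at the first end form a side.\<close>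
lemma positive_sides_nonempty:
  fixes A :: "'n::finite \<Rightarrow> 'n \<Rightarrow> real"
  assumes A: "trop_rank_le2 A" and pos: "cross A i0 j0 k0 l0 > 0"
  shows "positive_sides A \<noteq> {}"
proof -
  define Q where "Q = range (\<lambda>(i, j, k, l). cross A i j k l)"
  have Q: "finite Q" "Q \<noteq> {}" unfolding Q_def by auto
  define M where "M = Max Q"
  have "M \<in> Q" unfolding M_def by (rule Max_in[OF Q])
  then obtain i j k l where ijkl: "cross A i j k l = M" unfolding Q_def by auto
  have le: "cross A r c p q \<le> M" for r c p q
    unfolding M_def by (rule Max_ge[OF Q(1)]) (auto simp: Q_def image_iff)
  have M: "M > 0" using pos le[of i0 j0 k0 l0] by simp
  \<comment> \<open>Shifts of rows and columns that make row \<open>k\<close> and column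
    \<open>l\<close> vanish.\<close>
  define B where "B = (\<lambda>r c. cross A r c k l)"
  have Ble: "B r c \<le> M" for r c unfolding B_def by (rule le)
  \<comment> \<open>The entries at which \<open>B\<close> attains its maximum form a rectangle. With
    a smaller fourth corner, the matching of \<open>k\<close> with \<open>c\<close>,
    \<open>p\<close> with \<open>l\<close>, \<open>r\<close> with \<open>d\<close> has value
    \<open>B r d\<close>, and every other matching of this minor has value at least \<open>M\<close>
    or exceeds \<open>B r d\<close> by \<open>M\<close>.\<close>
  have 1: "B r d = M" if "B p c = M" "B r c = M" "B p d = M" for p r c d
  proof (rule ccontr)
    assume "B r d \<noteq> M"
    then have "B r d < M" using Ble[of r d] by simp
    then show False using that M
      by (intro trop_rank_le2D[OF A, of k c p l r d]) (simp_all add: B_def cross_def)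
  qed
  \<comment> \<open>Otherwise \<open>B p q\<close> lies below both \<open>B r q\<close> and
    \<open>B p c\<close>, and matching \<open>k\<close> with \<open>c\<close>, \<open>r\<close> with
    \<open>l\<close>, \<open>p\<close> with \<open>q\<close> is the only minimum of its
    minor.\<close>
  have 2: "B p q + M > B r q + B p c" if "B r c = M" "B p c < M" "B r q < M" for p q r c
  proof (rule ccontr)
    assume "\<not> ?thesis"
    then show False using that M
      by (intro trop_rank_le2D[OF A, of k c r l p q]) (simp_all add: B_def cross_def)
  qed
  have B0: "B k c = 0" "B r l = 0" for c r by (simp_all add: B_def cross_def)
  have Bij: "B i j = M" using ijkl by (simp add: B_def)
  \<comment> \<open>The rows and columns of this rectangle; \<open>k\<close> and \<open>l\<close>
    stay outside because \<open>B\<close> vanishes there and \<open>M\<close> is positive.\<close>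
  define X where "X = Inl ` {r. B r j = M} \<union> Inr ` {c. B i c = M}"
  have mem: "Inl r \<in> X \<longleftrightarrow> B r j = M" "Inr c \<in> X \<longleftrightarrow> B i c = M" for r c by (auto simp: X_def)
  have "bicoloured X" "bicoloured (- X)"
    using Bij B0 M by (auto simp: bicoloured_def mem intro: exI[of _ i] exI[of _ j] exI[of _ k] exI[of _ l])
  moreover have "cross A r c p q > 0" if "separates X r c p q" for r c p q
  proof -
    have s: "B r j = M" "B i c = M" "B p j \<noteq> M" "B i q \<noteq> M" using that by (auto simp: separates_def mem)
    have rc: "B r c = M" using 1[OF Bij s(1,2)] .
    have "B p c \<noteq> M" using 1[OF rc _ s(1), of p] s(3) by blast
    moreover have "B r q \<noteq> M" using 1[OF rc s(2), of q] s(4) by blast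
    ultimately have "B p q + M > B r q + B p c" using 2[OF rc] Ble less_le by metis
    then show ?thesis using rc by (simp add: B_def cross_def)
  qed
  ultimately have "X \<in> positive_sides A" by (simp add: positive_sides_def)
  then show ?thesis by blast
qed

text \<open>Shortens the edge of \<open>X\<close> by \<open>t\<close>. Treating \<open>X\<close>
  without its complement suffices, because the products of indicators for \<open>X\<close> and
  \<open>-X\<close> differ by a function of the row plus a function of the column.\<close>

definition drop_side :: "('n \<Rightarrow> 'n \<Rightarrow> real) \<Rightarrow> real \<Rightarrow> ('n + 'n) set \<Rightarrow> 'n \<Rightarrow> 'n \<Rightarrow> real" where
  "drop_side A t X i j = A i j - t * of_bool (Inl i \<in> X) * of_bool (Inr j \<in> X)"

lemma cross_drop_side:
  "cross (drop_side A t X) i j k l = cross A i j k l -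
     t * ((of_bool (Inl i \<in> X) - of_bool (Inl k \<in> X)) * (of_bool (Inr j \<in> X) - of_bool (Inr l \<in> X)))"
  by (simp add: cross_def drop_side_def algebra_simps)

text \<open>Dropping raises a cross difference only where \<open>X\<close> pairs the four labels the
  other way. There the old value is at most \<open>-t\<close>, so the new one is not positive, and
  no new positive side can arise.\<close>

lemma positive_sides_drop_side:
  assumes t: "t \<ge> 0" and le: "\<And>i j k l. separates X i j k l \<Longrightarrow> t \<le> cross A i j k l"
  shows "positive_sides (drop_side A t X) \<subseteq> positive_sides A"
proof
  fix Y assume Y: "Y \<in> positive_sides (drop_side A t X)"
  have "cross A i j k l > 0" if s: "separates Y i j k l" for i j k l
  proof -
    have p: "cross (drop_side A t X) i j k l > 0" by (rule positive_sidesD(3)[OF Y s])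
    consider "separates X i l k j" | "separates X k j i l" | "\<not> separates X i l k j" "\<not> separates X k j i l" by blast
    then show ?thesis
    proof cases
      case 1
      then have "cross (drop_side A t X) i j k l = cross A i j k l + t"
        by (simp add: cross_drop_side separates_def)
      then show ?thesis using p le[OF 1] cross_simps(2)[of A i l k j] by linarith
    next
      case 2
      then have "cross (drop_side A t X) i j k l = cross A i j k l + t"
        by (simp add: cross_drop_side separates_def)
      then show ?thesis using p le[OF 2] cross_simps(1)[of A k j i l] cross_simps(2)[of A i l k j] by linarith
    next
      case 3
      then show ?thesis using p t
        by (cases "Inl i \<in> X"; cases "Inl k \<in> X"; cases "Inr j \<in> X"; cases "Inr l \<in> X")
          (simp_all add: cross_drop_side separates_def)
    qed
  qed
  then show "Y \<in> positive_sides A" using positive_sidesD(1,2)[OF Y] by (simp add: positive_sides_def)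
qed

text \<open>If the identity is the only minimal permutation after dropping \<open>X\<close>, then it matches the two
  sides of \<open>X\<close> with each other as much as possible, so it was already the only minimal permutation.\<close>
lemma trop_rank_le2_drop_side:
  assumes A: "trop_rank_le2 A" and t: "t \<ge> 0" and le: "\<And>i j k l. separates X i j k l \<Longrightarrow> t \<le> cross A i j k l"
  shows "trop_rank_le2 (drop_side A t X)"
  unfolding trop_rank_le2_def
proof (intro allI notI, elim conjE)
  let ?A = "drop_side A t X"
  fix i1 i2 i3 j1 j2 j3
  assume m: "?A i1 j1 + ?A i2 j2 + ?A i3 j3 < ?A i1 j1 + ?A i2 j3 + ?A i3 j2"
    "?A i1 j1 + ?A i2 j2 + ?A i3 j3 < ?A i1 j2 + ?A i2 j1 + ?A i3 j3"
    "?A i1 j1 + ?A i2 j2 + ?A i3 j3 < ?A i1 j3 + ?A i2 j2 + ?A i3 j1"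
    "?A i1 j1 + ?A i2 j2 + ?A i3 j3 < ?A i1 j2 + ?A i2 j3 + ?A i3 j1"
    "?A i1 j1 + ?A i2 j2 + ?A i3 j3 < ?A i1 j3 + ?A i2 j1 + ?A i3 j2"
  have q: "cross ?A i j k l \<ge> 0" if "separates X i j k l" for i j k l
    using le[OF that] that by (simp add: cross_drop_side separates_def)
  define n where "n = (\<lambda>i j. of_bool (Inl i \<in> X) * of_bool (Inr j \<in> X) :: real)"
  have A': "A i j = ?A i j + t * n i j" for i j by (simp add: drop_side_def n_def)
  \<comment> \<open>For a separated pair of matched pairs, \<open>q\<close> says that exchanging the
    partners does not increase the weight, against the strict minimality of the identity.\<close>
  have no: "\<not> separates X i1 j1 i2 j2" "\<not> separates X i2 j2 i1 j1" "\<not> separates X i1 j1 i3 j3"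
    "\<not> separates X i3 j3 i1 j1" "\<not> separates X i2 j2 i3 j3" "\<not> separates X i3 j3 i2 j2"
    using q[of i1 j1 i2 j2] q[of i2 j2 i1 j1] q[of i1 j1 i3 j3] q[of i3 j3 i1 j1] q[of i2 j2 i3 j3] q[of i3 j3 i2 j2] m
    by (auto simp: cross_def)
  let ?n = "n i1 j1 + n i2 j2 + n i3 j3"
  \<comment> \<open>\<open>n\<close> counts matched pairs inside \<open>X\<close>. By
    \<open>no\<close>, the identity has no pair inside \<open>X\<close> or none outside. In the
    first case the count is zero, in the second it equals the number of labels in \<open>X\<close>
    minus 3; either way no permutation has a smaller count.\<close>
  have "?n \<le> n i1 j1 + n i2 j3 + n i3 j2 \<and> ?n \<le> n i1 j2 + n i2 j1 + n i3 j3 \<and> ?n \<le> n i1 j3 + n i2 j2 + n i3 j1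
      \<and> ?n \<le> n i1 j2 + n i2 j3 + n i3 j1 \<and> ?n \<le> n i1 j3 + n i2 j1 + n i3 j2"
    using no unfolding n_def separates_def
    by (cases "Inl i1 \<in> X"; cases "Inl i2 \<in> X"; cases "Inl i3 \<in> X"; cases "Inr j1 \<in> X"; cases "Inr j2 \<in> X"; cases "Inr j3 \<in> X") simp_all
  then have "t * ?n \<le> t * (n i1 j1 + n i2 j3 + n i3 j2)" "t * ?n \<le> t * (n i1 j2 + n i2 j1 + n i3 j3)"
    "t * ?n \<le> t * (n i1 j3 + n i2 j2 + n i3 j1)" "t * ?n \<le> t * (n i1 j2 + n i2 j3 + n i3 j1)"
    "t * ?n \<le> t * (n i1 j3 + n i2 j1 + n i3 j2)"
    using t by (auto intro: mult_left_mono)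
  then show False using m
    by (intro trop_rank_le2D[OF A, of i1 j1 i2 j2 i3 j3]) (simp_all add: A' distrib_left)
qed

text \<open>Induction on the number of positive sides. Dropping \<open>X\<close> by the least cross
  difference among the quadruples it separates makes one of them vanish, so \<open>X\<close> is no
  longer positive and no side becomes so. The clause that \<open>U\<close> consists of positive
  sides is what makes \<open>X\<close> compatible with the sides found for the smaller matrix.
  Without positive sides all cross differences vanish, as they change sign under exchange of the
  columns.\<close>

theorem trop_rank_le2_decomposition:
  fixes A :: "'n::finite \<Rightarrow> 'n \<Rightarrow> real"
  assumes "trop_rank_le2 A"
  shows "\<exists>U w. side_system U \<and> weighting U w \<and> U \<subseteq> positive_sides A \<and>
    (\<forall>i j k l. cross A i j k l = cross (gram U w) i j k l)"
  using assms
proof (induction "card (positive_sides A)" arbitrary: A rule: less_induct)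
  case (less A)
  show ?case
  proof (cases "positive_sides A = {}")
    case True
    have "cross A i j k l \<le> 0" for i j k l
      using positive_sides_nonempty[OF less.prems] True by (meson not_le)
    moreover have "cross A i j k l \<ge> 0" for i j k l using calculation[of i l k j] cross_simps(2)[of A i l k j] by linarith
    ultimately have "cross A i j k l = 0" for i j k l by (simp add: antisym)
    then show ?thesis
      by (intro exI[of _ "{}"] exI[of _ "\<lambda>_. 1"]) (auto simp: side_system_def weighting_def cross_gram)
  next
    case False
    then obtain X where X: "X \<in> positive_sides A" by blast
    define Q where "Q = (\<lambda>(i, j, k, l). cross A i j k l) ` {(i, j, k, l). separates X i j k l}"
    obtain i0 j0 k0 l0 where "separates X i0 j0 k0 l0"
      using positive_sidesD(1,2)[OF X] unfolding bicoloured_def separates_def by blast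
    then have Q: "finite Q" "Q \<noteq> {}" unfolding Q_def by auto
    define t where "t = Min Q"
    have "t \<in> Q" unfolding t_def by (rule Min_in[OF Q])
    then obtain i j k l where s: "separates X i j k l" and teq: "t = cross A i j k l" unfolding Q_def by auto
    have t: "t > 0" using positive_sidesD(3)[OF X s] teq by simp
    have le: "t \<le> cross A i j k l" if "separates X i j k l" for i j k l
      unfolding t_def by (rule Min_le[OF Q(1)]) (use that in \<open>auto simp: Q_def image_iff\<close>)
    let ?B = "drop_side A t X"
    have B: "trop_rank_le2 ?B" using trop_rank_le2_drop_side[OF less.prems _ le] t by simp
    have sub: "positive_sides ?B \<subseteq> positive_sides A" using positive_sides_drop_side[OF _ le] t by simp
    have "cross ?B i j k l = 0" using s teq by (simp add: cross_drop_side separates_def)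
    then have XB: "X \<notin> positive_sides ?B" using positive_sidesD(3)[OF _ s, of ?B] by fastforce
    then have "card (positive_sides ?B) < card (positive_sides A)"
      using sub X by (intro psubset_card_mono) auto
    from less.hyps[OF this B] obtain U w where U: "side_system U" "weighting U w" "U \<subseteq> positive_sides ?B"
      and eq: "\<And>i j k l. cross ?B i j k l = cross (gram U w) i j k l" by blast
    have XU: "X \<notin> U" "- X \<notin> U" using U(1,3) XB side_systemD(1)[OF U(1), of "- X"] by auto
    have X0: "X \<noteq> - X" using positive_sidesD(1)[OF X] unfolding bicoloured_def by blast
    define V where "V = insert X (insert (- X) U)"
    define v where "v = w(X := t, - X := t)"
    have VA: "V \<subseteq> positive_sides A" using X U(3) sub positive_sides_compl[OF X] by (auto simp: V_def)
    have V: "side_system V"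
      unfolding side_system_def
    proof (intro conjI ballI)
      fix Y assume Y: "Y \<in> V"
      show "- Y \<in> V" using Y side_systemD(1)[OF U(1)] by (auto simp: V_def)
      show "bicoloured Y" using Y VA positive_sidesD(1) by blast
      show "compat Y Z" if "Z \<in> V" for Z
        using positive_sides_compat[OF less.prems] Y that VA by blast
    qed
    have v: "weighting V v"
      using U(2) t XU side_systemD(1)[OF U(1)] unfolding weighting_def V_def v_def by auto
    have "cross A i j k l = cross (gram V v) i j k l" for i j k l
    proof -
      let ?c = "\<lambda>X. (of_bool (Inl i \<in> X) - of_bool (Inl k \<in> X)) * (of_bool (Inr j \<in> X) - of_bool (Inr l \<in> X)) :: real"
      have "(\<Sum>Y\<in>V. v Y * ?c Y) = v X * ?c X + v (- X) * ?c (- X) + (\<Sum>Y\<in>U. v Y * ?c Y)"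
        unfolding V_def using XU X0 by simp
      also have "(\<Sum>Y\<in>U. v Y * ?c Y) = (\<Sum>Y\<in>U. w Y * ?c Y)"
        by (rule sum.cong) (use XU in \<open>auto simp: v_def\<close>)
      also have "v X * ?c X + v (- X) * ?c (- X) = 2 * (t * ?c X)"
        by (simp add: v_def)
      finally have "cross (gram V v) i j k l = t * ?c X + cross (gram U w) i j k l"
        unfolding cross_gram by simp
      then show ?thesis using eq[of i j k l] by (simp add: cross_drop_side)
    qed
    then show ?thesis using V v VA by blast
  qed
qed

section \<open>Symmetric minors\<close>

definition monomial3 :: "'n uprod \<Rightarrow> 'n uprod \<Rightarrow> 'n uprod \<Rightarrow> 'n sym_monomial" where
  "monomial3 d e f = Poly_Mapping.single d 1 + Poly_Mapping.single e 1 + Poly_Mapping.single f 1"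

lemma lookup_monomial3:
  "Poly_Mapping.lookup (monomial3 d e f) x = of_bool (d = x) + of_bool (e = x) + of_bool (f = x)"
  by (simp add: monomial3_def lookup_add lookup_single when_def)

lemma monomial3_commute: "monomial3 d e f = monomial3 e d f" "monomial3 d e f = monomial3 d f e"
  by (simp_all add: monomial3_def ac_simps)

lemma monomial3_neq:
  assumes "e \<noteq> e'" "e \<noteq> f'"
  shows "monomial3 d e f \<noteq> monomial3 d e' f'"
proof
  assume "monomial3 d e f = monomial3 d e' f'"
  then have "Poly_Mapping.lookup (monomial3 d e f) e = Poly_Mapping.lookup (monomial3 d e' f') e" by simp
  then show False using assms by (simp add: lookup_monomial3)
qed

lemma monomial3_mem:
  assumes "monomial3 d e f = monomial3 d' e' f'"
  shows "d = d' \<or> d = e' \<or> d = f'"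
proof -
  have "Poly_Mapping.lookup (monomial3 d e f) d = Poly_Mapping.lookup (monomial3 d' e' f') d" using assms by simp
  then show ?thesis by (auto simp: lookup_monomial3 of_bool_def split: if_splits)
qed

definition minor_monomials :: "'n \<Rightarrow> 'n \<Rightarrow> 'n \<Rightarrow> 'n \<Rightarrow> 'n \<Rightarrow> 'n \<Rightarrow> 'n sym_monomial set" where
  "minor_monomials r1 r2 r3 c1 c2 c3 =
    {monomial3 (Upair r1 c1) (Upair r2 c2) (Upair r3 c3), monomial3 (Upair r1 c2) (Upair r2 c3) (Upair r3 c1),
     monomial3 (Upair r1 c3) (Upair r2 c1) (Upair r3 c2), monomial3 (Upair r1 c1) (Upair r2 c3) (Upair r3 c2),
     monomial3 (Upair r1 c2) (Upair r2 c1) (Upair r3 c3), monomial3 (Upair r1 c3) (Upair r2 c2) (Upair r3 c1)}"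

text \<open>Permutations of opposite sign agree at exactly one place, so their monomials differ.\<close>
lemma monomial3_parity:
  assumes "distinct [r1, r2, r3]" "distinct [c1, c2, c3]"
    and "m \<in> {monomial3 (Upair r1 c1) (Upair r2 c2) (Upair r3 c3), monomial3 (Upair r1 c2) (Upair r2 c3) (Upair r3 c1),
     monomial3 (Upair r1 c3) (Upair r2 c1) (Upair r3 c2)}"
    and "m' \<in> {monomial3 (Upair r1 c1) (Upair r2 c3) (Upair r3 c2),
     monomial3 (Upair r1 c2) (Upair r2 c1) (Upair r3 c3), monomial3 (Upair r1 c3) (Upair r2 c2) (Upair r3 c1)}"
  shows "m \<noteq> m'"
proof -
  have A: "monomial3 (Upair a x) (Upair b y) (Upair c z) \<noteq> monomial3 (Upair a x) (Upair b z) (Upair c y)"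
    if "b \<noteq> c" "y \<noteq> z" for a b c x y z
    by (rule monomial3_neq) (use that in auto)
  have B: "monomial3 (Upair b y) (Upair a x) (Upair c z) \<noteq> monomial3 (Upair b z) (Upair a x) (Upair c y)"
    if "b \<noteq> c" "y \<noteq> z" for a b c x y z
    using A[OF that] by (simp add: monomial3_commute(1)[of "Upair b _"])
  have C: "monomial3 (Upair b y) (Upair c z) (Upair a x) \<noteq> monomial3 (Upair b z) (Upair c y) (Upair a x)"
    if "b \<noteq> c" "y \<noteq> z" for a b c x y z
    using B[OF that] by (simp add: monomial3_commute(2)[of "Upair b _" "Upair c _"])
  have n: "r1 \<noteq> r2" "r1 \<noteq> r3" "r2 \<noteq> r3" "c1 \<noteq> c2" "c1 \<noteq> c3" "c2 \<noteq> c3"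
    "c2 \<noteq> c1" "c3 \<noteq> c1" "c3 \<noteq> c2"
    using assms(1,2) by auto
  show ?thesis
    using assms(3,4) by (elim insertE emptyE) (simp_all only: A[OF n(3)] B[OF n(2)] C[OF n(1)] n not_False_eq_True)
qed

text \<open>Cancellation could only occur between permutations of opposite sign, whose monomials
  differ. Coinciding monomials of equal sign add up to a nonzero coefficient, as the characteristic
  is 0.\<close>

lemma keys_generic_sym_minor:
  assumes "inj r" "inj c"
  shows "Poly_Mapping.keys (generic_sym_minor r c) = minor_monomials (r 1) (r 2) (r 3) (c 1) (c 2) (c 3)"
proof -
  let ?e = "\<lambda>a b. Upair (r a) (c b)"
  let ?s = "\<lambda>m. Poly_Mapping.single m (1::rat)"
  let ?m1 = "monomial3 (?e 1 1) (?e 2 2) (?e 3 3)" let ?m2 = "monomial3 (?e 1 2) (?e 2 3) (?e 3 1)"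
  let ?m3 = "monomial3 (?e 1 3) (?e 2 1) (?e 3 2)" let ?m4 = "monomial3 (?e 1 1) (?e 2 3) (?e 3 2)"
  let ?m5 = "monomial3 (?e 1 2) (?e 2 1) (?e 3 3)" let ?m6 = "monomial3 (?e 1 3) (?e 2 2) (?e 3 1)"
  have d: "distinct [r 1, r 2, r 3]" "distinct [c 1, c 2, c 3]" using assms by (auto simp: inj_eq)
  have p: "m \<noteq> m'" if "m \<in> {?m1, ?m2, ?m3}" "m' \<in> {?m4, ?m5, ?m6}" for m m'
    by (rule monomial3_parity[OF d that])
  have det: "generic_sym_minor r c = ?s ?m1 + ?s ?m2 + ?s ?m3 - ?s ?m4 - ?s ?m5 - ?s ?m6"
    unfolding generic_sym_minor_def det_3 by (simp add: sym_var_def mult_single monomial3_def)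
  have l: "Poly_Mapping.lookup (generic_sym_minor r c) m = of_bool (?m1 = m) + of_bool (?m2 = m) + of_bool (?m3 = m)
     - of_bool (?m4 = m) - of_bool (?m5 = m) - of_bool (?m6 = m)" for m
    unfolding det by (simp add: lookup_add lookup_minus lookup_single when_def)
  have "m \<in> Poly_Mapping.keys (generic_sym_minor r c) \<longleftrightarrow> m \<in> {?m1, ?m2, ?m3} \<or> m \<in> {?m4, ?m5, ?m6}" for m
  proof (cases "m \<in> {?m1, ?m2, ?m3}")
    case True
    then have "m \<noteq> ?m4" "m \<noteq> ?m5" "m \<noteq> ?m6" using p by blast+
    then have "Poly_Mapping.lookup (generic_sym_minor r c) m > 0"
      using True unfolding l by (auto simp: of_bool_def)
    then show ?thesis using True by (simp add: in_keys_iff)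
  next
    case False
    show ?thesis
    proof (cases "m \<in> {?m4, ?m5, ?m6}")
      case True
      then have "Poly_Mapping.lookup (generic_sym_minor r c) m < 0"
        using False unfolding l by (auto simp: of_bool_def)
      then show ?thesis using True by (simp add: in_keys_iff)
    next
      case F: False
      then have "Poly_Mapping.lookup (generic_sym_minor r c) m = 0"
        using False unfolding l by (auto simp: of_bool_def)
      then show ?thesis using False F by (simp add: in_keys_iff)
    qed
  qed
  then show ?thesis unfolding minor_monomials_def by blast
qed

section \<open>Symmetric tropical rank two in terms of permutations\<close>

lemma sym_entry_Upair:
  assumes "transpose A = A" shows "sym_entry A (Upair i j) = A $ i $ j"
proof -
  have s: "A $ i $ j = A $ j $ i" for i j using assms by (metis transpose_def vec_lambda_beta)
  show ?thesis unfolding sym_entry_def by (rule the_equality) (auto simp: s)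
qed

lemma monomial_weight_add:
  "monomial_weight A (m + m') = monomial_weight A m + monomial_weight A m'"
proof -
  let ?K = "Poly_Mapping.keys m \<union> Poly_Mapping.keys m'"
  have e: "monomial_weight A n = (\<Sum>e\<in>?K. real (Poly_Mapping.lookup n e) * sym_entry A e)"
    if "Poly_Mapping.keys n \<subseteq> ?K" for n
    unfolding monomial_weight_def by (rule sum.mono_neutral_left) (use that in \<open>auto simp: in_keys_iff\<close>)
  show ?thesis
    by (simp add: e keys_add lookup_add sum.distrib[symmetric] algebra_simps)
qed

lemma monomial_weight_monomial3:
  "monomial_weight A (monomial3 d e f) = sym_entry A d + sym_entry A e + sym_entry A f"
proof -
  have "monomial_weight A (Poly_Mapping.single d 1) = sym_entry A d" for d
    by (simp add: monomial_weight_def)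
  then show ?thesis by (simp add: monomial3_def monomial_weight_add)
qed

lemma sym_trop_rank2_minors:
  fixes A :: "real ^ 'n::finite ^ 'n"
  shows "A \<in> sym_trop_rank2 \<longleftrightarrow> transpose A = A \<and> (\<forall>r1 r2 r3 c1 c2 c3. distinct [r1, r2, r3] \<longrightarrow> distinct [c1, c2, c3] \<longrightarrow>
     min_attained_twice (monomial_weight A) (minor_monomials r1 r2 r3 c1 c2 c3))"
proof -
  have ex: "\<exists>f :: 3 \<Rightarrow> 'n. inj f \<and> f 1 = a \<and> f 2 = b \<and> f 3 = c" if "distinct [a, b, c]" for a b c
  proof (intro exI conjI)
    let ?f = "\<lambda>x :: 3. if x = 1 then a else if x = 2 then b else c"
    show "inj ?f" unfolding inj_def using that exhaust_3 by (smt (verit) distinct_length_2_or_more)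
  qed auto
  show ?thesis
    unfolding sym_trop_rank2_def mem_Collect_eq
  proof (intro conj_cong refl iffI allI impI)
    fix r1 r2 r3 c1 c2 c3 :: 'n
    assume *: "\<forall>r c. inj r \<longrightarrow> inj c \<longrightarrow> min_attained_twice (monomial_weight A) (Poly_Mapping.keys (generic_sym_minor r c))"
      "distinct [r1, r2, r3]" "distinct [c1, c2, c3]"
    obtain r c :: "3 \<Rightarrow> 'n" where "inj r" "inj c" "r 1 = r1" "r 2 = r2" "r 3 = r3" "c 1 = c1" "c 2 = c2" "c 3 = c3"
      using ex[OF *(2)] ex[OF *(3)] by metis
    then show "min_attained_twice (monomial_weight A) (minor_monomials r1 r2 r3 c1 c2 c3)"
      using *(1) keys_generic_sym_minor[of r c] by metis
  next
    fix r c :: "3 \<Rightarrow> 'n" assume *: "\<forall>r1 r2 r3 c1 c2 c3. distinct [r1, r2, r3] \<longrightarrow> distinct [c1, c2, c3] \<longrightarrow>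
     min_attained_twice (monomial_weight A) (minor_monomials r1 r2 r3 c1 c2 c3)" and i: "inj r" "inj c"
    have "distinct [r 1, r 2, r 3]" "distinct [c 1, c 2, c 3]" using i by (auto simp: inj_eq)
    then show "min_attained_twice (monomial_weight A) (Poly_Mapping.keys (generic_sym_minor r c))"
      using * keys_generic_sym_minor[OF i] by metis
  qed
qed

text \<open>In the principal minor on \<open>i\<close>, \<open>j\<close>, \<open>k\<close> both
  3-cycles give the monomial of the triangle. Two minimal permutations are therefore too weak a
  condition when they are these two; the triangle has to be excluded as sole minimal monomial. For
  equal indices one of the inequalities is an equation, so nothing is demanded.\<close>

definition no_principal_triangle :: "('n \<Rightarrow> 'n \<Rightarrow> real) \<Rightarrow> bool" where
  "no_principal_triangle A \<longleftrightarrow> (\<forall>i j k.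
     \<not> (A i j + A j k + A k i < A i i + A j j + A k k \<and> A i j + A j k + A k i < A i i + A j k + A k j \<and>
        A i j + A j k + A k i < A j j + A i k + A k i \<and> A i j + A j k + A k i < A k k + A i j + A j i))"

text \<open>A permutation that is strictly better than the five others has a monomial that is
  strictly better than all others; likewise for the triangle in a principal minor.\<close>

lemma sym_trop_rank2_imp:
  assumes A: "A \<in> sym_trop_rank2"
  shows "trop_rank_le2 (\<lambda>i j. A $ i $ j)" "no_principal_triangle (\<lambda>i j. A $ i $ j)"
proof -
  have sym: "transpose A = A" using A by (simp add: sym_trop_rank2_def)
  then have s: "A $ i $ j = A $ j $ i" for i j by (metis transpose_def vec_lambda_beta)
  have w: "monomial_weight A (monomial3 (Upair a b) (Upair c d) (Upair e f)) = A $ a $ b + A $ c $ d + A $ e $ f" for a b c d e f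
    by (simp add: monomial_weight_monomial3 sym_entry_Upair[OF sym])
  have twice: "\<exists>m\<in>minor_monomials r1 r2 r3 c1 c2 c3. \<exists>m'\<in>minor_monomials r1 r2 r3 c1 c2 c3. m \<noteq> m' \<and>
     (\<forall>k\<in>minor_monomials r1 r2 r3 c1 c2 c3. monomial_weight A m \<le> monomial_weight A k \<and> monomial_weight A m' \<le> monomial_weight A k)"
    if "distinct [r1, r2, r3]" "distinct [c1, c2, c3]" for r1 r2 r3 c1 c2 c3
    using A that unfolding sym_trop_rank2_minors min_attained_twice_def by blast
  have unique: False if "distinct [r1, r2, r3]" "distinct [c1, c2, c3]"
    and "n \<in> minor_monomials r1 r2 r3 c1 c2 c3"
    and "\<forall>k\<in>minor_monomials r1 r2 r3 c1 c2 c3. k \<noteq> n \<longrightarrow> monomial_weight A n < monomial_weight A k" for r1 r2 r3 c1 c2 c3 n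
    using twice[OF that(1,2)] that(3,4) by (metis not_le)
  show "trop_rank_le2 (\<lambda>i j. A $ i $ j)"
    unfolding trop_rank_le2_def
  proof (intro allI notI, elim conjE)
    fix i1 i2 i3 j1 j2 j3
    assume h: "A $ i1 $ j1 + A $ i2 $ j2 + A $ i3 $ j3 < A $ i1 $ j1 + A $ i2 $ j3 + A $ i3 $ j2"
      "A $ i1 $ j1 + A $ i2 $ j2 + A $ i3 $ j3 < A $ i1 $ j2 + A $ i2 $ j1 + A $ i3 $ j3"
      "A $ i1 $ j1 + A $ i2 $ j2 + A $ i3 $ j3 < A $ i1 $ j3 + A $ i2 $ j2 + A $ i3 $ j1"
      "A $ i1 $ j1 + A $ i2 $ j2 + A $ i3 $ j3 < A $ i1 $ j2 + A $ i2 $ j3 + A $ i3 $ j1"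
      "A $ i1 $ j1 + A $ i2 $ j2 + A $ i3 $ j3 < A $ i1 $ j3 + A $ i2 $ j1 + A $ i3 $ j2"
    then have "distinct [i1, i2, i3]" "distinct [j1, j2, j3]" by auto
    then show False
      by (rule unique[of _ _ _ _ _ _ "monomial3 (Upair i1 j1) (Upair i2 j2) (Upair i3 j3)"])
        (use h in \<open>auto simp: minor_monomials_def w\<close>)
  qed
  show "no_principal_triangle (\<lambda>i j. A $ i $ j)"
    unfolding no_principal_triangle_def
  proof (intro allI notI, elim conjE)
    fix i j k
    assume h: "A $ i $ j + A $ j $ k + A $ k $ i < A $ i $ i + A $ j $ j + A $ k $ k"
      "A $ i $ j + A $ j $ k + A $ k $ i < A $ i $ i + A $ j $ k + A $ k $ j"
      "A $ i $ j + A $ j $ k + A $ k $ i < A $ j $ j + A $ i $ k + A $ k $ i"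
      "A $ i $ j + A $ j $ k + A $ k $ i < A $ k $ k + A $ i $ j + A $ j $ i"
    then have d: "distinct [i, j, k]" using s by auto
    have c: "Upair k j = Upair j k" "Upair j i = Upair i j" "Upair k i = Upair i k" by auto
    \<comment> \<open>The monomial of the inverse 3-cycle coincides with that of the
      triangle.\<close>
    have e: "monomial3 (Upair i k) (Upair i j) (Upair j k) = monomial3 (Upair i j) (Upair j k) (Upair i k)"
      by (simp add: monomial3_def ac_simps)
    show False
      by (rule unique[OF d d, of "monomial3 (Upair i j) (Upair j k) (Upair k i)"])
        (use h s[of j i] s[of k i] s[of k j] in \<open>auto simp: minor_monomials_def w c e\<close>)
  qed
qed

text \<open>The pair of \<open>r1\<close> and \<open>c1\<close> must occur in the second monomial.
  It cannot equal a pair with the same row or the same column, so it is the pair of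
  \<open>r2\<close> and \<open>c3\<close> with rows and columns exchanged. Hence a coincidence
  occurs only in a principal minor.\<close>

lemma monomial3_three_cycle:
  assumes d: "distinct [r1, r2, r3]" "distinct [c1, c2, c3]"
    and e: "monomial3 (Upair r1 c1) (Upair r2 c2) (Upair r3 c3) = monomial3 (Upair r1 c2) (Upair r2 c3) (Upair r3 c1)"
  shows "c1 = r2" "c2 = r3" "c3 = r1"
proof -
  have "Upair r1 c1 = Upair r2 c3" using monomial3_mem[OF e] d by auto
  then have 1: "r1 = c3" "c1 = r2" using d by auto
  have "Upair r2 c2 = Upair r3 c1"
    using monomial3_mem[of "Upair r2 c2" "Upair r1 c1" "Upair r3 c3" "Upair r1 c2" "Upair r2 c3" "Upair r3 c1"] e d
    by (auto simp: monomial3_commute(1)[of "Upair r2 c2"])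
  then show "c1 = r2" "c2 = r3" "c3 = r1" using 1 d by auto
qed

text \<open>If the monomial of the identity differs from those of both cyclic shifts, being its only
  minimum means being the only minimal permutation. If it agrees with one of them, the minor is
  principal and the monomial is that of the triangle.\<close>

lemma no_unique_minor_monomial:
  fixes a :: "'n \<Rightarrow> 'n \<Rightarrow> real"
  assumes s: "\<And>i j. a i j = a j i" and t: "trop_rank_le2 a" and p: "no_principal_triangle a"
    and w: "\<And>a' b c d e f. w (monomial3 (Upair a' b) (Upair c d) (Upair e f)) = a a' b + a c d + a e f"
    and d: "distinct [r1, r2, r3]" "distinct [c1, c2, c3]"
  shows "\<exists>m\<in>minor_monomials r1 r2 r3 c1 c2 c3. m \<noteq> monomial3 (Upair r1 c1) (Upair r2 c2) (Upair r3 c3) \<and>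
    w m \<le> w (monomial3 (Upair r1 c1) (Upair r2 c2) (Upair r3 c3))" (is "\<exists>m\<in>?M. m \<noteq> ?m1 \<and> w m \<le> w ?m1")
proof (rule ccontr)
  assume "\<not> ?thesis"
  then have no: "\<And>m. m \<in> ?M \<Longrightarrow> m \<noteq> ?m1 \<Longrightarrow> w ?m1 < w m" by (meson not_le)
  let ?m2 = "monomial3 (Upair r1 c2) (Upair r2 c3) (Upair r3 c1)"
  let ?m3 = "monomial3 (Upair r1 c3) (Upair r2 c1) (Upair r3 c2)"
  let ?m4 = "monomial3 (Upair r1 c1) (Upair r2 c3) (Upair r3 c2)"
  let ?m5 = "monomial3 (Upair r1 c2) (Upair r2 c1) (Upair r3 c3)"
  let ?m6 = "monomial3 (Upair r1 c3) (Upair r2 c2) (Upair r3 c1)"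
  have M: "?m2 \<in> ?M" "?m3 \<in> ?M" "?m4 \<in> ?M" "?m5 \<in> ?M" "?m6 \<in> ?M" by (auto simp: minor_monomials_def)
  have odd: "?m4 \<noteq> ?m1" "?m5 \<noteq> ?m1" "?m6 \<noteq> ?m1"
    using monomial3_parity[OF d] by (metis insertI1 insertI2)+
  have lt: "w ?m1 < w ?m4" "w ?m1 < w ?m5" "w ?m1 < w ?m6" using no M odd by blast+
  consider "?m1 \<noteq> ?m2" "?m1 \<noteq> ?m3" | "?m1 = ?m2" | "?m1 = ?m3" by blast
  then show False
  proof cases
    case 1
    then have "w ?m1 < w ?m2" "w ?m1 < w ?m3" using no M by metis+
    then show False using lt by (intro trop_rank_le2D[OF t, of r1 c1 r2 c2 r3 c3]) (simp_all add: w)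
  next
    case 2
    have c: "c1 = r2" "c2 = r3" "c3 = r1" using monomial3_three_cycle[OF d 2] .
    have "?m3 \<noteq> ?m1" using monomial3_mem[of "Upair r1 c3" "Upair r2 c1" "Upair r3 c2" "Upair r1 c1" "Upair r2 c2" "Upair r3 c3"] d c by auto
    then have "w ?m1 < w ?m3" using no M by blast
    then show False using p[unfolded no_principal_triangle_def, rule_format, of r1 r2 r3] lt c s by (simp add: w add.commute add.left_commute)
  next
    case 3
    have "distinct [r1, r3, r2]" "distinct [c1, c3, c2]" using d by auto
    moreover have "monomial3 (Upair r1 c1) (Upair r3 c3) (Upair r2 c2) = monomial3 (Upair r1 c3) (Upair r3 c2) (Upair r2 c1)"
      using 3 by (simp add: monomial3_commute(2)[of "Upair r1 _" "Upair r3 _"])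
    ultimately have c: "c1 = r3" "c3 = r2" "c2 = r1" by (rule monomial3_three_cycle)+
    have "?m2 \<noteq> ?m1" using monomial3_mem[of "Upair r1 c2" "Upair r2 c3" "Upair r3 c1" "Upair r1 c1" "Upair r2 c2" "Upair r3 c3"] d c by auto
    then have "w ?m1 < w ?m2" using no M by blast
    then show False using p[unfolded no_principal_triangle_def, rule_format, of r1 r3 r2] lt c s by (simp add: w add.commute add.left_commute)
  qed
qed

text \<open>Reordering the columns turns any minimal monomial into that of the identity, to which
  \<open>no_unique_minor_monomial\<close> applies.\<close>

lemma sym_trop_rank2_intro:
  fixes A :: "real ^ 'n::finite ^ 'n"
  assumes sym: "transpose A = A" and t: "trop_rank_le2 (\<lambda>i j. A $ i $ j)" and p: "no_principal_triangle (\<lambda>i j. A $ i $ j)"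
  shows "A \<in> sym_trop_rank2"
  unfolding sym_trop_rank2_minors
proof (intro conjI sym allI impI)
  fix r1 r2 r3 c1 c2 c3 :: 'n
  assume d: "distinct [r1, r2, r3]" "distinct [c1, c2, c3]"
  let ?M = "minor_monomials r1 r2 r3 c1 c2 c3" let ?w = "monomial_weight A"
  have s: "A $ i $ j = A $ j $ i" for i j using sym by (metis transpose_def vec_lambda_beta)
  have w: "?w (monomial3 (Upair a b) (Upair c d) (Upair e f)) = A $ a $ b + A $ c $ d + A $ e $ f" for a b c d e f
    by (simp add: monomial_weight_monomial3 sym_entry_Upair[OF sym])
  have fin: "finite ?M" "?M \<noteq> {}" by (auto simp: minor_monomials_def)
  have "Min (?w ` ?M) \<in> ?w ` ?M" by (rule Min_in) (use fin in auto)
  then obtain m where m: "m \<in> ?M" "?w m = Min (?w ` ?M)" by (metis imageE)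
  have min: "?w m \<le> ?w k" if "k \<in> ?M" for k
    unfolding m(2) by (rule Min_le) (use fin that in auto)
  note core = no_unique_minor_monomial[of "\<lambda>i j. A $ i $ j" ?w, OF s t p w d(1)]
  have core': "\<exists>k\<in>?M. k \<noteq> monomial3 (Upair r1 x) (Upair r2 y) (Upair r3 z) \<and> ?w k \<le> ?w (monomial3 (Upair r1 x) (Upair r2 y) (Upair r3 z))"
    if "(x, y, z) \<in> {(c1, c2, c3), (c2, c3, c1), (c3, c1, c2), (c1, c3, c2), (c2, c1, c3), (c3, c2, c1)}" for x y z
  proof -
    have "distinct [x, y, z]" using d that by auto
    moreover have "minor_monomials r1 r2 r3 x y z = ?M" using that by (auto simp: minor_monomials_def)
    ultimately show ?thesis using core[of x y z] by simp
  qed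
  have "\<exists>x y z. (x, y, z) \<in> {(c1, c2, c3), (c2, c3, c1), (c3, c1, c2), (c1, c3, c2), (c2, c1, c3), (c3, c2, c1)} \<and>
     m = monomial3 (Upair r1 x) (Upair r2 y) (Upair r3 z)"
    using m(1) unfolding minor_monomials_def by (elim insertE emptyE) blast+
  then obtain x y z where xyz: "(x, y, z) \<in> {(c1, c2, c3), (c2, c3, c1), (c3, c1, c2), (c1, c3, c2), (c2, c1, c3), (c3, c2, c1)}"
    and mx: "m = monomial3 (Upair r1 x) (Upair r2 y) (Upair r3 z)" by (elim exE conjE)
  obtain k where k: "k \<in> ?M" "k \<noteq> m" "?w k \<le> ?w m" using core'[OF xyz] unfolding mx by (elim bexE conjE)
  have "?w k \<le> ?w l" if "l \<in> ?M" for l using k(3) min[OF that] by simp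
  then show "min_attained_twice ?w ?M"
    unfolding min_attained_twice_def using m(1) k(1,2) min by (intro bexI[of _ m] bexI[of _ k]) auto
qed

section \<open>Involution-invariant systems of sides\<close>

lemma swap_label_simps [simp]:
  "swap_label (swap_label l) = l" "swap_label (Inl i) = Inr i" "swap_label (Inr i) = Inl i"
  by (cases l) (simp_all add: swap_label_def)

lemma bij_swap_label: "bij swap_label"
  by (rule o_bij[of swap_label]) (auto simp: fun_eq_iff)

lemma mem_swap_label_image [simp]: "l \<in> swap_label ` X \<longleftrightarrow> swap_label l \<in> X"
  by (metis (no_types, lifting) image_iff swap_label_simps(1))

lemma swap_side_simps [simp]:
  "swap_label ` swap_label ` X = X" "swap_label ` (- X) = - (swap_label ` X)"
  by (rule set_eqI, simp)+

lemma bicoloured_swap [simp]: "bicoloured (swap_label ` X) = bicoloured X"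
  unfolding bicoloured_def by (simp add: conj_commute)

lemma compat_swap: "compat (swap_label ` X) (swap_label ` Y) \<longleftrightarrow> compat X Y"
proof -
  have "swap_label ` X \<inter> swap_label ` Y = swap_label ` (X \<inter> Y)" for X Y :: "('a + 'a) set"
    by (rule set_eqI) simp
  then show ?thesis unfolding compat_def swap_side_simps(2)[symmetric] by (simp del: swap_side_simps)
qed

text \<open>Three disjoint invariant sides would make the fixed points of the involution branch.\<close>
definition no_tripod :: "('n + 'n) set set \<Rightarrow> bool" where
  "no_tripod U \<longleftrightarrow> (\<forall>X\<in>U. \<forall>Y\<in>U. \<forall>Z\<in>U. swap_label ` X = X \<longrightarrow> swap_label ` Y = Y \<longrightarrow> swap_label ` Z = Z \<longrightarrow>
     \<not> (X \<inter> Y = {} \<and> X \<inter> Z = {} \<and> Y \<inter> Z = {}))"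

definition symbic_system :: "('n + 'n) set set \<Rightarrow> bool" where
  "symbic_system U \<longleftrightarrow> side_system U \<and> (\<forall>X\<in>U. swap_label ` X \<in> U) \<and> no_tripod U"

text \<open>The three rows and the three columns hang in pairs on three branches of a common vertex, and
  neither matching uses such a pair; so both have the total distance to that vertex as weight.\<close>
lemma tripod_matchings:
  fixes U :: "('n::finite + 'n) set set"
  assumes U: "side_system U"
    and eq: "\<And>i j k l. cross A i j k l = cross (gram U w) i j k l"
    and X: "X \<in> U" "Inl i1 \<in> X" "Inr j2 \<in> X" and Y: "Y \<in> U" "Inl i2 \<in> Y" "Inr j3 \<in> Y"
    and Z: "Z \<in> U" "Inl i3 \<in> Z" "Inr j1 \<in> Z" and disj: "X \<inter> Y = {}" "X \<inter> Z = {}" "Y \<inter> Z = {}"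
  shows "A i1 j1 + A i2 j2 + A i3 j3 = A i1 j3 + A i2 j1 + A i3 j2"
proof -
  let ?b = "\<lambda>V i j. of_bool (Inl i \<in> V) * of_bool (Inr j \<in> V) :: real"
  have n: "Inl i1 \<notin> Y" "Inr j2 \<notin> Y" "Inl i1 \<notin> Z" "Inr j2 \<notin> Z" "Inl i2 \<notin> X" "Inr j3 \<notin> X" "Inl i2 \<notin> Z" "Inr j3 \<notin> Z"
    "Inl i3 \<notin> X" "Inr j1 \<notin> X" "Inl i3 \<notin> Y" "Inr j1 \<notin> Y"
    using X Y Z disj by blast+
  have t: "w V * (?b V i1 j1 + ?b V i2 j2 + ?b V i3 j3 - ?b V i1 j3 - ?b V i2 j1 - ?b V i3 j2) = 0" if V: "V \<in> U" for V
  proof -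
    have c: "compat X V" "compat Y V" "compat Z V" using side_systemD(3)[OF U _ V] X Y Z by blast+
    \<comment> \<open>If \<open>V\<close> separates the two labels in one branch, compatibility with
      that branch puts the other four labels on one side of \<open>V\<close>; if it separates no
      such pair, it treats the branches as units. In both situations the two matchings have equally
      many pairs inside \<open>V\<close>.\<close>
    have 1: "(Inl i1 \<notin> V \<and> Inr j2 \<notin> V) \<or> (Inl i1 \<in> V \<and> Inr j2 \<in> V) \<or>
      (Inl i2 \<notin> V \<and> Inr j3 \<notin> V \<and> Inl i3 \<notin> V \<and> Inr j1 \<notin> V) \<or> (Inl i2 \<in> V \<and> Inr j3 \<in> V \<and> Inl i3 \<in> V \<and> Inr j1 \<in> V)"
      using c(1) X n unfolding compat_def by blast
    have 2: "(Inl i2 \<notin> V \<and> Inr j3 \<notin> V) \<or> (Inl i2 \<in> V \<and> Inr j3 \<in> V) \<or>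
      (Inl i1 \<notin> V \<and> Inr j2 \<notin> V \<and> Inl i3 \<notin> V \<and> Inr j1 \<notin> V) \<or> (Inl i1 \<in> V \<and> Inr j2 \<in> V \<and> Inl i3 \<in> V \<and> Inr j1 \<in> V)"
      using c(2) Y n unfolding compat_def by blast
    have 3: "(Inl i3 \<notin> V \<and> Inr j1 \<notin> V) \<or> (Inl i3 \<in> V \<and> Inr j1 \<in> V) \<or>
      (Inl i1 \<notin> V \<and> Inr j2 \<notin> V \<and> Inl i2 \<notin> V \<and> Inr j3 \<notin> V) \<or> (Inl i1 \<in> V \<and> Inr j2 \<in> V \<and> Inl i2 \<in> V \<and> Inr j3 \<in> V)"
      using c(3) Z n unfolding compat_def by blast
    show ?thesis using 1 2 3
      by (cases "Inl i1 \<in> V"; cases "Inr j2 \<in> V"; cases "Inl i2 \<in> V"; cases "Inr j3 \<in> V"; cases "Inl i3 \<in> V"; cases "Inr j1 \<in> V")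
        simp_all
  qed
  have "A i1 j1 + A i2 j2 + A i3 j3 - (A i1 j3 + A i2 j1 + A i3 j2) = cross A i1 j1 i2 j3 + cross A i2 j2 i3 j3"
    by (simp add: cross_def)
  also have "\<dots> = cross (gram U w) i1 j1 i2 j3 + cross (gram U w) i2 j2 i3 j3" by (simp only: eq)
  also have "\<dots> = (\<Sum>V\<in>U. w V * (?b V i1 j1 + ?b V i2 j2 + ?b V i3 j3 - ?b V i1 j3 - ?b V i2 j1 - ?b V i3 j2)) / 2"
    unfolding cross_gram add_divide_distrib[symmetric] sum.distrib[symmetric]
    by (intro arg_cong[of _ _ "\<lambda>x. x / 2"] sum.cong refl) (simp add: algebra_simps)
  also have "\<dots> = 0" using t by (simp add: sum.neutral)
  finally show ?thesis by simp
qed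

lemma disjoint_of_compat:
  "compat X Y \<Longrightarrow> a \<in> X \<Longrightarrow> a \<notin> Y \<Longrightarrow> b \<notin> X \<Longrightarrow> b \<in> Y \<Longrightarrow> c \<notin> X \<Longrightarrow> c \<notin> Y \<Longrightarrow> X \<inter> Y = {}"
  "compat X Y \<Longrightarrow> a \<in> X \<Longrightarrow> a \<in> Y \<Longrightarrow> c \<notin> X \<Longrightarrow> c \<notin> Y \<Longrightarrow> X \<subseteq> Y \<or> Y \<subseteq> X"
  unfolding compat_def by blast+

text \<open>If the identity were the only minimum, each transposition would yield a positive cross
  difference and thus a separating side. Compatibility arranges the three sides, up to complements,
  as disjoint branches of a tripod, and there the identity has the same weight as a 3-cycle.\<close>

lemma trop_rank_le2_of_gram:
  fixes U :: "('n::finite + 'n) set set"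
  assumes U: "side_system U" "weighting U w"
    and eq: "\<And>i j k l. cross A i j k l = cross (gram U w) i j k l"
  shows "trop_rank_le2 A"
  unfolding trop_rank_le2_def
proof (intro allI notI, elim conjE)
  fix i1 i2 i3 j1 j2 j3
  assume m: "A i1 j1 + A i2 j2 + A i3 j3 < A i1 j1 + A i2 j3 + A i3 j2"
    "A i1 j1 + A i2 j2 + A i3 j3 < A i1 j2 + A i2 j1 + A i3 j3"
    "A i1 j1 + A i2 j2 + A i3 j3 < A i1 j3 + A i2 j2 + A i3 j1"
    "A i1 j1 + A i2 j2 + A i3 j3 < A i1 j2 + A i2 j3 + A i3 j1"
    "A i1 j1 + A i2 j2 + A i3 j3 < A i1 j3 + A i2 j1 + A i3 j2"
  have ex: "\<exists>X\<in>U. separates X i j k l" if "cross A i j k l > 0" for i j k l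
    using cross_gram_pos_separated[OF U, of i j k l] that eq by simp
  have "cross A i1 j2 i2 j1 > 0" "cross A i1 j3 i3 j1 > 0" "cross A i2 j3 i3 j2 > 0"
    using m by (simp_all add: cross_def)
  then obtain X Y Z where X: "X \<in> U" "separates X i1 j2 i2 j1" and Y: "Y \<in> U" "separates Y i1 j3 i3 j1"
    and Z: "Z \<in> U" "separates Z i2 j3 i3 j2" using ex by meson
  note s = X(2)[unfolded separates_def] Y(2)[unfolded separates_def] Z(2)[unfolded separates_def]
  have c: "compat X Y" "compat X Z" "compat Y Z" using side_systemD(3)[OF U(1)] X Y Z by blast+
  have "X \<subseteq> Y \<or> Y \<subseteq> X" using disjoint_of_compat(2)[OF c(1), of "Inl i1" "Inr j1"] s by blast
  then show False
  proof
    \<comment> \<open>Here the branches are \<open>X\<close>, \<open>Z\<close> and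
      \<open>-Y\<close>; in the other case they are \<open>Y\<close>, \<open>-Z\<close> and
      \<open>-X\<close>, which leads to the other 3-cycle.\<close>
    assume XY: "X \<subseteq> Y"
    have XZ: "X \<inter> Z = {}" by (rule disjoint_of_compat(1)[OF c(2), of "Inl i1 " "Inl i2" "Inl i3", rotated -1])
      (use s XY c(2) in \<open>unfold compat_def, blast+\<close>)
    have ZY: "Z \<inter> - Y = {}" using c(3) s XY XZ unfolding compat_def by blast
    have "A i1 j1 + A i2 j2 + A i3 j3 = A i1 j3 + A i2 j1 + A i3 j2"
      by (rule tripod_matchings[OF U(1) eq, of X i1 j2 Z i2 j3 "- Y" i3 j1])
        (use X Y Z s XY XZ ZY side_systemD(1)[OF U(1)] in auto)
    then show False using m by simp
  next
    assume YX: "Y \<subseteq> X"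
    have XZ: "- X \<inter> - Z = {}" using c(2) s YX unfolding compat_def by blast
    have YZ: "Y \<inter> - Z = {}" using c(3) s YX XZ unfolding compat_def by blast
    have "A i1 j1 + A i3 j3 + A i2 j2 = A i1 j2 + A i3 j1 + A i2 j3"
      by (rule tripod_matchings[OF U(1) eq, of Y i1 j3 "- Z" i3 j2 "- X" i2 j1])
        (use X Y Z s XZ YZ YX side_systemD(1)[OF U(1)] in auto)
    then show False using m by simp
  qed
qed

lemma swap_side_subset:
  fixes X :: "('n::finite + 'n) set"
  assumes "X \<subseteq> swap_label ` X \<or> swap_label ` X \<subseteq> X"
  shows "swap_label ` X = X"
proof -
  have c: "card (swap_label ` X) = card X"
    by (rule card_image) (use bij_swap_label in \<open>auto simp: bij_def inj_on_def\<close>)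
  from assms show ?thesis
  proof
    assume "X \<subseteq> swap_label ` X"
    from card_subset_eq[OF _ this] c show ?thesis by simp
  next
    assume "swap_label ` X \<subseteq> X"
    from card_subset_eq[OF _ this] c show ?thesis by simp
  qed
qed

text \<open>The side and its image share \<open>i\<close>, so compatibility leaves nesting or
  covering, and nested sets of equal finite size are equal.\<close>

lemma swap_invariant_side:
  fixes X :: "('n::finite + 'n) set"
  assumes "compat X (swap_label ` X)" "Inl i \<in> X" "Inr i \<in> X"
  shows "swap_label ` X = X \<or> X \<union> swap_label ` X = UNIV"
proof (cases "X \<subseteq> swap_label ` X \<or> swap_label ` X \<subseteq> X")
  case True
  then show ?thesis using swap_side_subset by blast
next
  case False
  have "Inl i \<in> swap_label ` X" using assms by simp
  then show ?thesis using False assms(1,2) unfolding compat_def by blast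
qed

text \<open>A triangle that is the sole minimum makes the cross differences of \<open>i\<close>,
  \<open>j\<close>, \<open>k\<close> with themselves positive, so that each of the three lies
  together with its primed copy in a side that avoids one label of each of the other two. These
  sides turn out to be invariant and disjoint, a tripod.\<close>

lemma no_principal_triangle_of_gram:
  fixes U :: "('n::finite + 'n) set set"
  assumes U: "symbic_system U" "weighting U w"
    and eq: "\<And>i j k l. cross A i j k l = cross (gram U w) i j k l" and sym: "\<And>i j. A i j = A j i"
  shows "no_principal_triangle A"
  unfolding no_principal_triangle_def
proof (intro allI notI, elim conjE)
  fix i j k
  assume m: "A i j + A j k + A k i < A i i + A j j + A k k" "A i j + A j k + A k i < A i i + A j k + A k j"
    "A i j + A j k + A k i < A j j + A i k + A k i" "A i j + A j k + A k i < A k k + A i j + A j i"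
  have U': "side_system U" and nt: "no_tripod U" and sw: "\<And>X. X \<in> U \<Longrightarrow> swap_label ` X \<in> U"
    using U(1) by (auto simp: symbic_system_def)
  have ex: "\<exists>X\<in>U. separates X i j k l" if "cross A i j k l > 0" for i j k l
    using cross_gram_pos_separated[OF U' U(2), of i j k l] that eq by simp
  have "cross A i i j k > 0" "cross A j j i k > 0" "cross A k k i j > 0"
    using m sym[of j i] sym[of k i] sym[of k j] by (simp_all add: cross_def)
  then obtain X Y Z where X: "X \<in> U" "separates X i i j k" and Y: "Y \<in> U" "separates Y j j i k"
    and Z: "Z \<in> U" "separates Z k k i j" using ex by meson
  note s = X(2)[unfolded separates_def] Y(2)[unfolded separates_def] Z(2)[unfolded separates_def]
  have c: "compat X Y" "compat X Z" "compat Y Z" using side_systemD(3)[OF U'] X Y Z by blast+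
  have inv: "swap_label ` V = V \<or> V \<union> swap_label ` V = UNIV" if "V \<in> U" "Inl a \<in> V" "Inr a \<in> V" for V a
    by (rule swap_invariant_side[OF _ that(2,3)]) (rule side_systemD(3)[OF U' that(1) sw[OF that(1)]])
  have mem: "Inl a \<in> V \<or> Inr a \<in> V" if "V \<union> swap_label ` V = UNIV" for V a
  proof -
    have "Inl a \<in> V \<union> swap_label ` V" using that by simp
    then show ?thesis by auto
  qed
  have X': "swap_label ` X = X"
  proof (rule ccontr)
    assume "swap_label ` X \<noteq> X"
    \<comment> \<open>If \<open>X\<close> and its image covered all labels, \<open>j'\<close> would
      be in \<open>X\<close>, and then \<open>j'\<close>, \<open>i\<close>, \<open>j\<close>,
      \<open>k'\<close> would occupy all four intersections of \<open>X\<close> and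
      \<open>Y\<close>.\<close>
    then have "X \<union> swap_label ` X = UNIV" using inv[OF X(1), of i] s by simp
    then have "Inr j \<in> X" using mem[of X j] s by simp
    then show False using compat_witnesses[OF c(1), of "Inr j" "Inl i" "Inl j" "Inr k"] s by blast
  qed
  have Y': "swap_label ` Y = Y"
  proof (rule ccontr)
    assume "swap_label ` Y \<noteq> Y"
    then have "Y \<union> swap_label ` Y = UNIV" using inv[OF Y(1), of j] s by simp
    then have "Inr i \<in> Y" using mem[of Y i] s by simp
    then show False using compat_witnesses[OF c(1), of "Inr i" "Inl i" "Inl j" "Inr k"] s by blast
  qed
  have e: "Inl a \<in> V \<longleftrightarrow> Inr a \<in> V" if "swap_label ` V = V" for V a
    using mem_swap_label_image[of "Inl a" V] that by simp
  have Z': "swap_label ` Z = Z"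
  proof (rule ccontr)
    assume "swap_label ` Z \<noteq> Z"
    then have "Z \<union> swap_label ` Z = UNIV" using inv[OF Z(1), of k] s by simp
    then have "Inr i \<in> Z" using mem[of Z i] s by simp
    then show False using compat_witnesses[OF c(2), of "Inr i" "Inl i" "Inl k" "Inr j"] s e[OF X'] by blast
  qed
  note ee = e[OF X'] e[OF Y'] e[OF Z']
  have "X \<inter> Y = {}" by (rule disjoint_of_compat(1)[OF c(1), of "Inl i" "Inl j" "Inl k"]) (use s ee in blast)+
  moreover have "X \<inter> Z = {}" by (rule disjoint_of_compat(1)[OF c(2), of "Inl i" "Inl k" "Inl j"]) (use s ee in blast)+
  moreover have "Y \<inter> Z = {}" by (rule disjoint_of_compat(1)[OF c(3), of "Inl j" "Inl k" "Inl i"]) (use s ee in blast)+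
  ultimately show False using nt X Y Z X' Y' Z' unfolding no_tripod_def by blast
qed

lemma gram_swap_image:
  fixes U :: "('n::finite + 'n) set set"
  shows "cross (gram ((`) swap_label ` U) (\<lambda>X. w (swap_label ` X))) i j k l = cross (gram U w) j i l k"
proof -
  have inj: "inj_on ((`) swap_label) U" by (rule inj_onI) (metis swap_side_simps(1))
  show ?thesis unfolding cross_gram sum.reindex[OF inj] by (simp add: mult.commute)
qed

text \<open>Transposition exchanges the colours. As the matrix is symmetric, the image of its
  decomposition under the swap is again a decomposition, and uniqueness makes sides and weights
  invariant. For three disjoint invariant sides, one label from each would span a triangle that is
  the sole minimum.\<close>

lemma symbic_decomposition:
  fixes A :: "'n::finite \<Rightarrow> 'n \<Rightarrow> real"
  assumes t: "trop_rank_le2 A" and p: "no_principal_triangle A" and sym: "\<And>i j. A i j = A j i"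
  shows "\<exists>U w. symbic_system U \<and> weighting U w \<and> (\<forall>X\<in>U. w (swap_label ` X) = w X) \<and>
    (\<forall>i j k l. cross A i j k l = cross (gram U w) i j k l)"
proof -
  obtain U w where U: "side_system U" "weighting U w" "U \<subseteq> positive_sides A"
    and eq: "\<And>i j k l. cross A i j k l = cross (gram U w) i j k l"
    using trop_rank_le2_decomposition[OF t] by blast
  let ?V = "(`) swap_label ` U" and ?v = "\<lambda>X. w (swap_label ` X)"
  have V: "side_system ?V"
    using U(1) unfolding side_system_def by (auto simp: compat_swap simp flip: swap_side_simps(2))
  have v: "weighting ?V ?v"
    using U(2) unfolding weighting_def by auto
  have "cross (gram U w) i j k l = cross (gram ?V ?v) i j k l" for i j k l
  proof -
    have "cross A i j k l = cross A j i l k" by (simp add: cross_def sym)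
    then show ?thesis unfolding gram_swap_image eq .
  qed
  note u = gram_unique[OF U(1,2) V v this]
  have sw: "swap_label ` X \<in> U" if "X \<in> U" for X using u(1) that by blast
  have w: "w (swap_label ` X) = w X" if "X \<in> U" for X using u(2)[OF that] by simp
  have "no_tripod U"
    unfolding no_tripod_def
  proof (intro ballI impI notI, elim conjE)
    fix X Y Z assume X: "X \<in> U" "swap_label ` X = X" and Y: "Y \<in> U" "swap_label ` Y = Y" and Z: "Z \<in> U" "swap_label ` Z = Z"
      and d: "X \<inter> Y = {}" "X \<inter> Z = {}" "Y \<inter> Z = {}"
    obtain i j k where i: "Inl i \<in> X" and j: "Inl j \<in> Y" and k: "Inl k \<in> Z"
      using side_systemD(2)[OF U(1)] X Y Z unfolding bicoloured_def by meson
    have e: "Inl a \<in> V \<longleftrightarrow> Inr a \<in> V" if "swap_label ` V = V" for V a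
      using mem_swap_label_image[of "Inl a" V] that by simp
    have n: "Inl i \<notin> Y" "Inl i \<notin> Z" "Inl j \<notin> X" "Inl j \<notin> Z" "Inl k \<notin> X" "Inl k \<notin> Y" using i j k d by blast+
    have pos: "cross A a b c d > 0" if "V \<in> U" "separates V a b c d" for V a b c d
      by (rule positive_sidesD(3)[OF subsetD[OF U(3) that(1)] that(2)])
    note m = i j k n e[OF X(2)] e[OF Y(2)] e[OF Z(2)]
    have "cross A i i j k > 0" "cross A i i j j > 0"
      by (rule pos[OF X(1)]; use m in \<open>simp add: separates_def\<close>)+
    moreover have "cross A j j i k > 0" by (rule pos[OF Y(1)]) (use m in \<open>simp add: separates_def\<close>)
    moreover have "cross A k k i j > 0" by (rule pos[OF Z(1)]) (use m in \<open>simp add: separates_def\<close>)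
    ultimately show False
      using p[unfolded no_principal_triangle_def, rule_format, of i j k] sym[of j i] sym[of k i] sym[of k j]
      by (simp add: cross_def)
  qed
  then show ?thesis using U eq sw w unfolding symbic_system_def by blast
qed

theorem sym_trop_rank2_iff:
  fixes A :: "real ^ 'n::finite ^ 'n"
  shows "A \<in> sym_trop_rank2 \<longleftrightarrow> (\<forall>i j. A $ i $ j = A $ j $ i) \<and>
    (\<exists>U w. symbic_system U \<and> weighting U w \<and> (\<forall>X\<in>U. w (swap_label ` X) = w X) \<and>
      (\<forall>i j k l. cross (\<lambda>i j. A $ i $ j) i j k l = cross (gram U w) i j k l))"
proof -
  have sym: "transpose A = A \<longleftrightarrow> (\<forall>i j. A $ i $ j = A $ j $ i)"
    unfolding vec_eq_iff transpose_def by (auto simp: eq_commute)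
  show ?thesis
  proof
    assume A: "A \<in> sym_trop_rank2"
    then have "\<forall>i j. A $ i $ j = A $ j $ i" using sym by (simp add: sym_trop_rank2_def)
    then show "(\<forall>i j. A $ i $ j = A $ j $ i) \<and>
    (\<exists>U w. symbic_system U \<and> weighting U w \<and> (\<forall>X\<in>U. w (swap_label ` X) = w X) \<and>
      (\<forall>i j k l. cross (\<lambda>i j. A $ i $ j) i j k l = cross (gram U w) i j k l))"
      using symbic_decomposition[OF sym_trop_rank2_imp[OF A]] by blast
  next
    assume *: "(\<forall>i j. A $ i $ j = A $ j $ i) \<and>
    (\<exists>U w. symbic_system U \<and> weighting U w \<and> (\<forall>X\<in>U. w (swap_label ` X) = w X) \<and>
      (\<forall>i j k l. cross (\<lambda>i j. A $ i $ j) i j k l = cross (gram U w) i j k l))"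
    then obtain U w where U: "symbic_system U" "weighting U w"
      and eq: "\<And>i j k l. cross (\<lambda>i j. A $ i $ j) i j k l = cross (gram U w) i j k l" by blast
    have "side_system U" using U(1) by (simp add: symbic_system_def)
    from trop_rank_le2_of_gram[OF this U(2) eq] no_principal_triangle_of_gram[OF U eq]
    show "A \<in> sym_trop_rank2" using sym_trop_rank2_intro sym * by blast
  qed
qed

section \<open>Simplicial fans from unique conic combinations\<close>

locale unique_cone_family =
  fixes L :: "'a::euclidean_space set" and gen :: "'i \<Rightarrow> 'a" and F :: "'i set set"
  assumes subspace_L: "subspace L" and finite_F: "finite F" and finite_face: "s \<in> F \<Longrightarrow> finite s"
    and down_closed: "s \<in> F \<Longrightarrow> t \<subseteq> s \<Longrightarrow> t \<in> F"
    and unique: "\<And>s t c d. s \<in> F \<Longrightarrow> t \<in> F \<Longrightarrow> \<forall>i\<in>s. c i > (0::real) \<Longrightarrow> \<forall>i\<in>t. d i > 0 \<Longrightarrow>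
      (\<Sum>i\<in>s. c i *\<^sub>R gen i) - (\<Sum>i\<in>t. d i *\<^sub>R gen i) \<in> L \<Longrightarrow> s = t \<and> (\<forall>i\<in>s. c i = d i)"
begin

definition cone :: "'i set \<Rightarrow> 'a set" where
  "cone s = {l + (\<Sum>i\<in>s. c i *\<^sub>R gen i) | l c. l \<in> L \<and> (\<forall>i\<in>s. 0 \<le> c i)}"

definition open_cone :: "'i set \<Rightarrow> 'a set" where
  "open_cone s = {l + (\<Sum>i\<in>s. c i *\<^sub>R gen i) | l c. l \<in> L \<and> (\<forall>i\<in>s. 0 < c i)}"

lemma coneI:
  "x = l + (\<Sum>i\<in>s. c i *\<^sub>R gen i) \<Longrightarrow> l \<in> L \<Longrightarrow> \<forall>i\<in>s. 0 \<le> c i \<Longrightarrow> x \<in> cone s"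
  unfolding cone_def by (intro CollectI exI[of _ l] exI[of _ c] conjI)

lemma open_coneI:
  "x = l + (\<Sum>i\<in>s. c i *\<^sub>R gen i) \<Longrightarrow> l \<in> L \<Longrightarrow> \<forall>i\<in>s. 0 < c i \<Longrightarrow> x \<in> open_cone s"
  unfolding open_cone_def by (intro CollectI exI[of _ l] exI[of _ c] conjI)

text \<open>Uniqueness is assumed for positive coefficients only. Arbitrary ones are the difference
  of the positive families \<open>K + a i\<close> and \<open>K\<close>, where \<open>K\<close>
  exceeds all absolute values.\<close>

lemma coefficients_zero:
  assumes s: "s \<in> F" and L: "(\<Sum>i\<in>s. a i *\<^sub>R gen i) \<in> L" and i: "i \<in> s"
  shows "a i = 0"
proof -
  define K where "K = (\<Sum>i\<in>s. \<bar>a i\<bar>) + 1"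
  have K: "\<bar>a i\<bar> < K" if "i \<in> s" for i
    using member_le_sum[of i s "\<lambda>i. \<bar>a i\<bar>"] finite_face[OF s] that by (simp add: K_def)
  have K0: "K > 0" using K[OF i] by linarith
  have "(\<Sum>i\<in>s. (K + a i) *\<^sub>R gen i) - (\<Sum>i\<in>s. K *\<^sub>R gen i) = (\<Sum>i\<in>s. a i *\<^sub>R gen i)"
    by (simp only: sum_subtractf[symmetric] scaleR_diff_left[symmetric] add_diff_cancel_left')
  then have "(\<Sum>i\<in>s. (K + a i) *\<^sub>R gen i) - (\<Sum>i\<in>s. K *\<^sub>R gen i) \<in> L" using L by (simp only:)
  moreover have "\<forall>i\<in>s. K + a i > 0"
  proof
    fix i assume "i \<in> s"
    then show "K + a i > 0" using K[of i] by linarith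
  qed
  moreover have "\<forall>i\<in>s. K > 0" using K0 by blast
  ultimately have "s = s \<and> (\<forall>i\<in>s. K + a i = K)" by (intro unique[OF s s])
  then show ?thesis using i by auto
qed

lemma inj_on_gen: assumes s: "s \<in> F" shows "inj_on gen s"
proof (rule inj_onI, rule ccontr)
  fix i j assume ij: "i \<in> s" "j \<in> s" "gen i = gen j" "i \<noteq> j"
  let ?a = "\<lambda>k. (if k = i then 1 else 0) - (if k = j then 1 else 0) :: real"
  have "(\<Sum>k\<in>s. ?a k *\<^sub>R gen k) = 0"
    using finite_face[OF s] ij by (simp add: scaleR_diff_left sum_subtractf if_distrib[of "\<lambda>x. x *\<^sub>R _"] sum.delta cong: if_cong)
  then have "?a i = 0" using coefficients_zero[OF s _ ij(1), of ?a] subspace_0[OF subspace_L] by simp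
  then show False using ij by simp
qed

lemma generators_independent:
  assumes s: "s \<in> F"
  shows "independent (gen ` s)" "span (gen ` s) \<inter> L = {0}"
proof -
  note fin = finite_face[OF s] and inj = inj_on_gen[OF s]
  show "independent (gen ` s)"
    unfolding independent_explicit
  proof (intro conjI allI impI ballI)
    show "finite (gen ` s)" using fin by simp
    fix c v assume 0: "(\<Sum>v\<in>gen ` s. c v *\<^sub>R v) = 0" and "v \<in> gen ` s"
    then obtain i where i: "i \<in> s" "v = gen i" by blast
    have "(\<Sum>i\<in>s. c (gen i) *\<^sub>R gen i) = 0" using 0 by (simp add: sum.reindex[OF inj])
    then show "c v = 0" using coefficients_zero[OF s _ i(1), of "\<lambda>i. c (gen i)"] subspace_0[OF subspace_L] i(2) by simp
  qed
  have "x = 0" if x: "x \<in> span (gen ` s)" "x \<in> L" for x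
  proof -
    obtain u where u: "x = (\<Sum>v\<in>gen ` s. u v *\<^sub>R v)" using x(1) span_finite[of "gen ` s"] fin by auto
    then have "x = (\<Sum>i\<in>s. u (gen i) *\<^sub>R gen i)" by (simp add: sum.reindex[OF inj])
    then show ?thesis using coefficients_zero[OF s, of "\<lambda>i. u (gen i)"] x(2) by simp
  qed
  then show "span (gen ` s) \<inter> L = {0}" using subspace_0[OF subspace_L] span_zero by auto
qed

text \<open>The generators of a face together with a basis of \<open>L\<close> are independent, so
  the dual functionals of the generators that vanish on \<open>L\<close> exist.\<close>

lemma coordinates:
  assumes s: "s \<in> F"
  shows "\<exists>f. \<forall>i\<in>s. linear (f i) \<and> (\<forall>l\<in>L. f i l = 0) \<and> (\<forall>j\<in>s. f i (gen j) = (if j = i then 1 else 0 :: real))"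
proof -
  obtain B where B0: "B \<subseteq> L" "independent B" "L \<subseteq> span B" using basis_exists[of L] .
  then have B: "B \<subseteq> L" "independent B" "L = span B" using span_minimal[OF B0(1) subspace_L] by auto
  note R = generators_independent[OF s]
  have R0: "0 \<notin> gen ` s" using R(1) dependent_zero[of "gen ` s"] by auto
  have disj: "gen ` s \<inter> B = {}"
  proof (rule ccontr)
    assume "gen ` s \<inter> B \<noteq> {}"
    then obtain v where v: "v \<in> gen ` s" "v \<in> B" by blast
    then have "v \<in> span (gen ` s) \<inter> L" using B(1) span_base[OF v(1)] by blast
    then show False using R(2) R0 v(1) by simp
  qed
  have finB: "finite B" using B(2) independent_explicit by blast
  have fin: "finite (gen ` s)" using finite_face[OF s] by simp
  have ind: "independent (gen ` s \<union> B)"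
    unfolding independent_explicit
  proof (intro conjI allI impI)
    show "finite (gen ` s \<union> B)" using fin finB by simp
    fix u assume "(\<Sum>v\<in>gen ` s \<union> B. u v *\<^sub>R v) = 0"
    then have sum: "(\<Sum>v\<in>gen ` s. u v *\<^sub>R v) + (\<Sum>v\<in>B. u v *\<^sub>R v) = 0"
      using disj fin finB by (simp add: sum.union_disjoint)
    have 1: "(\<Sum>v\<in>gen ` s. u v *\<^sub>R v) \<in> span (gen ` s)" by (intro span_sum span_scale span_base)
    have 2: "(\<Sum>v\<in>B. u v *\<^sub>R v) \<in> L" unfolding B(3) by (intro span_sum span_scale span_base)
    have "(\<Sum>v\<in>gen ` s. u v *\<^sub>R v) = - (\<Sum>v\<in>B. u v *\<^sub>R v)" using sum by (simp add: eq_neg_iff_add_eq_0)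
    then have "(\<Sum>v\<in>gen ` s. u v *\<^sub>R v) \<in> L" using subspace_neg[OF subspace_L 2] by simp
    then have "(\<Sum>v\<in>gen ` s. u v *\<^sub>R v) = 0" using 1 R(2) by blast
    moreover from this have "(\<Sum>v\<in>B. u v *\<^sub>R v) = 0" using sum by simp
    ultimately show "\<forall>v\<in>gen ` s \<union> B. u v = 0" using R(1) B(2) unfolding independent_explicit by blast
  qed
  have "\<exists>g. linear g \<and> (\<forall>l\<in>L. g l = 0) \<and> (\<forall>j\<in>s. g (gen j) = (if j = i then 1 else 0 :: real))" if i: "i \<in> s" for i
  proof -
    obtain g :: "'a \<Rightarrow> real" where g: "linear g" "\<forall>x\<in>gen ` s \<union> B. g x = (if x = gen i then 1 else 0)"
      using linear_independent_extend[OF ind, of "\<lambda>x. if x = gen i then 1 else 0 :: real"] by blast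
    have "g x = 0" if "x \<in> B" for x using g(2) that disj i by auto
    then have "\<forall>l\<in>L. g l = 0" unfolding B(3) using linear_eq_0_on_span[OF g(1)] by blast
    then show ?thesis using g inj_on_gen[OF s] i by (intro exI[of _ g]) (auto simp: inj_on_def)
  qed
  then show ?thesis by metis
qed

definition coord :: "'i set \<Rightarrow> 'i \<Rightarrow> 'a \<Rightarrow> real" where
  "coord s = (SOME f. \<forall>i\<in>s. linear (f i) \<and> (\<forall>l\<in>L. f i l = 0) \<and> (\<forall>j\<in>s. f i (gen j) = (if j = i then 1 else 0 :: real)))"

lemma coord:
  assumes s: "s \<in> F" and i: "i \<in> s"
  shows "linear (coord s i)" "l \<in> L \<Longrightarrow> coord s i l = 0" "l \<in> L \<Longrightarrow> coord s i (l + (\<Sum>j\<in>s. c j *\<^sub>R gen j)) = c i"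
proof -
  have *: "\<forall>i\<in>s. linear (coord s i) \<and> (\<forall>l\<in>L. coord s i l = 0) \<and> (\<forall>j\<in>s. coord s i (gen j) = (if j = i then 1 else 0 :: real))"
    unfolding coord_def by (rule someI_ex[OF coordinates[OF s]])
  show lin: "linear (coord s i)" and "l \<in> L \<Longrightarrow> coord s i l = 0" using * i by auto
  then show "l \<in> L \<Longrightarrow> coord s i (l + (\<Sum>j\<in>s. c j *\<^sub>R gen j)) = c i"
    using * i finite_face[OF s] by (simp add: linear_add linear_sum linear_cmul if_distrib[of "\<lambda>x. _ * x"] sum.delta cong: if_cong)
qed

lemma cone_subspan: "x \<in> cone s \<Longrightarrow> x \<in> span (L \<union> gen ` s)"
  unfolding cone_def by (auto intro!: span_add span_sum span_scale intro: span_base)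

lemma span_coord:
  assumes s: "s \<in> F" and x: "x \<in> span (L \<union> gen ` s)"
  shows "\<exists>l\<in>L. x = l + (\<Sum>i\<in>s. coord s i x *\<^sub>R gen i)"
proof -
  obtain l y where l: "l \<in> L" and y: "y \<in> span (gen ` s)" and xly: "x = l + y"
    using x span_eq_iff[THEN iffD2, OF subspace_L] unfolding span_Un by auto
  obtain u where u: "y = (\<Sum>v\<in>gen ` s. u v *\<^sub>R v)" using y span_finite[of "gen ` s"] finite_face[OF s] by auto
  then have y': "y = (\<Sum>i\<in>s. u (gen i) *\<^sub>R gen i)" by (simp add: sum.reindex[OF inj_on_gen[OF s]])
  have "coord s i x = u (gen i)" if "i \<in> s" for i unfolding xly y' using coord(3)[OF s that l] .
  then show ?thesis using l xly y' by auto
qed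

lemma cone_coord:
  assumes s: "s \<in> F"
  shows "cone s = {x \<in> span (L \<union> gen ` s). \<forall>i\<in>s. coord s i x \<ge> 0}"
proof (intro set_eqI iffI CollectI conjI)
  fix x assume x: "x \<in> cone s"
  then show "x \<in> span (L \<union> gen ` s)" by (rule cone_subspan)
  obtain l c where "x = l + (\<Sum>i\<in>s. c i *\<^sub>R gen i)" "l \<in> L" "\<forall>i\<in>s. 0 \<le> c i" using x unfolding cone_def by auto
  then show "\<forall>i\<in>s. coord s i x \<ge> 0" using coord(3)[OF s] by simp
next
  fix x assume "x \<in> {x \<in> span (L \<union> gen ` s). \<forall>i\<in>s. coord s i x \<ge> 0}"
  then obtain l where "l \<in> L" "x = l + (\<Sum>i\<in>s. coord s i x *\<^sub>R gen i)" "\<forall>i\<in>s. 0 \<le> coord s i x"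
    using span_coord[OF s, of x] by blast
  then show "x \<in> cone s" by (intro coneI)
qed

section \<open>Faces, intersections and closures of the cones\<close>

lemma closed_cone: assumes s: "s \<in> F" shows "closed (cone s)"
proof -
  have "cone s = span (L \<union> gen ` s) \<inter> (\<Inter>i\<in>s. {x. 0 \<le> coord s i x})"
    unfolding cone_coord[OF s] by auto
  moreover have "closed {x. 0 \<le> coord s i x}" if "i \<in> s" for i
    using coord(1)[OF s that] by (intro closed_Collect_le continuous_intros linear_continuous_on linear_conv_bounded_linear[THEN iffD1])
  then have "closed (\<Inter>i\<in>s. {x. 0 \<le> coord s i x})" by (intro closed_INT ballI)
  ultimately show ?thesis using closed_Int[OF closed_subspace[OF subspace_span]] by simp
qed

lemma convex_cone: "convex (cone s)"
proof (rule convexI)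
  fix x y and u v :: real assume x: "x \<in> cone s" and y: "y \<in> cone s" and uv: "0 \<le> u" "0 \<le> v" "u + v = 1"
  obtain l c where l: "x = l + (\<Sum>i\<in>s. c i *\<^sub>R gen i)" "l \<in> L" "\<forall>i\<in>s. 0 \<le> c i" using x unfolding cone_def by auto
  obtain m d where m: "y = m + (\<Sum>i\<in>s. d i *\<^sub>R gen i)" "m \<in> L" "\<forall>i\<in>s. 0 \<le> d i" using y unfolding cone_def by auto
  have "u *\<^sub>R x + v *\<^sub>R y = (u *\<^sub>R l + v *\<^sub>R m) + (\<Sum>i\<in>s. (u * c i + v * d i) *\<^sub>R gen i)"
    unfolding l m scaleR_add_right scaleR_add_left scaleR_sum_right sum.distrib scaleR_scaleR by (simp only: ac_simps)
  moreover have "u *\<^sub>R l + v *\<^sub>R m \<in> L" using l m subspace_L by (simp add: subspace_add subspace_scale)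
  moreover have "\<forall>i\<in>s. 0 \<le> u * c i + v * d i" using l m uv by simp
  ultimately show "u *\<^sub>R x + v *\<^sub>R y \<in> cone s" by (rule coneI)
qed

lemma subcone:
  assumes s: "s \<in> F" and t: "t \<subseteq> s"
  shows "cone t = {x \<in> cone s. \<forall>i\<in>s - t. coord s i x = 0}"
proof (intro set_eqI iffI)
  fix x assume "x \<in> cone t"
  then obtain l c where x: "x = l + (\<Sum>i\<in>t. c i *\<^sub>R gen i)" "l \<in> L" "\<forall>i\<in>t. 0 \<le> c i" unfolding cone_def by auto
  let ?c = "\<lambda>i. if i \<in> t then c i else 0"
  have "(\<Sum>i\<in>t. c i *\<^sub>R gen i) = (\<Sum>i\<in>s. ?c i *\<^sub>R gen i)"
    by (rule sum.mono_neutral_cong_left) (use t finite_face[OF s] in auto)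
  then have x': "x = l + (\<Sum>i\<in>s. ?c i *\<^sub>R gen i)" using x by simp
  then have "x \<in> cone s" using x by (intro coneI[of x l ?c]) auto
  moreover have "coord s i x = ?c i" if "i \<in> s" for i unfolding x' using coord(3)[OF s that x(2)] .
  ultimately show "x \<in> {x \<in> cone s. \<forall>i\<in>s - t. coord s i x = 0}" by auto
next
  fix x assume x: "x \<in> {x \<in> cone s. \<forall>i\<in>s - t. coord s i x = 0}"
  then obtain l where l: "l \<in> L" "x = l + (\<Sum>i\<in>s. coord s i x *\<^sub>R gen i)"
    using span_coord[OF s cone_subspan] by blast
  have "(\<Sum>i\<in>s. coord s i x *\<^sub>R gen i) = (\<Sum>i\<in>t. coord s i x *\<^sub>R gen i)"
    by (rule sum.mono_neutral_right) (use t finite_face[OF s] x in auto)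
  moreover have "\<forall>i\<in>t. coord s i x \<ge> 0" using x t cone_coord[OF s] by auto
  ultimately show "x \<in> cone t" using l by (intro coneI[of x l "\<lambda>i. coord s i x"]) simp_all
qed

lemma subcone_face_of:
  assumes s: "s \<in> F" and t: "t \<subseteq> s"
  shows "cone t face_of cone s"
  unfolding face_of_def
proof (intro conjI ballI impI convex_cone)
  show "cone t \<subseteq> cone s" using subcone[OF s t] by auto
  fix a b x assume a: "a \<in> cone s" and b: "b \<in> cone s" and x: "x \<in> cone t" and "x \<in> open_segment a b"
  then obtain u where u: "0 < u" "u < 1" "x = (1 - u) *\<^sub>R a + u *\<^sub>R b" by (auto simp: in_segment)
  have "coord s i a = 0 \<and> coord s i b = 0" if i: "i \<in> s - t" for i
  proof -
    have lin: "linear (coord s i)" using coord(1)[OF s] i by auto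
    have "coord s i x = (1 - u) * coord s i a + u * coord s i b"
      unfolding u(3) by (simp add: linear_add[OF lin] linear_cmul[OF lin])
    moreover have "coord s i x = 0" using x i unfolding subcone[OF s t] by simp
    moreover have "coord s i a \<ge> 0" "coord s i b \<ge> 0" using a b i cone_coord[OF s] by auto
    moreover have "(1 - u) * coord s i a \<ge> 0" "u * coord s i b \<ge> 0" using calculation u by simp_all
    ultimately have "(1 - u) * coord s i a = 0" "u * coord s i b = 0" by linarith+
    then show ?thesis using u by simp
  qed
  then show "a \<in> cone t" "b \<in> cone t" using a b subcone[OF s t] by auto
qed

text \<open>Take a point \<open>x\<close> of the face with the largest number of positive
  coordinates. Averaging with \<open>x\<close> shows that no point of the face has further positive
  coordinates. Conversely, a segment from any point of the cone on these coordinates to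
  \<open>x\<close> can be prolonged beyond \<open>x\<close> within the big cone, so the face
  contains its starting point.\<close>

lemma face_of_cone:
  assumes s: "s \<in> F" and G: "G face_of cone s" and ne: "G \<noteq> {}"
  shows "\<exists>t\<subseteq>s. G = cone t"
proof -
  define supp where "supp = (\<lambda>x. {i \<in> s. coord s i x > 0})"
  have finsupp: "finite (supp x)" for x using finite_face[OF s] by (simp add: supp_def)
  have Gs: "G \<subseteq> cone s" using G by (rule face_of_imp_subset)
  obtain x0 where "x0 \<in> G" using ne by auto
  then have "\<exists>x. x \<in> G \<and> (\<forall>y. y \<in> G \<longrightarrow> card (supp y) \<le> card (supp x))"
    by (rule ex_has_greatest_nat[of _ _ _ "Suc (card s)"])
      (auto simp: supp_def less_Suc_eq_le intro!: card_mono finite_face[OF s])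
  then obtain x where x: "x \<in> G" and max: "\<And>y. y \<in> G \<Longrightarrow> card (supp y) \<le> card (supp x)" by blast
  have sub: "supp x \<subseteq> s" by (auto simp: supp_def)
  have 1: "G \<subseteq> cone (supp x)"
  proof
    fix y assume y: "y \<in> G"
    let ?m = "(1 / 2) *\<^sub>R x + (1 / 2) *\<^sub>R y"
    have m: "?m \<in> G" using face_of_imp_convex[OF G] x y by (simp add: convexD)
    have "supp x \<union> supp y \<subseteq> supp ?m"
    proof
      fix i assume i: "i \<in> supp x \<union> supp y"
      then have si: "i \<in> s" by (auto simp: supp_def)
      note lin = coord(1)[OF s si]
      have "coord s i x \<ge> 0" "coord s i y \<ge> 0" using x y Gs si cone_coord[OF s] by auto
      then have "coord s i ?m > 0" using i by (auto simp: supp_def linear_add[OF lin] linear_cmul[OF lin])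
      then show "i \<in> supp ?m" using si by (simp add: supp_def)
    qed
    then have "card (supp x \<union> supp y) \<le> card (supp x)" using max[OF m] card_mono[OF finsupp] order_trans by blast
    then have "supp y \<subseteq> supp x" using card_seteq[of "supp x \<union> supp y" "supp x"] finsupp by blast
    moreover have "\<forall>i\<in>s. coord s i y \<ge> 0" using y Gs cone_coord[OF s] by auto
    ultimately show "y \<in> cone (supp x)" unfolding subcone[OF s sub] using y Gs by (force simp: supp_def)
  qed
  have 2: "cone (supp x) \<subseteq> G"
  proof
    fix z assume z: "z \<in> cone (supp x)"
    have zs: "z \<in> cone s" "\<And>i. i \<in> s - supp x \<Longrightarrow> coord s i z = 0" using z subcone[OF s sub] by auto
    have z0: "\<forall>i\<in>s. coord s i z \<ge> 0" and x0: "\<forall>i\<in>s. coord s i x \<ge> 0" using zs x Gs cone_coord[OF s] by auto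
    \<comment> \<open>So large that \<open>z\<close> is at most \<open>M\<close> times
      \<open>x\<close> in every coordinate; then going beyond \<open>x\<close> by the fraction
      \<open>1 / M\<close> of \<open>x - z\<close> keeps all coordinates nonnegative.\<close>
    define M where "M = (\<Sum>i\<in>supp x. coord s i z / coord s i x) + 1"
    have nn: "coord s i z / coord s i x \<ge> 0" if "i \<in> supp x" for i using that z0 by (auto simp: supp_def)
    have M: "M > 0" unfolding M_def using sum_nonneg[of "supp x" "\<lambda>i. coord s i z / coord s i x"] nn by (simp add: add_nonneg_pos)
    have Mi: "coord s i z \<le> M * coord s i x" if "i \<in> supp x" for i
    proof -
      have "coord s i z / coord s i x \<le> M"
        unfolding M_def using member_le_sum[of i "supp x" "\<lambda>i. coord s i z / coord s i x"] that finsupp nn by fastforce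
      then show ?thesis using that by (simp add: supp_def pos_divide_le_eq)
    qed
    let ?w = "x + (1 / M) *\<^sub>R (x - z)"
    have sp: "x \<in> span (L \<union> gen ` s)" "z \<in> span (L \<union> gen ` s)" using x Gs zs cone_subspan by auto
    have "?w \<in> cone s" unfolding cone_coord[OF s]
    proof (intro CollectI conjI ballI)
      show "?w \<in> span (L \<union> gen ` s)" using sp by (intro span_add span_scale span_diff)
      fix i assume i: "i \<in> s"
      note lin = coord(1)[OF s i]
      have "coord s i z \<le> M * coord s i x"
        using Mi[of i] zs(2)[of i] i x0 M by (cases "i \<in> supp x") auto
      then have "(1 / M) * coord s i z \<le> coord s i x" using M by (simp add: field_simps)
      moreover have "coord s i ?w = coord s i x + (1 / M) * coord s i x - (1 / M) * coord s i z"
        by (simp add: linear_add[OF lin] linear_cmul[OF lin] linear_diff[OF lin] algebra_simps diff_divide_distrib)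
      moreover have "(1 / M) * coord s i x \<ge> 0" using x0 i M by simp
      ultimately show "coord s i ?w \<ge> 0" by linarith
    qed
    show "z \<in> G"
    proof (cases "z = x")
      case False
      have "x = (1 - M / (M + 1)) *\<^sub>R z + (M / (M + 1)) *\<^sub>R ?w"
      proof -
        have "(1 - M / (M + 1)) = 1 / (M + 1)" using M by (simp add: field_simps)
        moreover have "(M / (M + 1)) *\<^sub>R ?w = (M / (M + 1)) *\<^sub>R x + (1 / (M + 1)) *\<^sub>R x - (1 / (M + 1)) *\<^sub>R z"
          using M by (simp add: scaleR_add_right scaleR_diff_right)
        moreover have "(M / (M + 1)) *\<^sub>R x + (1 / (M + 1)) *\<^sub>R x = x"
          using M by (simp add: scaleR_add_left[symmetric] add_divide_distrib[symmetric])
        ultimately show ?thesis by simp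
      qed
      moreover have "0 < M / (M + 1)" "M / (M + 1) < 1" using M by simp_all
      moreover have "z \<noteq> ?w"
      proof
        assume "z = ?w"
        moreover have "(1 + 1 / M) *\<^sub>R (x - z) = ?w - z" by (simp add: scaleR_add_left)
        ultimately have "(1 + 1 / M) *\<^sub>R (x - z) = 0" by simp
        moreover have "1 + 1 / M > 0" using M by (simp add: add_pos_pos)
        ultimately show False using False by simp
      qed
      ultimately have "x \<in> open_segment z ?w" unfolding in_segment by blast
      then show ?thesis using G zs(1) \<open>?w \<in> cone s\<close> x unfolding face_of_def by blast
    qed (use x in simp)
  qed
  show ?thesis using 1 2 sub by blast
qed

lemma cone_support:
  assumes s: "s \<in> F" and x: "x \<in> cone s"
  shows "\<exists>t\<subseteq>s. x \<in> open_cone t"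
proof -
  obtain l c where l: "x = l + (\<Sum>i\<in>s. c i *\<^sub>R gen i)" "l \<in> L" "\<forall>i\<in>s. 0 \<le> c i" using x unfolding cone_def by auto
  have "(\<Sum>i\<in>s. c i *\<^sub>R gen i) = (\<Sum>i\<in>{i\<in>s. c i > 0}. c i *\<^sub>R gen i)"
    by (rule sum.mono_neutral_right) (use l(3) finite_face[OF s] in \<open>auto simp: not_less\<close>)
  then show ?thesis using l by (intro exI[of _ "{i\<in>s. c i > 0}"] conjI open_coneI[of x l c]) auto
qed

lemma open_cone_disjoint:
  assumes "s \<in> F" "t \<in> F" "x \<in> open_cone s" "x \<in> open_cone t" shows "s = t"
proof -
  obtain l c where l: "x = l + (\<Sum>i\<in>s. c i *\<^sub>R gen i)" "l \<in> L" "\<forall>i\<in>s. 0 < c i" using assms unfolding open_cone_def by auto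
  obtain m d where m: "x = m + (\<Sum>i\<in>t. d i *\<^sub>R gen i)" "m \<in> L" "\<forall>i\<in>t. 0 < d i" using assms unfolding open_cone_def by auto
  have "(\<Sum>i\<in>s. c i *\<^sub>R gen i) - (\<Sum>i\<in>t. d i *\<^sub>R gen i) = m - l" using l(1) m(1) by (simp add: algebra_simps)
  then show ?thesis using unique[OF assms(1,2) l(3) m(3)] subspace_diff[OF subspace_L m(2) l(2)] by simp
qed

lemma open_cone_nonempty: "(\<Sum>i\<in>s. gen i) \<in> open_cone s"
  unfolding open_cone_def using subspace_0[OF subspace_L] by (intro CollectI exI[of _ 0] exI[of _ "\<lambda>_. 1"]) simp

lemma open_cone_subset: "open_cone s \<subseteq> cone s"
  unfolding open_cone_def cone_def using less_imp_le by blast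

text \<open>The sum of all generators of \<open>s\<close> lies in the open cone of \<open>s\<close>
  and of no other face, which makes it a test point for \<open>s\<close>.\<close>

lemma cone_subset_iff:
  assumes "s \<in> F" "t \<in> F"
  shows "cone s \<subseteq> cone t \<longleftrightarrow> s \<subseteq> t"
proof
  assume "cone s \<subseteq> cone t"
  then have "(\<Sum>i\<in>s. gen i) \<in> cone t" using open_cone_nonempty open_cone_subset by blast
  then obtain u where u: "u \<subseteq> t" "(\<Sum>i\<in>s. gen i) \<in> open_cone u" using cone_support[OF assms(2)] by blast
  have "s = u" by (rule open_cone_disjoint[OF assms(1) down_closed[OF assms(2) u(1)] open_cone_nonempty u(2)])
  then show "s \<subseteq> t" using u(1) by simp
next
  assume "s \<subseteq> t"
  from subcone[OF assms(2) this] show "cone s \<subseteq> cone t" by auto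
qed

text \<open>A common point lies in the open cone of some subset of \<open>s\<close> and of some
  subset of \<open>t\<close>; these agree because open cones of different faces are
  disjoint.\<close>

lemma cone_Int:
  assumes "s \<in> F" "t \<in> F"
  shows "cone s \<inter> cone t = cone (s \<inter> t)"
proof
  show "cone (s \<inter> t) \<subseteq> cone s \<inter> cone t"
    using subcone[OF assms(1) Int_lower1, of t] subcone[OF assms(2) Int_lower2, of s] by auto
  show "cone s \<inter> cone t \<subseteq> cone (s \<inter> t)"
  proof
    fix x assume x: "x \<in> cone s \<inter> cone t"
    obtain u where u: "u \<subseteq> s" "x \<in> open_cone u" using x cone_support[OF assms(1), of x] by blast
    obtain v where v: "v \<subseteq> t" "x \<in> open_cone v" using x cone_support[OF assms(2), of x] by blast
    have "u = v" using open_cone_disjoint[OF down_closed[OF assms(1) u(1)] down_closed[OF assms(2) v(1)] u(2) v(2)] .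
    then have "u \<subseteq> s \<inter> t" using u v by blast
    moreover have "s \<inter> t \<in> F" using down_closed[OF assms(1)] by blast
    ultimately have "cone u \<subseteq> cone (s \<inter> t)" using subcone[of "s \<inter> t" u] by blast
    then show "x \<in> cone (s \<inter> t)" using u(2) open_cone_subset by blast
  qed
qed

lemma closure_open_cone:
  assumes s: "s \<in> F" shows "closure (open_cone s) = cone s"
proof
  show "closure (open_cone s) \<subseteq> cone s" using open_cone_subset closed_cone[OF s] by (rule closure_minimal)
  show "cone s \<subseteq> closure (open_cone s)"
  proof
    fix x assume "x \<in> cone s"
    then obtain l c where l: "x = l + (\<Sum>i\<in>s. c i *\<^sub>R gen i)" "l \<in> L" "\<forall>i\<in>s. 0 \<le> c i" unfolding cone_def by auto
    let ?g = "\<Sum>i\<in>s. gen i"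
    \<comment> \<open>Adding a small multiple of the sum of the generators makes every coefficient
      positive.\<close>
    let ?x = "\<lambda>n. x + inverse (real (Suc n)) *\<^sub>R ?g"
    have "?x n \<in> open_cone s" for n
    proof -
      have "?x n = l + (\<Sum>i\<in>s. (c i + inverse (real (Suc n))) *\<^sub>R gen i)"
        unfolding l(1) scaleR_add_left sum.distrib scaleR_sum_right by simp
      moreover have "\<forall>i\<in>s. 0 < c i + inverse (real (Suc n))" using l(3) by (simp add: add_nonneg_pos)
      ultimately show ?thesis using l(2) by (intro open_coneI)
    qed
    moreover have "?x \<longlonglongrightarrow> x + 0 *\<^sub>R ?g"
      by (intro tendsto_intros LIMSEQ_inverse_real_of_nat)
    ultimately show "x \<in> closure (open_cone s)" unfolding closure_sequential by (intro exI[of _ ?x]) simp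
  qed
qed

lemma simplicial_cone: assumes s: "s \<in> F" shows "simplicial_cone_mod L (cone s)"
  unfolding simplicial_cone_mod_def
proof (intro exI[of _ "gen ` s"] conjI generators_independent[OF s])
  note inj = inj_on_gen[OF s]
  show "finite (gen ` s)" using finite_face[OF s] by simp
  show "cone s = {l + (\<Sum>r\<in>gen ` s. c r *\<^sub>R r) | l c. l \<in> L \<and> (\<forall>r\<in>gen ` s. 0 \<le> c r)}" (is "_ = ?C")
  proof (intro set_eqI iffI)
    fix x assume "x \<in> cone s"
    then obtain l c where l: "x = l + (\<Sum>i\<in>s. c i *\<^sub>R gen i)" "l \<in> L" "\<forall>i\<in>s. 0 \<le> c i" unfolding cone_def by auto
    have "(\<Sum>r\<in>gen ` s. c (inv_into s gen r) *\<^sub>R r) = (\<Sum>i\<in>s. c i *\<^sub>R gen i)"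
      unfolding sum.reindex[OF inj] by (simp add: inv_into_f_f[OF inj])
    then show "x \<in> ?C" using l by (intro CollectI exI[of _ l] exI[of _ "\<lambda>r. c (inv_into s gen r)"]) (simp add: inv_into_f_f[OF inj])
  next
    fix x assume "x \<in> ?C"
    then obtain l c where l: "x = l + (\<Sum>r\<in>gen ` s. c r *\<^sub>R r)" "l \<in> L" "\<forall>r\<in>gen ` s. 0 \<le> c r" by auto
    then show "x \<in> cone s" by (intro coneI[of x l "\<lambda>i. c (gen i)"]) (simp_all add: sum.reindex[OF inj])
  qed
qed

theorem simplicial_fan: "simplicial_fan_mod L (cone ` F)"
  unfolding simplicial_fan_mod_def
proof (intro conjI ballI allI impI)
  show "subspace L" "finite (cone ` F)" using subspace_L finite_F by auto
  show "simplicial_cone_mod L \<sigma>" if "\<sigma> \<in> cone ` F" for \<sigma> using that simplicial_cone by auto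
  show "G \<in> cone ` F" if \<sigma>: "\<sigma> \<in> cone ` F" and G: "G face_of \<sigma>" "G \<noteq> {}" for \<sigma> G
  proof -
    obtain s where s: "s \<in> F" "\<sigma> = cone s" using \<sigma> by blast
    obtain t where "t \<subseteq> s" "G = cone t" using face_of_cone[OF s(1) G(1)[unfolded s(2)] G(2)] by blast
    then show ?thesis using down_closed[OF s(1)] by blast
  qed
  fix \<sigma> \<tau> assume "\<sigma> \<in> cone ` F" "\<tau> \<in> cone ` F"
  then obtain s t where st: "s \<in> F" "t \<in> F" "\<sigma> = cone s" "\<tau> = cone t" by auto
  show "\<sigma> \<inter> \<tau> face_of \<sigma>" "\<sigma> \<inter> \<tau> face_of \<tau>"
    unfolding st(3,4) cone_Int[OF st(1,2)]
    by (rule subcone_face_of[OF st(1) Int_lower1], rule subcone_face_of[OF st(2) Int_lower2])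
qed

lemma inj_on_cone: "inj_on cone F"
proof (rule inj_onI)
  fix s t assume "s \<in> F" "t \<in> F" "cone s = cone t"
  then show "s = t" using cone_subset_iff[of s t] cone_subset_iff[of t s] by simp
qed

lemma cone_face_of_iff:
  assumes "s \<in> F" "t \<in> F" shows "cone s face_of cone t \<longleftrightarrow> s \<subseteq> t"
  using subcone_face_of[OF assms(2), of s] cone_subset_iff[OF assms] face_of_imp_subset[of "cone s" "cone t"] by blast

lemma union_open_cones: "(\<Union>s\<in>F. cone s) = (\<Union>s\<in>F. open_cone s)"
proof (intro equalityI UN_least)
  fix s assume s: "s \<in> F"
  show "open_cone s \<subseteq> (\<Union>s\<in>F. cone s)" using s open_cone_subset by blast
  show "cone s \<subseteq> (\<Union>s\<in>F. open_cone s)"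
  proof
    fix x assume "x \<in> cone s"
    then obtain t where "t \<subseteq> s" "x \<in> open_cone t" using cone_support[OF s] by blast
    then show "x \<in> (\<Union>s\<in>F. open_cone s)" using down_closed[OF s] by blast
  qed
qed

end

section \<open>Trees\<close>

definition adj :: "'v set set \<Rightarrow> ('v \<times> 'v) set" where
  "adj E = {(u, v). {u, v} \<in> E}"

definition side :: "'v set set \<Rightarrow> 'v set \<Rightarrow> 'v \<Rightarrow> 'v set" where
  "side E e a = {x. (a, x) \<in> (adj (E - {e}))\<^sup>*}"

lemma adj_mono: "E \<subseteq> E' \<Longrightarrow> (adj E)\<^sup>* \<subseteq> (adj E')\<^sup>*"
  by (rule rtrancl_mono) (auto simp: adj_def)

lemma adj_rtrancl_sym: "(x, y) \<in> (adj E)\<^sup>* \<Longrightarrow> (y, x) \<in> (adj E)\<^sup>*"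
  by (rule symD[OF sym_rtrancl]) (auto simp: adj_def sym_def insert_commute)

lemma simple_path_mono: "simple_path E p \<Longrightarrow> E \<subseteq> E' \<Longrightarrow> simple_path E' p"
  unfolding simple_path_def by (auto elim: successively_mono)

lemma simple_path_reach:
  assumes "simple_path E p" "x \<in> set p" shows "(hd p, x) \<in> (adj E)\<^sup>*"
proof -
  have "successively (\<lambda>u v. {u, v} \<in> E) p \<Longrightarrow> x \<in> set p \<Longrightarrow> (hd p, x) \<in> (adj E)\<^sup>*" for p
  proof (induction p)
    case (Cons a p)
    show ?case
    proof (cases "x = a \<or> p = []")
      case False
      then have "(hd p, x) \<in> (adj E)\<^sup>*" "(a, hd p) \<in> adj E" using Cons by (auto simp: successively_Cons adj_def)
      then show ?thesis by (simp add: converse_rtrancl_into_rtrancl)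
    qed (use Cons in auto)
  qed simp
  then show ?thesis using assms by (simp add: simple_path_def)
qed

lemma reach_simple_path:
  assumes "(x, y) \<in> (adj E)\<^sup>*"
  shows "\<exists>p. simple_path E p \<and> hd p = x \<and> last p = y"
  using assms
proof (induction rule: rtrancl_induct)
  case base
  show ?case by (rule exI[of _ "[x]"]) (simp add: simple_path_def)
next
  case (step y z)
  then obtain p where p: "simple_path E p" "hd p = x" "last p = y" by blast
  show ?case
  proof (cases "z \<in> set p")
    case True
    then obtain as bs where s: "p = as @ z # bs" by (meson split_list)
    have "simple_path E (as @ [z])" using p(1) unfolding s simple_path_def by (auto simp: successively_append_iff)
    moreover have "hd (as @ [z]) = x" using p(2) s by (cases as) auto
    ultimately show ?thesis by (intro exI[of _ "as @ [z]"]) simp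
  next
    case False
    have "simple_path E (p @ [z])"
      using p False step(2) unfolding simple_path_def by (auto simp: successively_append_iff adj_def)
    then show ?thesis using p by (intro exI[of _ "p @ [z]"]) (auto simp: simple_path_def)
  qed
qed

lemma cut_constant:
  assumes "successively (\<lambda>u v. {u, v} \<in> E) p" "p \<noteq> []" "\<And>x y. {x, y} \<in> E \<Longrightarrow> g x = g y"
  shows "g (hd p) = g (last p)"
  using assms(1,2)
proof (induction p)
  case (Cons a p)
  show ?case
  proof (cases p)
    case (Cons b q)
    then have "{a, b} \<in> E" "g b = g (last p)" using Cons.prems Cons.IH by (auto simp: successively_Cons)
    then show ?thesis using assms(3) Cons by simp
  qed simp
qed simp

lemma successively_avoid:
  assumes "successively (\<lambda>u v. {u, v} \<in> E) p" "u \<notin> set p"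
  shows "successively (\<lambda>x y. {x, y} \<in> E - {{u, w}}) p"
  using assms(1)
  by (rule successively_mono) (use assms(2) in \<open>auto simp: doubleton_eq_iff\<close>)

text \<open>The hypothesis \<open>cut\<close> says that every edge is a bridge. If two simple paths
  with the same ends left \<open>u\<close> by different edges, neither would return to
  \<open>u\<close>, so the cut function of the first edge would be constant along both from there on
  and take the same value at the two successors of \<open>u\<close>. But only one of the two edges
  changes it.\<close>

lemma is_tree_of_cuts:
  assumes V: "finite V" "V \<noteq> {}" and E: "\<forall>e\<in>E. \<exists>u\<in>V. \<exists>v\<in>V. u \<noteq> v \<and> e = {u, v}"
    and conn: "\<And>u v. u \<in> V \<Longrightarrow> v \<in> V \<Longrightarrow> (u, v) \<in> (adj E)\<^sup>*"
    and cut: "\<And>e. e \<in> E \<Longrightarrow> \<exists>g :: 'v \<Rightarrow> bool. \<forall>x y. {x, y} \<in> E \<longrightarrow> (g x \<noteq> g y \<longleftrightarrow> {x, y} = e)"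
  shows "is_tree V E"
proof -
  have uniq: "p = q" if "simple_path E p" "simple_path E q" "hd p = hd q" "last p = last q" for p q :: "'v list"
    using that
  proof (induction p arbitrary: q)
    case (Cons u p)
    obtain q' where q: "q = u # q'" using Cons.prems(2,3) by (cases q) (auto simp: simple_path_def)
    show ?case
    proof (cases "p = [] \<or> q' = []")
      case True
      then show ?thesis using Cons.prems q unfolding simple_path_def
        by (metis distinct.simps(2) last.simps last_in_set)
    next
      case False
      then obtain w p' w' q'' where p': "p = w # p'" and q'': "q' = w' # q''" by (meson neq_Nil_conv)
      have sp: "simple_path E p" "simple_path E q'" and ne: "u \<notin> set p" "u \<notin> set q'" and uw: "{u, w} \<in> E" "{u, w'} \<in> E"
        using Cons.prems(1,2) q p' q'' unfolding simple_path_def by (auto simp: successively_Cons)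
      have w: "w = w'"
      proof (rule ccontr)
        assume "w \<noteq> w'"
        then have n: "{u, w'} \<noteq> {u, w}" by (auto simp: doubleton_eq_iff)
        obtain g :: "'v \<Rightarrow> bool" where g: "\<forall>x y. {x, y} \<in> E \<longrightarrow> (g x \<noteq> g y \<longleftrightarrow> {x, y} = {u, w})"
          using cut[OF uw(1)] by blast
        have c: "\<And>x y. {x, y} \<in> E - {{u, w}} \<Longrightarrow> g x = g y" using g by blast
        have s: "successively (\<lambda>x y. {x, y} \<in> E - {{u, w}}) p" "successively (\<lambda>x y. {x, y} \<in> E - {{u, w}}) q'"
          using successively_avoid[of E p u w] successively_avoid[of E q' u w] sp ne unfolding simple_path_def by blast+
        have "g w = g (last p)"
          using cut_constant[of "E - {{u, w}}" p g, OF s(1) _ c] p' by simp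
        moreover have "g w' = g (last q')"
          using cut_constant[of "E - {{u, w}}" q' g, OF s(2) _ c] q'' by simp
        moreover have "g u \<noteq> g w" "g u = g w'" using g uw n by auto
        moreover have "last p = last q'" using Cons.prems(4) q p' q'' by simp
        ultimately show False by simp
      qed
      have "p = q'" by (rule Cons.IH[OF sp]) (use Cons.prems(4) q p' q'' w in auto)
      then show ?thesis using q by simp
    qed
  qed (simp add: simple_path_def)
  show ?thesis unfolding is_tree_def
  proof (intro conjI V ballI)
    show "\<exists>u\<in>V. \<exists>v\<in>V. u \<noteq> v \<and> e = {u, v}" if "e \<in> E" for e using E that by blast
  next
    fix u v assume "u \<in> V" "v \<in> V"
    from reach_simple_path[OF conn[OF this]] obtain p where p: "simple_path E p \<and> hd p = u \<and> last p = v" by blast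
    show "\<exists>!p. simple_path E p \<and> hd p = u \<and> last p = v"
      by (rule ex1I[of _ p]) (use p uniq in auto)
  qed
qed

section \<open>The two sides of an edge in a tree\<close>

locale tree =
  fixes V :: "'v set" and E :: "'v set set"
  assumes is_tree: "is_tree V E"
begin

lemma finite_V: "finite V" and edge_obtain: "e \<in> E \<Longrightarrow> \<exists>u\<in>V. \<exists>v\<in>V. u \<noteq> v \<and> e = {u, v}"
  and unique_path: "u \<in> V \<Longrightarrow> v \<in> V \<Longrightarrow> \<exists>!p. simple_path E p \<and> hd p = u \<and> last p = v"
  using is_tree unfolding is_tree_def by simp_all

lemma edge_verts: assumes "{a, b} \<in> E" shows "a \<in> V" "b \<in> V" "a \<noteq> b"
proof -
  obtain u v where "u \<in> V" "v \<in> V" "u \<noteq> v" "{a, b} = {u, v}" using edge_obtain[OF assms] by blast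
  then show "a \<in> V" "b \<in> V" "a \<noteq> b" by (auto simp: doubleton_eq_iff)
qed

lemma path_eq:
  assumes "simple_path E p" "simple_path E q" "hd p = hd q" "last p = last q" "hd p \<in> V" "last p \<in> V"
  shows "p = q"
  using unique_path[OF assms(5,6)] assms by metis

lemma connected: assumes "u \<in> V" "v \<in> V" shows "(u, v) \<in> (adj E)\<^sup>*"
proof -
  obtain p where p: "simple_path E p" "hd p = u" "last p = v" using unique_path[OF assms] by blast
  then show ?thesis using simple_path_reach[OF p(1), of v] by (auto simp: simple_path_def)
qed

lemma reach_verts: "(u, v) \<in> (adj E)\<^sup>* \<Longrightarrow> u \<in> V \<Longrightarrow> v \<in> V"
  by (induction rule: rtrancl_induct) (auto simp: adj_def dest: edge_verts)

lemma path_verts: assumes "simple_path E p" "hd p \<in> V" shows "set p \<subseteq> V"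
  using simple_path_reach[OF assms(1)] reach_verts assms(2) by blast

lemma side_self: "a \<in> side E e a" by (simp add: side_def)

lemma side_other: assumes e: "{a, b} \<in> E" shows "b \<notin> side E {a, b} a"
proof
  assume "b \<in> side E {a, b} a"
  then obtain p where p: "simple_path (E - {{a, b}}) p" "hd p = a" "last p = b"
    using reach_simple_path[of a b "E - {{a, b}}"] by (auto simp: side_def)
  have "simple_path E p" using p(1) by (rule simple_path_mono) auto
  moreover have "simple_path E [a, b]" using e edge_verts(3)[OF e] by (simp add: simple_path_def)
  ultimately have "p = [a, b]" using path_eq[of p "[a, b]"] p edge_verts[OF e] by simp
  then show False using p(1) by (simp add: simple_path_def)
qed

lemma side_step: assumes "{x, y} \<in> E" "{x, y} \<noteq> e" shows "x \<in> side E e a \<longleftrightarrow> y \<in> side E e a"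
proof -
  have "(x, y) \<in> adj (E - {e})" "(y, x) \<in> adj (E - {e})" using assms by (auto simp: adj_def insert_commute)
  then show ?thesis unfolding side_def by (auto intro: rtrancl_into_rtrancl)
qed

lemma side_verts: "a \<in> V \<Longrightarrow> side E e a \<subseteq> V"
  using reach_verts adj_mono[of "E - {e}" E] unfolding side_def by blast

lemma side_disjoint: assumes e: "{a, b} \<in> E" shows "side E {a, b} a \<inter> side E {a, b} b = {}"
proof (rule ccontr)
  assume "\<not> ?thesis"
  then obtain x where "(a, x) \<in> (adj (E - {{a, b}}))\<^sup>*" "(b, x) \<in> (adj (E - {{a, b}}))\<^sup>*" unfolding side_def by blast
  then have "(a, b) \<in> (adj (E - {{a, b}}))\<^sup>*" using adj_rtrancl_sym rtrancl_trans by metis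
  then show False using side_other[OF e] by (simp add: side_def)
qed

lemma side_cover: assumes e: "{a, b} \<in> E" and x: "x \<in> V" shows "x \<in> side E {a, b} a \<or> x \<in> side E {a, b} b"
proof -
  have "(a, x) \<in> (adj E)\<^sup>*" using connected edge_verts[OF e] x by blast
  then show ?thesis
  proof (induction rule: rtrancl_induct)
    case (step y z)
    show ?case
    proof (cases "{y, z} = {a, b}")
      case True
      then have "z = a \<or> z = b" by (auto simp: doubleton_eq_iff)
      then show ?thesis using side_self by blast
    next
      case False
      have "{y, z} \<in> E" using step(2) by (simp add: adj_def)
      from side_step[OF this False] show ?thesis using step(3) by blast
    qed
  qed (simp add: side_self)
qed

lemma side_compl: "{a, b} \<in> E \<Longrightarrow> x \<in> V \<Longrightarrow> x \<in> side E {a, b} b \<longleftrightarrow> x \<notin> side E {a, b} a"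
  using side_cover side_disjoint by (metis disjoint_iff)

text \<open>No edge leaves the intersection: either removed edge could only be crossed from a vertex
  on the wrong side of the other one. If nonempty, the intersection would therefore be the whole
  connected tree, but \<open>a\<close> is not in it.\<close>

lemma sides_far_disjoint:
  assumes e: "{a, b} \<in> E" and f: "{c, d} \<in> E"
    and fe: "{c, d} \<subseteq> side E {a, b} b" and ef: "{a, b} \<subseteq> side E {c, d} c"
  shows "side E {a, b} a \<inter> side E {c, d} d = {}"
proof (rule ccontr)
  let ?Z = "side E {a, b} a \<inter> side E {c, d} d"
  assume "?Z \<noteq> {}"
  then obtain x where x: "x \<in> ?Z" by blast
  have closed: "y \<in> ?Z" if "(x, y) \<in> (adj E)\<^sup>*" for y
    using that
  proof (induction rule: rtrancl_induct)
    case base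
    show ?case by (rule x)
  next
    case (step y z)
    have yz: "{y, z} \<in> E" using step(2) by (simp add: adj_def)
    have "y \<notin> side E {a, b} b" using step(3) side_disjoint[OF e] by blast
    then have 1: "{y, z} \<noteq> {c, d}" using fe by blast
    have "y \<notin> side E {c, d} c" using step(3) side_disjoint[OF f] by blast
    then have 2: "{y, z} \<noteq> {a, b}" using ef by blast
    show ?case using side_step[OF yz 2, of a] side_step[OF yz 1, of d] step(3) by simp
  qed
  have "x \<in> V" using x side_verts[OF edge_verts(1)[OF e]] by blast
  then have "a \<in> ?Z" using closed connected edge_verts(1)[OF e] by blast
  then show False using ef side_disjoint[OF f] by blast
qed

text \<open>Each of the two edges lies entirely on one side of the other, so in each of the four
  cases the sides facing away from each other are disjoint.\<close>

lemma sides_compat: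
  assumes e: "{a, b} \<in> E" and f: "{c, d} \<in> E" and ne: "{a, b} \<noteq> {c, d}"
  shows "side E {a, b} a \<inter> side E {c, d} c = {} \<or> side E {a, b} a \<inter> side E {c, d} d = {} \<or>
    side E {a, b} b \<inter> side E {c, d} c = {} \<or> side E {a, b} b \<inter> side E {c, d} d = {}"
proof -
  have f': "c \<in> side E {a, b} x \<longleftrightarrow> d \<in> side E {a, b} x" for x using side_step[OF f] ne by auto
  have e': "a \<in> side E {c, d} x \<longleftrightarrow> b \<in> side E {c, d} x" for x using side_step[OF e] ne by auto
  have c: "c \<in> side E {a, b} a \<or> c \<in> side E {a, b} b" using side_cover[OF e edge_verts(1)[OF f]] .
  have a: "a \<in> side E {c, d} c \<or> a \<in> side E {c, d} d" using side_cover[OF f edge_verts(1)[OF e]] .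
  have ba: "{b, a} = {a, b}" "{d, c} = {c, d}" by auto
  have e2: "{b, a} \<in> E" and f2: "{d, c} \<in> E" using e f ba by simp_all
  note s = sides_far_disjoint[OF e f] sides_far_disjoint[OF e2 f] sides_far_disjoint[OF e f2] sides_far_disjoint[OF e2 f2]
  note s' = s[unfolded ba insert_subset]
  from c show ?thesis
  proof
    assume c: "c \<in> side E {a, b} a"
    from a show ?thesis
    proof
      assume a: "a \<in> side E {c, d} c"
      show ?thesis using s'(2) c f'[of a] a e'[of c] by simp
    next
      assume a: "a \<in> side E {c, d} d"
      show ?thesis using s'(4) c f'[of a] a e'[of d] by simp
    qed
  next
    assume c: "c \<in> side E {a, b} b"
    from a show ?thesis
    proof
      assume a: "a \<in> side E {c, d} c"
      show ?thesis using s'(1) c f'[of b] a e'[of c] by simp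
    next
      assume a: "a \<in> side E {c, d} d"
      show ?thesis using s'(3) c f'[of b] a e'[of d] by simp
    qed
  qed
qed

text \<open>Leaving a side and returning to it uses the edge \<open>{a, b}\<close> twice, which
  repeats a vertex of the path.\<close>

lemma side_convex:
  assumes e: "{a, b} \<in> E" and p: "simple_path E p" "hd p \<in> V"
    and ij: "i < j" "j < k" "k < length p" and s: "p ! i \<in> side E {a, b} a" "p ! k \<in> side E {a, b} a"
  shows "p ! j \<in> side E {a, b} a"
proof (rule ccontr)
  assume j: "p ! j \<notin> side E {a, b} a"
  let ?G = "\<lambda>m. p ! m \<in> side E {a, b} a"
  have edge: "{p ! m, p ! Suc m} \<in> E" if "Suc m < length p" for m
    using p(1) that successively_conv_nth[of "\<lambda>u v. {u, v} \<in> E" p] unfolding simple_path_def by blast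
  have cross: "{p ! m, p ! Suc m} = {a, b}" if "Suc m < length p" "?G m \<noteq> ?G (Suc m)" for m
  proof (rule ccontr)
    assume "\<not> ?thesis"
    from side_step[OF edge[OF that(1)] this, of a] that(2) show False by simp
  qed
  have "\<exists>m. i \<le> m \<and> m < j \<and> ?G m \<noteq> ?G (Suc m)"
  proof (rule ccontr)
    assume no: "\<not> ?thesis"
    have "?G m" if "i \<le> m" "m \<le> j" for m
      using that by (induction m rule: dec_induct) (use s no in auto)
    then show False using j ij by simp
  qed
  then obtain m where m: "i \<le> m" "m < j" "?G m \<noteq> ?G (Suc m)" by blast
  have "\<exists>m. j \<le> m \<and> m < k \<and> ?G m \<noteq> ?G (Suc m)"
  proof (rule ccontr)
    assume no: "\<not> ?thesis"
    have "\<not> ?G m" if "j \<le> m" "m \<le> k" for m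
      using that by (induction m rule: dec_induct) (use j no in auto)
    then show False using s ij by simp
  qed
  then obtain n where n: "j \<le> n" "n < k" "?G n \<noteq> ?G (Suc n)" by blast
  have "{p ! m, p ! Suc m} = {p ! n, p ! Suc n}" using cross[OF _ m(3)] cross[OF _ n(3)] m n ij by simp
  then have "p ! m = p ! n \<or> p ! m = p ! Suc n" by (auto simp: doubleton_eq_iff)
  moreover have "distinct p" using p(1) by (simp add: simple_path_def)
  ultimately show False using m n ij by (auto simp: nth_eq_iff_index_eq)
qed

text \<open>The path from \<open>u\<close> to \<open>\<tau> u\<close> is reversed by \<open>\<tau>\<close>, which therefore fixes its middle.\<close>
lemma midpoint:
  assumes \<tau>: "inj_on \<tau> V" "\<And>e. e \<in> E \<Longrightarrow> \<tau> ` e \<in> E"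
    and p: "simple_path E p" "hd p \<in> V" "last p = \<tau> (hd p)" "\<tau> (\<tau> (hd p)) = hd p"
  shows "(\<exists>v\<in>set p. \<tau> v = v) \<or> (\<exists>x\<in>set p. \<exists>y\<in>set p. {x, y} \<in> E \<and> \<tau> x = y \<and> \<tau> y = x)"
proof -
  have pV: "set p \<subseteq> V" by (rule path_verts[OF p(1,2)])
  have p0: "p \<noteq> []" "distinct p" "successively (\<lambda>u v. {u, v} \<in> E) p" using p(1) by (auto simp: simple_path_def)
  have "simple_path E (rev (map \<tau> p))"
    unfolding simple_path_def
  proof (intro conjI)
    show "rev (map \<tau> p) \<noteq> []" using p0 by simp
    show "distinct (rev (map \<tau> p))" using p0 inj_on_subset[OF \<tau>(1) pV] by (simp add: distinct_map)
    have "successively (\<lambda>u v. {v, u} \<in> E) (map \<tau> p)"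
      unfolding successively_map
      by (rule successively_mono[OF p0(3)]) (use \<tau>(2) in \<open>force simp: insert_commute\<close>)
    then show "successively (\<lambda>u v. {u, v} \<in> E) (rev (map \<tau> p))" by (simp add: successively_rev)
  qed
  moreover have "hd (rev (map \<tau> p)) = hd p" "last (rev (map \<tau> p)) = last p"
    using p0 p by (simp_all add: hd_rev last_rev last_map hd_map)
  moreover have "last p \<in> V" using pV p0 by auto
  ultimately have eq: "rev (map \<tau> p) = p" using path_eq[OF _ p(1)] p(2) by simp
  have nth: "\<tau> (p ! (length p - Suc k)) = p ! k" if "k < length p" for k
  proof -
    have "p ! k = rev (map \<tau> p) ! k" by (simp only: eq)
    also have "\<dots> = map \<tau> p ! (length p - Suc k)" using that by (simp add: rev_nth)
    finally show ?thesis using that by simp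
  qed
  show ?thesis
  proof (cases "odd (length p)")
    case True
    then obtain m where m: "length p = 2 * m + 1" by (elim oddE)
    have "\<tau> (p ! m) = p ! m" using nth[of m] m by simp
    moreover have "p ! m \<in> set p" using m by simp
    ultimately show ?thesis by blast
  next
    case False
    then obtain m where m: "length p = 2 * m" by (auto elim!: evenE)
    then have m0: "0 < m" using p0 by (cases m) auto
    then have "\<tau> (p ! m) = p ! (m - 1)" "\<tau> (p ! (m - 1)) = p ! m" using nth[of "m - 1"] nth[of m] m by simp_all
    moreover have "{p ! (m - 1), p ! m} \<in> E"
      using p0(3) m m0 successively_conv_nth[of "\<lambda>u v. {u, v} \<in> E" p] by (auto dest!: spec[of _ "m - 1"])
    moreover have "p ! (m - 1) \<in> set p" "p ! m \<in> set p" using m m0 by simp_all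
    ultimately show ?thesis by blast
  qed
qed

end

section \<open>Labelled trees and the sides of their splits\<close>

definition label_side :: "'n mtree \<Rightarrow> nat set \<Rightarrow> nat \<Rightarrow> ('n + 'n) set" where
  "label_side T e a = {l. leaf T l \<in> side (edges T) e a}"

lemma quotient_two_classes:
  assumes "X \<noteq> {}" "- X \<noteq> {}" shows "UNIV // {(k, l). k \<in> X \<longleftrightarrow> l \<in> X} = {X, - X}"
proof -
  have "{(k, l). k \<in> X \<longleftrightarrow> l \<in> X} `` {x} = (if x \<in> X then X else - X)" for x by auto
  then show ?thesis using assms unfolding quotient_def by auto
qed

locale ltree =
  fixes T :: "'n::finite mtree"
  assumes labelled: "labelled_tree T"
begin

sublocale tree "verts T" "edges T"
  using labelled by unfold_locales (simp add: labelled_tree_def)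

lemma leaf_bij: "bij_betw (leaf T) UNIV {v \<in> verts T. degree_in T v = 1}"
  using labelled by (simp add: labelled_tree_def)

lemma leaf_verts: "leaf T l \<in> verts T" "degree_in T (leaf T l) = 1"
  using bij_betwE[OF leaf_bij] by auto

lemma degree_one_leaf: "v \<in> verts T \<Longrightarrow> degree_in T v = 1 \<Longrightarrow> \<exists>l. v = leaf T l"
  using leaf_bij unfolding bij_betw_def by auto

lemma leaf_eq_iff: "leaf T k = leaf T l \<longleftrightarrow> k = l"
  using leaf_bij unfolding bij_betw_def inj_on_def by auto

text \<open>Walk away from the edge: unless \<open>b\<close> is a leaf it has a further edge, whose
  far side is strictly smaller.\<close>

lemma leaf_in_side:
  assumes "{a, b} \<in> edges T" shows "\<exists>l. leaf T l \<in> side (edges T) {a, b} b"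
  using assms
proof (induction "card (side (edges T) {a, b} b)" arbitrary: a b rule: less_induct)
  case less
  note e = less.prems
  note V = edge_verts[OF e]
  show ?case
  proof (cases "degree_in T b = 1")
    case True
    obtain l where "b = leaf T l" using degree_one_leaf[OF V(2) True] by blast
    then show ?thesis using side_self[of b "{a, b}"] by auto
  next
    case False
    have "\<exists>f\<in>edges T. b \<in> f \<and> f \<noteq> {a, b}"
    proof (rule ccontr)
      assume no: "\<not> ?thesis"
      have "{f \<in> edges T. b \<in> f} = {{a, b}}"
      proof (intro equalityI subsetI)
        fix f assume "f \<in> {f \<in> edges T. b \<in> f}"
        then show "f \<in> {{a, b}}" using no by simp
      next
        fix f assume "f \<in> {{a, b}}"
        then show "f \<in> {f \<in> edges T. b \<in> f}" using e by simp
      qed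
      then show False using False unfolding degree_in_def by simp
    qed
    then obtain f where f: "f \<in> edges T" "b \<in> f" "f \<noteq> {a, b}" by blast
    obtain u v where "f = {u, v}" using edge_obtain[OF f(1)] by blast
    then have "f = {b, u} \<or> f = {b, v}" using f(2) by (auto simp: insert_commute)
    then obtain r where r: "f = {b, r}" by blast
    have br: "{b, r} \<in> edges T" "{b, r} \<noteq> {a, b}" using f r by auto
    have "side (edges T) {a, b} a \<inter> side (edges T) {b, r} r = {}"
    proof (rule sides_far_disjoint[OF e br(1)])
      show "{b, r} \<subseteq> side (edges T) {a, b} b"
        using side_step[OF br, of b] side_self[of b "{a, b}"] by simp
      show "{a, b} \<subseteq> side (edges T) {b, r} b"
        using side_step[OF e br(2)[symmetric], of b] side_self[of b "{b, r}"] by simp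
    qed
    moreover have "side (edges T) {b, r} r \<subseteq> verts T" by (rule side_verts[OF edge_verts(2)[OF br(1)]])
    ultimately have sub: "side (edges T) {b, r} r \<subseteq> side (edges T) {a, b} b"
      using side_cover[OF e] by blast
    have "b \<notin> side (edges T) {b, r} r" using side_other[of r b] br(1) by (simp add: insert_commute)
    then have "side (edges T) {b, r} r \<subset> side (edges T) {a, b} b" using sub side_self[of b "{a, b}"] by blast
    moreover have "finite (side (edges T) {a, b} b)" by (rule finite_subset[OF side_verts[OF V(2)] finite_V])
    ultimately have "card (side (edges T) {b, r} r) < card (side (edges T) {a, b} b)" by (rule psubset_card_mono[rotated])
    from less.hyps[OF this br(1)] show ?thesis using sub by blast
  qed
qed

lemma label_side_compl: assumes e: "{a, b} \<in> edges T" shows "label_side T {a, b} b = - label_side T {a, b} a"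
  unfolding label_side_def using side_compl[OF e leaf_verts(1)] by auto

lemma label_side_nonempty: assumes e: "{a, b} \<in> edges T"
  shows "label_side T {a, b} a \<noteq> {}" "label_side T {a, b} b \<noteq> {}"
proof -
  have "{b, a} \<in> edges T" using e by (simp add: insert_commute)
  from leaf_in_side[OF this] leaf_in_side[OF e]
  show "label_side T {a, b} a \<noteq> {}" "label_side T {a, b} b \<noteq> {}"
    unfolding label_side_def by (auto simp: insert_commute)
qed

lemma same_component_side:
  assumes e: "{a, b} \<in> edges T"
  shows "same_component T {a, b} = {(k, l). k \<in> label_side T {a, b} a \<longleftrightarrow> l \<in> label_side T {a, b} a}"
proof -
  let ?R = "(adj (edges T - {{a, b}}))\<^sup>*"
  have eq: "(leaf T k, leaf T l) \<in> ?R \<longleftrightarrow> (leaf T k \<in> side (edges T) {a, b} a \<longleftrightarrow> leaf T l \<in> side (edges T) {a, b} a)" for k l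
  proof
    assume kl: "(leaf T k, leaf T l) \<in> ?R"
    show "leaf T k \<in> side (edges T) {a, b} a \<longleftrightarrow> leaf T l \<in> side (edges T) {a, b} a"
    proof
      assume "leaf T k \<in> side (edges T) {a, b} a"
      then show "leaf T l \<in> side (edges T) {a, b} a" unfolding side_def mem_Collect_eq using kl by (rule rtrancl_trans)
    next
      assume "leaf T l \<in> side (edges T) {a, b} a"
      then show "leaf T k \<in> side (edges T) {a, b} a"
        unfolding side_def mem_Collect_eq using adj_rtrancl_sym[OF kl] by (rule rtrancl_trans)
    qed
  next
    assume eq: "leaf T k \<in> side (edges T) {a, b} a \<longleftrightarrow> leaf T l \<in> side (edges T) {a, b} a"
    have "\<exists>x. leaf T k \<in> side (edges T) {a, b} x \<and> leaf T l \<in> side (edges T) {a, b} x"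
      using side_cover[OF e leaf_verts(1)[of k]] side_cover[OF e leaf_verts(1)[of l]] side_disjoint[OF e] eq by blast
    then obtain x where "(x, leaf T k) \<in> ?R" "(x, leaf T l) \<in> ?R" unfolding side_def by blast
    then show "(leaf T k, leaf T l) \<in> ?R" by (rule rtrancl_trans[OF adj_rtrancl_sym])
  qed
  show ?thesis unfolding same_component_def label_side_def adj_def[symmetric] by (simp only: eq mem_Collect_eq)
qed

lemma split_of_side:
  assumes e: "{a, b} \<in> edges T"
  shows "split_of T {a, b} = {label_side T {a, b} a, - label_side T {a, b} a}"
  unfolding split_of_def same_component_side[OF e]
  by (rule quotient_two_classes) (use label_side_nonempty[OF e] label_side_compl[OF e] in auto)

lemma internal_edge_edge: "e \<in> internal_edges T \<Longrightarrow> e \<in> edges T"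
  by (simp add: internal_edges_def)

lemma Union_splits: "X \<in> \<Union> (splits T) \<longleftrightarrow> (\<exists>a b. {a, b} \<in> internal_edges T \<and> X = label_side T {a, b} a)"
proof
  assume "X \<in> \<Union> (splits T)"
  then obtain e where e: "e \<in> internal_edges T" "X \<in> split_of T e" unfolding splits_def by blast
  obtain a b where ab: "e = {a, b}" using edge_obtain[OF internal_edge_edge[OF e(1)]] by blast
  note E = internal_edge_edge[OF e(1)[unfolded ab]]
  have "X = label_side T {a, b} a \<or> X = label_side T {a, b} b"
    using e(2) label_side_compl[OF E] unfolding ab split_of_side[OF E] by auto
  then show "\<exists>a b. {a, b} \<in> internal_edges T \<and> X = label_side T {a, b} a"
  proof
      assume "X = label_side T {a, b} a"
      then show ?thesis using e(1) ab by blast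
    next
      assume "X = label_side T {a, b} b"
      then have "{b, a} \<in> internal_edges T \<and> X = label_side T {b, a} b" using e(1) ab by (simp add: insert_commute)
      then show ?thesis by blast
    qed
next
  assume "\<exists>a b. {a, b} \<in> internal_edges T \<and> X = label_side T {a, b} a"
  then obtain a b where "{a, b} \<in> internal_edges T" "X = label_side T {a, b} a" by blast
  then show "X \<in> \<Union> (splits T)"
    unfolding splits_def using split_of_side[OF internal_edge_edge, of a b] by auto
qed

lemma splits_pairs: "splits T = (\<lambda>X. {X, - X}) ` \<Union> (splits T)"
proof (intro equalityI subsetI)
  fix S assume S: "S \<in> splits T"
  then obtain e where e: "e \<in> internal_edges T" "S = split_of T e" unfolding splits_def by blast
  obtain a b where ab: "e = {a, b}" using edge_obtain[OF internal_edge_edge[OF e(1)]] by blast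
  have "S = {label_side T {a, b} a, - label_side T {a, b} a}"
    using e(2) split_of_side[OF internal_edge_edge[OF e(1)[unfolded ab]]] ab by simp
  then show "S \<in> (\<lambda>X. {X, - X}) ` \<Union> (splits T)" using S by blast
next
  fix S assume "S \<in> (\<lambda>X. {X, - X}) ` \<Union> (splits T)"
  then obtain X where X: "X \<in> \<Union> (splits T)" "S = {X, - X}" by blast
  obtain a b where ab: "{a, b} \<in> internal_edges T" "X = label_side T {a, b} a" using X(1) Union_splits by blast
  then have "S = split_of T {a, b}" using X(2) split_of_side[OF internal_edge_edge[OF ab(1)]] by simp
  then show "S \<in> splits T" using ab(1) unfolding splits_def by blast
qed

lemma label_side_disjoint:
  "side (edges T) e a \<inter> side (edges T) f c = {} \<Longrightarrow> label_side T e a \<inter> label_side T f c = {}"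
  unfolding label_side_def by blast

lemma label_side_edge_cases:
  assumes e: "{a, b} \<in> edges T" and eq: "{a, b} = {c, d}"
  shows "label_side T {c, d} c = label_side T {a, b} a \<or> label_side T {c, d} c = - label_side T {a, b} a"
proof -
  have "c = a \<or> c = b" using eq by (auto simp: doubleton_eq_iff)
  then show ?thesis using label_side_compl[OF e] unfolding eq[symmetric] by blast
qed

lemma label_sides_compat:
  assumes e: "{a, b} \<in> edges T" and f: "{c, d} \<in> edges T"
  shows "compat (label_side T {a, b} a) (label_side T {c, d} c)"
proof (cases "{a, b} = {c, d}")
  case True
  from label_side_edge_cases[OF e True] show ?thesis
    by (elim disjE) (simp_all add: compat_self compat_compl)
next
  case False
  note c = label_side_compl[OF e] label_side_compl[OF f]
  from sides_compat[OF e f False] show ?thesis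
  proof (elim disjE)
    assume "side (edges T) {a, b} a \<inter> side (edges T) {c, d} c = {}"
    from label_side_disjoint[OF this] show ?thesis by (simp add: compat_def)
  next
    assume "side (edges T) {a, b} a \<inter> side (edges T) {c, d} d = {}"
    from label_side_disjoint[OF this] show ?thesis unfolding c by (simp add: compat_def)
  next
    assume "side (edges T) {a, b} b \<inter> side (edges T) {c, d} c = {}"
    from label_side_disjoint[OF this] show ?thesis unfolding c by (simp add: compat_def)
  next
    assume "side (edges T) {a, b} b \<inter> side (edges T) {c, d} d = {}"
    from label_side_disjoint[OF this] show ?thesis unfolding c by (simp add: compat_def)
  qed
qed

text \<open>For two different edges one of four intersections of sides is empty. Each of the other
  three contains a leaf, which \<open>z\<close> provides for the intersection of the two
  complements.\<close>

lemma side_disjoint_of_labels: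
  assumes e: "{a, b} \<in> edges T" and f: "{c, d} \<in> edges T"
    and d: "label_side T {a, b} a \<inter> label_side T {c, d} c = {}" and z: "z \<notin> label_side T {a, b} a" "z \<notin> label_side T {c, d} c"
  shows "side (edges T) {a, b} a \<inter> side (edges T) {c, d} c = {}"
proof -
  note n = label_side_nonempty(1)[OF e] label_side_nonempty(1)[OF f]
  have ne: "{a, b} \<noteq> {c, d}"
  proof
    assume eq: "{a, b} = {c, d}"
    from label_side_edge_cases[OF e this] show False using d n z by (elim disjE) auto
  qed
  have 1: "side (edges T) {a, b} a \<inter> side (edges T) {c, d} d \<noteq> {}"
  proof
    assume "side (edges T) {a, b} a \<inter> side (edges T) {c, d} d = {}"
    then have "label_side T {a, b} a \<inter> label_side T {c, d} d = {}" by (rule label_side_disjoint)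
    then show False using d n label_side_compl[OF f] by auto
  qed
  have 2: "side (edges T) {a, b} b \<inter> side (edges T) {c, d} c \<noteq> {}"
  proof
    assume "side (edges T) {a, b} b \<inter> side (edges T) {c, d} c = {}"
    then have "label_side T {a, b} b \<inter> label_side T {c, d} c = {}" by (rule label_side_disjoint)
    then show False using d n label_side_compl[OF e] by auto
  qed
  have 3: "side (edges T) {a, b} b \<inter> side (edges T) {c, d} d \<noteq> {}"
  proof
    assume "side (edges T) {a, b} b \<inter> side (edges T) {c, d} d = {}"
    then have "label_side T {a, b} b \<inter> label_side T {c, d} d = {}" by (rule label_side_disjoint)
    then show False using z label_side_compl[OF e] label_side_compl[OF f] by auto
  qed
  from sides_compat[OF e f ne] 1 2 3 show ?thesis by blast
qed

lemma splits_swap: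
  assumes \<tau>: "swap_automorphism T \<tau>" and X: "X \<in> \<Union> (splits T)"
  shows "swap_label ` X \<in> \<Union> (splits T)"
proof -
  obtain a b where ab: "{a, b} \<in> internal_edges T" "X = label_side T {a, b} a" using X Union_splits[of X] by blast
  have bij: "bij_betw \<tau> (verts T) (verts T)" and img: "(\<lambda>e. \<tau> ` e) ` edges T = edges T"
    and lf: "\<And>l. \<tau> (leaf T l) = leaf T (swap_label l)" using \<tau> unfolding swap_automorphism_def by auto
  note E = internal_edge_edge[OF ab(1)]
  have inj: "inj_on \<tau> (verts T)" using bij by (simp add: bij_betw_def)
  have E': "{\<tau> a, \<tau> b} \<in> edges T" using imageI[OF E, of "(`) \<tau>"] img by simp
  have inner: "\<tau> v \<in> inner_verts T" if "v \<in> inner_verts T" for v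
  proof -
    have v: "v \<in> verts T" "v \<notin> range (leaf T)" using that by (auto simp: inner_verts_def)
    have "\<tau> v \<notin> range (leaf T)"
    proof
      assume "\<tau> v \<in> range (leaf T)"
      then obtain l where "\<tau> v = leaf T l" by blast
      then have "\<tau> v = \<tau> (leaf T (swap_label l))" using lf by simp
      then have "v = leaf T (swap_label l)" using inj_onD[OF inj] v(1) leaf_verts(1) by blast
      then show False using v(2) by blast
    qed
    then show ?thesis using v(1) bij_betwE[OF bij] by (auto simp: inner_verts_def)
  qed
  have I': "{\<tau> a, \<tau> b} \<in> internal_edges T" using ab(1) E' inner[of a] inner[of b] by (simp add: internal_edges_def)
  have reach: "(\<tau> x, \<tau> y) \<in> (adj (edges T - {{\<tau> a, \<tau> b}}))\<^sup>*" if "(x, y) \<in> (adj (edges T - {{a, b}}))\<^sup>*" for x y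
    using that
  proof (induction rule: rtrancl_induct)
    case (step y z)
    have yz: "{y, z} \<in> edges T" "{y, z} \<noteq> {a, b}" using step(2) by (auto simp: adj_def)
    have "\<tau> ` {y, z} \<noteq> \<tau> ` {a, b}"
    proof
      assume eq: "\<tau> ` {y, z} = \<tau> ` {a, b}"
      have "{y, z} = {a, b}"
        by (rule inj_on_image_eq_iff[THEN iffD1, OF inj _ _ eq]) (use edge_verts[OF yz(1)] edge_verts[OF E] in simp_all)
      then show False using yz(2) by contradiction
    qed
    moreover have "\<tau> ` {y, z} \<in> edges T" using img yz(1) by blast
    ultimately have "(\<tau> y, \<tau> z) \<in> adj (edges T - {{\<tau> a, \<tau> b}})" by (simp add: adj_def)
    then show ?case using step(3) by (rule rtrancl_into_rtrancl[rotated])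
  qed simp
  let ?Y = "label_side T {\<tau> a, \<tau> b} (\<tau> a)"
  have 1: "swap_label l \<in> ?Y" if "l \<in> X" for l
    using reach[of a "leaf T l"] that lf unfolding ab(2) label_side_def side_def by simp
  have 2: "swap_label l \<notin> ?Y" if "l \<notin> X" for l
  proof -
    have "l \<in> label_side T {a, b} b" using that ab(2) label_side_compl[OF E] by auto
    then have "swap_label l \<in> label_side T {\<tau> a, \<tau> b} (\<tau> b)"
      using reach[of b "leaf T l"] lf unfolding label_side_def side_def by simp
    then show ?thesis using label_side_compl[OF E'] by auto
  qed
  have "swap_label ` X = ?Y"
  proof (rule set_eqI)
    fix l show "l \<in> swap_label ` X \<longleftrightarrow> l \<in> ?Y" using 1[of "swap_label l"] 2[of "swap_label l"] by auto
  qed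
  then show ?thesis unfolding Union_splits[of "swap_label ` X"] using I' by blast
qed

text \<open>The path from \<open>i\<close> to \<open>i'\<close> does not leave the side, and by
  \<open>midpoint\<close> it contains a fixed vertex or an edge whose ends are exchanged.\<close>

lemma invariant_side_fixed:
  assumes \<tau>: "swap_automorphism T \<tau>" and e: "{a, b} \<in> edges T"
    and inv: "swap_label ` label_side T {a, b} a = label_side T {a, b} a" and i: "Inl i \<in> label_side T {a, b} a"
  shows "(\<exists>v\<in>side (edges T) {a, b} a. v \<in> verts T \<and> \<tau> v = v) \<or>
    (\<exists>x\<in>side (edges T) {a, b} a. \<exists>y\<in>side (edges T) {a, b} a. {x, y} \<in> edges T \<and> \<tau> x = y \<and> \<tau> y = x)"
proof -
  have bij: "bij_betw \<tau> (verts T) (verts T)" and img: "(\<lambda>e. \<tau> ` e) ` edges T = edges T"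
    and lf: "\<And>l. \<tau> (leaf T l) = leaf T (swap_label l)" using \<tau> unfolding swap_automorphism_def by auto
  have "Inr i \<in> swap_label ` label_side T {a, b} a" using i by simp
  then have i': "Inr i \<in> label_side T {a, b} a" by (simp only: inv)
  let ?R = "(adj (edges T - {{a, b}}))\<^sup>*"
  have a: "(a, leaf T (Inl i)) \<in> ?R" "(a, leaf T (Inr i)) \<in> ?R" using i i' by (auto simp: label_side_def side_def)
  have "(leaf T (Inl i), leaf T (Inr i)) \<in> ?R" by (rule rtrancl_trans[OF adj_rtrancl_sym[OF a(1)] a(2)])
  from reach_simple_path[OF this]
  obtain p where p: "simple_path (edges T - {{a, b}}) p" "hd p = leaf T (Inl i)" "last p = leaf T (Inr i)" by blast
  have sub: "set p \<subseteq> side (edges T) {a, b} a"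
  proof
    fix x assume "x \<in> set p"
    from rtrancl_trans[OF a(1) simple_path_reach[OF p(1) this, unfolded p(2)]]
    show "x \<in> side (edges T) {a, b} a" by (simp add: side_def)
  qed
  have p': "simple_path (edges T) p" using p(1) by (rule simple_path_mono) auto
  have hv: "hd p \<in> verts T" using p(2) leaf_verts by simp
  have "(\<exists>v\<in>set p. \<tau> v = v) \<or> (\<exists>x\<in>set p. \<exists>y\<in>set p. {x, y} \<in> edges T \<and> \<tau> x = y \<and> \<tau> y = x)"
  proof (rule midpoint[OF _ _ p' hv])
    show "inj_on \<tau> (verts T)" using bij by (simp add: bij_betw_def)
    show "\<tau> ` e \<in> edges T" if "e \<in> edges T" for e using img that by blast
    show "last p = \<tau> (hd p)" "\<tau> (\<tau> (hd p)) = hd p" using p lf by simp_all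
  qed
  then show ?thesis using sub path_verts[OF p' hv] by blast
qed

text \<open>The complement of a side is the opposite side of the same edge, hence convex as
  well.\<close>

lemma no_three_disjoint_sides_on_path:
  assumes e: "{a, b} \<in> edges T" and p: "simple_path (edges T) p" "set p \<subseteq> verts T"
    and ijk: "i < j" "j < k" "k < length p"
    and "p ! i \<notin> side (edges T) {a, b} a" "p ! j \<in> side (edges T) {a, b} a" "p ! k \<notin> side (edges T) {a, b} a"
  shows False
proof -
  have "{b, a} \<in> edges T" using e by (simp add: insert_commute)
  note c = side_convex[OF this p(1) _ ijk]
  have V: "p ! i \<in> verts T" "p ! j \<in> verts T" "p ! k \<in> verts T" "hd p \<in> verts T"
    using p ijk nth_mem[of _ p] by (auto simp: simple_path_def)
  note sc = side_compl[OF e]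
  have "p ! i \<in> side (edges T) {b, a} b" "p ! k \<in> side (edges T) {b, a} b"
    using sc[OF V(1)] sc[OF V(3)] assms(7,9) by (simp_all add: insert_commute)
  from c[OF V(4) this] have "p ! j \<in> side (edges T) {a, b} b" by (simp add: insert_commute)
  then show False using sc[OF V(2)] assms(8) by simp
qed

text \<open>Each of three disjoint invariant sides contains a fixed vertex or an inverted edge. If
  the fixed vertices form a path, one of three of them lies between the other two, although these
  are outside its side. If there is just one inverted edge, it would lie in two disjoint
  sides.\<close>

lemma symbic_no_tripod:
  assumes \<tau>: "swap_automorphism T \<tau>" and fp: "fixed_points_path T \<tau>"
    and bic: "\<And>X. X \<in> \<Union> (splits T) \<Longrightarrow> bicoloured X"
  shows "no_tripod (\<Union> (splits T))"
  unfolding no_tripod_def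
proof (intro ballI impI notI, elim conjE)
  fix X Y Z assume X: "X \<in> \<Union> (splits T)" "swap_label ` X = X" and Y: "Y \<in> \<Union> (splits T)" "swap_label ` Y = Y"
    and Z: "Z \<in> \<Union> (splits T)" "swap_label ` Z = Z" and d: "X \<inter> Y = {}" "X \<inter> Z = {}" "Y \<inter> Z = {}"
  obtain a1 b1 where 1: "{a1, b1} \<in> edges T" "X = label_side T {a1, b1} a1" using X(1) Union_splits[of X] internal_edge_edge by blast
  obtain a2 b2 where 2: "{a2, b2} \<in> edges T" "Y = label_side T {a2, b2} a2" using Y(1) Union_splits[of Y] internal_edge_edge by blast
  obtain a3 b3 where 3: "{a3, b3} \<in> edges T" "Z = label_side T {a3, b3} a3" using Z(1) Union_splits[of Z] internal_edge_edge by blast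
  let ?S1 = "side (edges T) {a1, b1} a1" let ?S2 = "side (edges T) {a2, b2} a2" let ?S3 = "side (edges T) {a3, b3} a3"
  obtain i where i: "Inl i \<in> X" using bic[OF X(1)] unfolding bicoloured_def by blast
  obtain j where j: "Inl j \<in> Y" using bic[OF Y(1)] unfolding bicoloured_def by blast
  obtain k where k: "Inl k \<in> Z" using bic[OF Z(1)] unfolding bicoloured_def by blast
  have D: "?S1 \<inter> ?S2 = {}" "?S1 \<inter> ?S3 = {}" "?S2 \<inter> ?S3 = {}"
    using side_disjoint_of_labels[OF 1(1) 2(1), of "Inl k"] side_disjoint_of_labels[OF 1(1) 3(1), of "Inl j"]
      side_disjoint_of_labels[OF 2(1) 3(1), of "Inl i"] d i j k 1(2) 2(2) 3(2) by blast+
  note F1 = invariant_side_fixed[OF \<tau> 1(1) X(2)[unfolded 1(2)] i[unfolded 1(2)]]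
  note F2 = invariant_side_fixed[OF \<tau> 2(1) Y(2)[unfolded 2(2)] j[unfolded 2(2)]]
  note F3 = invariant_side_fixed[OF \<tau> 3(1) Z(2)[unfolded 3(2)] k[unfolded 3(2)]]
  let ?Fix = "{v \<in> verts T. \<tau> v = v}" let ?Flip = "{e \<in> edges T. \<tau> ` e = e \<and> (\<forall>v\<in>e. \<tau> v \<noteq> v)}"
  have flip: "{x, y} \<in> ?Flip" if "{x, y} \<in> edges T" "\<tau> x = y" "\<tau> y = x" for x y
    using that edge_verts(3)[OF that(1)] by auto
  have "(?Flip = {} \<and> (\<exists>p. simple_path (edges T) p \<and> set p = ?Fix)) \<or> (?Fix = {} \<and> (\<exists>e. ?Flip = {e}))"
    using fp unfolding fixed_points_path_def Let_def .
  then show False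
  proof
    assume "?Flip = {} \<and> (\<exists>p. simple_path (edges T) p \<and> set p = ?Fix)"
    then obtain p where nf: "?Flip = {}" and p: "simple_path (edges T) p" "set p = ?Fix" by blast
    have nf': "\<not> (\<exists>x\<in>S. \<exists>y\<in>S. {x, y} \<in> edges T \<and> \<tau> x = y \<and> \<tau> y = x)" for S using flip nf by blast
    obtain v1 where "v1 \<in> ?S1" "v1 \<in> set p" using F1 nf' p(2) by blast
    then obtain n1 where n1: "n1 < length p" "p ! n1 \<in> ?S1" unfolding in_set_conv_nth by blast
    obtain v2 where "v2 \<in> ?S2" "v2 \<in> set p" using F2 nf' p(2) by blast
    then obtain n2 where n2: "n2 < length p" "p ! n2 \<in> ?S2" unfolding in_set_conv_nth by blast
    obtain v3 where "v3 \<in> ?S3" "v3 \<in> set p" using F3 nf' p(2) by blast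
    then obtain n3 where n3: "n3 < length p" "p ! n3 \<in> ?S3" unfolding in_set_conv_nth by blast
    have pV: "set p \<subseteq> verts T" using p(2) by blast
    note c1 = no_three_disjoint_sides_on_path[OF 1(1) p(1) pV]
    note c2 = no_three_disjoint_sides_on_path[OF 2(1) p(1) pV]
    note c3 = no_three_disjoint_sides_on_path[OF 3(1) p(1) pV]
    have m: "p ! n1 \<notin> ?S2" "p ! n1 \<notin> ?S3" "p ! n2 \<notin> ?S1" "p ! n2 \<notin> ?S3" "p ! n3 \<notin> ?S1" "p ! n3 \<notin> ?S2"
      using n1(2) n2(2) n3(2) D by blast+
    have "n1 \<noteq> n2" "n1 \<noteq> n3" "n2 \<noteq> n3" using m n1 n2 n3 by metis+
    then consider "n1 < n2" "n2 < n3" | "n1 < n3" "n3 < n2" | "n2 < n1" "n1 < n3" | "n2 < n3" "n3 < n1" | "n3 < n1" "n1 < n2" | "n3 < n2" "n2 < n1"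
      by linarith
    then show False
    proof cases
      case 1 show False by (rule c2[of n1 n2 n3]) (use 1 n1 n2 n3 m in simp_all)
    next
      case 2 show False by (rule c3[of n1 n3 n2]) (use 2 n1 n2 n3 m in simp_all)
    next
      case 3 show False by (rule c1[of n2 n1 n3]) (use 3 n1 n2 n3 m in simp_all)
    next
      case 4 show False by (rule c3[of n2 n3 n1]) (use 4 n1 n2 n3 m in simp_all)
    next
      case 5 show False by (rule c1[of n3 n1 n2]) (use 5 n1 n2 n3 m in simp_all)
    next
      case 6 show False by (rule c2[of n3 n2 n1]) (use 6 n1 n2 n3 m in simp_all)
    qed
  next
    assume A: "?Fix = {} \<and> (\<exists>e. ?Flip = {e})"
    then obtain e where e: "?Flip = {e}" by blast
    have nf: "\<not> (\<exists>v\<in>S. v \<in> verts T \<and> \<tau> v = v)" for S using A by blast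
    obtain x y where xy: "x \<in> ?S1" "y \<in> ?S1" "{x, y} \<in> ?Flip" using F1 nf[of ?S1] flip by blast
    obtain x' y' where xy': "x' \<in> ?S2" "y' \<in> ?S2" "{x', y'} \<in> ?Flip" using F2 nf[of ?S2] flip by blast
    have "{x, y} = {x', y'}" using xy(3) xy'(3) unfolding e by blast
    then have "x \<in> {x', y'}" by blast
    then show False using xy xy' D(1) by blast
  qed
qed

end

theorem symbic_tree_system:
  fixes T :: "'n::finite mtree"
  assumes "symbic_tree T"
  shows "symbic_system (\<Union> (splits T))" "splits T = (\<lambda>X. {X, - X}) ` \<Union> (splits T)"
proof -
  have lab: "labelled_tree T" and bic: "\<And>X. X \<in> \<Union> (splits T) \<Longrightarrow> bicoloured X"
    and ex: "\<exists>\<tau>. swap_automorphism T \<tau> \<and> fixed_points_path T \<tau>"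
    using assms unfolding symbic_tree_def bicoloured_def by blast+
  interpret ltree T by unfold_locales (rule lab)
  obtain \<tau> where \<tau>: "swap_automorphism T \<tau>" "fixed_points_path T \<tau>" using ex by blast
  show "splits T = (\<lambda>X. {X, - X}) ` \<Union> (splits T)" by (rule splits_pairs)
  have c: "- X \<in> \<Union> (splits T)" if X: "X \<in> \<Union> (splits T)" for X
  proof -
    obtain a b where ab: "{a, b} \<in> internal_edges T" "X = label_side T {a, b} a" using X Union_splits[of X] by blast
    have "{b, a} \<in> internal_edges T \<and> - X = label_side T {b, a} b"
      using ab label_side_compl[OF internal_edge_edge[OF ab(1)]] by (simp add: insert_commute)
    then show ?thesis unfolding Union_splits[of "- X"] by blast
  qed
  have comp: "compat X Y" if XY: "X \<in> \<Union> (splits T)" "Y \<in> \<Union> (splits T)" for X Y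
  proof -
    obtain a b where ab: "{a, b} \<in> internal_edges T" "X = label_side T {a, b} a" using XY(1) Union_splits[of X] by blast
    obtain a' b' where ab': "{a', b'} \<in> internal_edges T" "Y = label_side T {a', b'} a'" using XY(2) Union_splits[of Y] by blast
    show ?thesis unfolding ab(2) ab'(2) by (rule label_sides_compat[OF internal_edge_edge[OF ab(1)] internal_edge_edge[OF ab'(1)]])
  qed
  show "symbic_system (\<Union> (splits T))"
    unfolding symbic_system_def side_system_def
    by (intro conjI ballI c bic comp splits_swap[OF \<tau>(1)] symbic_no_tripod[OF \<tau> bic])
qed

section \<open>The tree of a compatible system of splits\<close>

text \<open>The vertices are the choices of one side of each split such that the chosen sides pairwise
  intersect; an edge reverses the choice for a single split.\<close>
locale split_tree =
  fixes W :: "'l::finite set set" and enc :: "'l set set \<Rightarrow> nat"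
  assumes compl: "X \<in> W \<Longrightarrow> - X \<in> W" and nonempty: "X \<in> W \<Longrightarrow> X \<noteq> {}"
    and compat_W: "X \<in> W \<Longrightarrow> Y \<in> W \<Longrightarrow> compat X Y" and single: "{l} \<in> W"
    and inj_enc: "inj enc"
begin

definition vertex :: "'l set set \<Rightarrow> bool" where
  "vertex v \<longleftrightarrow> v \<subseteq> W \<and> (\<forall>X\<in>W. X \<in> v \<longleftrightarrow> - X \<notin> v) \<and> (\<forall>X\<in>v. \<forall>Y\<in>v. X \<inter> Y \<noteq> {})"

definition flip :: "'l set \<Rightarrow> 'l set set \<Rightarrow> 'l set set" where
  "flip X v = insert (- X) (v - {X})"

text \<open>The chosen sides that may be reversed without losing pairwise intersection; they
  correspond to the edges at \<open>v\<close>.\<close>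

definition minimal :: "'l set \<Rightarrow> 'l set set \<Rightarrow> bool" where
  "minimal X v \<longleftrightarrow> X \<in> v \<and> (\<forall>Y\<in>v. Y \<subseteq> X \<longrightarrow> Y = X)"

text \<open>The leaf with label \<open>l\<close>: every split is oriented towards
  \<open>l\<close>.\<close>

definition star :: "'l \<Rightarrow> 'l set set" where
  "star l = {X \<in> W. l \<in> X}"

lemma vertex_subset: "vertex v \<Longrightarrow> X \<in> v \<Longrightarrow> X \<in> W"
  unfolding vertex_def by blast

lemma vertex_compl: "vertex v \<Longrightarrow> X \<in> W \<Longrightarrow> - X \<in> v \<longleftrightarrow> X \<notin> v"
  unfolding vertex_def by blast

lemma vertex_Int: "vertex v \<Longrightarrow> X \<in> v \<Longrightarrow> Y \<in> v \<Longrightarrow> X \<inter> Y \<noteq> {}"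
  unfolding vertex_def by blast

lemma vertex_not_compl: "vertex v \<Longrightarrow> X \<in> v \<Longrightarrow> - X \<notin> v"
  using vertex_compl[of v X] vertex_subset[of v X] by simp

lemma vertexI:
  assumes "v \<subseteq> W" "\<And>X. X \<in> W \<Longrightarrow> X \<in> v \<or> - X \<in> v" "\<And>X Y. X \<in> v \<Longrightarrow> Y \<in> v \<Longrightarrow> X \<inter> Y \<noteq> {}"
  shows "vertex v"
  unfolding vertex_def
proof (intro conjI ballI iffI)
  show "v \<subseteq> W" by (rule assms(1))
  show "- X \<notin> v" if "X \<in> W" "X \<in> v" for X using assms(3)[of X "- X"] that by auto
  show "X \<in> v" if "X \<in> W" "- X \<notin> v" for X using assms(2)[of X] that by blast
  show "X \<inter> Y \<noteq> {}" if "X \<in> v" "Y \<in> v" for X Y by (rule assms(3)[OF that])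
qed

lemma vertex_up: assumes "vertex v" "X \<in> v" "X \<subseteq> Y" "Y \<in> W" shows "Y \<in> v"
proof (rule ccontr)
  assume "Y \<notin> v"
  then have "- Y \<in> v" using vertex_compl[OF assms(1,4)] by simp
  from vertex_Int[OF assms(1,2) this] assms(3) show False by blast
qed

lemma vertex_eqI: assumes v: "vertex v" and w: "vertex w" and sub: "v \<subseteq> w" shows "v = w"
proof (intro equalityI sub subsetI)
  fix X assume X: "X \<in> w"
  show "X \<in> v"
  proof (rule ccontr)
    assume "X \<notin> v"
    then have "- X \<in> w" using vertex_compl[OF v vertex_subset[OF w X]] sub by auto
    then show False using vertex_not_compl[OF w X] by simp
  qed
qed

lemma minimalD: "minimal X v \<Longrightarrow> X \<in> v" "minimal X v \<Longrightarrow> Y \<in> v \<Longrightarrow> Y \<subseteq> X \<Longrightarrow> Y = X"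
  unfolding minimal_def by blast+

lemma minimal_Int: assumes "minimal X v" "Y \<in> v" "Y \<noteq> X" shows "- X \<inter> Y \<noteq> {}"
proof
  assume "- X \<inter> Y = {}"
  then have "Y \<subseteq> X" by blast
  then show False using minimalD(2)[OF assms(1,2)] assms(3) by simp
qed

lemma not_self_compl: "X \<noteq> - (X :: 'l set)" if "X \<in> W" for X
proof
  assume "X = - X"
  then have "X \<inter> X = {}" by blast
  then show False using nonempty[OF that] by simp
qed

lemma vertex_flip: assumes v: "vertex v" and X: "minimal X v" shows "vertex (flip X v)"
proof (rule vertexI)
  have XW: "X \<in> W" by (rule vertex_subset[OF v minimalD(1)[OF X]])
  show "flip X v \<subseteq> W" using compl[OF XW] vertex_subset[OF v] unfolding flip_def by blast
  show "Y \<in> flip X v \<or> - Y \<in> flip X v" if "Y \<in> W" for Y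
  proof (cases "Y = X \<or> Y = - X")
    case False
    then have "Y \<noteq> X" "- Y \<noteq> X" by auto
    then show ?thesis using vertex_compl[OF v that] unfolding flip_def by blast
  qed (auto simp: flip_def)
  fix Y Z assume Y: "Y \<in> flip X v" and Z: "Z \<in> flip X v"
  have 1: "- X \<inter> Z \<noteq> {}" if "Z \<in> v" "Z \<noteq> X" for Z by (rule minimal_Int[OF X that])
  have 2: "- X \<noteq> {}" by (rule nonempty[OF compl[OF XW]])
  consider "Y = - X" "Z = - X" | "Y = - X" "Z \<in> v" "Z \<noteq> X" | "Z = - X" "Y \<in> v" "Y \<noteq> X" | "Y \<in> v" "Z \<in> v"
    using Y Z unfolding flip_def by blast
  then show "Y \<inter> Z \<noteq> {}"
  proof cases
    case 1 then show ?thesis using 2 by simp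
  next
    case 2 then show ?thesis using 1[of Z] by simp
  next
    case 3 then show ?thesis using 1[of Y] by (simp add: Int_commute)
  next
    case 4 then show ?thesis using vertex_Int[OF v] by simp
  qed
qed

lemma mem_flip: assumes v: "vertex v" and X: "X \<in> v"
  shows "Y \<in> flip X v \<longleftrightarrow> (if Y = X then False else if Y = - X then True else Y \<in> v)"
  using not_self_compl[OF vertex_subset[OF v X]] unfolding flip_def by auto

lemma flip_flip: assumes v: "vertex v" and X: "X \<in> v" shows "flip (- X) (flip X v) = v"
  using X vertex_not_compl[OF v X] unfolding flip_def by auto

lemma flip_neq: assumes v: "vertex v" and X: "X \<in> v" shows "flip X v \<noteq> v"
  using mem_flip[OF v X, of X] X by auto

lemma minimal_flip: assumes v: "vertex v" and X: "minimal X v" shows "minimal (- X) (flip X v)"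
  unfolding minimal_def
proof (intro conjI ballI impI)
  show "- X \<in> flip X v" by (simp add: flip_def)
  fix Y assume Y: "Y \<in> flip X v" "Y \<subseteq> - X"
  show "Y = - X"
  proof (rule ccontr)
    assume "Y \<noteq> - X"
    then have "Y \<in> v" using Y(1) unfolding flip_def by blast
    from vertex_Int[OF v this minimalD(1)[OF X]] Y(2) show False by blast
  qed
qed

text \<open>If two vertices at which \<open>X\<close> is minimal made different choices for the
  split of \<open>Y\<close>, then \<open>X\<close> and \<open>-X\<close> would both meet
  \<open>Y\<close> and \<open>-Y\<close>. Thus an oriented side determines an end of an edge, and
  distinct splits have distinct edges.\<close>

lemma edge_vertex_subset:
  assumes v: "vertex v" "minimal X v" and v': "vertex v'" "minimal X v'" shows "v \<subseteq> v'"
proof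
  fix Y assume Y: "Y \<in> v"
  show "Y \<in> v'"
  proof (rule ccontr)
    assume n: "Y \<notin> v'"
    have XW: "X \<in> W" and YW: "Y \<in> W" using vertex_subset[OF v(1)] minimalD(1)[OF v(2)] Y by blast+
    have nY: "- Y \<in> v'" using vertex_compl[OF v'(1) YW] n by simp
    have ne: "Y \<noteq> X" "- Y \<noteq> X"
      using n minimalD(1)[OF v'(2)] Y vertex_not_compl[OF v(1) Y] minimalD(1)[OF v(2)] by auto
    have "X \<inter> Y \<noteq> {}" "- X \<inter> Y \<noteq> {}" "X \<inter> - Y \<noteq> {}" "- X \<inter> - Y \<noteq> {}"
      using vertex_Int[OF v(1) minimalD(1)[OF v(2)] Y] minimal_Int[OF v(2) Y ne(1)]
        vertex_Int[OF v'(1) minimalD(1)[OF v'(2)] nY] minimal_Int[OF v'(2) nY ne(2)] by simp_all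
    then show False using compat_W[OF XW YW] unfolding compat_def by simp
  qed
qed

lemma edge_vertex_unique:
  assumes "vertex v" "minimal X v" "vertex v'" "minimal X v'" shows "v = v'"
  by (rule vertex_eqI[OF assms(1,3) edge_vertex_subset[OF assms]])

definition tree_edge :: "'l set \<Rightarrow> 'l set set \<Rightarrow> nat set" where
  "tree_edge X v = {enc v, enc (flip X v)}"

definition V :: "nat set" where "V = enc ` {v. vertex v}"

definition E :: "nat set set" where "E = {tree_edge X v | X v. vertex v \<and> minimal X v}"

definition dec :: "nat \<Rightarrow> 'l set set" where "dec = inv enc"

lemma dec_enc [simp]: "dec (enc v) = v"
  unfolding dec_def by (rule inv_f_f[OF inj_enc])

lemma enc_eq_iff [simp]: "enc v = enc w \<longleftrightarrow> v = w"
  using inj_enc by (simp add: inj_eq)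

lemma V_dec: "n \<in> V \<Longrightarrow> vertex (dec n) \<and> enc (dec n) = n"
  unfolding V_def by auto

lemma E_I: "vertex v \<Longrightarrow> minimal X v \<Longrightarrow> tree_edge X v \<in> E"
  unfolding E_def by blast

lemma tree_edge_flip: "vertex v \<Longrightarrow> minimal X v \<Longrightarrow> tree_edge (- X) (flip X v) = tree_edge X v"
  unfolding tree_edge_def by (simp add: flip_flip minimalD(1) insert_commute)

text \<open>Crossing an edge alters the choice for its own split only, and a split has only one
  edge. This provides the cut functions that \<open>is_tree_of_cuts\<close> asks for.\<close>

lemma edge_cut_iff:
  assumes v: "vertex v" "minimal X v" and xy: "{x, y} \<in> E"
  shows "(X \<in> dec x \<longleftrightarrow> X \<notin> dec y) \<longleftrightarrow> {x, y} = tree_edge X v"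
proof
  assume "{x, y} = tree_edge X v"
  then have "(x = enc v \<and> y = enc (flip X v)) \<or> (x = enc (flip X v) \<and> y = enc v)"
    unfolding tree_edge_def by (auto simp: doubleton_eq_iff)
  then show "X \<in> dec x \<longleftrightarrow> X \<notin> dec y" using mem_flip[OF v(1) minimalD(1)[OF v(2)], of X] minimalD(1)[OF v(2)] by auto
next
  assume d: "X \<in> dec x \<longleftrightarrow> X \<notin> dec y"
  obtain Y w where w: "vertex w" "minimal Y w" "{x, y} = tree_edge Y w" using xy unfolding E_def by blast
  have "(x = enc w \<and> y = enc (flip Y w)) \<or> (x = enc (flip Y w) \<and> y = enc w)"
    using w(3) unfolding tree_edge_def by (auto simp: doubleton_eq_iff)
  then have "X \<in> w \<longleftrightarrow> X \<notin> flip Y w" using d by auto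
  then have "X = Y \<or> X = - Y" using mem_flip[OF w(1) minimalD(1)[OF w(2)], of X] by (auto split: if_splits)
  then show "{x, y} = tree_edge X v"
  proof
    assume "X = Y"
    then have "v = w" using edge_vertex_unique[OF v w(1)] w(2) by simp
    then show ?thesis using w(3) \<open>X = Y\<close> by simp
  next
    assume XY: "X = - Y"
    have "v = flip Y w" using edge_vertex_unique[OF v vertex_flip[OF w(1,2)]] minimal_flip[OF w(1,2)] XY by simp
    then show ?thesis using w(3) tree_edge_flip[OF w(1,2)] XY by simp
  qed
qed

text \<open>A side on which the two end vertices agree need not be reversed on the way.\<close>
lemma vertices_connected:
  assumes "vertex v" "vertex w" "\<forall>Z\<in>S. Z \<in> v \<longleftrightarrow> Z \<in> w"
  shows "(enc v, enc w) \<in> (adj {tree_edge X u | X u. vertex u \<and> minimal X u \<and> X \<notin> S})\<^sup>*"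
  using assms
proof (induction "card (v - w)" arbitrary: v rule: less_induct)
  case less
  note v = less.prems(1) and w = less.prems(2)
  show ?case
  proof (cases "v - w = {}")
    case True
    then have "v = w" using vertex_eqI[OF v w] by blast
    then show ?thesis by simp
  next
    case False
    \<comment> \<open>Since \<open>w\<close> is closed under larger sides, a side minimal among
      those on which \<open>v\<close> differs from \<open>w\<close> is minimal in \<open>v\<close>,
      so it can be reversed, which brings \<open>v\<close> closer to \<open>w\<close>.\<close>
    obtain X where X: "X \<in> v - w" and min: "\<forall>Y\<in>v - w. Y \<le> X \<longrightarrow> X = Y"
      using finite_has_minimal[OF _ False] by auto
    have m: "minimal X v"
      unfolding minimal_def
    proof (intro conjI ballI impI)
      show "X \<in> v" using X by blast
      fix Y assume Y: "Y \<in> v" "Y \<subseteq> X"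
      have "Y \<notin> w" using vertex_up[OF w _ Y(2)] vertex_subset[OF v] X by blast
      then show "Y = X" using min Y by blast
    qed
    have XW: "X \<in> W" using vertex_subset[OF v] X by blast
    have XS: "X \<notin> S" "- X \<notin> S"
      using less.prems(3) X vertex_compl[OF v XW] vertex_compl[OF w XW] by blast+
    have eq: "flip X v - w = (v - w) - {X}" using vertex_compl[OF w XW] X unfolding flip_def by blast
    have "card (flip X v - w) < card (v - w)" unfolding eq by (rule card_Diff1_less) (use X in auto)
    moreover have "\<forall>Z\<in>S. Z \<in> flip X v \<longleftrightarrow> Z \<in> w"
      using less.prems(3) XS mem_flip[OF v minimalD(1)[OF m]] by auto
    ultimately have "(enc (flip X v), enc w) \<in> (adj {tree_edge X u | X u. vertex u \<and> minimal X u \<and> X \<notin> S})\<^sup>*"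
      using less.hyps[OF _ vertex_flip[OF v m] w] by blast
    moreover have "(enc v, enc (flip X v)) \<in> adj {tree_edge X u | X u. vertex u \<and> minimal X u \<and> X \<notin> S}"
      unfolding adj_def using v m XS(1) by (auto simp: tree_edge_def)
    ultimately show ?thesis by (rule converse_rtrancl_into_rtrancl[rotated])
  qed
qed

lemma star_vertex: "vertex (star l)"
  by (rule vertexI) (auto simp: star_def compl)

lemma star_eq_iff: "star k = star l \<longleftrightarrow> k = l"
proof
  assume eq: "star k = star l"
  have "{k} \<in> star k" using single[of k] by (simp add: star_def)
  then have "{k} \<in> star l" by (simp only: eq)
  then show "k = l" by (simp add: star_def)
qed simp

lemma singleton_star: assumes v: "vertex v" and l: "{l} \<in> v" shows "v = star l"
proof (rule vertex_eqI[OF v star_vertex], rule subsetI)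
  fix X assume X: "X \<in> v"
  from vertex_Int[OF v X l] show "X \<in> star l" using vertex_subset[OF v X] by (simp add: star_def)
qed

lemma minimal_star: "minimal X (star l) \<longleftrightarrow> X = {l}"
proof
  assume m: "minimal X (star l)"
  have 1: "{l} \<in> star l" using single by (simp add: star_def)
  have 2: "{l} \<subseteq> X" using minimalD(1)[OF m] by (simp add: star_def)
  from minimalD(2)[OF m 1 2] show "X = {l}" by simp
next
  assume "X = {l}"
  then show "minimal X (star l)" unfolding minimal_def star_def using single by auto
qed

lemma is_tree_VE: "is_tree V E"
proof (rule is_tree_of_cuts)
  show "finite V" unfolding V_def by simp
  show "V \<noteq> {}" unfolding V_def using star_vertex by blast
  show "\<forall>e\<in>E. \<exists>u\<in>V. \<exists>v\<in>V. u \<noteq> v \<and> e = {u, v}"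
  proof
    fix e assume "e \<in> E"
    then obtain X v where v: "vertex v" "minimal X v" and e: "e = tree_edge X v" unfolding E_def by blast
    have "enc v \<in> V" "enc (flip X v) \<in> V" "enc v \<noteq> enc (flip X v)"
      using v vertex_flip[OF v] flip_neq[OF v(1) minimalD(1)[OF v(2)]] unfolding V_def by auto
    then show "\<exists>u\<in>V. \<exists>v\<in>V. u \<noteq> v \<and> e = {u, v}" unfolding e tree_edge_def by blast
  qed
  show "(u, v) \<in> (adj E)\<^sup>*" if "u \<in> V" "v \<in> V" for u v
    using vertices_connected[of "dec u" "dec v" "{}"] V_dec[OF that(1)] V_dec[OF that(2)] unfolding E_def by simp
  show "\<exists>g :: nat \<Rightarrow> bool. \<forall>x y. {x, y} \<in> E \<longrightarrow> (g x \<noteq> g y \<longleftrightarrow> {x, y} = e)" if e: "e \<in> E" for e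
  proof -
    obtain X v where v: "vertex v" "minimal X v" and e: "e = tree_edge X v" using e unfolding E_def by blast
    show ?thesis unfolding e
      using edge_cut_iff[OF v] by (intro exI[of _ "\<lambda>n. X \<in> dec n"] allI impI) blast
  qed
qed

lemma edges_at: assumes v: "vertex v" shows "{e \<in> E. enc v \<in> e} = (\<lambda>X. tree_edge X v) ` {X. minimal X v}"
proof (intro equalityI subsetI)
  fix e assume "e \<in> {e \<in> E. enc v \<in> e}"
  then obtain X w where w: "vertex w" "minimal X w" "e = tree_edge X w" "enc v \<in> e" unfolding E_def by blast
  then have "v = w \<or> v = flip X w" unfolding tree_edge_def by auto
  then show "e \<in> (\<lambda>X. tree_edge X v) ` {X. minimal X v}"
  proof
    assume "v = w" then show ?thesis using w by blast
  next
    assume "v = flip X w"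
    then show ?thesis using minimal_flip[OF w(1,2)] tree_edge_flip[OF w(1,2)] w(3) by (intro image_eqI[of _ _ "- X"]) simp_all
  qed
next
  fix e assume "e \<in> (\<lambda>X. tree_edge X v) ` {X. minimal X v}"
  then show "e \<in> {e \<in> E. enc v \<in> e}" using E_I[OF v] unfolding tree_edge_def by auto
qed

lemma card_edges_at: assumes v: "vertex v" shows "card {e \<in> E. enc v \<in> e} = card {X. minimal X v}"
  unfolding edges_at[OF v]
proof (rule card_image, rule inj_onI)
  fix X Y assume m: "X \<in> {X. minimal X v}" "Y \<in> {X. minimal X v}" and eq: "tree_edge X v = tree_edge Y v"
  have X: "X \<in> v" and Y: "Y \<in> v" using m minimalD(1) by blast+
  have "flip X v = flip Y v"
    using eq flip_neq[OF v X] unfolding tree_edge_def by (auto simp: doubleton_eq_iff)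
  then have "X \<notin> flip Y v" using mem_flip[OF v X, of X] by simp
  then show "X = Y" using mem_flip[OF v Y, of X] X by (auto split: if_splits)
qed

lemma star_degree: "card {X. minimal X (star l)} = 1"
  by (simp add: minimal_star)

lemma minimal_below: assumes "vertex v" "X \<in> v" shows "\<exists>Y. minimal Y v \<and> Y \<subseteq> X"
proof -
  have "{Y \<in> v. Y \<subseteq> X} \<noteq> {}" using assms by blast
  then obtain Y where Y: "Y \<in> {Y \<in> v. Y \<subseteq> X}" "\<forall>Z\<in>{Y \<in> v. Y \<subseteq> X}. Z \<le> Y \<longrightarrow> Y = Z"
    using finite_has_minimal[of "{Y \<in> v. Y \<subseteq> X}"] by auto
  then show ?thesis unfolding minimal_def by (intro exI[of _ Y]) auto
qed

text \<open>Away from the leaves, every label is missed by some minimal side, one below the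
  complement of that label. So the minimal sides have no label in common: a single one would be
  empty, and two would be disjoint.\<close>

lemma inner_degree: assumes v: "vertex v" and inner: "\<And>l. {l} \<notin> v"
  shows "card {X. minimal X v} \<noteq> 1" "card {X. minimal X v} \<noteq> 2"
proof -
  have ex: "\<exists>M. minimal M v \<and> l \<notin> M" for l
  proof -
    have "- {l} \<in> v" using vertex_compl[OF v single] inner by simp
    from minimal_below[OF v this] show ?thesis by blast
  qed
  show "card {X. minimal X v} \<noteq> 1"
  proof
    assume "card {X. minimal X v} = 1"
    then obtain M where M: "{X. minimal X v} = {M}" by (auto simp: card_1_singleton_iff)
    then have "l \<notin> M" for l using ex[of l] by auto
    then have "M = {}" by blast
    moreover have "minimal M v" using M by blast
    ultimately show False using nonempty[OF vertex_subset[OF v minimalD(1)]] by blast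
  qed
  show "card {X. minimal X v} \<noteq> 2"
  proof
    assume "card {X. minimal X v} = 2"
    then obtain M N where MN: "{X. minimal X v} = {M, N}" by (auto simp: card_2_iff)
    then have "l \<notin> M \<or> l \<notin> N" for l using ex[of l] by auto
    then have "M \<inter> N = {}" by blast
    moreover have "minimal M v" "minimal N v" using MN by blast+
    ultimately show False using vertex_Int[OF v minimalD(1) minimalD(1)] by blast
  qed
qed

text \<open>Without an edge for \<open>X\<close>, membership of \<open>X\<close> would be the same
  at all vertices, yet the leaves on its two sides differ and are connected.\<close>

lemma side_has_edge: assumes X: "X \<in> W" shows "\<exists>v. vertex v \<and> minimal X v"
proof (rule ccontr)
  assume no: "\<not> ?thesis"
  obtain k l where k: "k \<in> X" and l: "l \<in> - X" using nonempty[OF X] nonempty[OF compl[OF X]] by blast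
  have "(enc (star k), enc (star l)) \<in> (adj {tree_edge Y u | Y u. vertex u \<and> minimal Y u \<and> Y \<notin> {}})\<^sup>*"
    by (rule vertices_connected[OF star_vertex star_vertex]) simp
  then have "X \<in> dec (enc (star l))"
  proof (induction rule: rtrancl_induct)
    case base
    show ?case using k X by (simp add: star_def)
  next
    case (step y z)
    obtain Y u where u: "vertex u" "minimal Y u" "{y, z} = tree_edge Y u" using step(2) unfolding adj_def by blast
    have "X \<noteq> Y" using no u by blast
    moreover have "X \<noteq> - Y" using no vertex_flip[OF u(1,2)] minimal_flip[OF u(1,2)] by blast
    ultimately have "X \<in> u \<longleftrightarrow> X \<in> flip Y u" using mem_flip[OF u(1) minimalD(1)[OF u(2)], of X] by simp
    moreover have "(y = enc u \<and> z = enc (flip Y u)) \<or> (y = enc (flip Y u) \<and> z = enc u)"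
      using u(3) unfolding tree_edge_def by (auto simp: doubleton_eq_iff)
    ultimately show ?case using step(3) by auto
  qed
  then show False using l by (simp add: star_def)
qed

text \<open>Leaves on the same side of \<open>X\<close> are joined by a path that reverses neither
  \<open>X\<close> nor its complement, hence avoids the edge of \<open>X\<close>.\<close>

lemma agree_connected:
  assumes v: "vertex v" "minimal X v"
  shows "(enc (star k), enc (star l)) \<in> (adj (E - {tree_edge X v}))\<^sup>* \<longleftrightarrow> (k \<in> X \<longleftrightarrow> l \<in> X)"
proof
  have XW: "X \<in> W" by (rule vertex_subset[OF v(1) minimalD(1)[OF v(2)]])
  {
    assume "(enc (star k), enc (star l)) \<in> (adj (E - {tree_edge X v}))\<^sup>*"
    then have "X \<in> dec (enc (star k)) \<longleftrightarrow> X \<in> dec (enc (star l))"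
    proof (induction rule: rtrancl_induct)
      case (step y z)
      have "{y, z} \<in> E" "{y, z} \<noteq> tree_edge X v" using step(2) by (auto simp: adj_def)
      then show ?case using edge_cut_iff[OF v, of y z] step(3) by blast
    qed simp
    then show "k \<in> X \<longleftrightarrow> l \<in> X" using XW by (simp add: star_def)
  }
  assume kl: "k \<in> X \<longleftrightarrow> l \<in> X"
  let ?F = "{tree_edge Y u | Y u. vertex u \<and> minimal Y u \<and> Y \<notin> {X, - X}}"
  have "(enc (star k), enc (star l)) \<in> (adj ?F)\<^sup>*"
    by (rule vertices_connected[OF star_vertex star_vertex]) (use kl XW compl[OF XW] in \<open>simp add: star_def\<close>)
  moreover have "?F \<subseteq> E - {tree_edge X v}"
  proof
    fix e assume "e \<in> ?F"
    then obtain Y u where u: "vertex u" "minimal Y u" "e = tree_edge Y u" "Y \<noteq> X" "Y \<noteq> - X" by blast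
    have "e \<in> E" using E_I[OF u(1,2)] u(3) by simp
    moreover have "e \<noteq> tree_edge X v"
    proof
      assume "e = tree_edge X v"
      then have eq: "{enc u, enc (flip Y u)} = tree_edge X v" using u(3) unfolding tree_edge_def by simp
      moreover have "{enc u, enc (flip Y u)} \<in> E" using E_I[OF u(1,2)] by (simp add: tree_edge_def)
      ultimately have "X \<in> u \<longleftrightarrow> X \<notin> flip Y u" using edge_cut_iff[OF v, of "enc u" "enc (flip Y u)"] by simp
      then show False using mem_flip[OF u(1) minimalD(1)[OF u(2)], of X] u(4,5) by (auto split: if_splits)
    qed
    ultimately show "e \<in> E - {tree_edge X v}" by blast
  qed
  ultimately show "(enc (star k), enc (star l)) \<in> (adj (E - {tree_edge X v}))\<^sup>*" using adj_mono by blast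
qed

end

section \<open>Combinatorial symbic trees\<close>

locale label_tree =
  fixes U :: "('n::finite + 'n) set set" and enc :: "('n + 'n) set set \<Rightarrow> nat"
  assumes side_system: "side_system U" and inj_enc': "inj enc"
begin

text \<open>The trivial splits are added because the construction needs an edge for each leaf; only
  the sides in \<open>U\<close> give internal edges.\<close>

definition W :: "('n + 'n) set set" where
  "W = U \<union> range (\<lambda>l. {l}) \<union> range (\<lambda>l. - {l})"

lemma W_cases: assumes "X \<in> W" obtains "X \<in> U" | l where "X = {l}" | l where "X = - {l}"
  using assms unfolding W_def by blast

lemma W_compl: assumes "X \<in> W" shows "- X \<in> W"
  using assms by (rule W_cases) (use side_systemD(1)[OF side_system] in \<open>auto simp: W_def\<close>)

lemma U_W: "X \<in> U \<Longrightarrow> X \<in> W" by (simp add: W_def)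

lemma single_W: "{l} \<in> W" by (simp add: W_def)

lemma compat_single: "compat {l} X" "compat (- {l}) X"
proof -
  show "compat {l} X" unfolding compat_def by (cases "l \<in> X") simp_all
  then show "compat (- {l}) X" by (simp add: compat_compl)
qed

lemma W_compat: assumes X: "X \<in> W" and Y: "Y \<in> W" shows "compat X Y"
  using X
proof (rule W_cases)
  assume XU: "X \<in> U"
  show ?thesis
    using Y
  proof (rule W_cases)
    assume "Y \<in> U" then show ?thesis by (rule side_systemD(3)[OF side_system XU])
  next
    fix l assume "Y = {l}" then show ?thesis by (subst compat_sym) (simp add: compat_single)
  next
    fix l assume "Y = - {l}" then show ?thesis by (subst compat_sym) (simp add: compat_single)
  qed
qed (simp_all add: compat_single)

lemma label_neq: "\<exists>k. k \<noteq> (l :: 'n + 'n)"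
  by (cases l) (metis sum.distinct)+

lemma W_nonempty: assumes "X \<in> W" shows "X \<noteq> {}"
  using assms
proof (rule W_cases)
  assume "X \<in> U" then show ?thesis using side_systemD(2)[OF side_system, of X] unfolding bicoloured_def by blast
next
  fix l assume "X = - {l}" then show ?thesis using label_neq[of l] by blast
qed simp

sublocale split_tree W enc
  by unfold_locales (simp_all add: W_compl W_nonempty W_compat single_W inj_enc')

sublocale tree V E
  by unfold_locales (rule is_tree_VE)

lemma U_not_single: assumes "X \<in> U" shows "X \<noteq> {l}" "X \<noteq> - {l}"
proof -
  have *: "X \<noteq> {l}" if "X \<in> U" for X :: "('n + 'n) set" and l
    using side_systemD(2)[OF side_system that] unfolding bicoloured_def by auto
  show "X \<noteq> {l}" by (rule *[OF assms])
  have "- X \<noteq> {l}" by (rule *[OF side_systemD(1)[OF side_system assms]])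
  then show "X \<noteq> - {l}" by auto
qed

definition T :: "(nat set \<Rightarrow> real) \<Rightarrow> 'n mtree" where
  "T d = \<lparr>verts = V, edges = E, leaf = \<lambda>l. enc (star l), len = d\<rparr>"

lemma T_sel [simp]: "verts (T d) = V" "edges (T d) = E" "leaf (T d) l = enc (star l)" "len (T d) = d"
  by (simp_all add: T_def)

lemma V_obtain: "n \<in> V \<Longrightarrow> \<exists>v. vertex v \<and> n = enc v"
  unfolding V_def by blast

lemma degree_T: assumes "vertex v" shows "degree_in (T d) (enc v) = card {X. minimal X v}"
  unfolding degree_in_def using card_edges_at[OF assms] by simp

definition inner :: "('n + 'n) set set \<Rightarrow> bool" where
  "inner v \<longleftrightarrow> vertex v \<and> (\<forall>l. {l} \<notin> v)"

lemma vertex_cases: assumes "vertex v" obtains l where "v = star l" | "inner v"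
  using assms singleton_star unfolding inner_def by blast

lemma star_not_inner: "\<not> inner (star l)"
  unfolding inner_def star_def using single_W by blast

lemma labelled_T: "labelled_tree (T d)"
  unfolding labelled_tree_def
proof (intro conjI ballI)
  show "is_tree (verts (T d)) (edges (T d))" by (simp add: is_tree_VE)
  show "bij_betw (leaf (T d)) UNIV {v \<in> verts (T d). degree_in (T d) v = 1}"
    unfolding bij_betw_def
  proof (intro conjI equalityI subsetI)
    show "inj (leaf (T d))" by (rule injI) (simp add: star_eq_iff)
    fix n assume "n \<in> range (leaf (T d))"
    then obtain l where "n = enc (star l)" by auto
    then show "n \<in> {v \<in> verts (T d). degree_in (T d) v = 1}"
      using star_vertex degree_T[OF star_vertex] star_degree by (simp add: V_def)
  next
    fix n assume n: "n \<in> {v \<in> verts (T d). degree_in (T d) v = 1}"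
    then obtain v where v: "vertex v" "n = enc v" using V_obtain[of n] by auto
    from v(1) show "n \<in> range (leaf (T d))"
    proof (rule vertex_cases)
      fix l assume "v = star l" then show ?thesis using v(2) by auto
    next
      assume "inner v"
      then show ?thesis using inner_degree(1)[of v] degree_T[OF v(1)] n v(2) unfolding inner_def by simp
    qed
  qed
  fix n assume "n \<in> verts (T d)"
  then obtain v where v: "vertex v" "n = enc v" using V_obtain[of n] by auto
  from v(1) show "degree_in (T d) n \<noteq> 2"
  proof (rule vertex_cases)
    fix l assume "v = star l" then show ?thesis using v(2) degree_T[OF v(1)] star_degree by simp
  next
    assume "inner v"
    then show ?thesis using inner_degree(2)[of v] degree_T[OF v(1)] v(2) unfolding inner_def by simp
  qed
qed

lemma inner_verts_T: "inner_verts (T d) = enc ` {v. inner v}"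
proof (intro equalityI subsetI)
  fix n assume "n \<in> inner_verts (T d)"
  then obtain v where v: "vertex v" "n = enc v" "n \<notin> range (\<lambda>l. enc (star l))"
    unfolding inner_verts_def by (auto simp: V_def)
  from v(1) show "n \<in> enc ` {v. inner v}"
    by (rule vertex_cases) (use v in auto)
next
  fix n assume "n \<in> enc ` {v. inner v}"
  then obtain v where v: "inner v" "n = enc v" by blast
  then have "n \<notin> range (\<lambda>l. enc (star l))" using star_not_inner by auto
  then show "n \<in> inner_verts (T d)" using v unfolding inner_verts_def inner_def by (simp add: V_def)
qed

lemma edge_inner:
  assumes v: "vertex v" "minimal X v" and XU: "X \<in> U" shows "inner v" "inner (flip X v)"
proof -
  have *: "inner v" if v: "vertex v" "minimal X v" and XU: "X \<in> U" for v X
    unfolding inner_def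
  proof (intro conjI v(1) allI notI)
    fix l assume "{l} \<in> v"
    from singleton_star[OF v(1) this] v(2) have "X = {l}" by (simp add: minimal_star)
    then show False using U_not_single(1)[OF XU] by simp
  qed
  show "inner v" by (rule *[OF assms])
  show "inner (flip X v)" by (rule *[OF vertex_flip[OF v] minimal_flip[OF v] side_systemD(1)[OF side_system XU]])
qed

lemma internal_edges_T: "internal_edges (T d) = {tree_edge X v | X v. vertex v \<and> minimal X v \<and> X \<in> U}"
proof (intro equalityI subsetI)
  fix e assume "e \<in> internal_edges (T d)"
  then have e: "e \<in> E" "e \<subseteq> enc ` {v. inner v}" unfolding internal_edges_def inner_verts_T by auto
  obtain X v where v: "vertex v" "minimal X v" "e = tree_edge X v" using e(1) unfolding E_def by blast
  have i: "inner v" "inner (flip X v)" using e(2) unfolding v(3) tree_edge_def by auto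
  have "X \<in> W" by (rule vertex_subset[OF v(1) minimalD(1)[OF v(2)]])
  then have "X \<in> U"
  proof (rule W_cases)
    fix l assume "X = {l}"
    then show ?thesis using i(1) minimalD(1)[OF v(2)] unfolding inner_def by blast
  next
    fix l assume "X = - {l}"
    then have "{l} \<in> flip X v" unfolding flip_def by simp
    then show ?thesis using i(2) unfolding inner_def by blast
  qed
  then show "e \<in> {tree_edge X v | X v. vertex v \<and> minimal X v \<and> X \<in> U}" using v by blast
next
  fix e assume "e \<in> {tree_edge X v | X v. vertex v \<and> minimal X v \<and> X \<in> U}"
  then obtain X v where v: "vertex v" "minimal X v" "e = tree_edge X v" "X \<in> U" by blast
  show "e \<in> internal_edges (T d)"
    using edge_inner[OF v(1,2,4)] E_I[OF v(1,2)] unfolding internal_edges_def inner_verts_T v(3) tree_edge_def by auto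
qed

lemma split_of_T: assumes v: "vertex v" "minimal X v" shows "split_of (T d) (tree_edge X v) = {X, - X}"
proof -
  have "same_component (T d) (tree_edge X v) = {(k, l). k \<in> X \<longleftrightarrow> l \<in> X}"
    unfolding same_component_def adj_def[symmetric] T_sel agree_connected[OF v] ..
  moreover have "X \<in> W" by (rule vertex_subset[OF v(1) minimalD(1)[OF v(2)]])
  then have "X \<noteq> {}" "- X \<noteq> {}" using W_nonempty W_compl by blast+
  ultimately show ?thesis unfolding split_of_def by (simp add: quotient_two_classes)
qed

lemma splits_T: "splits (T d) = (\<lambda>X. {X, - X}) ` U"
proof (intro equalityI subsetI)
  fix S assume "S \<in> splits (T d)"
  then obtain X v where v: "vertex v" "minimal X v" "X \<in> U" "S = split_of (T d) (tree_edge X v)"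
    unfolding splits_def internal_edges_T by blast
  then show "S \<in> (\<lambda>X. {X, - X}) ` U" using split_of_T[OF v(1,2)] by blast
next
  fix S assume "S \<in> (\<lambda>X. {X, - X}) ` U"
  then obtain X where X: "X \<in> U" "S = {X, - X}" by blast
  obtain v where v: "vertex v" "minimal X v" using side_has_edge[OF U_W[OF X(1)]] by blast
  have "tree_edge X v \<in> internal_edges (T d)" unfolding internal_edges_T using v X(1) by blast
  then show "S \<in> splits (T d)" unfolding splits_def using split_of_T[OF v] X(2) by blast
qed

lemma mem_side:
  assumes u: "vertex u" "minimal X u" and n: "n \<in> V"
  shows "n \<in> side E (tree_edge X u) (enc u) \<longleftrightarrow> X \<in> dec n"
proof -
  have const: "X \<in> dec m \<longleftrightarrow> X \<in> dec n" if "n \<in> side E (tree_edge X u) m" for n m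
    using that[unfolded side_def mem_Collect_eq]
  proof (induction rule: rtrancl_induct)
    case (step y z)
    have "{y, z} \<in> E" "{y, z} \<noteq> tree_edge X u" using step(2) by (auto simp: adj_def)
    then show ?case using edge_cut_iff[OF u, of y z] step(3) by blast
  qed simp
  have e: "{enc u, enc (flip X u)} \<in> E" using E_I[OF u] unfolding tree_edge_def .
  have "X \<in> u" "X \<notin> flip X u" using minimalD(1)[OF u(2)] mem_flip[OF u(1) minimalD(1)[OF u(2)]] by auto
  then show ?thesis
    using const[of n "enc u"] const[of n "enc (flip X u)"] side_cover[OF e n] unfolding tree_edge_def by auto
qed

end

section \<open>The involution on the constructed tree and its fixed points\<close>

locale symbic_label_tree = label_tree +
  assumes symbic: "symbic_system U"
begin

definition swap_vertex :: "('a + 'a) set set \<Rightarrow> ('a + 'a) set set" where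
  "swap_vertex v = (`) swap_label ` v"

lemma mem_swap_vertex [simp]: "X \<in> swap_vertex v \<longleftrightarrow> swap_label ` X \<in> v"
proof
  assume "X \<in> swap_vertex v"
  then obtain Y where "Y \<in> v" "X = swap_label ` Y" unfolding swap_vertex_def by blast
  then show "swap_label ` X \<in> v" by simp
next
  assume "swap_label ` X \<in> v"
  then show "X \<in> swap_vertex v" unfolding swap_vertex_def by (intro image_eqI[of _ _ "swap_label ` X"]) simp_all
qed

lemma swap_vertex_swap [simp]: "swap_vertex (swap_vertex v) = v"
  by (rule set_eqI) simp

lemma swap_U: "X \<in> U \<Longrightarrow> swap_label ` X \<in> U"
  using symbic unfolding symbic_system_def by blast

lemma swap_W: assumes "X \<in> W" shows "swap_label ` X \<in> W"
  using assms
proof (rule W_cases)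
  assume "X \<in> U" then show ?thesis by (intro U_W swap_U)
next
  fix l assume "X = {l}" then show ?thesis by (simp add: single_W)
next
  fix l assume "X = - {l}"
  then have "swap_label ` X = - {swap_label l}" by simp
  then show ?thesis by (simp add: W_def)
qed

lemma swap_disjoint: "swap_label ` X \<inter> swap_label ` Y = {} \<longleftrightarrow> X \<inter> Y = {}"
proof -
  have "swap_label ` X \<inter> swap_label ` Y = swap_label ` (X \<inter> Y)" by (rule set_eqI) simp
  then show ?thesis by simp
qed

lemma vertex_swap: assumes v: "vertex v" shows "vertex (swap_vertex v)"
proof (rule vertexI)
  show "swap_vertex v \<subseteq> W"
  proof
    fix X assume "X \<in> swap_vertex v"
    then have "swap_label ` X \<in> v" by simp
    from swap_W[OF vertex_subset[OF v this]] show "X \<in> W" by simp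
  qed
  show "X \<in> swap_vertex v \<or> - X \<in> swap_vertex v" if "X \<in> W" for X
    using vertex_compl[OF v swap_W[OF that]] by simp
  show "X \<inter> Y \<noteq> {}" if "X \<in> swap_vertex v" "Y \<in> swap_vertex v" for X Y
    using vertex_Int[OF v that[unfolded mem_swap_vertex]] unfolding swap_disjoint .
qed

lemma minimal_swap: assumes "minimal X v" shows "minimal (swap_label ` X) (swap_vertex v)"
  unfolding minimal_def
proof (intro conjI ballI impI)
  show "swap_label ` X \<in> swap_vertex v" using minimalD(1)[OF assms] by simp
  fix Y assume Y: "Y \<in> swap_vertex v" "Y \<subseteq> swap_label ` X"
  have "swap_label ` Y \<subseteq> X" using image_mono[OF Y(2), of swap_label] by simp
  then have "swap_label ` Y = X" using minimalD(2)[OF assms] Y(1) by simp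
  then show "Y = swap_label ` X" by (metis swap_side_simps(1))
qed

lemma flip_swap: "swap_vertex (flip X v) = flip (swap_label ` X) (swap_vertex v)"
proof -
  have inj: "inj ((`) swap_label)" by (rule injI) (metis swap_side_simps(1))
  show ?thesis unfolding swap_vertex_def flip_def image_insert image_set_diff[OF inj] by simp
qed

definition \<tau> :: "nat \<Rightarrow> nat" where "\<tau> n = enc (swap_vertex (dec n))"

lemma \<tau>_enc [simp]: "\<tau> (enc v) = enc (swap_vertex v)" by (simp add: \<tau>_def)

lemma \<tau>_V: "n \<in> V \<Longrightarrow> \<tau> n \<in> V" unfolding V_def using vertex_swap by auto

lemma \<tau>_\<tau>: "n \<in> V \<Longrightarrow> \<tau> (\<tau> n) = n" unfolding V_def by auto

lemma \<tau>_edge: "\<tau> ` tree_edge X v = tree_edge (swap_label ` X) (swap_vertex v)"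
  unfolding tree_edge_def by (simp add: flip_swap)

lemma \<tau>_E: assumes "e \<in> E" shows "\<tau> ` e \<in> E"
proof -
  obtain X v where "vertex v" "minimal X v" "e = tree_edge X v" using assms unfolding E_def by blast
  then show ?thesis using E_I[OF vertex_swap minimal_swap] \<tau>_edge by simp
qed

lemma \<tau>_inj: "inj_on \<tau> V" by (rule inj_on_inverseI[of _ \<tau>]) (rule \<tau>_\<tau>)

lemma swap_star: "swap_vertex (star l) = star (swap_label l)"
proof (rule set_eqI)
  fix X show "X \<in> swap_vertex (star l) \<longleftrightarrow> X \<in> star (swap_label l)"
    using swap_W[of X] swap_W[of "swap_label ` X"] by (auto simp: star_def)
qed

lemma swap_automorphism_T:
  assumes "\<And>e. e \<in> internal_edges (T d) \<Longrightarrow> d (\<tau> ` e) = d e"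
  shows "swap_automorphism (T d) \<tau>"
  unfolding swap_automorphism_def
proof (intro conjI allI ballI)
  show "bij_betw \<tau> (verts (T d)) (verts (T d))"
    by (rule bij_betw_byWitness[of _ \<tau>]) (use \<tau>_\<tau> \<tau>_V in auto)
  have "e \<in> (`) \<tau> ` E" if "e \<in> E" for e
  proof -
    have "\<tau> ` \<tau> ` e = e"
    proof -
      have "e \<subseteq> V" using edge_obtain[OF that] by blast
      then have "(\<lambda>n. \<tau> (\<tau> n)) ` e = (\<lambda>n. n) ` e" by (intro image_cong refl \<tau>_\<tau>) blast
      then show ?thesis by (simp add: image_image)
    qed
    then show ?thesis using \<tau>_E[OF that] by (intro image_eqI[of _ _ "\<tau> ` e"]) simp_all
  qed
  then show "(`) \<tau> ` edges (T d) = edges (T d)" using \<tau>_E by auto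
  show "\<tau> (leaf (T d) l) = leaf (T d) (swap_label l)" for l by (simp add: swap_star)
  show "len (T d) (\<tau> ` e) = len (T d) e" if "e \<in> internal_edges (T d)" for e using assms[OF that] by simp
qed

abbreviation Fix where "Fix \<equiv> {n \<in> V. \<tau> n = n}"
abbreviation Flip where "Flip \<equiv> {e \<in> E. \<tau> ` e = e \<and> (\<forall>n\<in>e. \<tau> n \<noteq> n)}"

text \<open>The ends of an inverted edge of \<open>X\<close> differ only in the choice for that
  split. The image of \<open>X\<close> is chosen at one end and not at the other, so it is the
  complement of \<open>X\<close>.\<close>

lemma FlipD: assumes "e \<in> Flip"
  shows "\<exists>X v. vertex v \<and> minimal X v \<and> e = tree_edge X v \<and> swap_label ` X = - X"
proof -
  have e: "e \<in> E" "\<tau> ` e = e" "\<forall>n\<in>e. \<tau> n \<noteq> n" using assms by blast+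
  obtain X v where v: "vertex v" "minimal X v" "e = tree_edge X v" using e(1) unfolding E_def by blast
  note X = minimalD(1)[OF v(2)]
  have "\<tau> (enc v) \<in> \<tau> ` e" using v(3) unfolding tree_edge_def by blast
  then have "enc (swap_vertex v) \<in> e" unfolding e(2) by simp
  moreover have "\<tau> (enc v) \<noteq> enc v" using e(3) unfolding v(3) tree_edge_def by blast
  then have "swap_vertex v \<noteq> v" by simp
  ultimately have sv: "swap_vertex v = flip X v" unfolding v(3) tree_edge_def by simp
  have "swap_label ` X \<in> flip X v" unfolding sv[symmetric] using X by simp
  moreover have "- X \<in> swap_vertex v" unfolding sv flip_def by simp
  then have "- swap_label ` X \<in> v" by simp
  then have "swap_label ` X \<notin> v" using vertex_not_compl[OF v(1), of "- swap_label ` X"] by simp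
  ultimately have "swap_label ` X = - X" unfolding flip_def by blast
  then show ?thesis using v by blast
qed

text \<open>A fixed vertex would choose both or neither of \<open>X\<close> and its complement. For
  a second side \<open>Y\<close> of this kind the swap pairs up the four alternatives of
  compatibility, two intersections are empty at once, and \<open>Y\<close> is \<open>X\<close> or
  its complement.\<close>

lemma Flip_unique:
  assumes X: "X \<in> W" "swap_label ` X = - X"
  shows "Fix = {}" "\<exists>e. Flip = {e}"
proof -
  show "Fix = {}"
  proof (rule ccontr)
    assume "Fix \<noteq> {}"
    then obtain v where v: "vertex v" "swap_vertex v = v" unfolding V_def by auto
    have "X \<in> v \<longleftrightarrow> - X \<in> v" using mem_swap_vertex[of X v] v(2) X(2) by simp
    then show False using vertex_compl[OF v(1) X(1)] by blast
  qed
  obtain v where v: "vertex v" "minimal X v" using side_has_edge[OF X(1)] by blast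
  have sv: "swap_vertex v = flip X v"
    by (rule edge_vertex_unique[OF vertex_swap[OF v(1)] _ vertex_flip[OF v] minimal_flip[OF v]])
      (use minimal_swap[OF v(2)] X(2) in simp)
  have sv': "swap_vertex (flip X v) = v" unfolding sv[symmetric] by simp
  have F1: "tree_edge X v \<in> Flip"
    using E_I[OF v] flip_neq[OF v(1) minimalD(1)[OF v(2)]] unfolding tree_edge_def by (auto simp: sv sv')
  have F2: "e = tree_edge X v" if eF: "e \<in> Flip" for e
  proof -
    obtain Y w where w: "vertex w" "minimal Y w" "e = tree_edge Y w" "swap_label ` Y = - Y" using FlipD[OF eF] by blast
    have "Y \<in> W" by (rule vertex_subset[OF w(1) minimalD(1)[OF w(2)]])
    then have c: "compat X Y" using W_compat X(1) by blast
    have s: "X \<inter> Y = {} \<longleftrightarrow> - X \<inter> - Y = {}" "X \<inter> - Y = {} \<longleftrightarrow> - X \<inter> Y = {}"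
      using swap_disjoint[of X Y] swap_disjoint[of X "- Y"] X(2) w(4) by simp_all
    have "Y = X \<or> Y = - X" using c s unfolding compat_def by blast
    then show ?thesis
    proof
      assume "Y = X" then show ?thesis using edge_vertex_unique[OF v w(1)] w(2,3) by simp
    next
      assume Y: "Y = - X"
      have "w = flip X v" using edge_vertex_unique[OF w(1,2) vertex_flip[OF v]] minimal_flip[OF v] Y by simp
      then show ?thesis using tree_edge_flip[OF v] w(3) Y by simp
    qed
  qed
  have "e \<in> Flip \<longleftrightarrow> e \<in> {tree_edge X v}" for e
  proof
    assume "e \<in> Flip"
    from F2[OF this] show "e \<in> {tree_edge X v}" by simp
  next
    assume "e \<in> {tree_edge X v}"
    then show "e \<in> Flip" using F1 by (simp only: singleton_iff)
  qed
  then show "\<exists>e. Flip = {e}" by (intro exI[of _ "tree_edge X v"] set_eqI)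
qed

text \<open>Only the edge of \<open>Z\<close> changes membership of \<open>Z\<close>, so a path that
  meets both sides contains both ends of that edge.\<close>

lemma path_crosses:
  assumes p: "simple_path E p" and y: "vertex y" "minimal Z y"
    and n: "n \<in> set p" "Z \<in> dec n" and m: "m \<in> set p" "Z \<notin> dec m"
  shows "enc (flip Z y) \<in> set p"
proof (rule ccontr)
  assume no: "enc (flip Z y) \<notin> set p"
  have c: "(Z \<in> dec (p ! k)) = (Z \<in> dec (p ! 0))" if "k < length p" for k
    using that
  proof (induction k)
    case (Suc k)
    have e: "{p ! k, p ! Suc k} \<in> E"
      using p Suc.prems successively_conv_nth[of "\<lambda>u v. {u, v} \<in> E" p] unfolding simple_path_def by blast
    have "{p ! k, p ! Suc k} \<subseteq> set p" using Suc.prems by simp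
    then have "{p ! k, p ! Suc k} \<noteq> tree_edge Z y" using no unfolding tree_edge_def by blast
    then show ?case using edge_cut_iff[OF y e] Suc by auto
  qed simp
  then show False using n m unfolding in_set_conv_nth by auto
qed

text \<open>The image of \<open>X\<close> separates the same two fixed vertices in the same
  direction. Hence \<open>X\<close> and its image meet and so do their complements, which leaves
  nesting and thus equality. Trivial splits are not invariant, as no label is its own image.\<close>

lemma invariant_between:
  assumes v: "vertex v" "swap_vertex v = v" and y: "vertex y" "swap_vertex y = y" and X: "X \<in> v" "X \<notin> y"
  shows "swap_label ` X = X" "X \<in> U"
proof -
  have XW: "X \<in> W" by (rule vertex_subset[OF v(1) X(1)])
  have "swap_label ` X \<in> v" "swap_label ` X \<notin> y" using X mem_swap_vertex[of X v] mem_swap_vertex[of X y] v(2) y(2) by simp_all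
  then have "X \<inter> swap_label ` X \<noteq> {}" "- X \<inter> - swap_label ` X \<noteq> {}"
    using vertex_Int[OF v(1) X(1)] vertex_Int[OF y(1), of "- X" "- swap_label ` X"]
      vertex_compl[OF y(1) XW] vertex_compl[OF y(1) swap_W[OF XW]] X(2) by simp_all
  then have "X \<subseteq> swap_label ` X \<or> swap_label ` X \<subseteq> X"
    using W_compat[OF XW swap_W[OF XW]] unfolding compat_def by blast
  then show inv: "swap_label ` X = X" by (rule swap_side_subset)
  have l: "swap_label l \<noteq> l" for l :: "'a + 'a" by (cases l) simp_all
  from XW show "X \<in> U"
  proof (rule W_cases)
    fix k assume "X = {k}"
    then show ?thesis using inv l[of k] by simp
  next
    fix k assume "X = - {k}"
    then have "swap_label ` {k} = {k}" using inv by simp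
    then show ?thesis using l[of k] by simp
  qed
qed

text \<open>With no inverted edge, the middle of a path between a leaf and its image is fixed. Join
  two fixed vertices at maximal distance by a path; uniqueness of paths makes it fixed pointwise. A
  fixed vertex off this path would branch off at some point of it that is not an end, and the sides
  towards the two ends and towards that vertex would form a tripod.\<close>

lemma Fix_path:
  assumes no: "\<And>X. X \<in> W \<Longrightarrow> swap_label ` X \<noteq> - X"
  shows "\<exists>p. simple_path E p \<and> set p = Fix"
proof -
  have noflip: "Flip = {}"
  proof (rule ccontr)
    assume "Flip \<noteq> {}"
    then obtain e where "e \<in> Flip" by blast
    from FlipD[OF this] obtain X v where "vertex v" "minimal X v" "swap_label ` X = - X" by blast
    then show False using no[of X] vertex_subset[of v X] minimalD(1)[of X v] by blast
  qed
  obtain l :: "'a + 'a" where True by blast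
  have sV0: "enc (star l) \<in> V" using star_vertex unfolding V_def by blast
  note sV = sV0 \<tau>_V[OF sV0]
  obtain q where q: "simple_path E q" "hd q = enc (star l)" "last q = \<tau> (enc (star l))"
    using unique_path[OF sV] by blast
  have "(\<exists>n\<in>set q. \<tau> n = n) \<or> (\<exists>x\<in>set q. \<exists>y\<in>set q. {x, y} \<in> E \<and> \<tau> x = y \<and> \<tau> y = x)"
    by (rule midpoint[OF \<tau>_inj \<tau>_E q(1)]) (use q sV \<tau>_\<tau>[OF sV(1)] in simp_all)
  moreover have "\<not> (\<exists>x\<in>set q. \<exists>y\<in>set q. {x, y} \<in> E \<and> \<tau> x = y \<and> \<tau> y = x)"
  proof
    assume "\<exists>x\<in>set q. \<exists>y\<in>set q. {x, y} \<in> E \<and> \<tau> x = y \<and> \<tau> y = x"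
    then obtain x y where xy: "{x, y} \<in> E" "\<tau> x = y" "\<tau> y = x" by blast
    then have "{x, y} \<in> Flip" using edge_verts(3)[OF xy(1)] by auto
    then show False using noflip by blast
  qed
  ultimately obtain n where "n \<in> set q" "\<tau> n = n" by blast
  moreover have "set q \<subseteq> V" by (rule path_verts[OF q(1)]) (simp add: q sV)
  ultimately obtain v0 where v0: "vertex v0" "swap_vertex v0 = v0" unfolding V_def by auto
  \<comment> \<open>\<open>card (v - w)\<close> is the number of splits that separate
    \<open>v\<close> from \<open>w\<close>, so it serves as the distance.\<close>
  define P where "P = (\<lambda>(v, w). vertex v \<and> swap_vertex v = v \<and> vertex w \<and> swap_vertex w = w)"
  have "\<exists>vw. P vw \<and> (\<forall>vw'. P vw' \<longrightarrow> card (fst vw' - snd vw') \<le> card (fst vw - snd vw))"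
  proof (rule ex_has_greatest_nat[of P "(v0, v0)" _ "Suc (card (UNIV :: ('a + 'a) set set))"])
    show "P (v0, v0)" using v0 by (simp add: P_def)
    show "\<forall>y. P y \<longrightarrow> card (fst y - snd y) < Suc (card (UNIV :: ('a + 'a) set set))"
      unfolding less_Suc_eq_le by (intro allI impI card_mono finite_class.finite_UNIV subset_UNIV)
  qed
  then obtain v w where "P (v, w)" and max0: "\<And>vw'. P vw' \<Longrightarrow> card (fst vw' - snd vw') \<le> card (v - w)" by auto
  then have v: "vertex v" "swap_vertex v = v" and w: "vertex w" "swap_vertex w = w" by (simp_all add: P_def)
  have max: "card (v' - w') \<le> card (v - w)" if "vertex v'" "swap_vertex v' = v'" "vertex w'" "swap_vertex w' = w'" for v' w'
    using max0[of "(v', w')"] that by (simp add: P_def)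
  have vwV: "enc v \<in> V" "enc w \<in> V" using v w unfolding V_def by auto
  obtain p where p: "simple_path E p" "hd p = enc v" "last p = enc w" using unique_path[OF vwV] by blast
  have p0: "p \<noteq> []" "distinct p" "successively (\<lambda>u v. {u, v} \<in> E) p" using p(1) unfolding simple_path_def by blast+
  have pV: "set p \<subseteq> V" by (rule path_verts[OF p(1)]) (simp add: p vwV)
  have "simple_path E (map \<tau> p)"
    unfolding simple_path_def
  proof (intro conjI)
    show "map \<tau> p \<noteq> []" using p0 by simp
    show "distinct (map \<tau> p)" using p0 inj_on_subset[OF \<tau>_inj pV] by (simp add: distinct_map)
    show "successively (\<lambda>u v. {u, v} \<in> E) (map \<tau> p)"
      unfolding successively_map by (rule successively_mono[OF p0(3)]) (use \<tau>_E in force)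
  qed
  then have "map \<tau> p = p"
    by (rule path_eq[OF _ p(1)]) (use p0 p v w vwV in \<open>simp_all add: hd_map last_map\<close>)
  then have fixp: "\<tau> n = n" if "n \<in> set p" for n using that by (metis map_idI map_eq_conv list.map_ident)
  have ends: "enc v \<in> set p" "enc w \<in> set p" using p p0 hd_in_set[of p] last_in_set[of p] by simp_all
  have "enc x \<in> set p" if x: "vertex x" "swap_vertex x = x" for x
  proof -
    \<comment> \<open>\<open>y\<close> is the point of the path nearest to \<open>x\<close>, the
      place where \<open>x\<close> would branch off.\<close>
    have "\<exists>y. enc y \<in> set p \<and> (\<forall>y'. enc y' \<in> set p \<longrightarrow> card (y - x) \<le> card (y' - x))"
      by (rule ex_has_least_nat[of "\<lambda>y. enc y \<in> set p" v, OF ends(1)])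
    then obtain y where yp: "enc y \<in> set p" and least: "\<And>y'. enc y' \<in> set p \<Longrightarrow> card (y - x) \<le> card (y' - x)" by blast
    have y: "vertex y" "swap_vertex y = y" using yp pV fixp[OF yp] V_dec[of "enc y"] by auto
    \<comment> \<open>If the path crossed the edge of \<open>Z\<close>, its far end would lie on the
      path and be nearer to \<open>x\<close> than \<open>y\<close>.\<close>
    have mini: "Z \<in> u" if Z: "minimal Z y" "Z \<notin> x" and u: "enc u \<in> set p" for Z u
    proof (rule ccontr)
      assume "Z \<notin> u"
      then have f: "enc (flip Z y) \<in> set p"
        using path_crosses[OF p(1) y(1) Z(1) yp _ u] minimalD(1)[OF Z(1)] by simp
      have ZW: "Z \<in> W" by (rule vertex_subset[OF y(1) minimalD(1)[OF Z(1)]])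
      have "flip Z y - x = (y - x) - {Z}" using vertex_compl[OF x(1) ZW] Z(2) unfolding flip_def by blast
      then have "card (flip Z y - x) < card (y - x)"
        using minimalD(1)[OF Z(1)] Z(2) by (simp only:) (rule card_Diff1_less, simp_all)
      then show False using least[OF f] by simp
    qed
    \<comment> \<open>So a side that separates \<open>y\<close> from \<open>x\<close> separates the
      whole path from \<open>x\<close>.\<close>
    have both: "Y \<in> u" if Y: "Y \<in> y" "Y \<notin> x" and u: "vertex u" "enc u \<in> set p" for Y u
    proof -
      obtain Z where Z: "minimal Z y" "Z \<subseteq> Y" using minimal_below[OF y(1) Y(1)] by blast
      have YW: "Y \<in> W" by (rule vertex_subset[OF y(1) Y(1)])
      have "Z \<notin> x" using vertex_up[OF x(1) _ Z(2) YW] Y(2) by blast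
      then show ?thesis using vertex_up[OF u(1) _ Z(2) YW] mini[OF Z(1) _ u(2)] by blast
    qed
    show ?thesis
    proof (rule ccontr)
      assume xp: "enc x \<notin> set p"
      then have "y \<noteq> x" using yp by blast
      then obtain Z where Z: "Z \<in> y" "Z \<notin> x" using vertex_eqI[OF y(1) x(1)] by blast
      have Zv: "Z \<in> v" "Z \<in> w" using both[OF Z v(1) ends(1)] both[OF Z w(1) ends(2)] .
      have ZW: "Z \<in> W" by (rule vertex_subset[OF y(1) Z(1)])
      have nZ: "- Z \<in> x" "- Z \<notin> v" "- Z \<notin> w" "- Z \<notin> y"
        using vertex_compl[OF x(1) ZW] vertex_compl[OF v(1) ZW] vertex_compl[OF w(1) ZW] vertex_compl[OF y(1) ZW] Z Zv by simp_all
      have away: "X \<notin> x" if "X \<in> u" "X \<notin> y" "vertex u" "enc u \<in> set p" for X u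
      proof
        assume Xx: "X \<in> x"
        have XW: "X \<in> W" by (rule vertex_subset[OF that(3,1)])
        have "- X \<in> y" "- X \<notin> x" using vertex_compl[OF y(1) XW] vertex_compl[OF x(1) XW] Xx that(2) by simp_all
        from both[OF this that(3,4)] show False using vertex_compl[OF that(3) XW] that(1) by simp
      qed
      \<comment> \<open>If \<open>x\<close> branched off at the end \<open>v\<close>, it would be
        farther from \<open>w\<close> than \<open>v\<close> is; the same argument excludes
        \<open>w\<close>.\<close>
      have yv: "y \<noteq> v"
      proof
        assume yv: "y = v"
        have "v - w \<subset> x - w"
        proof
          show "v - w \<subseteq> x - w" using both[OF _ _ w(1) ends(2)] yv by blast
          show "v - w \<noteq> x - w" using nZ by blast
        qed
        then have "card (v - w) < card (x - w)" by (rule psubset_card_mono[rotated]) simp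
        then show False using max[OF x w] by simp
      qed
      have yw: "y \<noteq> w"
      proof
        assume yw: "y = w"
        have "v - w \<subset> v - x"
        proof
          show "v - w \<subseteq> v - x" using away[OF _ _ v(1) ends(1)] yw by blast
          show "v - w \<noteq> v - x" using Z Zv by blast
        qed
        then have "card (v - w) < card (v - x)" by (rule psubset_card_mono[rotated]) simp
        then show False using max[OF v x] by simp
      qed
      obtain X where X: "X \<in> v" "X \<notin> y" using vertex_eqI[OF v(1) y(1)] yv by blast
      obtain Y where Y: "Y \<in> w" "Y \<notin> y" using vertex_eqI[OF w(1) y(1)] yw by blast
      \<comment> \<open>Sides are convex, and \<open>y\<close> lies strictly between the two ends of
        the path. Consequently a side chosen at \<open>v\<close> but not at \<open>y\<close> is not
        chosen at \<open>w\<close>, and vice versa.\<close>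
      have between: "Q \<in> y" if Q: "Q \<in> v" "Q \<in> w" for Q
      proof -
        obtain u where u: "vertex u" "minimal Q u" using side_has_edge[OF vertex_subset[OF v(1) Q(1)]] by blast
        note m = mem_side[OF u]
        have e: "{enc u, enc (flip Q u)} \<in> E" using E_I[OF u] unfolding tree_edge_def .
        obtain k where k: "k < length p" "p ! k = enc y" using yp unfolding in_set_conv_nth by blast
        have p00: "p ! 0 = enc v" "p ! (length p - 1) = enc w" using p p0 hd_conv_nth[of p] last_conv_nth[of p] by simp_all
        have "k \<noteq> 0" "k \<noteq> length p - 1" using k(2) p00 yv yw by auto
        then have kk: "0 < k" "k < length p - 1" "length p - 1 < length p" using k(1) by simp_all
        have "p ! k \<in> side E {enc u, enc (flip Q u)} (enc u)"
          by (rule side_convex[OF e p(1) _ kk]) (use p00 m[OF vwV(1)] m[OF vwV(2)] Q p(2) vwV in \<open>simp_all add: tree_edge_def\<close>)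
        then show ?thesis using m[of "enc y"] k(2) yp pV unfolding tree_edge_def by auto
      qed
      have Xw: "X \<notin> w" "X \<notin> x" and Yv: "Y \<notin> v" "Y \<notin> x"
        using between[OF X(1)] X between[of Y] Y away[OF X v(1) ends(1)] away[OF Y w(1) ends(2)] by blast+
      have XW: "X \<in> W" and YW: "Y \<in> W" using vertex_subset[OF v(1) X(1)] vertex_subset[OF w(1) Y(1)] .
      have disj: "A \<inter> B = {}" if "A \<in> W" "B \<in> W" "vertex a" "A \<in> a" "B \<notin> a" "vertex b" "B \<in> b" "A \<notin> b"
        "vertex c" "A \<notin> c" "B \<notin> c" for A B a b c
      proof -
        have "A \<inter> - B \<noteq> {}" using vertex_Int[OF that(3,4)] vertex_compl[OF that(3,2)] that(5) by simp
        moreover have "- A \<inter> B \<noteq> {}" using vertex_Int[OF that(6) _ that(7)] vertex_compl[OF that(6,1)] that(8) by simp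
        moreover have "- A \<inter> - B \<noteq> {}"
          using vertex_Int[OF that(9)] vertex_compl[OF that(9,1)] vertex_compl[OF that(9,2)] that(10,11) by simp
        ultimately show ?thesis using W_compat[OF that(1,2)] unfolding compat_def by simp
      qed
      have nZW: "- Z \<in> W" by (rule W_compl[OF ZW])
      have d: "X \<inter> Y = {} \<and> X \<inter> - Z = {} \<and> Y \<inter> - Z = {}"
        using disj[OF XW YW v(1) X(1) Yv(1) w(1) Y(1) Xw(1) x(1) Xw(2) Yv(2)]
          disj[OF XW nZW v(1) X(1) nZ(2) x(1) nZ(1) Xw(2) w(1) Xw(1) nZ(3)]
          disj[OF YW nZW w(1) Y(1) nZ(3) x(1) nZ(1) Yv(2) v(1) Yv(1) nZ(2)] by (intro conjI)
      note iX = invariant_between[OF v y X] and iY = invariant_between[OF w y Y] and iZ = invariant_between[OF x y nZ(1,4)]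
      have nt: "no_tripod U" using symbic unfolding symbic_system_def by blast
      show False
        using nt[unfolded no_tripod_def, rule_format, OF iX(2) iY(2) iZ(2) iX(1) iY(1) iZ(1)] d by (rule notE)
    qed
  qed
  then have "Fix \<subseteq> set p" unfolding V_def by auto
  moreover have "set p \<subseteq> Fix" using pV fixp by blast
  ultimately show ?thesis using p(1) by blast
qed

lemma fixed_points_path_T: "fixed_points_path (T d) \<tau>"
proof (cases "\<exists>X\<in>W. swap_label ` X = - X")
  case True
  then obtain X where X: "X \<in> W" "swap_label ` X = - X" by blast
  show ?thesis unfolding fixed_points_path_def Let_def T_sel by (intro disjI2 conjI Flip_unique[OF X])
next
  case False
  then have no: "\<And>X. X \<in> W \<Longrightarrow> swap_label ` X \<noteq> - X" by blast
  have "Flip = {}"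
  proof (rule ccontr)
    assume "Flip \<noteq> {}"
    then obtain e where "e \<in> Flip" by blast
    from FlipD[OF this] obtain X v where "vertex v" "minimal X v" "swap_label ` X = - X" by blast
    then show False using no[of X] vertex_subset[of v X] minimalD(1)[of X v] by blast
  qed
  then show ?thesis unfolding fixed_points_path_def Let_def T_sel by (intro disjI1 conjI Fix_path[OF no])
qed

lemma symbic_tree_T: "symbic_tree (T (\<lambda>_. 1))"
  unfolding symbic_tree_def
proof (intro conjI ballI)
  show "labelled_tree (T (\<lambda>_. 1))" by (rule labelled_T)
  fix S X assume "S \<in> splits (T (\<lambda>_. 1))" "X \<in> S"
  then have "X \<in> U" unfolding splits_T using side_systemD(1)[OF side_system] by auto
  then show "\<exists>i. Inl i \<in> X" "\<exists>i. Inr i \<in> X"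
    using side_systemD(2)[OF side_system] unfolding bicoloured_def by blast+
next
  show "\<exists>\<tau>. swap_automorphism (T (\<lambda>_. 1)) \<tau> \<and> fixed_points_path (T (\<lambda>_. 1)) \<tau>"
    using swap_automorphism_T[of "\<lambda>_. 1"] fixed_points_path_T by blast
qed simp

end

lemma ex_inj_nat: "\<exists>enc :: 'a::finite \<Rightarrow> nat. inj enc"
  using finite_imp_inj_to_nat_seg[of "UNIV :: 'a set"] by auto

theorem combinatorial_symbic_trees_eq:
  "(combinatorial_symbic_trees :: 'n::finite split set set) = (\<lambda>U. (\<lambda>X. {X, - X}) ` U) ` {U. symbic_system U}"
proof (intro equalityI subsetI)
  fix \<T> :: "'n split set" assume "\<T> \<in> combinatorial_symbic_trees"
  then obtain T where T: "symbic_tree T" "\<T> = splits T" unfolding combinatorial_symbic_trees_def by blast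
  show "\<T> \<in> (\<lambda>U. (\<lambda>X. {X, - X}) ` U) ` {U. symbic_system U}"
    by (rule image_eqI[of _ _ "\<Union> (splits T)"]) (use symbic_tree_system[OF T(1)] T(2) in simp_all)
next
  fix \<T> :: "'n split set" assume "\<T> \<in> (\<lambda>U. (\<lambda>X. {X, - X}) ` U) ` {U. symbic_system U}"
  then obtain U where U: "symbic_system U" "\<T> = (\<lambda>X. {X, - X}) ` U" by blast
  obtain enc :: "('n + 'n) set set \<Rightarrow> nat" where enc: "inj enc" using ex_inj_nat by blast
  interpret symbic_label_tree U enc
    using U(1) enc by unfold_locales (simp_all add: symbic_system_def)
  show "\<T> \<in> combinatorial_symbic_trees"
    unfolding combinatorial_symbic_trees_def using symbic_tree_T splits_T[of "\<lambda>_. 1"] U(2) by blast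
qed

section \<open>The tree of a matrix\<close>

lemma span_one_iff: "(x :: real ^ 'n) \<in> span {1} \<longleftrightarrow> (\<exists>c. \<forall>r. x $ r = c)"
  unfolding span_singleton by (auto simp: vec_eq_iff)

locale weighted_tree = label_tree U enc
  for U :: "('n::finite + 'n) set set" and enc +
  fixes w :: "('n + 'n) set \<Rightarrow> real" and A :: "real ^ 'n ^ 'n" and f g :: "'n \<Rightarrow> real"
  assumes w: "weighting U w" and symA: "\<And>i j. A $ i $ j = A $ j $ i"
    and A: "\<And>i j. A $ i $ j = f i + g j + gram U w i j" and card2: "CARD('n) \<ge> 2"
begin

lemma w_pos: "X \<in> U \<Longrightarrow> w X > 0" and w_compl: "X \<in> U \<Longrightarrow> w (- X) = w X"
  by (rule weightingD[OF w], assumption)+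

lemma U_compl: "X \<in> U \<Longrightarrow> - X \<in> U" by (rule side_systemD(1)[OF side_system])

lemma U_compat: "X \<in> U \<Longrightarrow> Y \<in> U \<Longrightarrow> compat X Y" by (rule side_systemD(3)[OF side_system])

lemma U_bicoloured: "X \<in> U \<Longrightarrow> bicoloured X" by (rule side_systemD(2)[OF side_system])

text \<open>By symmetry a column is a row, so that the unprimed labels index the generators of the
  hull and the primed labels its coordinates.\<close>

lemma column_A: "column i A $ r = f i + g r + (\<Sum>X\<in>U. w X * of_bool (Inl i \<in> X) * of_bool (Inr r \<in> X)) / 2"
  unfolding column_def using symA[of r i] A[of i r] by (simp add: gram_def)

text \<open>A point of the metric tree assigns to each side the fraction of its edge on which it has
  already passed, so that a vertex is the indicator of its chosen sides.\<close>
definition valid :: "(('n + 'n) set \<Rightarrow> real) \<Rightarrow> bool" where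
  "valid \<theta> \<longleftrightarrow> (\<forall>X\<in>U. 0 \<le> \<theta> X \<and> \<theta> (- X) = 1 - \<theta> X) \<and>
     (\<forall>X\<in>U. \<forall>Y\<in>U. \<theta> X > 0 \<longrightarrow> \<theta> Y > 0 \<longrightarrow> Y \<noteq> - X \<longrightarrow> X \<inter> Y \<noteq> {})"

text \<open>At the point where the label \<open>i\<close> is attached, all sides containing
  \<open>i\<close> have been passed, and the formula gives column \<open>i\<close> up to the
  constant \<open>f i\<close>. The other points are obtained by keeping the formula for fractional
  values.\<close>

definition Phi :: "(('n + 'n) set \<Rightarrow> real) \<Rightarrow> real ^ 'n" where
  "Phi \<theta> = (\<chi> r. g r + (\<Sum>X\<in>U. w X * \<theta> X * of_bool (Inr r \<in> X)) / 2)"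

definition ind :: "('n + 'n) set set \<Rightarrow> ('n + 'n) set \<Rightarrow> real" where
  "ind v X = of_bool (X \<in> v)"

lemma validD:
  assumes "valid \<theta>" "X \<in> U"
  shows "0 \<le> \<theta> X" "\<theta> (- X) = 1 - \<theta> X" "\<theta> X \<le> 1"
    "Y \<in> U \<Longrightarrow> \<theta> X > 0 \<Longrightarrow> \<theta> Y > 0 \<Longrightarrow> Y \<noteq> - X \<Longrightarrow> X \<inter> Y \<noteq> {}"
proof -
  show 1: "0 \<le> \<theta> X" "\<theta> (- X) = 1 - \<theta> X" using assms unfolding valid_def by blast+
  have "0 \<le> \<theta> (- X)" using assms(1) U_compl[OF assms(2)] unfolding valid_def by blast
  then show "\<theta> X \<le> 1" using 1 by simp
  show "Y \<in> U \<Longrightarrow> \<theta> X > 0 \<Longrightarrow> \<theta> Y > 0 \<Longrightarrow> Y \<noteq> - X \<Longrightarrow> X \<inter> Y \<noteq> {}"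
    using assms unfolding valid_def by blast
qed

lemma Phi_cong: "(\<And>X. X \<in> U \<Longrightarrow> \<theta> X = \<theta>' X) \<Longrightarrow> Phi \<theta> = Phi \<theta>'"
  unfolding Phi_def by (simp cong: sum.cong)

lemma Phi_affine: "(1 - t) *\<^sub>R Phi \<theta> + t *\<^sub>R Phi \<theta>' = Phi (\<lambda>X. (1 - t) * \<theta> X + t * \<theta>' X)"
proof (rule vec_eq_iff[THEN iffD2], rule allI)
  fix r
  let ?b = "\<lambda>X :: ('n + 'n) set. of_bool (Inr r \<in> X) :: real"
  have "(\<Sum>X\<in>U. w X * ((1 - t) * \<theta> X + t * \<theta>' X) * ?b X) =
    (1 - t) * (\<Sum>X\<in>U. w X * \<theta> X * ?b X) + t * (\<Sum>X\<in>U. w X * \<theta>' X * ?b X)"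
    unfolding sum_distrib_left sum.distrib[symmetric] by (rule sum.cong) (simp_all add: algebra_simps)
  then show "((1 - t) *\<^sub>R Phi \<theta> + t *\<^sub>R Phi \<theta>') $ r = Phi (\<lambda>X. (1 - t) * \<theta> X + t * \<theta>' X) $ r"
    by (simp add: Phi_def algebra_simps add_divide_distrib diff_divide_distrib)
qed

text \<open>Compatible sides that pairwise meet and whose complements pairwise meet form a chain,
  and its least member has both colours.\<close>

lemma chain_colours:
  assumes D: "D \<subseteq> U" "\<And>X Y. X \<in> D \<Longrightarrow> Y \<in> D \<Longrightarrow> X \<inter> Y \<noteq> {} \<and> - X \<inter> - Y \<noteq> {}"
  shows "\<exists>i. \<forall>X\<in>D. Inl i \<in> X" "\<exists>j. \<forall>X\<in>D. Inr j \<in> X"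
proof -
  have "(\<exists>i. \<forall>X\<in>D. Inl i \<in> X) \<and> (\<exists>j. \<forall>X\<in>D. Inr j \<in> X)"
  proof (cases "D = {}")
    case False
    obtain M where M: "M \<in> D" "\<forall>X\<in>D. X \<le> M \<longrightarrow> M = X"
      using finite_has_minimal[of D] False by auto
    have sub: "M \<subseteq> X" if "X \<in> D" for X
    proof -
      have "compat M X" using U_compat D(1) M(1) that by blast
      then have "M \<subseteq> X \<or> X \<subseteq> M" using D(2)[OF M(1) that] unfolding compat_def by blast
      then show ?thesis using M(2) that by blast
    qed
    have "bicoloured M" using U_bicoloured D(1) M(1) by blast
    then show ?thesis using sub unfolding bicoloured_def by blast
  qed simp
  then show "\<exists>i. \<forall>X\<in>D. Inl i \<in> X" "\<exists>j. \<forall>X\<in>D. Inr j \<in> X" by blast+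
qed

text \<open>The sides on which \<theta> exceeds \<theta>' form a chain, and so do their complements.
  Hence some primed label lies in all of them and another one in none. If there is such a side at
  all, the difference of the two points is positive in the first coordinate and not positive in the
  second, so it is not constant.\<close>

lemma Phi_inject:
  assumes v: "valid \<theta>" "valid \<theta>'" and s: "Phi \<theta> - Phi \<theta>' \<in> span {1}" and X: "X \<in> U"
  shows "\<theta> X = \<theta>' X"
proof -
  define D where "D = {X \<in> U. \<theta>' X < \<theta> X}"
  have DU: "D \<subseteq> U" unfolding D_def by blast
  have neg: "- X \<in> D \<longleftrightarrow> \<theta> X < \<theta>' X" if "X \<in> U" for X
    using validD(2)[OF v(1) that] validD(2)[OF v(2) that] U_compl[OF that] by (simp add: D_def)
  have DD: "X \<inter> Y \<noteq> {} \<and> - X \<inter> - Y \<noteq> {}" if X: "X \<in> D" and Y: "Y \<in> D" for X Y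
  proof
    have XU: "X \<in> U" and YU: "Y \<in> U" using X Y DU by blast+
    have XY: "Y \<noteq> - X" using neg[OF XU] X Y unfolding D_def by auto
    have px: "\<theta> X > 0" "\<theta> Y > 0" using X Y validD(1)[OF v(2) XU] validD(1)[OF v(2) YU] unfolding D_def by auto
    show "X \<inter> Y \<noteq> {}" by (rule validD(4)[OF v(1) XU YU px XY])
    have "\<theta> X \<le> 1" "\<theta> Y \<le> 1" using validD(3)[OF v(1) XU] validD(3)[OF v(1) YU] .
    then have pn: "\<theta>' (- X) > 0" "\<theta>' (- Y) > 0"
      using validD(2)[OF v(2) XU] validD(2)[OF v(2) YU] X Y unfolding D_def by auto
    show "- X \<inter> - Y \<noteq> {}" by (rule validD(4)[OF v(2) U_compl[OF XU] U_compl[OF YU] pn]) (use XY in auto)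
  qed
  have "D = {}"
  proof (rule ccontr)
    assume "D \<noteq> {}"
    then obtain X0 where X0: "X0 \<in> D" by blast
    obtain j where j: "\<And>X. X \<in> D \<Longrightarrow> Inr j \<in> X" using chain_colours(2)[OF DU DD] by blast
    have "uminus ` D \<subseteq> U" using DU U_compl by blast
    moreover have "X \<inter> Y \<noteq> {} \<and> - X \<inter> - Y \<noteq> {}" if "X \<in> uminus ` D" "Y \<in> uminus ` D" for X Y
      using that DD by auto
    ultimately have "\<exists>k. \<forall>X\<in>uminus ` D. Inr k \<in> X" by (rule chain_colours(2))
    then obtain k where k0: "\<forall>X\<in>uminus ` D. Inr k \<in> X" by blast
    have k: "Inr k \<notin> X" if "X \<in> D" for X using bspec[OF k0 imageI[OF that]] by simp
    let ?t = "\<lambda>r X. w X * (\<theta> X - \<theta>' X) * of_bool (Inr r \<in> X)"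
    have diff: "Phi \<theta> $ r - Phi \<theta>' $ r = (\<Sum>X\<in>U. ?t r X) / 2" for r
      unfolding Phi_def by (simp add: algebra_simps sum_subtractf diff_divide_distrib)
    have "0 < (\<Sum>X\<in>U. ?t j X)"
    proof (rule sum_pos2[of U X0])
      show "finite U" by (rule finite_subset[of _ UNIV]) auto
      show "X0 \<in> U" using X0 DU by blast
      show "0 < ?t j X0" using X0 j[OF X0] w_pos DU unfolding D_def by auto
      fix X assume X: "X \<in> U"
      show "0 \<le> ?t j X"
      proof (cases "\<theta> X < \<theta>' X")
        case True
        then have "Inr j \<in> - X" using j neg[OF X] by blast
        then show ?thesis by simp
      next
        case False
        then show ?thesis using w_pos[OF X] by simp
      qed
    qed
    moreover have "(\<Sum>X\<in>U. ?t k X) \<le> 0"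
    proof (rule sum_nonpos)
      fix X assume X: "X \<in> U"
      show "?t k X \<le> 0"
      proof (cases "X \<in> D")
        case True
        then show ?thesis using k by simp
      next
        case False
        then have "\<theta> X - \<theta>' X \<le> 0" using X unfolding D_def by simp
        then show ?thesis using w_pos[OF X] by (simp add: mult_nonneg_nonpos)
      qed
    qed
    moreover have "Phi \<theta> $ j - Phi \<theta>' $ j = Phi \<theta> $ k - Phi \<theta>' $ k"
      using s unfolding span_one_iff by auto
    ultimately show False unfolding diff by simp
  qed
  then have "\<not> \<theta>' X < \<theta> X" "\<not> \<theta> X < \<theta>' X" using X neg[OF X] unfolding D_def by blast+
  then show ?thesis by simp
qed

text \<open>The coefficients \<open>c'\<close> are chosen so that the slack of column
  \<open>i\<close> in coordinate \<open>r\<close> is the distance of the point from the path between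
  \<open>i\<close> and \<open>r'\<close>: sides containing both labels count with the part not
  passed, sides containing neither with the part passed, sides separating them not at all. For every
  \<open>r\<close> some such path runs through the point.\<close>

lemma trop_hull_I:
  assumes v: "valid \<theta>"
  shows "Phi \<theta> + c *\<^sub>R 1 \<in> trop_hull A"
proof -
  define K where "K = (\<Sum>X\<in>U. w X * \<theta> X) / 2"
  define c' where "c' = (\<lambda>i. c - f i - (\<Sum>X\<in>U. w X * \<theta> X * of_bool (Inl i \<in> X)) / 2 + K)"
  let ?s = "\<lambda>i r X. w X * (of_bool (Inl i \<in> X) * of_bool (Inr r \<in> X) - \<theta> X * of_bool (Inr r \<in> X) - \<theta> X * of_bool (Inl i \<in> X) + \<theta> X)"
  have slack: "c' i + column i A $ r - (Phi \<theta> + c *\<^sub>R 1) $ r = (\<Sum>X\<in>U. ?s i r X) / 2" for i r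
    unfolding c'_def K_def column_A Phi_def
    by (simp add: algebra_simps sum.distrib sum_subtractf add_divide_distrib diff_divide_distrib)
  have s0: "?s i r X \<ge> 0" if "X \<in> U" for i r X
    using w_pos[OF that] validD(1,3)[OF v that] by (cases "Inl i \<in> X"; cases "Inr r \<in> X") simp_all
  have eq: "\<exists>i. \<forall>X\<in>U. ?s i r X = 0" for r
  proof -
    \<comment> \<open>The sides passed at least partially that do not contain \<open>r'\<close> form
      a chain; an unprimed label in all of them lies beyond the point as seen from
      \<open>r'\<close>.\<close>
    let ?F = "{X \<in> U. \<theta> X > 0 \<and> Inr r \<notin> X}"
    have "\<exists>i. \<forall>X\<in>?F. Inl i \<in> X"
    proof (rule chain_colours(1))
      show "?F \<subseteq> U" by blast
      fix X Y assume X: "X \<in> ?F" and Y: "Y \<in> ?F"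
      have "Y \<noteq> - X" using X Y by auto
      then have "X \<inter> Y \<noteq> {}" using validD(4)[OF v, of X Y] X Y by simp
      then show "X \<inter> Y \<noteq> {} \<and> - X \<inter> - Y \<noteq> {}" using X Y by blast
    qed
    then obtain i where i: "\<And>X. X \<in> U \<Longrightarrow> \<theta> X > 0 \<Longrightarrow> Inr r \<notin> X \<Longrightarrow> Inl i \<in> X" by blast
    have "?s i r X = 0" if X: "X \<in> U" for X
    proof (cases "Inl i \<in> X"; cases "Inr r \<in> X")
      assume ir: "Inl i \<in> X" "Inr r \<in> X"
      then have "\<not> \<theta> (- X) > 0" using i[OF U_compl[OF X]] by auto
      then have "\<theta> X = 1" using validD(2,3)[OF v X] by simp
      then show ?thesis using ir by simp
    next
      assume ir: "Inl i \<notin> X" "Inr r \<notin> X"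
      then have "\<theta> X = 0" using i[OF X] validD(1)[OF v X] by force
      then show ?thesis using ir by simp
    qed simp_all
    then show ?thesis by blast
  qed
  have "(Phi \<theta> + c *\<^sub>R 1) $ r = Min (range (\<lambda>i. c' i + column i A $ r))" for r
  proof (rule Min_eqI[symmetric])
    show "finite (range (\<lambda>i. c' i + column i A $ r))" by simp
    fix y assume "y \<in> range (\<lambda>i. c' i + column i A $ r)"
    then obtain i where y: "y = c' i + column i A $ r" by blast
    have "0 \<le> (\<Sum>X\<in>U. ?s i r X)" by (rule sum_nonneg) (rule s0)
    then show "(Phi \<theta> + c *\<^sub>R 1) $ r \<le> y" using slack[of i r] unfolding y by linarith
  next
    obtain i where "\<forall>X\<in>U. ?s i r X = 0" using eq by blast
    then have "(\<Sum>X\<in>U. ?s i r X) = 0" by (intro sum.neutral)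
    then have "(Phi \<theta> + c *\<^sub>R 1) $ r = c' i + column i A $ r" using slack[of i r] by linarith
    then show "(Phi \<theta> + c *\<^sub>R 1) $ r \<in> range (\<lambda>i. c' i + column i A $ r)" by blast
  qed
  then show ?thesis unfolding trop_hull_def by blast
qed

text \<open>A point of the hull is described by its slacks with respect to the columns. A side is passed
  entirely iff it contains a pair of labels with slack \<open>0\<close>.\<close>
context
  fixes x :: "real ^ 'n" and s :: "'n \<Rightarrow> 'n \<Rightarrow> real" and a :: "'n \<Rightarrow> real"
  assumes s: "\<And>i r. s i r = a i + column i A $ r - x $ r" and s_nonneg: "\<And>i r. s i r \<ge> 0"
    and tight_row: "\<And>i. \<exists>r. s i r = 0" and tight_column: "\<And>r. \<exists>i. s i r = 0"
begin

definition C :: "('n + 'n) set set" where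
  "C = {X \<in> U. \<exists>i r. s i r = 0 \<and> Inl i \<in> X \<and> Inr r \<in> X}"

text \<open>Here and in \<open>\<beta>\<close> the shifts of rows and columns are corrected so that
  a side in \<open>C\<close> contributes to a slack only if it contains neither of the two labels;
  see \<open>slack_eq\<close>.\<close>

definition \<alpha> :: "'n \<Rightarrow> real" where
  "\<alpha> i = a i + f i + (\<Sum>X\<in>C. w X * (of_bool (Inl i \<in> X) - 1)) / 2"

definition \<beta> :: "'n \<Rightarrow> real" where
  "\<beta> r = x $ r - g r - (\<Sum>X\<in>C. w X * of_bool (Inr r \<in> X)) / 2"

text \<open>The sides whose split is crossed by every tight pair. They turn out to be at most the
  two sides of one split, and the point then lies on its edge.\<close>

definition free :: "('n + 'n) set set" where
  "free = {X \<in> U. X \<notin> C \<and> - X \<notin> C}"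

lemma C_U: "X \<in> C \<Longrightarrow> X \<in> U" unfolding C_def by blast

lemma C_I: "X \<in> U \<Longrightarrow> s i r = 0 \<Longrightarrow> Inl i \<in> X \<Longrightarrow> Inr r \<in> X \<Longrightarrow> X \<in> C" unfolding C_def by blast

lemma C_E: "X \<in> C \<Longrightarrow> \<exists>i r. s i r = 0 \<and> Inl i \<in> X \<and> Inr r \<in> X" unfolding C_def by blast

text \<open>Tight pairs in \<open>X\<close> and in its complement form a quadruple separated by
  \<open>X\<close>, so their cross difference is positive; on the other hand it is minus the sum of
  the two mixed slacks.\<close>

lemma C_compl: assumes "X \<in> C" shows "- X \<notin> C"
proof
  assume "- X \<in> C"
  then obtain k q where kq: "s k q = 0" "Inl k \<notin> X" "Inr q \<notin> X" using C_E by blast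
  obtain i r where ir: "s i r = 0" "Inl i \<in> X" "Inr r \<in> X" using C_E[OF assms] by blast
  have sep: "separates X i r k q" using ir kq by (simp add: separates_def)
  have "w X \<le> (\<Sum>Y | Y \<in> U \<and> separates Y i r k q. w Y)"
    by (rule member_le_sum) (use C_U[OF assms] sep w_pos in \<open>auto intro: less_imp_le\<close>)
  then have pos: "cross (gram U w) i r k q > 0"
    using cross_gram_separated[OF side_system w C_U[OF assms] sep] w_pos[OF C_U[OF assms]] by simp
  have "cross (gram U w) i r k q = s i r + s k q - s i q - s k r"
    unfolding cross_def s column_A gram_def by simp
  then show False using pos ir(1) kq(1) s_nonneg[of i q] s_nonneg[of k r] by simp
qed

lemma free_cross: assumes "X \<in> free" "s i r = 0" shows "Inl i \<in> X \<longleftrightarrow> Inr r \<notin> X"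
  using C_I[of X i r] C_I[of "- X" i r] U_compl[of X] assms unfolding free_def by auto

text \<open>Every label has a tight partner on the other side of each free split. The partner of a
  label in \<open>Y\<close> outside \<open>X\<close> would be in \<open>X\<close> but not in
  \<open>Y\<close>.\<close>

lemma free_subset_eq: assumes X: "X \<in> free" and Y: "Y \<in> free" and XY: "X \<subseteq> Y" shows "X = Y"
proof (rule ccontr)
  assume "X \<noteq> Y"
  then obtain l where l: "l \<in> Y" "l \<notin> X" using XY by blast
  show False
  proof (cases l)
    case (Inl i)
    obtain r where r: "s i r = 0" using tight_row by blast
    show False using free_cross[OF X r] free_cross[OF Y r] l XY unfolding Inl by blast
  next
    case (Inr r)
    obtain i where i: "s i r = 0" using tight_column by blast
    show False using free_cross[OF X i] free_cross[OF Y i] l XY unfolding Inr by blast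
  qed
qed

lemma free_compl: "X \<in> free \<Longrightarrow> - X \<in> free"
  unfolding free_def using U_compl by auto

lemma free_unique: assumes X: "X \<in> free" and Y: "Y \<in> free" shows "Y = X \<or> Y = - X"
proof -
  have "compat X Y" using U_compat X Y unfolding free_def by blast
  then consider "X \<subseteq> - Y" | "X \<subseteq> Y" | "Y \<subseteq> X" | "- X \<subseteq> Y" unfolding compat_def by blast
  then show ?thesis
  proof cases
    case 1 from free_subset_eq[OF X free_compl[OF Y] 1] show ?thesis by simp
  next
    case 2 from free_subset_eq[OF X Y 2] show ?thesis by simp
  next
    case 3 from free_subset_eq[OF Y X 3] show ?thesis by simp
  next
    case 4 from free_subset_eq[OF free_compl[OF X] Y 4] show ?thesis by simp
  qed
qed

lemma C_Int: assumes X: "X \<in> C" and Y: "Y \<in> C \<or> Y \<in> free" shows "Y \<inter> X \<noteq> {}"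
proof
  assume e: "Y \<inter> X = {}"
  obtain i r where ir: "s i r = 0" "Inl i \<in> X" "Inr r \<in> X" using C_E[OF X] by blast
  have YU: "Y \<in> U" using Y C_U unfolding free_def by blast
  have "- Y \<in> C" using C_I[OF U_compl[OF YU] ir(1)] ir e by blast
  then show False using Y C_compl[of Y] unfolding free_def by blast
qed

lemma sum_U_split: "(\<Sum>X\<in>U. h X) = (\<Sum>X\<in>C. h X + h (- X)) + (\<Sum>X\<in>free. h X)" for h :: "('n + 'n) set \<Rightarrow> real"
proof -
  have fin: "finite S" for S :: "('n + 'n) set set" by (rule finite_subset[of _ UNIV]) auto
  have "U = (C \<union> uminus ` C) \<union> free"
  proof (intro equalityI subsetI)
    fix X assume "X \<in> U"
    then show "X \<in> (C \<union> uminus ` C) \<union> free" unfolding free_def by (cases "- X \<in> C") (auto intro: image_eqI[of _ _ "- X"])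
  next
    fix X assume "X \<in> (C \<union> uminus ` C) \<union> free"
    then show "X \<in> U" using C_U U_compl unfolding free_def by auto
  qed
  then have "(\<Sum>X\<in>U. h X) = (\<Sum>X\<in>(C \<union> uminus ` C) \<union> free. h X)" by (rule arg_cong)
  also have "\<dots> = (\<Sum>X\<in>C \<union> uminus ` C. h X) + (\<Sum>X\<in>free. h X)"
    by (rule sum.union_disjoint[OF fin fin]) (use C_compl in \<open>auto simp: free_def\<close>)
  also have "(\<Sum>X\<in>C \<union> uminus ` C. h X) = (\<Sum>X\<in>C. h X) + (\<Sum>X\<in>uminus ` C. h X)"
    by (rule sum.union_disjoint[OF fin fin]) (use C_compl in auto)
  also have "(\<Sum>X\<in>uminus ` C. h X) = (\<Sum>X\<in>C. h (- X))" by (subst sum.reindex) (simp_all add: inj_on_def)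
  finally show ?thesis by (simp add: sum.distrib)
qed

lemma slack_eq:
  "s i r = \<alpha> i - \<beta> r + (\<Sum>X\<in>C. w X * of_bool (Inl i \<notin> X \<and> Inr r \<notin> X))
     + (\<Sum>X\<in>free. w X * of_bool (Inl i \<in> X \<and> Inr r \<in> X)) / 2"
proof -
  let ?b = "\<lambda>X. w X * of_bool (Inl i \<in> X) * of_bool (Inr r \<in> X)"
  have "(\<Sum>X\<in>U. ?b X) - (\<Sum>X\<in>C. w X * (of_bool (Inl i \<in> X) - 1)) - (\<Sum>X\<in>C. w X * of_bool (Inr r \<in> X))
    = (\<Sum>X\<in>C. ?b X + ?b (- X) - w X * (of_bool (Inl i \<in> X) - 1) - w X * of_bool (Inr r \<in> X)) + (\<Sum>X\<in>free. ?b X)"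
    using sum_U_split[of ?b] by (simp only: sum_subtractf)
  also have "(\<Sum>X\<in>C. ?b X + ?b (- X) - w X * (of_bool (Inl i \<in> X) - 1) - w X * of_bool (Inr r \<in> X))
    = (\<Sum>X\<in>C. 2 * (w X * of_bool (Inl i \<notin> X \<and> Inr r \<notin> X)))"
    by (rule sum.cong) (auto simp: w_compl[OF C_U] of_bool_def)
  also have "\<dots> = 2 * (\<Sum>X\<in>C. w X * of_bool (Inl i \<notin> X \<and> Inr r \<notin> X))" by (rule sum_distrib_left[symmetric])
  also have "(\<Sum>X\<in>free. ?b X) = (\<Sum>X\<in>free. w X * of_bool (Inl i \<in> X \<and> Inr r \<in> X))"
    by (rule sum.cong) (auto simp: of_bool_def)
  finally show ?thesis
    using s[of i r] column_A[of i r] unfolding \<alpha>_def \<beta>_def by linarith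
qed

lemma slack_good:
  assumes "\<And>X. X \<in> C \<Longrightarrow> Inl i \<in> X \<or> Inr r \<in> X"
  shows "s i r = \<alpha> i - \<beta> r + (\<Sum>X\<in>free. w X * of_bool (Inl i \<in> X \<and> Inr r \<in> X)) / 2"
proof -
  have "(\<Sum>X\<in>C. w X * of_bool (Inl i \<notin> X \<and> Inr r \<notin> X)) = 0"
    by (rule sum.neutral) (use assms in auto)
  then show ?thesis using slack_eq[of i r] by linarith
qed

lemma tight_good: assumes "s i r = 0" "X \<in> C" shows "Inl i \<in> X \<or> Inr r \<in> X"
  using C_I[OF U_compl[OF C_U[OF assms(2)]] assms(1)] C_compl[OF assms(2)] by blast

lemma tight_eq: assumes "s i r = 0" shows "\<alpha> i = \<beta> r"
proof -
  have "(\<Sum>X\<in>free. w X * of_bool (Inl i \<in> X \<and> Inr r \<in> X)) = 0"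
    by (rule sum.neutral) (use free_cross[OF _ assms] in auto)
  then show ?thesis using slack_good[of i r] tight_good[OF assms] assms by simp
qed

text \<open>Let \<open>q\<close> be tight for \<open>k\<close>. If every side in \<open>C\<close>
  contains \<open>i\<close> or \<open>q'\<close>, the slack gives the inequality. Otherwise a
  minimal side of \<open>C\<close> avoiding both contains a tight pair \<open>p\<close>,
  \<open>r\<close>, and by minimality the pairs \<open>i\<close>, \<open>r\<close> and
  \<open>p\<close>, \<open>q\<close> are no longer obstructed; the inequalities chain through the
  tight pair.\<close>

lemma constant_without_free:
  assumes free: "free = {}" shows "\<alpha> k \<le> \<alpha> i"
proof -
  have good: "\<beta> r \<le> \<alpha> i" if "\<And>X. X \<in> C \<Longrightarrow> Inl i \<in> X \<or> Inr r \<in> X" for i r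
    using slack_good[OF that] s_nonneg[of i r] unfolding free by simp
  obtain q where q: "s k q = 0" using tight_row by blast
  let ?B = "{X \<in> C. Inl i \<notin> X \<and> Inr q \<notin> X}"
  show ?thesis
  proof (cases "?B = {}")
    case True
    then show ?thesis using good[of i q] tight_eq[OF q] by auto
  next
    case False
    obtain X where X: "X \<in> ?B" and min: "\<forall>Y\<in>?B. Y \<le> X \<longrightarrow> X = Y"
      using finite_has_minimal[OF _ False] by auto
    then have XC: "X \<in> C" and iq: "Inl i \<notin> X" "Inr q \<notin> X" by auto
    obtain p r where pr: "s p r = 0" "Inl p \<in> X" "Inr r \<in> X" using C_E[OF XC] by blast
    have key: False if Y: "Y \<in> C" and l: "l \<in> X" "l \<notin> Y" and m: "m \<notin> X" "m \<notin> Y" and iqm: "m = Inl i \<or> m = Inr q" for Y l m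
    proof -
      have "Y \<subseteq> X"
        using U_compat[OF C_U[OF XC] C_U[OF Y]] C_Int[OF XC, of Y] Y l m unfolding compat_def by blast
      then have "Y \<in> ?B" using Y iq by blast
      then show False using min \<open>Y \<subseteq> X\<close> l by blast
    qed
    have "\<beta> r \<le> \<alpha> i" by (rule good) (use key[of _ "Inr r" "Inl i"] pr(3) iq(1) in blast)
    moreover have "\<beta> q \<le> \<alpha> p" by (rule good) (use key[of _ "Inl p" "Inr q"] pr(2) iq(2) in blast)
    ultimately show ?thesis using tight_eq[OF pr(1)] tight_eq[OF q] by simp
  qed
qed

lemma crossing_good:
  assumes X: "X \<in> free" and i: "Inl i \<in> X" and q: "Inr q \<notin> X" and Y: "Y \<in> C"
  shows "Inl i \<in> Y \<or> Inr q \<in> Y"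
proof (rule ccontr)
  assume n: "\<not> ?thesis"
  have XU: "X \<in> U" using X unfolding free_def by blast
  have "X \<inter> Y \<noteq> {}" "- X \<inter> Y \<noteq> {}" using C_Int[OF Y] X free_compl[OF X] by blast+
  then show False using U_compat[OF XU C_U[OF Y]] n i q unfolding compat_def by blast
qed

text \<open>For an unprimed label in \<open>X\<close> and a primed one outside, the slack is just
  the difference of the two values, so it has a sign. The tight pairs, which all cross
  \<open>X\<close>, turn the inequalities into equations.\<close>

lemma free_values:
  assumes X: "X \<in> free"
  shows "\<exists>\<kappa>. (\<forall>i. Inl i \<in> X \<longrightarrow> \<alpha> i = \<kappa>) \<and> (\<forall>r. Inr r \<notin> X \<longrightarrow> \<beta> r = \<kappa>)"
proof -
  have ge: "\<beta> q \<le> \<alpha> i" if i: "Inl i \<in> X" and q: "Inr q \<notin> X" for i q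
  proof -
    have "Y = X \<or> Y = - X" if "Y \<in> free" for Y by (rule free_unique[OF X that])
    then have "(\<Sum>Y\<in>free. w Y * of_bool (Inl i \<in> Y \<and> Inr q \<in> Y)) = 0"
      by (intro sum.neutral ballI) (use i q in force)
    then show ?thesis using slack_good[OF crossing_good[OF X i q]] s_nonneg[of i q] by simp
  qed
  have eq: "\<alpha> i = \<alpha> k" if i: "Inl i \<in> X" and k: "Inl k \<in> X" for i k
  proof -
    obtain q where q: "s k q = 0" using tight_row by blast
    obtain r where r: "s i r = 0" using tight_row by blast
    have "Inr q \<notin> X" "Inr r \<notin> X" using free_cross[OF X q] free_cross[OF X r] i k by blast+
    then show ?thesis using ge[OF i, of q] ge[OF k, of r] tight_eq[OF q] tight_eq[OF r] by simp
  qed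
  have "X \<in> U" using X unfolding free_def by blast
  then obtain i0 where i0: "Inl i0 \<in> X" using U_bicoloured unfolding bicoloured_def by blast
  have "\<beta> r = \<alpha> i0" if "Inr r \<notin> X" for r
  proof -
    obtain i where i: "s i r = 0" using tight_column by blast
    then show ?thesis using tight_eq[OF i] eq[OF _ i0, of i] free_cross[OF X i] that by simp
  qed
  then show ?thesis using eq[OF _ i0] by blast
qed

text \<open>For the pair of \<open>sharp_pair\<close> no side in \<open>C\<close> avoids both
  labels, so its slack contains half the weight of \<open>X\<close> and nothing else besides the two
  values.\<close>

lemma free_sharp:
  assumes X: "X \<in> free"
  shows "\<exists>i r. Inl i \<in> X \<and> Inr r \<in> X \<and> \<beta> r \<le> \<alpha> i + w X / 2"
proof -
  have XU: "X \<in> U" using X unfolding free_def by blast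
  obtain i r where ir: "Inl i \<in> X" "Inr r \<in> X" and sh: "\<forall>Y\<in>U. Y \<subset> X \<longrightarrow> \<not> (Inl i \<in> Y \<and> Inr r \<in> Y)"
    using sharp_pair[OF side_system XU] by blast
  have good: "Inl i \<in> Y \<or> Inr r \<in> Y" if Y: "Y \<in> C" for Y
  proof (rule ccontr)
    assume n: "\<not> ?thesis"
    have ne: "X \<inter> Y \<noteq> {}" "- X \<inter> Y \<noteq> {}" using C_Int[OF Y] X free_compl[OF X] by blast+
    then have "- Y \<subseteq> X" using U_compat[OF XU C_U[OF Y]] n ir unfolding compat_def by blast
    then have "- Y \<subset> X" using ne(1) by blast
    then show False using sh U_compl[OF C_U[OF Y]] n by blast
  qed
  have "free = {X, - X}" using free_unique[OF X] X free_compl[OF X] by blast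
  moreover have "X \<noteq> - X" using ir by blast
  ultimately have "(\<Sum>Y\<in>free. w Y * of_bool (Inl i \<in> Y \<and> Inr r \<in> Y)) = w X" using ir by simp
  then show ?thesis using slack_good[OF good] s_nonneg[of i r] ir by (intro exI[of _ i] exI[of _ r]) simp
qed

lemma hull_point: "\<exists>\<theta> c. valid \<theta> \<and> x = Phi \<theta> + c *\<^sub>R 1"
proof -
  have CC: "- X \<in> C \<longleftrightarrow> X \<notin> C" if "X \<in> U" "X \<notin> free" for X
    using that C_compl unfolding free_def by auto
  obtain \<theta> c where v: "valid \<theta>" and \<theta>: "\<And>X. X \<in> C \<Longrightarrow> \<theta> X = 1"
    and b: "\<And>r. \<beta> r = c + (\<Sum>X\<in>free. w X * \<theta> X * of_bool (Inr r \<in> X)) / 2"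
  proof (cases "free = {}")
    case True
    obtain i :: 'n where True by blast
    have "\<beta> r = \<alpha> i" for r
    proof -
      obtain k where "s k r = 0" using tight_column by blast
      then show ?thesis using tight_eq[of k r] constant_without_free[OF True, of i k] constant_without_free[OF True, of k i] by simp
    qed
    moreover have "valid (\<lambda>X. of_bool (X \<in> C))"
      unfolding valid_def using CC C_Int True by (auto simp: Int_commute)
    ultimately show thesis using that[of "\<lambda>X. of_bool (X \<in> C)" "\<alpha> i"] True by simp
  next
    case False
    then obtain X where X: "X \<in> free" by blast
    have XU: "X \<in> U" "- X \<in> U" using X U_compl unfolding free_def by blast+
    have X0: "X \<noteq> - X" by (rule not_self_compl[OF U_W[OF XU(1)]])
    have fr: "free = {X, - X}" using free_unique[OF X] X free_compl[OF X] by blast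
    have nC: "X \<notin> C" "- X \<notin> C" using X unfolding free_def by blast+
    obtain \<kappa>1 where \<kappa>1: "\<And>i. Inl i \<in> X \<Longrightarrow> \<alpha> i = \<kappa>1" "\<And>r. Inr r \<notin> X \<Longrightarrow> \<beta> r = \<kappa>1" using free_values[OF X] by blast
    obtain \<kappa>2 where \<kappa>2: "\<And>i. Inl i \<notin> X \<Longrightarrow> \<alpha> i = \<kappa>2" "\<And>r. Inr r \<in> X \<Longrightarrow> \<beta> r = \<kappa>2" using free_values[OF free_compl[OF X]] by auto
    have le: "\<kappa>2 \<le> \<kappa>1 + w X / 2" using free_sharp[OF X] \<kappa>1(1) \<kappa>2(2) by auto
    have ge: "\<kappa>1 \<le> \<kappa>2 + w X / 2" using free_sharp[OF free_compl[OF X]] \<kappa>2(1) \<kappa>1(2) w_compl[OF XU(1)] by auto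
    have wX: "w X > 0" by (rule w_pos[OF XU(1)])
    \<comment> \<open>The difference of the constants on the two halves of the tree fixes the
      position on the edge of \<open>X\<close>. By \<open>free_sharp\<close>, for \<open>X\<close>
      and for its complement, it is at most half the weight in absolute value, so the position is
      between 0 and 1.\<close>
    define t where "t = 1 / 2 + (\<kappa>2 - \<kappa>1) / w X"
    have "\<kappa>2 - \<kappa>1 \<le> (1 / 2) * w X" "- (1 / 2) * w X \<le> \<kappa>2 - \<kappa>1" using le ge by simp_all
    from pos_divide_le_eq[OF wX, THEN iffD2, OF this(1)] pos_le_divide_eq[OF wX, THEN iffD2, OF this(2)]
    have t: "0 \<le> t" "t \<le> 1" unfolding t_def by linarith+
    have tw: "w X * t = w X / 2 + (\<kappa>2 - \<kappa>1)" unfolding t_def using wX by (simp add: field_simps)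
    define \<theta> where "\<theta> = (\<lambda>Y. if Y = X then t else if Y = - X then 1 - t else of_bool (Y \<in> C))"
    have \<theta>X: "\<theta> X = t" "\<theta> (- X) = 1 - t" using X0 unfolding \<theta>_def by auto
    have \<theta>C: "\<theta> Y = of_bool (Y \<in> C)" if "Y \<notin> free" for Y using that unfolding \<theta>_def fr by simp
    have "valid \<theta>"
      unfolding valid_def
    proof (intro conjI ballI impI)
      fix Y assume Y: "Y \<in> U"
      show "0 \<le> \<theta> Y" unfolding \<theta>_def using t by simp
      show "\<theta> (- Y) = 1 - \<theta> Y"
      proof (cases "Y \<in> free")
        case True
        then show ?thesis using fr \<theta>X by auto
      next
        case False
        then have "- Y \<notin> free" using free_compl[of "- Y"] by auto
        then show ?thesis using \<theta>C False CC[OF Y False] by simp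
      qed
      fix Z assume Z: "Z \<in> U" and pos: "\<theta> Y > 0" "\<theta> Z > 0" and ne: "Z \<noteq> - Y"
      have "Q \<in> free \<or> Q \<in> C" if Q: "\<theta> Q > 0" for Q
      proof (cases "Q \<in> free")
        case False
        then show ?thesis using \<theta>C[OF False] Q by (cases "Q \<in> C") simp_all
      qed simp
      from this[OF pos(1)] this[OF pos(2)]
      show "Y \<inter> Z \<noteq> {}"
        using C_Int[of Z Y] C_Int[of Y Z] free_unique[of Y Z] ne W_nonempty[OF U_W[OF Y]] by blast
    qed
    moreover have "\<theta> Y = 1" if "Y \<in> C" for Y using that \<theta>C[of Y] unfolding free_def by simp
    moreover have "\<beta> r = (\<kappa>1 - w X / 2 * (1 - t)) + (\<Sum>Y\<in>free. w Y * \<theta> Y * of_bool (Inr r \<in> Y)) / 2" for r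
    proof -
      have "(\<Sum>Y\<in>free. w Y * \<theta> Y * of_bool (Inr r \<in> Y)) = w X * (if Inr r \<in> X then t else 1 - t)"
        unfolding fr using X0 \<theta>X w_compl[OF XU(1)] by simp
      then show ?thesis using \<kappa>1(2)[of r] \<kappa>2(2)[of r] tw by (simp add: field_simps)
    qed
    ultimately show thesis using that[of \<theta> "\<kappa>1 - w X / 2 * (1 - t)"] by blast
  qed
  have \<theta>0: "\<theta> (- X) = 0" if "X \<in> C" for X using validD(2)[OF v C_U[OF that]] \<theta>[OF that] by simp
  have *: "x $ r = (Phi \<theta> + c *\<^sub>R 1) $ r" for r
  proof -
    have "(\<Sum>X\<in>U. w X * \<theta> X * of_bool (Inr r \<in> X)) =
      (\<Sum>X\<in>C. w X * of_bool (Inr r \<in> X)) + (\<Sum>X\<in>free. w X * \<theta> X * of_bool (Inr r \<in> X))"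
      unfolding sum_U_split by (simp add: \<theta> \<theta>0 cong: sum.cong)
    then show ?thesis using b[of r] unfolding \<beta>_def Phi_def by (simp add: add_divide_distrib)
  qed
  have "x = Phi \<theta> + c *\<^sub>R 1" by (rule vec_eq_iff[THEN iffD2], rule allI, rule *)
  then show ?thesis using v by blast
qed

end

lemma trop_hull_D:
  assumes "x \<in> trop_hull A" shows "\<exists>\<theta> c. valid \<theta> \<and> x = Phi \<theta> + c *\<^sub>R 1"
proof -
  obtain c where c: "\<And>r. x $ r = Min (range (\<lambda>i. c i + column i A $ r))" using assms unfolding trop_hull_def by blast
  \<comment> \<open>The least shift that keeps column \<open>i\<close> above \<open>x\<close>, so
    that every column becomes tight somewhere. It is at most \<open>c i\<close>; hence in every
    coordinate the column that attained the minimum is still tight.\<close>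
  define a where "a = (\<lambda>i. Max (range (\<lambda>r. x $ r - column i A $ r)))"
  have le: "x $ r - column i A $ r \<le> a i" for i r unfolding a_def by (rule Max_ge) auto
  have ac: "a i \<le> c i" for i
    unfolding a_def
  proof (rule Max.boundedI)
    fix y assume "y \<in> range (\<lambda>r. x $ r - column i A $ r)"
    then obtain r where y: "y = x $ r - column i A $ r" by blast
    have "x $ r \<le> c i + column i A $ r" unfolding c by (rule Min_le) auto
    then show "y \<le> c i" unfolding y by simp
  qed auto
  show ?thesis
  proof (rule hull_point[of "\<lambda>i r. a i + column i A $ r - x $ r" a x])
    show "a i + column i A $ r - x $ r = a i + column i A $ r - x $ r" for i r ..
    show "0 \<le> a i + column i A $ r - x $ r" for i r using le[of r i] by simp
    show "\<exists>r. a i + column i A $ r - x $ r = 0" for i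
    proof -
      have "a i \<in> range (\<lambda>r. x $ r - column i A $ r)" unfolding a_def by (rule Max_in) auto
      then obtain r where "a i = x $ r - column i A $ r" by blast
      then show ?thesis by (intro exI[of _ r]) simp
    qed
    show "\<exists>i. a i + column i A $ r - x $ r = 0" for r
    proof -
      have "x $ r \<in> range (\<lambda>i. c i + column i A $ r)" unfolding c by (rule Min_in) auto
      then obtain i where "x $ r = c i + column i A $ r" by blast
      then show ?thesis using le[of r i] ac[of i] by (intro exI[of _ i]) simp
    qed
  qed
qed

lemma trop_hull_eq: "trop_hull A = {Phi \<theta> + c *\<^sub>R 1 | \<theta> c. valid \<theta>}"
proof (intro equalityI subsetI)
  fix x assume "x \<in> trop_hull A"
  from trop_hull_D[OF this] show "x \<in> {Phi \<theta> + c *\<^sub>R 1 | \<theta> c. valid \<theta>}" by blast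
next
  fix x assume "x \<in> {Phi \<theta> + c *\<^sub>R 1 | \<theta> c. valid \<theta>}"
  then show "x \<in> trop_hull A" using trop_hull_I by blast
qed

end

section \<open>Primitive directions and cells\<close>

definition dvec :: "'n set \<Rightarrow> nat ^ 'n" where "dvec J = (\<chi> r. if r \<in> J then 1 else 0)"

lemma real_vec_dvec: "real_vec (dvec J) $ r = of_bool (r \<in> J)"
  by (simp add: real_vec_def dvec_def)

lemma dvec_inject: "dvec J = dvec J' \<Longrightarrow> J = J'"
  unfolding dvec_def vec_eq_iff by (auto split: if_splits)

lemma dvec_primitive:
  fixes J :: "'n::finite set"
  assumes "J \<noteq> {}" "- J \<noteq> {}"
  shows "(\<exists>r. dvec J $ r = 0) \<and> Gcd (range (\<lambda>r. dvec J $ r)) = 1"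
proof
  show "\<exists>r. dvec J $ r = 0" using assms(2) by (auto simp: dvec_def)
  have "1 \<in> range (\<lambda>r. dvec J $ r)" using assms(1) by (auto simp: dvec_def image_iff)
  then have "Gcd (range (\<lambda>r. dvec J $ r)) dvd 1" by (rule Gcd_dvd)
  then show "Gcd (range (\<lambda>r. dvec J $ r)) = 1" by simp
qed

text \<open>The vanishing minimal entry forces the constant to be 0. Then all nonzero entries are
  equal, and their common value divides the gcd.\<close>

lemma primitive_direction:
  fixes u :: "nat ^ 'n::finite"
  assumes u: "\<exists>r. u $ r = 0" "Gcd (range (\<lambda>r. u $ r)) = 1" and J: "J \<noteq> {}" "- J \<noteq> {}"
    and eq: "\<And>r. real (u $ r) = m * of_bool (r \<in> J) + c" and m: "m > 0"
  shows "u = dvec J"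
proof -
  obtain q where q: "q \<notin> J" using J by blast
  obtain j where j: "j \<in> J" using J by blast
  obtain z where z: "u $ z = 0" using u(1) by blast
  have c0: "c \<ge> 0" using eq[of q] q by simp
  have "c = 0" using eq[of z] z m c0 by (cases "z \<in> J") simp_all
  then have v: "u $ r = (if r \<in> J then u $ j else 0)" for r using eq[of r] eq[of j] j by auto
  have "u $ j dvd x" if xr: "x \<in> range (\<lambda>r. u $ r)" for x
  proof -
    obtain r where "x = u $ r" using xr by blast
    then show ?thesis using v[of r] by simp
  qed
  then have "u $ j dvd Gcd (range (\<lambda>r. u $ r))" by (rule Gcd_greatest)
  then have "u $ j = 1" using u(2) by simp
  then show ?thesis unfolding vec_eq_iff dvec_def using v by simp
qed

lemma trop_dist_commute: "trop_dist x y = trop_dist y x"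
proof -
  let ?S = "range (\<lambda>i. x $ i - y $ i)"
  have S: "range (\<lambda>i. y $ i - x $ i) = uminus ` ?S" by (auto simp: image_image)
  have fin: "finite ?S" "?S \<noteq> {}" by auto
  have "Max (uminus ` ?S) = - Min ?S"
    by (rule Max_eqI) (use fin Min_in[OF fin] in \<open>auto intro: Min_le\<close>)
  moreover have "Min (uminus ` ?S) = - Max ?S"
    by (rule Min_eqI) (use fin Max_in[OF fin] in \<open>auto intro: Max_ge\<close>)
  ultimately show ?thesis unfolding trop_dist_def S by linarith
qed

lemma cell_iff: "q \<in> cell \<phi> s \<longleftrightarrow> (\<exists>x\<in>convex hull (\<phi> ` s). q - x \<in> span {1})"
proof
  assume "q \<in> cell \<phi> s"
  then obtain x y where "q = x + y" "x \<in> convex hull (\<phi> ` s)" "y \<in> span {1}" unfolding cell_def by blast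
  then show "\<exists>x\<in>convex hull (\<phi> ` s). q - x \<in> span {1}" by (intro bexI[of _ x]) simp_all
next
  assume "\<exists>x\<in>convex hull (\<phi> ` s). q - x \<in> span {1}"
  then obtain x where "x \<in> convex hull (\<phi> ` s)" "q - x \<in> span {1}" by blast
  moreover have "q = x + (q - x)" by simp
  ultimately show "q \<in> cell \<phi> s" unfolding cell_def by blast
qed

lemma cell_single: "q \<in> cell \<phi> {v} \<longleftrightarrow> q - \<phi> v \<in> span {1}"
  unfolding cell_iff by simp

lemma cell_empty [simp]: "cell \<phi> {} = {}"
  unfolding cell_def by simp

lemma cell_segment: "q \<in> cell \<phi> {u, v} \<longleftrightarrow> (\<exists>t. 0 \<le> t \<and> t \<le> 1 \<and> q - ((1 - t) *\<^sub>R \<phi> u + t *\<^sub>R \<phi> v) \<in> span {1})"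
  unfolding cell_iff by (auto simp: segment_convex_hull[symmetric] closed_segment_def)

lemma cell_subset_mono: "s \<subseteq> s' \<Longrightarrow> cell \<phi> s \<subseteq> cell \<phi> s'"
  unfolding cell_def using hull_mono[of "\<phi> ` s" "\<phi> ` s'" convex] by blast

lemma cell_sums: "cell \<phi> s = (\<Union>x\<in>convex hull (\<phi> ` s). \<Union>y\<in>span {1}. {x + y})"
  unfolding cell_def by blast

lemma connected_cell: "connected (cell \<phi> s)"
  unfolding cell_sums by (intro convex_connected convex_sums convex_convex_hull subspace_imp_convex subspace_span)

lemma closed_segment_strip: "closed {q :: real ^ 'n. \<exists>t. a \<le> t \<and> t \<le> b \<and> q - (x + t *\<^sub>R d) \<in> span {1}}" for a b :: real
proof -
  have eq: "{q :: real ^ 'n. \<exists>t. a \<le> t \<and> t \<le> b \<and> q - (x + t *\<^sub>R d) \<in> span {1}} =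
    (\<Union>z\<in>(\<lambda>t. x + t *\<^sub>R d) ` {a..b}. \<Union>y\<in>span {1}. {z + y})" (is "?L = ?R")
  proof (intro equalityI subsetI)
    fix q assume "q \<in> ?L"
    then obtain t where t: "t \<in> {a..b}" "q - (x + t *\<^sub>R d) \<in> span {1}" by auto
    moreover have "q = (x + t *\<^sub>R d) + (q - (x + t *\<^sub>R d))" by simp
    ultimately show "q \<in> ?R" by blast
  qed auto
  have "compact ((\<lambda>t. x + t *\<^sub>R d) ` {a..b})" by (intro compact_continuous_image continuous_intros) simp
  moreover have "closed (span {1 :: real ^ 'n})" by (rule closed_subspace[OF subspace_span])
  ultimately show ?thesis unfolding eq by (rule compact_closed_sums)
qed

lemma closed_cell_finite: "finite s \<Longrightarrow> closed (cell \<phi> s)"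
  unfolding cell_sums
  by (intro compact_closed_sums finite_imp_compact_convex_hull closed_subspace subspace_span) simp

section \<open>The cells of the constructed tree and the hull\<close>

context weighted_tree
begin

definition \<phi> :: "nat \<Rightarrow> real ^ 'n" where "\<phi> n = Phi (ind (dec n))"

text \<open>The point of the edge of \<open>X\<close> at the fraction \<open>t\<close> of the way
  from \<open>v\<close> to its other end.\<close>

definition pt :: "('n + 'n) set set \<Rightarrow> ('n + 'n) set \<Rightarrow> real \<Rightarrow> ('n + 'n) set \<Rightarrow> real" where
  "pt v X t Y = (1 - t) * ind v Y + t * ind (flip X v) Y"

text \<open>For n at least 2 there are at least four labels. So the complements of any two labels
  meet, and there is an inner vertex even if \<open>U\<close> is empty.\<close>

lemma third_label: "\<exists>m :: 'n + 'n. m \<noteq> k \<and> m \<noteq> l"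
proof -
  have "card (UNIV :: ('n + 'n) set) > 2" using card2 by simp
  then have "card {k, l} < card (UNIV :: ('n + 'n) set)" by (rule le_less_trans[rotated]) (simp add: card_insert_if)
  then have "{k, l} \<noteq> UNIV" by auto
  then show ?thesis by blast
qed

lemma ind_01: "ind v X = 0 \<or> ind v X = 1" by (simp add: ind_def)

lemma ind_compl: "vertex v \<Longrightarrow> X \<in> U \<Longrightarrow> ind v (- X) = 1 - ind v X"
  unfolding ind_def using vertex_compl[of v X] U_W[of X] by simp

lemma ind_valid: assumes v: "vertex v" shows "valid (ind v)"
  unfolding valid_def
proof (intro conjI ballI impI)
  fix X assume X: "X \<in> U"
  show "0 \<le> ind v X" by (simp add: ind_def)
  show "ind v (- X) = 1 - ind v X" by (rule ind_compl[OF v X])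
  fix Y assume "0 < ind v X" "0 < ind v Y"
  then have "X \<in> v" "Y \<in> v" unfolding ind_def by (simp_all split: if_splits)
  then show "X \<inter> Y \<noteq> {}" by (rule vertex_Int[OF v])
qed

lemma pt_valid:
  assumes v: "vertex v" "minimal X v" and t: "0 \<le> t" "t \<le> 1" shows "valid (pt v X t)"
  unfolding valid_def
proof (intro conjI ballI impI)
  note v' = vertex_flip[OF v]
  fix Y assume Y: "Y \<in> U"
  show "0 \<le> pt v X t Y" using t unfolding pt_def ind_def by simp
  show "pt v X t (- Y) = 1 - pt v X t Y"
    unfolding pt_def ind_compl[OF v(1) Y] ind_compl[OF v' Y] by (simp add: algebra_simps)
  fix Z assume pos: "0 < pt v X t Y" "0 < pt v X t Z" and ne: "Z \<noteq> - Y"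
  have *: "Q \<in> v \<or> Q \<in> flip X v" if "0 < pt v X t Q" for Q
  proof (rule ccontr)
    assume "\<not> ?thesis"
    then have "pt v X t Q = 0" by (simp add: pt_def ind_def)
    then show False using that by simp
  qed
  consider "Y \<in> v" "Z \<in> v" | "Y \<in> flip X v" "Z \<in> flip X v" | "Y \<in> v" "Y \<notin> flip X v" "Z \<in> flip X v" "Z \<notin> v"
    | "Z \<in> v" "Z \<notin> flip X v" "Y \<in> flip X v" "Y \<notin> v" using *[OF pos(1)] *[OF pos(2)] by blast
  then show "Y \<inter> Z \<noteq> {}"
  proof cases
    case 1 then show ?thesis by (rule vertex_Int[OF v(1)])
  next
    case 2 then show ?thesis by (rule vertex_Int[OF v'])
  next
    case 3 then have "Y = X" "Z = - X" unfolding flip_def by blast+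
    then show ?thesis using ne by simp
  next
    case 4 then have "Z = X" "Y = - X" unfolding flip_def by blast+
    then show ?thesis using ne by simp
  qed
qed

lemma pt_0: "pt v X 0 = ind v" and pt_1: "pt v X 1 = ind (flip X v)"
  unfolding pt_def by auto

lemma pt_flip: assumes "vertex v" "minimal X v" shows "pt (flip X v) (- X) (1 - t) = pt v X t"
  unfolding pt_def using flip_flip[OF assms(1) minimalD(1)[OF assms(2)]] by (simp add: fun_eq_iff)

lemma pt_self: assumes v: "vertex v" "minimal X v" shows "pt v X t X = 1 - t"
  using minimalD(1)[OF v(2)] mem_flip[OF v(1) minimalD(1)[OF v(2)], of X] unfolding pt_def ind_def by simp

lemma pt_other: assumes v: "vertex v" "minimal X v" and Y: "Y \<noteq> X" "Y \<noteq> - X" shows "pt v X t Y = ind v Y"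
proof -
  have "ind (flip X v) Y = ind v Y" unfolding ind_def using mem_flip[OF v(1) minimalD(1)[OF v(2)], of Y] Y by simp
  then show ?thesis unfolding pt_def by (simp add: algebra_simps)
qed

text \<open>An inner vertex chooses the complement of every single label, so only its choices in
  \<open>U\<close> are at its disposal.\<close>

lemma inner_ext: assumes v: "inner v" and v': "inner v'" and eq: "\<And>X. X \<in> U \<Longrightarrow> ind v X = ind v' X" shows "v = v'"
proof (rule vertex_eqI)
  show V: "vertex v" "vertex v'" using v v' by (simp_all add: inner_def)
  show "v \<subseteq> v'"
  proof
    fix X assume X: "X \<in> v"
    have "X \<in> W" by (rule vertex_subset[OF V(1) X])
    then show "X \<in> v'"
    proof (rule W_cases)
      assume "X \<in> U" then show ?thesis using eq[of X] X unfolding ind_def by (simp split: if_splits)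
    next
      fix l assume "X = {l}" then show ?thesis using X v unfolding inner_def by blast
    next
      fix l assume "X = - {l}" then show ?thesis using vertex_compl[OF V(2) single_W[of l]] v' unfolding inner_def by simp
    qed
  qed
qed

lemma inner_of_sides:
  assumes S: "S \<subseteq> U" "\<And>Y. Y \<in> U \<Longrightarrow> Y \<in> S \<or> - Y \<in> S" "\<And>Y Z. Y \<in> S \<Longrightarrow> Z \<in> S \<Longrightarrow> Y \<inter> Z \<noteq> {}"
  shows "inner (S \<union> range (\<lambda>l. - {l}))" (is "inner ?v")
proof -
  have u: "Y \<inter> - {l} \<noteq> {}" if "Y \<in> U" for Y l
    using U_bicoloured[OF that] unfolding bicoloured_def by (cases l) auto
  have "vertex ?v"
  proof (rule vertexI)
    show "?v \<subseteq> W" using S(1) unfolding W_def by blast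
    show "X \<in> ?v \<or> - X \<in> ?v" if "X \<in> W" for X
      using that by (rule W_cases) (use S(2) in auto)
    fix X Y assume X: "X \<in> ?v" and Y: "Y \<in> ?v"
    consider "X \<in> S" "Y \<in> S" | l where "X \<in> S" "Y = - {l}" | l where "Y \<in> S" "X = - {l}" | k l where "X = - {k}" "Y = - {l}"
      using X Y by blast
    then show "X \<inter> Y \<noteq> {}"
    proof cases
      case 1 then show ?thesis by (rule S(3))
    next
      case 2 then show ?thesis using u[of X] S(1) by blast
    next
      case 3 then show ?thesis using u[of Y] S(1) by blast
    next
      case (4 k l)
      then show ?thesis using third_label[of k l] by blast
    qed
  qed
  moreover have "{l} \<notin> ?v" for l
  proof
    assume "{l} \<in> ?v"
    then consider "{l} \<in> U" | k where "{l} = - {k}" using S(1) by blast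
    then show False
    proof cases
      case 1 then show ?thesis using U_not_single(1) by blast
    next
      case (2 k) then show ?thesis using third_label[of k l] by blast
    qed
  qed
  ultimately show ?thesis unfolding inner_def by blast
qed

text \<open>At most one split can be passed fractionally: for two of them, validity would make all
  four intersections of their sides nonempty, against compatibility. Without any the point is a
  vertex, with one it is interior to the edge of that split.\<close>

lemma valid_cases:
  assumes \<theta>: "valid \<theta>"
  shows "(\<exists>v. inner v \<and> (\<forall>Y\<in>U. \<theta> Y = ind v Y)) \<or>
    (\<exists>v X t. vertex v \<and> minimal X v \<and> X \<in> U \<and> 0 < t \<and> t < 1 \<and> (\<forall>Y\<in>U. \<theta> Y = pt v X t Y))"
proof (cases "\<exists>X\<in>U. 0 < \<theta> X \<and> \<theta> X < 1")
  case False
  then have 01: "\<theta> Y = 0 \<or> \<theta> Y = 1" if "Y \<in> U" for Y using validD(1,3)[OF \<theta> that] that by force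
  let ?S = "{Y \<in> U. \<theta> Y = 1}"
  have "inner (?S \<union> range (\<lambda>l. - {l}))"
  proof (rule inner_of_sides)
    show "Y \<in> ?S \<or> - Y \<in> ?S" if "Y \<in> U" for Y using 01[OF that] validD(2)[OF \<theta> that] U_compl[OF that] that by auto
    fix Y Z assume Y: "Y \<in> ?S" and Z: "Z \<in> ?S"
    have "Z \<noteq> - Y" using Y Z validD(2)[OF \<theta>, of Y] by auto
    then show "Y \<inter> Z \<noteq> {}" using validD(4)[OF \<theta>, of Y Z] Y Z by simp
  qed blast
  moreover have "\<theta> Y = ind (?S \<union> range (\<lambda>l. - {l})) Y" if "Y \<in> U" for Y
  proof -
    have "Y \<notin> range (\<lambda>l. - {l})" using U_not_single(2)[OF that] by blast
    then show ?thesis using 01[OF that] that unfolding ind_def by auto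
  qed
  ultimately show ?thesis by blast
next
  case True
  then obtain X where X: "X \<in> U" "0 < \<theta> X" "\<theta> X < 1" by blast
  have nX: "0 < \<theta> (- X)" using validD(2)[OF \<theta> X(1)] X by simp
  have 01: "\<theta> Y = 0 \<or> \<theta> Y = 1" if Y: "Y \<in> U" "Y \<noteq> X" "Y \<noteq> - X" for Y
  proof (rule ccontr)
    assume "\<not> ?thesis"
    then have p: "0 < \<theta> Y" "0 < \<theta> (- Y)" using validD(1,3)[OF \<theta> Y(1)] validD(2)[OF \<theta> Y(1)] by auto
    note nY = U_compl[OF Y(1)] and nXU = U_compl[OF X(1)]
    have "X \<inter> Y \<noteq> {}" "X \<inter> - Y \<noteq> {}" "- X \<inter> Y \<noteq> {}" "- X \<inter> - Y \<noteq> {}"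
      using validD(4)[OF \<theta> X(1) Y(1) X(2) p(1)] validD(4)[OF \<theta> X(1) nY X(2) p(2)]
        validD(4)[OF \<theta> nXU Y(1) nX p(1)] validD(4)[OF \<theta> nXU nY nX p(2)] Y by auto
    then show False using U_compat[OF X(1) Y(1)] unfolding compat_def by simp
  qed
  \<comment> \<open>Rounding the fractional value at \<open>X\<close> up to 1 gives the end of the
    edge on the side of \<open>X\<close>; the distance left to it is the fraction
    \<open>1 - \<theta> X\<close>.\<close>
  let ?S = "insert X {Y \<in> U. \<theta> Y = 1}" let ?v = "?S \<union> range (\<lambda>l. - {l})"
  have inn: "inner ?v"
  proof (rule inner_of_sides)
    show "?S \<subseteq> U" using X(1) by blast
    show "Y \<in> ?S \<or> - Y \<in> ?S" if "Y \<in> U" for Y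
    proof (cases "Y = X \<or> Y = - X")
      case False
      then show ?thesis using 01[OF that] validD(2)[OF \<theta> that] U_compl[OF that] that by auto
    qed auto
    fix Y Z assume Y: "Y \<in> ?S" and Z: "Z \<in> ?S"
    have p: "Y \<in> U" "Z \<in> U" "\<theta> Y > 0" "\<theta> Z > 0" using Y Z X by auto
    have "Z \<noteq> - Y" using Y Z validD(2)[OF \<theta> p(1)] X nX p not_self_compl[OF U_W[OF X(1)]] validD(2)[OF \<theta> X(1)] by auto
    then show "Y \<inter> Z \<noteq> {}" by (rule validD(4)[OF \<theta> p])
  qed
  then have v: "vertex ?v" unfolding inner_def by blast
  have m: "minimal X ?v"
    unfolding minimal_def
  proof (intro conjI ballI impI)
    show "X \<in> ?v" by blast
    fix Y assume Y: "Y \<in> ?v" "Y \<subseteq> X"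
    show "Y = X"
    proof (rule ccontr)
      assume "Y \<noteq> X"
      then consider "Y \<in> U" "\<theta> Y = 1" | l where "Y = - {l}" using Y(1) by blast
      then show False
      proof cases
        case 1
        then show False using validD(4)[OF \<theta> U_compl[OF X(1)] 1(1) nX] \<open>Y \<noteq> X\<close> Y(2) by auto
      next
        case (2 l)
        then have "- X \<subseteq> {l}" using Y(2) by blast
        then show False using U_bicoloured[OF U_compl[OF X(1)]] unfolding bicoloured_def by blast
      qed
    qed
  qed
  have eq: "\<theta> Y = pt ?v X (1 - \<theta> X) Y" if Y: "Y \<in> U" for Y
  proof -
    have r: "Y \<notin> range (\<lambda>l. - {l})" using U_not_single(2)[OF Y] by blast
    consider "Y = X" | "Y = - X" | "Y \<noteq> X" "Y \<noteq> - X" by blast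
    then show ?thesis
    proof cases
      case 1 then show ?thesis using pt_self[OF v m] by simp
    next
      case 2
      have "pt ?v X (1 - \<theta> X) (- X) = 1 - pt ?v X (1 - \<theta> X) X"
        by (rule validD(2)[OF pt_valid[OF v m] X(1)]) (use X in simp_all)
      then show ?thesis using 2 pt_self[OF v m] validD(2)[OF \<theta> X(1)] by simp
    next
      case 3
      have "ind ?v Y = of_bool (\<theta> Y = 1)" using 3(1) r Y unfolding ind_def by simp
      then show ?thesis using pt_other[OF v m 3] 01[OF Y 3] by auto
    qed
  qed
  have "0 < 1 - \<theta> X" "1 - \<theta> X < 1" using X by simp_all
  then have "vertex ?v \<and> minimal X ?v \<and> X \<in> U \<and> 0 < 1 - \<theta> X \<and> 1 - \<theta> X < 1 \<and> (\<forall>Y\<in>U. \<theta> Y = pt ?v X (1 - \<theta> X) Y)"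
    by (intro conjI ballI v m X(1) eq)
  then show ?thesis by (intro disjI2 exI)
qed

definition K :: "nat set set" where
  "K = (\<lambda>n. {n}) ` (enc ` {v. inner v}) \<union> {tree_edge X v | X v. vertex v \<and> minimal X v \<and> X \<in> U}"

lemma K_cases:
  assumes "s \<in> K" obtains v where "inner v" "s = {enc v}"
    | X v where "vertex v" "minimal X v" "X \<in> U" "s = tree_edge X v"
  using assms unfolding K_def by blast

lemma cell_vertex: "p \<in> cell \<phi> {enc v} \<longleftrightarrow> (\<exists>c. p = Phi (ind v) + c *\<^sub>R 1)"
  unfolding cell_def \<phi>_def span_singleton by auto

lemma cell_edge: "p \<in> cell \<phi> (tree_edge X v) \<longleftrightarrow> (\<exists>t c. 0 \<le> t \<and> t \<le> 1 \<and> p = Phi (pt v X t) + c *\<^sub>R 1)"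
proof -
  have "convex hull (\<phi> ` tree_edge X v) = {(1 - t) *\<^sub>R Phi (ind v) + t *\<^sub>R Phi (ind (flip X v)) | t. 0 \<le> t \<and> t \<le> 1}"
    unfolding tree_edge_def \<phi>_def by (simp add: segment_convex_hull[symmetric] closed_segment_def)
  also have "\<dots> = {Phi (pt v X t) | t. 0 \<le> t \<and> t \<le> 1}"
    unfolding Phi_affine pt_def[abs_def] ..
  finally show ?thesis unfolding cell_def span_singleton by auto
qed

lemma same_point:
  assumes "valid \<theta>" "valid \<theta>'" "Phi \<theta> + c *\<^sub>R 1 = Phi \<theta>' + c' *\<^sub>R 1" "Y \<in> U" shows "\<theta> Y = \<theta>' Y"
proof (rule Phi_inject[OF assms(1,2) _ assms(4)])
  have "Phi \<theta> - Phi \<theta>' = (c' - c) *\<^sub>R 1" using assms(3) by (simp add: algebra_simps)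
  then show "Phi \<theta> - Phi \<theta>' \<in> span {1}" unfolding span_singleton by blast
qed

lemma vertex_on_edge:
  assumes v': "inner v'" and v: "vertex v" "minimal X v" "X \<in> U" and eq: "\<And>Y. Y \<in> U \<Longrightarrow> ind v' Y = pt v X t Y"
  shows "(t = 0 \<and> v' = v) \<or> (t = 1 \<and> v' = flip X v)"
proof -
  have "ind v' X = 1 - t" using eq[OF v(3)] pt_self[OF v(1,2)] by simp
  then have "t = 0 \<or> t = 1" using ind_01[of v' X] by auto
  then show ?thesis
  proof
    assume t: "t = 0"
    have "v' = v" by (rule inner_ext[OF v' edge_inner(1)[OF v]]) (use eq t pt_0 in simp)
    then show ?thesis using t by simp
  next
    assume t: "t = 1"
    have "v' = flip X v" by (rule inner_ext[OF v' edge_inner(2)[OF v]]) (use eq t pt_1 in simp)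
    then show ?thesis using t by simp
  qed
qed

lemma edge_on_edge:
  assumes v: "vertex v" "minimal X v" "X \<in> U" and v': "vertex v'" "minimal X' v'"
    and t: "0 < t" "t < 1" and eq: "\<And>Y. Y \<in> U \<Longrightarrow> pt v X t Y = pt v' X' t' Y"
  shows "(v' = v \<and> X' = X) \<or> (v' = flip X v \<and> X' = - X)"
proof -
  have "pt v' X' t' X = 1 - t" using eq[OF v(3)] pt_self[OF v(1,2)] by simp
  have "X = X' \<or> X = - X'"
  proof (rule ccontr)
    assume n: "\<not> ?thesis"
    have "pt v' X' t' X = ind v' X" by (rule pt_other[OF v']) (use n in blast)+
    then show False using \<open>pt v' X' t' X = 1 - t\<close> ind_01[of v' X] t by auto
  qed
  then show ?thesis
  proof
    assume "X = X'"
    then show ?thesis using edge_vertex_unique[OF v' v(1)] v(2) by simp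
  next
    assume X: "X = - X'"
    then have "minimal X' (flip X v)" using minimal_flip[OF v(1,2)] by simp
    then show ?thesis using edge_vertex_unique[OF v' vertex_flip[OF v(1,2)]] X by simp
  qed
qed

text \<open>A point of the hull determines its values on \<open>U\<close>. Integral values determine
  the vertex, and a fractional value determines the split and thereby the edge, so a common point of
  two different cells is an end of both.\<close>

lemma cells_Int:
  assumes s: "s \<in> K" and s': "s' \<in> K" and p: "p \<in> cell \<phi> s" "p \<in> cell \<phi> s'"
  shows "p \<in> cell \<phi> (s \<inter> s')"
proof -
  have ve: "p \<in> cell \<phi> (s \<inter> s')"
    if h: "inner v" "s = {enc v}" "s' \<in> K" "p \<in> cell \<phi> s" "p \<in> cell \<phi> s'" for s s' v
    using h(3)
  proof (rule K_cases)
    fix v' assume v': "inner v'" "s' = {enc v'}"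
    obtain c where c: "p = Phi (ind v) + c *\<^sub>R 1" using h(4) unfolding h(2) cell_vertex by blast
    obtain c' where c': "p = Phi (ind v') + c' *\<^sub>R 1" using h(5) unfolding v'(2) cell_vertex by blast
    have V: "vertex v" "vertex v'" using h(1) v'(1) unfolding inner_def by blast+
    have "v = v'" by (rule inner_ext[OF h(1) v'(1)]) (rule same_point[OF ind_valid[OF V(1)] ind_valid[OF V(2)] c[symmetric, THEN trans, OF c']])
    then show ?thesis using h v' by simp
  next
    fix X u assume u: "vertex u" "minimal X u" "X \<in> U" "s' = tree_edge X u"
    obtain c where c: "p = Phi (ind v) + c *\<^sub>R 1" using h(4) unfolding h(2) cell_vertex by blast
    obtain t c' where t: "0 \<le> t" "t \<le> 1" and c': "p = Phi (pt u X t) + c' *\<^sub>R 1" using h(5) unfolding u(4) cell_edge by blast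
    have V: "vertex v" using h(1) unfolding inner_def by blast
    have "(t = 0 \<and> v = u) \<or> (t = 1 \<and> v = flip X u)"
      by (rule vertex_on_edge[OF h(1) u(1,2,3)])
        (rule same_point[OF ind_valid[OF V] pt_valid[OF u(1,2) t] c[symmetric, THEN trans, OF c']])
    then have "s \<inter> s' = s" unfolding h(2) u(4) tree_edge_def by auto
    then show ?thesis using h(4) by simp
  qed
  show ?thesis
    using s
  proof (rule K_cases)
    fix v assume "inner v" "s = {enc v}"
    from ve[OF this s' p] show ?thesis .
  next
    fix X v assume v: "vertex v" "minimal X v" "X \<in> U" "s = tree_edge X v"
    obtain t c where t: "0 \<le> t" "t \<le> 1" and c: "p = Phi (pt v X t) + c *\<^sub>R 1" using p(1) unfolding v(4) cell_edge by blast
    have at_end: "p \<in> cell \<phi> (s \<inter> s')" if u: "inner u" "p \<in> cell \<phi> {enc u}" "enc u \<in> s" for u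
    proof -
      have "{enc u} \<inter> s' \<subseteq> s \<inter> s'" using u(3) by blast
      from cell_subset_mono[OF this] ve[OF u(1) refl s' u(2) p(2)] show ?thesis by blast
    qed
    consider "t = 0" | "t = 1" | "0 < t" "t < 1" using t by linarith
    then show ?thesis
    proof cases
      case 1
      then have "p = Phi (ind v) + c *\<^sub>R 1" using c by (simp add: pt_0)
      then have "p \<in> cell \<phi> {enc v}" unfolding cell_vertex by blast
      then show ?thesis by (rule at_end[OF edge_inner(1)[OF v(1,2,3)]]) (simp add: v(4) tree_edge_def)
    next
      case 2
      then have "p = Phi (ind (flip X v)) + c *\<^sub>R 1" using c by (simp add: pt_1)
      then have "p \<in> cell \<phi> {enc (flip X v)}" unfolding cell_vertex by blast
      then show ?thesis by (rule at_end[OF edge_inner(2)[OF v(1,2,3)]]) (simp add: v(4) tree_edge_def)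
    next
      case 3
      from s' show ?thesis
      proof (rule K_cases)
        fix u assume u: "inner u" "s' = {enc u}"
        from ve[OF u s p(2,1)] show ?thesis by (simp add: Int_commute)
      next
        fix X' v' assume v': "vertex v'" "minimal X' v'" "X' \<in> U" "s' = tree_edge X' v'"
        obtain t' c' where t': "0 \<le> t'" "t' \<le> 1" and c': "p = Phi (pt v' X' t') + c' *\<^sub>R 1" using p(2) unfolding v'(4) cell_edge by blast
        have "(v' = v \<and> X' = X) \<or> (v' = flip X v \<and> X' = - X)"
          by (rule edge_on_edge[OF v(1,2,3) v'(1,2) 3])
            (rule same_point[OF pt_valid[OF v(1,2) t] pt_valid[OF v'(1,2) t'] c[symmetric, THEN trans, OF c']])
        then have "s' = s" using tree_edge_flip[OF v(1,2)] unfolding v(4) v'(4) by auto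
        then show ?thesis using p by simp
      qed
    qed
  qed
qed

lemma hull_cells: "trop_hull A = (\<Union>s\<in>K. cell \<phi> s)"
proof (intro equalityI subsetI)
  fix p assume "p \<in> trop_hull A"
  then obtain \<theta> c where \<theta>: "valid \<theta>" "p = Phi \<theta> + c *\<^sub>R 1" unfolding trop_hull_eq by blast
  from valid_cases[OF \<theta>(1)] show "p \<in> (\<Union>s\<in>K. cell \<phi> s)"
  proof (elim disjE exE conjE)
    fix v assume v: "inner v" "\<forall>Y\<in>U. \<theta> Y = ind v Y"
    then have "p = Phi (ind v) + c *\<^sub>R 1" using \<theta>(2) Phi_cong[of \<theta> "ind v"] by simp
    then have "p \<in> cell \<phi> {enc v}" unfolding cell_vertex by blast
    moreover have "{enc v} \<in> K" using v(1) unfolding K_def by blast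
    ultimately show ?thesis by blast
  next
    fix v X t assume v: "vertex v" "minimal X v" "X \<in> U" "0 < t" "t < 1" "\<forall>Y\<in>U. \<theta> Y = pt v X t Y"
    then have "p = Phi (pt v X t) + c *\<^sub>R 1" using \<theta>(2) Phi_cong[of \<theta> "pt v X t"] by simp
    then have "p \<in> cell \<phi> (tree_edge X v)" unfolding cell_edge using v(4,5) by (intro exI[of _ t] exI[of _ c]) simp
    moreover have "tree_edge X v \<in> K" using v(1,2,3) unfolding K_def by blast
    ultimately show ?thesis by blast
  qed
next
  fix p assume "p \<in> (\<Union>s\<in>K. cell \<phi> s)"
  then obtain s where s: "s \<in> K" "p \<in> cell \<phi> s" by blast
  from s(1) show "p \<in> trop_hull A"
  proof (rule K_cases)
    fix v assume v: "inner v" "s = {enc v}"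
    then have val: "valid (ind v)" by (intro ind_valid) (simp add: inner_def)
    obtain c where "p = Phi (ind v) + c *\<^sub>R 1" using s(2) unfolding v(2) cell_vertex by blast
    then show ?thesis using trop_hull_I[OF val] by simp
  next
    fix X v assume v: "vertex v" "minimal X v" "X \<in> U" "s = tree_edge X v"
    obtain t c where t: "0 \<le> t" "t \<le> 1" "p = Phi (pt v X t) + c *\<^sub>R 1" using s(2) unfolding v(4) cell_edge by blast
    then show ?thesis using trop_hull_I[OF pt_valid[OF v(1,2) t(1,2)]] by simp
  qed
qed

text \<open>Only the choices for \<open>X\<close> and its complement change along the edge. Modulo
  constants the point moves by the weight of \<open>X\<close> in the direction of the primed labels
  outside \<open>X\<close>.\<close>

lemma Phi_pt:
  assumes v: "vertex v" "minimal X v" "X \<in> U"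
  shows "Phi (pt v X t) $ r = Phi (ind v) $ r + t * w X * (of_bool (Inr r \<notin> X) - 1 / 2)"
proof -
  let ?d = "\<lambda>Y. w Y * (ind (flip X v) Y - ind v Y) * of_bool (Inr r \<in> Y)"
  have X0: "X \<noteq> - X" by (rule not_self_compl[OF U_W[OF v(3)]])
  have fin: "finite U" by (rule finite_subset[of _ UNIV]) auto
  have m: "X \<in> v" "- X \<notin> v" "X \<notin> flip X v" "- X \<in> flip X v"
    using minimalD(1)[OF v(2)] vertex_not_compl[OF v(1) minimalD(1)[OF v(2)]] X0 unfolding flip_def by auto
  have "(\<Sum>Y\<in>U. ?d Y) = (\<Sum>Y\<in>{X, - X}. ?d Y)"
  proof (rule sum.mono_neutral_right[OF fin])
    show "{X, - X} \<subseteq> U" using v(3) U_compl by simp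
    show "\<forall>Y\<in>U - {X, - X}. ?d Y = 0"
      using mem_flip[OF v(1) minimalD(1)[OF v(2)]] by (simp add: ind_def)
  qed
  also have "\<dots> = w X * (of_bool (Inr r \<notin> X) - of_bool (Inr r \<in> X))"
    using X0 m w_compl[OF v(3)] by (simp add: ind_def algebra_simps)
  also have "\<dots> = w X * (2 * of_bool (Inr r \<notin> X) - 1)" by simp
  finally have D: "(\<Sum>Y\<in>U. ?d Y) = w X * (2 * of_bool (Inr r \<notin> X) - 1)" .
  have "(\<Sum>Y\<in>U. w Y * pt v X t Y * of_bool (Inr r \<in> Y)) = (\<Sum>Y\<in>U. w Y * ind v Y * of_bool (Inr r \<in> Y)) + t * (\<Sum>Y\<in>U. ?d Y)"
    unfolding sum_distrib_left sum.distrib[symmetric] by (rule sum.cong) (simp_all add: pt_def algebra_simps)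
  then show ?thesis unfolding Phi_def D by (simp add: algebra_simps add_divide_distrib diff_divide_distrib)
qed

section \<open>Directions at the points of the hull\<close>

lemma finite_K: "finite K"
proof -
  have "K \<subseteq> Pow V" unfolding K_def tree_edge_def V_def inner_def using vertex_flip by auto
  then show ?thesis using finite_V by (metis finite_Pow_iff finite_subset)
qed

lemma closed_cell: assumes "s \<in> K" shows "closed (cell \<phi> s)"
proof (rule closed_cell_finite)
  show "finite s" using assms by (rule K_cases) (simp_all add: tree_edge_def)
qed

text \<open>The finitely many closed cells that avoid \<open>p\<close> keep a distance from
  \<open>p\<close>, so a short segment starting at \<open>p\<close> ends in a cell that contains
  \<open>p\<close>.\<close>

lemma direction_in_cell:
  assumes u: "u \<in> directions (trop_hull A) p"
  shows "\<exists>t>0. \<exists>s\<in>K. p \<in> cell \<phi> s \<and> p + t *\<^sub>R real_vec u \<in> cell \<phi> s"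
proof -
  obtain \<epsilon> where \<epsilon>: "\<epsilon> > 0" "\<forall>t\<in>{0..\<epsilon>}. p + t *\<^sub>R real_vec u \<in> trop_hull A" using u unfolding directions_def by blast
  let ?B = "\<Union>s\<in>{s \<in> K. p \<notin> cell \<phi> s}. cell \<phi> s"
  have "closed ?B" by (rule closed_UN) (use finite_K closed_cell in auto)
  then have "open (- ?B)" by (rule open_Compl)
  moreover have "p \<in> - ?B" by simp
  ultimately obtain \<delta> where \<delta>: "\<delta> > 0" "ball p \<delta> \<subseteq> - ?B" by (rule openE)
  define t where "t = min \<epsilon> (\<delta> / (2 * (norm (real_vec u) + 1)))"
  have n: "norm (real_vec u) + 1 > 0" using norm_ge_zero[of "real_vec u"] by linarith
  have t: "0 < t" "t \<le> \<epsilon>" "t \<le> \<delta> / (2 * (norm (real_vec u) + 1))" using \<epsilon>(1) \<delta>(1) n unfolding t_def by simp_all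
  have "t * norm (real_vec u) \<le> t * (norm (real_vec u) + 1)" using t(1) by (simp add: distrib_left)
  also have "\<dots> \<le> \<delta> / (2 * (norm (real_vec u) + 1)) * (norm (real_vec u) + 1)" using t(3) n by (intro mult_right_mono) simp_all
  also have "\<dots> = \<delta> / 2" using n by (simp add: field_simps)
  also have "\<dots> < \<delta>" using \<delta>(1) by simp
  finally have "p + t *\<^sub>R real_vec u \<in> ball p \<delta>" using t(1) by (simp add: dist_norm)
  with \<delta>(2) have "p + t *\<^sub>R real_vec u \<in> - ?B" by (rule subsetD)
  then have nb: "p \<in> cell \<phi> s" if "s \<in> K" "p + t *\<^sub>R real_vec u \<in> cell \<phi> s" for s using that by auto
  have "p + t *\<^sub>R real_vec u \<in> trop_hull A" using \<epsilon>(2) t by simp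
  then obtain s where s: "s \<in> K" "p + t *\<^sub>R real_vec u \<in> cell \<phi> s" unfolding hull_cells by (elim UN_E)
  show ?thesis by (intro exI[of _ t] conjI t(1) bexI[of _ s] nb[OF s] s)
qed

lemma directions_primitive: "u \<in> directions P p \<Longrightarrow> (\<exists>r. u $ r = 0) \<and> Gcd (range (\<lambda>r. u $ r)) = 1"
  unfolding directions_def by blast

lemma primed_sides: assumes "X \<in> U" shows "{r. Inr r \<in> X} \<noteq> {}" "{r. Inr r \<notin> X} \<noteq> {}"
  using U_bicoloured[OF assms] U_bicoloured[OF U_compl[OF assms]] unfolding bicoloured_def by auto

lemma direction_along_edge:
  assumes v: "vertex v" "minimal X v" "X \<in> U" and u: "u \<in> directions P p"
    and p: "p = Phi (pt v X \<tau>) + c *\<^sub>R 1" and t: "t > 0" and q: "p + t *\<^sub>R real_vec u = Phi (pt v X \<tau>') + c' *\<^sub>R 1"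
  shows "(u = dvec {r. Inr r \<notin> X} \<and> \<tau> < \<tau>') \<or> (u = dvec {r. Inr r \<in> X} \<and> \<tau>' < \<tau>)"
proof -
  define m where "m = (\<tau>' - \<tau>) * w X / t"
  define k where "k = ((c' - c) - (\<tau>' - \<tau>) * w X / 2) / t"
  have eq: "real (u $ r) = m * of_bool (Inr r \<notin> X) + k" for r
  proof -
    have "(p + t *\<^sub>R real_vec u) $ r = (Phi (pt v X \<tau>') + c' *\<^sub>R 1) $ r" by (simp only: q)
    then have "t * real (u $ r) = (\<tau>' - \<tau>) * w X * (of_bool (Inr r \<notin> X) - 1 / 2) + (c' - c)"
      unfolding p by (simp add: Phi_pt[OF v] real_vec_def algebra_simps)
    then have "real (u $ r) = ((\<tau>' - \<tau>) * w X * (of_bool (Inr r \<notin> X) - 1 / 2) + (c' - c)) / t"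
      using t by (simp add: field_simps)
    then show ?thesis unfolding m_def k_def by (simp add: add_divide_distrib diff_divide_distrib algebra_simps)
  qed
  note prim = directions_primitive[OF u]
  note J = primed_sides[OF v(3)]
  have nJ: "- {r. Inr r \<notin> X} = {r. Inr r \<in> X}" "- {r. Inr r \<in> X} = {r. Inr r \<notin> X}" by auto
  consider "m > 0" | "m = 0" | "m < 0" by linarith
  then show ?thesis
  proof cases
    case 1
    have "u = dvec {r. Inr r \<notin> X}"
      by (rule primitive_direction[of u _ m k]) (use prim J nJ eq 1 in simp_all)
    moreover have "\<tau> < \<tau>'" using 1 t w_pos[OF v(3)] unfolding m_def by (simp add: zero_less_divide_iff zero_less_mult_iff)
    ultimately show ?thesis by blast
  next
    case 2
    obtain z where "u $ z = 0" using prim by blast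
    then have "u $ r = 0" for r using eq[of r] eq[of z] 2 by simp
    then have "range (\<lambda>r. u $ r) = {0}" by auto
    then show ?thesis using prim by simp
  next
    case 3
    have "u = dvec {r. Inr r \<in> X}"
      by (rule primitive_direction[of u _ "- m" "k + m"]) (use prim J nJ eq 3 in simp_all)
    moreover have "\<tau>' < \<tau>" using 3 t w_pos[OF v(3)] unfolding m_def by (simp add: divide_less_0_iff mult_less_0_iff)
    ultimately show ?thesis by blast
  qed
qed

lemma direction_of_edge:
  assumes v: "vertex v" "minimal X v" "X \<in> U" and \<tau>: "0 \<le> \<tau>" "\<tau> < 1" and p: "p = Phi (pt v X \<tau>) + c *\<^sub>R 1"
  shows "dvec {r. Inr r \<notin> X} \<in> directions (trop_hull A) p"
proof -
  note J = primed_sides[OF v(3)]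
  have nJ: "- {r. Inr r \<notin> X} = {r. Inr r \<in> X}" by auto
  have wX: "w X > 0" by (rule w_pos[OF v(3)])
  have "p + t *\<^sub>R real_vec (dvec {r. Inr r \<notin> X}) \<in> trop_hull A" if t: "t \<in> {0..(1 - \<tau>) * w X}" for t
  proof -
    have "t / w X \<le> 1 - \<tau>" using t wX by (simp add: pos_divide_le_eq)
    then have \<tau>': "0 \<le> \<tau> + t / w X" "\<tau> + t / w X \<le> 1" using \<tau> t wX by simp_all
    have "p + t *\<^sub>R real_vec (dvec {r. Inr r \<notin> X}) = Phi (pt v X (\<tau> + t / w X)) + (c + t / 2) *\<^sub>R 1"
      unfolding vec_eq_iff p using wX by (simp add: Phi_pt[OF v] real_vec_dvec algebra_simps)
    then show ?thesis using trop_hull_I[OF pt_valid[OF v(1,2) \<tau>']] by simp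
  qed
  moreover have "(1 - \<tau>) * w X > 0" using \<tau> wX by simp
  ultimately show ?thesis unfolding directions_def using dvec_primitive[of "{r. Inr r \<notin> X}"] J nJ by blast
qed

lemma directions_vertex:
  assumes v: "inner v" and p: "p = Phi (ind v) + c *\<^sub>R 1"
  shows "directions (trop_hull A) p = (\<lambda>X. dvec {r. Inr r \<notin> X}) ` {X \<in> U. minimal X v}"
proof (intro equalityI subsetI)
  have V: "vertex v" using v unfolding inner_def by blast
  fix u assume u: "u \<in> directions (trop_hull A) p"
  obtain t s where t: "t > 0" and s: "s \<in> K" "p \<in> cell \<phi> s" "p + t *\<^sub>R real_vec u \<in> cell \<phi> s" using direction_in_cell[OF u] by blast
  from s(1) show "u \<in> (\<lambda>X. dvec {r. Inr r \<notin> X}) ` {X \<in> U. minimal X v}"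
  proof (rule K_cases)
    fix v' assume v': "inner v'" "s = {enc v'}"
    obtain c1 where c1: "p = Phi (ind v') + c1 *\<^sub>R 1" using s(2) unfolding v'(2) cell_vertex by blast
    obtain c2 where c2: "p + t *\<^sub>R real_vec u = Phi (ind v') + c2 *\<^sub>R 1" using s(3) unfolding v'(2) cell_vertex by blast
    have e: "t * real (u $ r) = c2 - c1" for r
      using arg_cong[OF c2, of "\<lambda>x. x $ r"] unfolding c1 by (simp add: real_vec_def)
    obtain z where "u $ z = 0" using directions_primitive[OF u] by blast
    then have "u $ r = 0" for r using e[of r] e[of z] t by simp
    then have "range (\<lambda>r. u $ r) = {0}" by auto
    then show ?thesis using directions_primitive[OF u] by simp
  next
    fix X v' assume v': "vertex v'" "minimal X v'" "X \<in> U" "s = tree_edge X v'"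
    obtain \<tau> c1 where \<tau>: "0 \<le> \<tau>" "\<tau> \<le> 1" and c1: "p = Phi (pt v' X \<tau>) + c1 *\<^sub>R 1" using s(2) unfolding v'(4) cell_edge by blast
    obtain \<tau>' c2 where \<tau>': "0 \<le> \<tau>'" "\<tau>' \<le> 1" and c2: "p + t *\<^sub>R real_vec u = Phi (pt v' X \<tau>') + c2 *\<^sub>R 1" using s(3) unfolding v'(4) cell_edge by blast
    have "(\<tau> = 0 \<and> v = v') \<or> (\<tau> = 1 \<and> v = flip X v')"
      by (rule vertex_on_edge[OF v v'(1,2,3)]) (rule same_point[OF ind_valid[OF V] pt_valid[OF v'(1,2) \<tau>] p[symmetric, THEN trans, OF c1]])
    moreover have "(u = dvec {r. Inr r \<notin> X} \<and> \<tau> < \<tau>') \<or> (u = dvec {r. Inr r \<in> X} \<and> \<tau>' < \<tau>)"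
      by (rule direction_along_edge[OF v'(1,2,3) u c1 t c2])
    ultimately consider "v = v'" "u = dvec {r. Inr r \<notin> X}" | "v = flip X v'" "u = dvec {r. Inr r \<in> X}" using \<tau>' by fastforce
    then show ?thesis
    proof cases
      case 1
      then show ?thesis using v' by blast
    next
      case 2
      then have "- X \<in> U \<and> minimal (- X) v" using minimal_flip[OF v'(1,2)] U_compl[OF v'(3)] by simp
      moreover have "u = dvec {r. Inr r \<notin> - X}" using 2(2) by simp
      ultimately show ?thesis by blast
    qed
  qed
next
  have V: "vertex v" using v unfolding inner_def by blast
  fix u assume "u \<in> (\<lambda>X. dvec {r. Inr r \<notin> X}) ` {X \<in> U. minimal X v}"
  then obtain X where X: "X \<in> U" "minimal X v" "u = dvec {r. Inr r \<notin> X}" by blast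
  show "u \<in> directions (trop_hull A) p"
    unfolding X(3) by (rule direction_of_edge[OF V X(2,1), of 0 p c]) (use p pt_0 in simp_all)
qed

lemma directions_edge:
  assumes v: "vertex v" "minimal X v" "X \<in> U" and \<tau>: "0 < \<tau>" "\<tau> < 1" and p: "p = Phi (pt v X \<tau>) + c *\<^sub>R 1"
  shows "directions (trop_hull A) p = {dvec {r. Inr r \<notin> X}, dvec {r. Inr r \<in> X}}"
proof (intro equalityI subsetI)
  have \<tau>01: "0 \<le> \<tau>" "\<tau> \<le> 1" using \<tau> by simp_all
  fix u assume u: "u \<in> directions (trop_hull A) p"
  obtain t s where t: "t > 0" and s: "s \<in> K" "p \<in> cell \<phi> s" "p + t *\<^sub>R real_vec u \<in> cell \<phi> s" using direction_in_cell[OF u] by blast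
  from s(1) show "u \<in> {dvec {r. Inr r \<notin> X}, dvec {r. Inr r \<in> X}}"
  proof (rule K_cases)
    fix v' assume v': "inner v'" "s = {enc v'}"
    have V: "vertex v'" using v'(1) unfolding inner_def by blast
    obtain c1 where c1: "p = Phi (ind v') + c1 *\<^sub>R 1" using s(2) unfolding v'(2) cell_vertex by blast
    have "(\<tau> = 0 \<and> v' = v) \<or> (\<tau> = 1 \<and> v' = flip X v)"
      by (rule vertex_on_edge[OF v'(1) v]) (rule same_point[OF ind_valid[OF V] pt_valid[OF v(1,2) \<tau>01] c1[symmetric, THEN trans, OF p]])
    then show ?thesis using \<tau> by simp
  next
    fix X' v' assume v': "vertex v'" "minimal X' v'" "X' \<in> U" "s = tree_edge X' v'"
    obtain \<tau>1 c1 where \<tau>1: "0 \<le> \<tau>1" "\<tau>1 \<le> 1" and c1: "p = Phi (pt v' X' \<tau>1) + c1 *\<^sub>R 1" using s(2) unfolding v'(4) cell_edge by blast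
    obtain \<tau>2 c2 where c2: "p + t *\<^sub>R real_vec u = Phi (pt v' X' \<tau>2) + c2 *\<^sub>R 1" using s(3) unfolding v'(4) cell_edge by blast
    have "(v' = v \<and> X' = X) \<or> (v' = flip X v \<and> X' = - X)"
      by (rule edge_on_edge[OF v v'(1,2) \<tau>]) (rule same_point[OF pt_valid[OF v(1,2) \<tau>01] pt_valid[OF v'(1,2) \<tau>1] p[symmetric, THEN trans, OF c1]])
    then have "X' = X \<or> X' = - X" by blast
    moreover have "u = dvec {r. Inr r \<notin> X'} \<or> u = dvec {r. Inr r \<in> X'}"
      using direction_along_edge[OF v'(1,2,3) u c1 t c2] by blast
    ultimately show ?thesis by auto
  qed
next
  fix u assume "u \<in> {dvec {r. Inr r \<notin> X}, dvec {r. Inr r \<in> X}}"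
  then consider "u = dvec {r. Inr r \<notin> X}" | "u = dvec {r. Inr r \<notin> - X}" by auto
  then show "u \<in> directions (trop_hull A) p"
  proof cases
    case 1
    show ?thesis unfolding 1 by (rule direction_of_edge[OF v, of \<tau> p c]) (use p \<tau> in simp_all)
  next
    case 2
    show ?thesis unfolding 2
      by (rule direction_of_edge[OF vertex_flip[OF v(1,2)] minimal_flip[OF v(1,2)] U_compl[OF v(3)], of "1 - \<tau>" p c])
        (use p \<tau> pt_flip[OF v(1,2), of \<tau>] in simp_all)
  qed
qed

section \<open>Attachment of the leaves and balancing\<close>

definition attach :: "'n + 'n \<Rightarrow> ('n + 'n) set set" where "attach l = flip {l} (star l)"

lemma minimal_single: "minimal {l} (star l)" by (simp add: minimal_star)

lemma attach_inner: "inner (attach l)"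
  unfolding inner_def
proof (intro conjI allI notI)
  show "vertex (attach l)" unfolding attach_def by (rule vertex_flip[OF star_vertex minimal_single])
  fix k assume "{k} \<in> attach l"
  then consider "{k} = - {l}" | "{k} \<in> star l" "{k} \<noteq> {l}" unfolding attach_def flip_def by blast
  then show False
  proof cases
    case 1 then show False using third_label[of k l] by blast
  next
    case 2 then show False unfolding star_def by blast
  qed
qed

lemma ind_attach: "X \<in> U \<Longrightarrow> ind (attach l) X = of_bool (l \<in> X)"
  using U_not_single[of X l] U_W[of X] unfolding ind_def attach_def flip_def star_def by auto

lemma leaf_edge: assumes "{enc (star l), n} \<in> E" shows "n = enc (attach l)"
proof -
  have "{enc (star l), n} \<in> {e \<in> E. enc (star l) \<in> e}" using assms by blast
  then have "{enc (star l), n} = tree_edge {l} (star l)"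
    unfolding edges_at[OF star_vertex] minimal_star by simp
  moreover have "enc (star l) \<noteq> n" by (rule edge_verts(3)[OF assms])
  ultimately show ?thesis unfolding tree_edge_def attach_def by (auto simp: doubleton_eq_iff)
qed

definition \<rho> :: "'n \<Rightarrow> real ^ 'n" where "\<rho> j = Phi (ind (attach (Inr j)))"

lemma \<rho>_iff: assumes v: "inner v" and p: "p = Phi (ind v) + c *\<^sub>R 1"
  shows "\<rho> j - p \<in> span {1} \<longleftrightarrow> minimal (- {Inr j}) v"
proof -
  have V: "vertex v" "vertex (attach (Inr j))" using v attach_inner unfolding inner_def by blast+
  have "\<rho> j - p \<in> span {1} \<longleftrightarrow> v = attach (Inr j)"
  proof
    assume "\<rho> j - p \<in> span {1}"
    then obtain k where "\<rho> j - p = k *\<^sub>R 1" unfolding span_singleton by blast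
    then have e: "Phi (ind (attach (Inr j))) + 0 *\<^sub>R 1 = Phi (ind v) + (c + k) *\<^sub>R 1"
      unfolding \<rho>_def p by (simp add: algebra_simps)
    have "attach (Inr j) = v"
      by (rule inner_ext[OF attach_inner v]) (rule same_point[OF ind_valid[OF V(2)] ind_valid[OF V(1)] e])
    then show "v = attach (Inr j)" ..
  next
    assume "v = attach (Inr j)"
    then have "\<rho> j - p = (- c) *\<^sub>R 1" unfolding \<rho>_def p by simp
    then show "\<rho> j - p \<in> span {1}" unfolding span_singleton by blast
  qed
  also have "\<dots> \<longleftrightarrow> minimal (- {Inr j}) v"
  proof
    assume "v = attach (Inr j)"
    then show "minimal (- {Inr j}) v" unfolding attach_def using minimal_flip[OF star_vertex minimal_single] by simp
  next
    assume m: "minimal (- {Inr j}) v"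
    have "{Inr j} \<in> flip (- {Inr j}) v" unfolding flip_def by simp
    then have "flip (- {Inr j}) v = star (Inr j)" by (rule singleton_star[OF vertex_flip[OF V(1) m]])
    then show "v = attach (Inr j)" unfolding attach_def using flip_flip[OF V(1) minimalD(1)[OF m]] by simp
  qed
  finally show ?thesis .
qed

text \<open>The complements of the minimal sides are the branches at \<open>v\<close>; different
  edges at a vertex lead to disjoint branches.\<close>

lemma minimal_cover: assumes v: "vertex v" and m: "minimal M v" "minimal N v" "M \<noteq> N" shows "- M \<inter> - N = {}"
proof -
  have "M \<in> W" "N \<in> W" using vertex_subset[OF v] minimalD(1) m by blast+
  moreover have "M \<inter> N \<noteq> {}" using vertex_Int[OF v minimalD(1)[OF m(1)] minimalD(1)[OF m(2)]] .
  moreover have "- M \<inter> N \<noteq> {}" by (rule minimal_Int[OF m(1) minimalD(1)[OF m(2)]]) (use m in simp)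
  moreover have "- N \<inter> M \<noteq> {}" by (rule minimal_Int[OF m(2) minimalD(1)[OF m(1)]]) (use m in simp)
  ultimately show ?thesis using W_compat[of M N] unfolding compat_def by (auto simp: Int_commute)
qed

text \<open>A primed label \<open>r'\<close> lies in exactly one branch at \<open>v\<close>. If an
  internal edge leads there, its direction contributes 1 to coordinate \<open>r\<close>; if the
  branch is the leaf itself, the ray does. So the total is the all-ones vector.\<close>

lemma balanced_vertex:
  assumes v: "inner v" and p: "p = Phi (ind v) + c *\<^sub>R 1"
  shows "(\<Sum>u\<in>directions (trop_hull A) p. real_vec u) + (\<Sum>j | \<rho> j - p \<in> span {1}. axis j 1) = 1"
proof (rule vec_eq_iff[THEN iffD2], rule allI)
  fix r
  have V: "vertex v" using v unfolding inner_def by blast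
  let ?M = "{X \<in> U. minimal X v}"
  have inj: "inj_on (\<lambda>X. dvec {r. Inr r \<notin> X}) ?M"
  proof (rule inj_onI, rule ccontr)
    fix X Y assume X: "X \<in> ?M" and Y: "Y \<in> ?M" and eq: "dvec {r. Inr r \<notin> X} = dvec {r. Inr r \<notin> Y}" and ne: "X \<noteq> Y"
    obtain q where q: "Inr q \<notin> X" using primed_sides(2)[of X] X by blast
    then have "Inr q \<notin> Y" using dvec_inject[OF eq] by blast
    moreover have "- X \<inter> - Y = {}" using minimal_cover[OF V] X Y ne by blast
    ultimately show False using q by blast
  qed
  have 1: "(\<Sum>u\<in>directions (trop_hull A) p. real_vec u) $ r = (\<Sum>X\<in>?M. of_bool (Inr r \<notin> X))"
    unfolding directions_vertex[OF v p] sum.reindex[OF inj] by (simp add: real_vec_dvec)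
  have 2: "(\<Sum>j | \<rho> j - p \<in> span {1}. axis j 1) $ r = (of_bool (minimal (- {Inr r}) v) :: real)"
    unfolding \<rho>_iff[OF v p] by (simp add: axis_def if_distrib sum.delta cong: if_cong)
  obtain M where M: "minimal M v" "M \<subseteq> - {Inr r}"
    using minimal_below[OF V, of "- {Inr r}"] vertex_compl[OF V single_W[of "Inr r"]] v unfolding inner_def by blast
  have other: "Inr r \<in> N" if "minimal N v" "N \<noteq> M" for N
    using minimal_cover[OF V M(1) that(1)] that(2) M(2) by blast
  have fin: "finite ?M" by (rule finite_subset[of _ UNIV]) auto
  have "M \<in> W" by (rule vertex_subset[OF V minimalD(1)[OF M(1)]])
  then have "(\<Sum>X\<in>?M. of_bool (Inr r \<notin> X)) + (of_bool (minimal (- {Inr r}) v) :: real) = 1"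
  proof (rule W_cases)
    assume MU: "M \<in> U"
    have "(\<Sum>X\<in>?M. of_bool (Inr r \<notin> X)) = (\<Sum>X\<in>{M}. of_bool (Inr r \<notin> X) :: real)"
      by (rule sum.mono_neutral_right[OF fin]) (use MU M other in auto)
    moreover have "\<not> minimal (- {Inr r}) v" using other[of "- {Inr r}"] U_not_single(2)[OF MU] by auto
    ultimately show ?thesis using M(2) by auto
  next
    fix l assume "M = {l}"
    then show ?thesis using minimalD(1)[OF M(1)] v unfolding inner_def by blast
  next
    fix l assume l: "M = - {l}"
    then have lr: "M = - {Inr r}" using M(2) by auto
    have "(\<Sum>X\<in>?M. of_bool (Inr r \<notin> X) :: real) = 0"
    proof (rule sum.neutral, rule ballI)
      fix X assume X: "X \<in> ?M"
      then have "X \<noteq> M" using U_not_single(2) lr by blast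
      then show "(of_bool (Inr r \<notin> X) :: real) = 0" using other X by simp
    qed
    then show ?thesis using M(1) lr by simp
  qed
  then show "((\<Sum>u\<in>directions (trop_hull A) p. real_vec u) + (\<Sum>j | \<rho> j - p \<in> span {1}. axis j 1)) $ r = 1 $ r"
    using 1 2 by simp
qed

lemma balanced_edge:
  assumes v: "vertex v" "minimal X v" "X \<in> U" and \<tau>: "0 < \<tau>" "\<tau> < 1" and p: "p = Phi (pt v X \<tau>) + c *\<^sub>R 1"
  shows "(\<Sum>u\<in>directions (trop_hull A) p. real_vec u) + (\<Sum>j | \<rho> j - p \<in> span {1}. axis j 1) = 1"
proof -
  have \<tau>01: "0 \<le> \<tau>" "\<tau> \<le> 1" using \<tau> by simp_all
  have no: "{j. \<rho> j - p \<in> span {1}} = {}"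
  proof (rule ccontr)
    assume "{j. \<rho> j - p \<in> span {1}} \<noteq> {}"
    then obtain j k where "\<rho> j - p = k *\<^sub>R 1" unfolding span_singleton by blast
    then have e: "Phi (ind (attach (Inr j))) + 0 *\<^sub>R 1 = Phi (pt v X \<tau>) + (c + k) *\<^sub>R 1"
      unfolding \<rho>_def p by (simp add: algebra_simps)
    have V: "vertex (attach (Inr j))" using attach_inner unfolding inner_def by blast
    have "(\<tau> = 0 \<and> attach (Inr j) = v) \<or> (\<tau> = 1 \<and> attach (Inr j) = flip X v)"
      by (rule vertex_on_edge[OF attach_inner v]) (rule same_point[OF ind_valid[OF V] pt_valid[OF v(1,2) \<tau>01] e])
    then show False using \<tau> by simp
  qed
  have "dvec {r. Inr r \<notin> X} \<noteq> dvec {r. Inr r \<in> X}"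
    using dvec_inject[of "{r. Inr r \<notin> X}" "{r. Inr r \<in> X}"] by blast
  then have "(\<Sum>u\<in>directions (trop_hull A) p. real_vec u) = real_vec (dvec {r. Inr r \<notin> X}) + real_vec (dvec {r. Inr r \<in> X})"
    unfolding directions_edge[OF v \<tau> p] by simp
  also have "\<dots> = 1" unfolding vec_eq_iff by (simp add: real_vec_dvec)
  finally show ?thesis unfolding no by simp
qed

lemma balanced: "balanced_rays (trop_hull A) \<rho>"
  unfolding balanced_rays_def
proof (intro conjI allI ballI)
  fix j
  have "vertex (attach (Inr j))" using attach_inner unfolding inner_def by blast
  from trop_hull_I[OF ind_valid[OF this], of 0] show "\<rho> j \<in> trop_hull A" unfolding \<rho>_def by simp
next
  fix p assume "p \<in> trop_hull A"
  then obtain \<theta> c where \<theta>: "valid \<theta>" "p = Phi \<theta> + c *\<^sub>R 1" unfolding trop_hull_eq by blast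
  have "(\<Sum>u\<in>directions (trop_hull A) p. real_vec u) + (\<Sum>j | \<rho> j - p \<in> span {1}. axis j 1) = 1"
    using valid_cases[OF \<theta>(1)]
  proof (elim disjE exE conjE)
    fix v assume v: "inner v" "\<forall>Y\<in>U. \<theta> Y = ind v Y"
    then have "p = Phi (ind v) + c *\<^sub>R 1" using \<theta>(2) Phi_cong[of \<theta> "ind v"] by simp
    from balanced_vertex[OF v(1) this] show ?thesis .
  next
    fix v X t assume v: "vertex v" "minimal X v" "X \<in> U" "0 < t" "t < 1" "\<forall>Y\<in>U. \<theta> Y = pt v X t Y"
    then have "p = Phi (pt v X t) + c *\<^sub>R 1" using \<theta>(2) Phi_cong[of \<theta> "pt v X t"] by simp
    from balanced_edge[OF v(1-5) this] show ?thesis .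
  qed
  then show "(\<Sum>u\<in>directions (trop_hull A) p. real_vec u) + (\<Sum>j | \<rho> j - p \<in> span {1}. axis j 1) \<in> span {1}"
    by (simp add: span_base)
qed

text \<open>The minimum and maximum only name the two ends of an unordered edge; the order is
  irrelevant because the distance is symmetric.\<close>

definition edge_len :: "nat set \<Rightarrow> real" where "edge_len e = trop_dist (\<phi> (Min e)) (\<phi> (Max e))"

lemma edge_len: "edge_len {a, b} = trop_dist (\<phi> a) (\<phi> b)"
proof (cases "a \<le> b")
  case True
  then show ?thesis unfolding edge_len_def by simp
next
  case False
  then have "Min {a, b} = b" "Max {a, b} = a" by auto
  then show ?thesis unfolding edge_len_def using trop_dist_commute by metis
qed

theorem is_tree_of_T: "is_tree_of A (T edge_len)"
  unfolding is_tree_of_def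
proof (intro conjI labelled_T exI[of _ \<phi>] exI[of _ \<rho>] balanced)
  have K: "(\<lambda>v. {v}) ` inner_verts (T edge_len) \<union> internal_edges (T edge_len) = K"
    unfolding K_def inner_verts_T internal_edges_T ..
  have "cell \<phi> s \<inter> cell \<phi> s' = cell \<phi> (s \<inter> s')" if "s \<in> K" "s' \<in> K" for s s'
  proof (intro equalityI subsetI)
    fix p assume "p \<in> cell \<phi> s \<inter> cell \<phi> s'"
    then show "p \<in> cell \<phi> (s \<inter> s')" using cells_Int[OF that] by blast
  next
    fix p assume "p \<in> cell \<phi> (s \<inter> s')"
    then show "p \<in> cell \<phi> s \<inter> cell \<phi> s'" using cell_subset_mono[of "s \<inter> s'" s \<phi>] cell_subset_mono[of "s \<inter> s'" s' \<phi>] by blast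
  qed
  then show "embeds_onto (T edge_len) \<phi> (trop_hull A)"
    unfolding embeds_onto_def Let_def K
    by (intro conjI ballI allI impI hull_cells) (simp_all only: T_sel edge_len)
  show "\<forall>i v. {leaf (T edge_len) (Inl i), v} \<in> edges (T edge_len) \<longrightarrow> \<phi> v - column i A \<in> span {1}"
  proof (intro allI impI)
    fix i n assume "{leaf (T edge_len) (Inl i), n} \<in> edges (T edge_len)"
    then have n: "n = enc (attach (Inl i))" using leaf_edge by simp
    have "Phi (ind (attach (Inl i))) = Phi (\<lambda>X. of_bool (Inl i \<in> X))" by (rule Phi_cong) (rule ind_attach)
    then have "\<forall>r. (\<phi> n - column i A) $ r = - f i" unfolding \<phi>_def n by (simp add: Phi_def column_A)
    then show "\<phi> n - column i A \<in> span {1}" unfolding span_one_iff by blast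
  qed
  show "\<forall>j v. {leaf (T edge_len) (Inr j), v} \<in> edges (T edge_len) \<longrightarrow> \<phi> v - \<rho> j \<in> span {1}"
  proof (intro allI impI)
    fix j n assume "{leaf (T edge_len) (Inr j), n} \<in> edges (T edge_len)"
    then have n: "n = enc (attach (Inr j))" using leaf_edge by simp
    show "\<phi> n - \<rho> j \<in> span {1}" unfolding \<phi>_def n \<rho>_def by (simp add: span_zero)
  qed
qed

end

section \<open>Uniqueness of the splits\<close>

context weighted_tree
begin

text \<open>Subtracting two balancing conditions at a point shows that the indicators of the rays
  attached there differ by a constant. At \<open>\<rho> j\<close>, coordinate \<open>j\<close> gives
  the constant -1, so all rays of \<rho> start at this one point. Since each side separates two
  primed labels, \<open>U\<close> is empty, the hull is a single point, and the rays could not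
  differ.\<close>

lemma rays_unique:
  assumes \<rho>': "balanced_rays (trop_hull A) \<rho>'"
  shows "\<rho>' j - \<rho> j \<in> span {1}"
proof (rule ccontr)
  assume ne: "\<rho>' j - \<rho> j \<notin> span {1}"
  then have ne': "\<rho> j - \<rho>' j \<notin> span {1}" using span_neg[of "\<rho> j - \<rho>' j" "{1}"] by auto
  let ?J = "\<lambda>\<sigma> p. {j. \<sigma> j - p \<in> span {1 :: real ^ 'n}}"
  have ax: "(\<Sum>j\<in>J. axis j 1) $ r = (of_bool (r \<in> J) :: real)" for J :: "'n set" and r
    by (simp add: axis_def if_distrib sum.delta cong: if_cong)
  have key: "\<exists>c :: real. \<forall>r. of_bool (r \<in> ?J \<rho>' p) - of_bool (r \<in> ?J \<rho> p) = c" if p: "p \<in> trop_hull A" for p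
  proof -
    let ?S = "\<Sum>u\<in>directions (trop_hull A) p. real_vec u"
    have "?S + (\<Sum>j\<in>?J \<rho>' p. axis j 1) \<in> span {1}" "?S + (\<Sum>j\<in>?J \<rho> p. axis j 1) \<in> span {1}"
      using p \<rho>' balanced unfolding balanced_rays_def by simp_all
    from span_diff[OF this] have "(\<Sum>j\<in>?J \<rho>' p. axis j 1) - (\<Sum>j\<in>?J \<rho> p. axis j 1 :: real ^ 'n) \<in> span {1}" by simp
    then show ?thesis unfolding span_one_iff vector_minus_component ax .
  qed
  have mem: "\<rho>' j \<in> trop_hull A" "\<rho> j \<in> trop_hull A" using \<rho>' balanced unfolding balanced_rays_def by simp_all
  obtain c :: real where c: "\<And>r. of_bool (r \<in> ?J \<rho>' (\<rho> j)) - of_bool (r \<in> ?J \<rho> (\<rho> j)) = c" using key[OF mem(2)] by blast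
  have "c = -1" using c[of j] ne by (simp add: span_zero)
  then have all: "\<rho> r - \<rho> j \<in> span {1}" for r
    using c[of r] by (cases "r \<in> ?J \<rho> (\<rho> j)"; cases "r \<in> ?J \<rho>' (\<rho> j)") simp_all
  have U0: "X \<notin> U" for X
  proof
    assume X: "X \<in> U"
    obtain r where r: "Inr r \<in> X" using primed_sides(1)[OF X] by blast
    obtain q where q: "Inr q \<notin> X" using primed_sides(2)[OF X] by blast
    have "vertex (attach (Inr q))" "vertex (attach (Inr r))" using attach_inner unfolding inner_def by simp_all
    then have V: "valid (ind (attach (Inr r)))" "valid (ind (attach (Inr q)))" by (simp_all add: ind_valid)
    have "(\<rho> r - \<rho> j) - (\<rho> q - \<rho> j) \<in> span {1}" by (rule span_diff[OF all all])
    then have "Phi (ind (attach (Inr r))) - Phi (ind (attach (Inr q))) \<in> span {1}" unfolding \<rho>_def by simp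
    from Phi_inject[OF V this X] show False using r q by (simp add: ind_attach[OF X])
  qed
  then have "U = {}" by blast
  then have P: "Phi \<theta> = Phi \<theta>'" for \<theta> \<theta>' unfolding Phi_def by simp
  obtain \<theta> k where 1: "\<rho>' j = Phi \<theta> + k *\<^sub>R 1" using mem(1) unfolding trop_hull_eq by blast
  have "\<rho>' j - \<rho> j = k *\<^sub>R 1" unfolding 1 \<rho>_def using P[of \<theta> "ind (attach (Inr j))"] by simp
  then have "\<rho>' j - \<rho> j \<in> span {1}" unfolding span_singleton by blast
  then show False using ne by simp
qed

end

section \<open>Splits as components of the hull minus a point\<close>

lemma span_shift: "x \<in> span S \<Longrightarrow> x + y \<in> span S \<longleftrightarrow> y \<in> span (S :: 'a :: real_vector set)"
  by (simp add: span_add_eq)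

text \<open>\<open>P\<close> and \<open>loc\<close> will be data of the matrix alone, the hull and
  the positions of the labels, while \<open>T\<close> and \<phi> vary; whatever is expressed through
  \<open>P\<close> and \<open>loc\<close> is the same for all trees.\<close>

locale embedded_tree = ltree T for T :: "'n::finite mtree" +
  fixes \<phi> :: "nat \<Rightarrow> real ^ 'n" and P :: "(real ^ 'n) set" and loc :: "'n + 'n \<Rightarrow> real ^ 'n"
  assumes embeds: "embeds_onto T \<phi> P"
    and loc: "\<And>l v. {leaf T l, v} \<in> edges T \<Longrightarrow> \<phi> v - loc l \<in> span {1}"
    and card2: "CARD('n) \<ge> 2"
begin

definition cells :: "nat set set" where "cells = (\<lambda>v. {v}) ` inner_verts T \<union> internal_edges T"

lemma cover: "P = (\<Union>s\<in>cells. cell \<phi> s)"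
  and cell_Int: "s \<in> cells \<Longrightarrow> s' \<in> cells \<Longrightarrow> cell \<phi> s \<inter> cell \<phi> s' = cell \<phi> (s \<inter> s')"
  using embeds unfolding embeds_onto_def Let_def cells_def by simp_all

lemma cells_vertex: "v \<in> inner_verts T \<Longrightarrow> {v} \<in> cells" and cells_edge: "e \<in> internal_edges T \<Longrightarrow> e \<in> cells"
  unfolding cells_def by simp_all

lemma cells_cases: assumes "s \<in> cells"
  obtains v where "v \<in> inner_verts T" "s = {v}" | u v where "{u, v} \<in> internal_edges T" "s = {u, v}"
proof -
  from assms consider "s \<in> (\<lambda>v. {v}) ` inner_verts T" | "s \<in> internal_edges T" unfolding cells_def by blast
  then show thesis
  proof cases
    case 1 then show thesis using that(1) by blast
  next
    case 2
    then obtain u v where "s = {u, v}" using edge_obtain[OF internal_edge_edge] by blast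
    then show thesis using 2 that(2) by blast
  qed
qed

lemma inner_edge: assumes "{u, v} \<in> internal_edges T"
  shows "u \<in> inner_verts T" "v \<in> inner_verts T" "u \<noteq> v" "{u, v} \<in> edges T"
  using assms edge_verts(3)[of u v] unfolding internal_edges_def by simp_all

lemma leaf_edge_unique: assumes "{leaf T l, x} \<in> edges T" "{leaf T l, y} \<in> edges T" shows "x = y"
proof -
  have "card {e \<in> edges T. leaf T l \<in> e} = 1" using leaf_verts(2) unfolding degree_in_def .
  then obtain e0 where e0: "{e \<in> edges T. leaf T l \<in> e} = {e0}" by (rule card_1_singletonE)
  have "z \<in> {e0}" if "z \<in> edges T" "leaf T l \<in> z" for z unfolding e0[symmetric] using that by simp
  from this[OF assms(1)] this[OF assms(2)] have "{leaf T l, x} = {leaf T l, y}" by simp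
  then show ?thesis by (auto simp: doubleton_eq_iff)
qed

lemma leaf_side: assumes "{leaf T l, v} \<in> edges T"
  shows "side (edges T) {leaf T l, v} (leaf T l) = {leaf T l}"
proof (intro equalityI subsetI)
  fix x assume "x \<in> side (edges T) {leaf T l, v} (leaf T l)"
  then have "(leaf T l, x) \<in> (adj (edges T - {{leaf T l, v}}))\<^sup>*" unfolding side_def by simp
  then show "x \<in> {leaf T l}"
  proof (cases rule: converse_rtranclE)
    case (step y)
    then have y: "{leaf T l, y} \<in> edges T" "{leaf T l, y} \<noteq> {leaf T l, v}" by (simp_all add: adj_def)
    have "y = v" by (rule leaf_edge_unique[OF y(1) assms])
    then show ?thesis using y(2) by simp
  qed simp
qed (simp add: side_self)

text \<open>Two adjacent leaves would be the whole tree, but there are at least four labels.\<close>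

lemma leaf_neighbour: "\<exists>v. {leaf T l, v} \<in> edges T \<and> v \<in> inner_verts T"
proof -
  have "card {e \<in> edges T. leaf T l \<in> e} = 1" using leaf_verts(2) unfolding degree_in_def .
  then obtain e where e0: "{e \<in> edges T. leaf T l \<in> e} = {e}" by (rule card_1_singletonE)
  have "e \<in> {e \<in> edges T. leaf T l \<in> e}" unfolding e0 by simp
  then have e: "e \<in> edges T" "leaf T l \<in> e" by simp_all
  obtain a b where ab: "e = {a, b}" using edge_obtain[OF e(1)] by blast
  obtain v where v: "e = {leaf T l, v}"
  proof (cases "a = leaf T l")
    case True then show thesis using that[of b] ab by simp
  next
    case False then show thesis using that[of a] ab e(2) by (simp add: insert_commute)
  qed
  have E: "{leaf T l, v} \<in> edges T" using e(1) unfolding v .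
  have "v \<noteq> leaf T k" for k
  proof
    assume k: "v = leaf T k"
    have "card {l, k} \<le> 2" by (cases "l = k") simp_all
    moreover have "card (UNIV :: ('n + 'n) set) = CARD('n) + CARD('n)" by (simp add: card_UNIV_sum)
    ultimately have "{l, k} \<noteq> UNIV" using card2 by auto
    then obtain m where m: "m \<noteq> l" "m \<noteq> k" by blast
    have "leaf T m \<in> {leaf T l}" if "leaf T m \<in> side (edges T) {leaf T l, v} (leaf T l)"
      using that unfolding leaf_side[OF E] .
    moreover have "leaf T m \<in> {leaf T k}" if "leaf T m \<in> side (edges T) {leaf T l, v} v"
    proof -
      have "{leaf T k, leaf T l} \<in> edges T" using E unfolding k by (simp add: insert_commute)
      from leaf_side[OF this] show ?thesis using that unfolding k by (simp add: insert_commute)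
    qed
    ultimately show False using side_cover[OF E leaf_verts(1)[of m]] m leaf_eq_iff by blast
  qed
  moreover have "v \<in> verts T" by (rule edge_verts(2)[OF E])
  ultimately have "v \<in> inner_verts T" unfolding inner_verts_def by blast
  then show ?thesis using E by blast
qed

lemma direction_nonzero: assumes e: "{u, v} \<in> internal_edges T" shows "\<phi> v - \<phi> u \<notin> span {1}"
proof
  assume "\<phi> v - \<phi> u \<in> span {1}"
  then have "\<phi> v \<in> cell \<phi> {u} \<inter> cell \<phi> {v}" unfolding Int_iff cell_single by (simp add: span_zero)
  also have "\<dots> = cell \<phi> ({u} \<inter> {v})" by (rule cell_Int) (use inner_edge[OF e] cells_vertex in simp_all)
  finally show False using inner_edge(3)[OF e] by simp
qed

lemma edge_parameter:
  assumes e: "{u, v} \<in> internal_edges T"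
    and st: "q - (\<phi> u + s *\<^sub>R (\<phi> v - \<phi> u)) \<in> span {1}" "q - (\<phi> u + t *\<^sub>R (\<phi> v - \<phi> u)) \<in> span {1}"
  shows "s = t"
proof (rule ccontr)
  assume "s \<noteq> t"
  have "(t - s) *\<^sub>R (\<phi> v - \<phi> u) \<in> span {1}" using span_diff[OF st] by (simp add: algebra_simps)
  then have "(1 / (t - s)) *\<^sub>R ((t - s) *\<^sub>R (\<phi> v - \<phi> u)) \<in> span {1}" by (rule span_scale)
  then show False using direction_nonzero[OF e] \<open>s \<noteq> t\<close> by simp
qed

lemma cell_edge_iff: "q \<in> cell \<phi> {u, v} \<longleftrightarrow> (\<exists>t. 0 \<le> t \<and> t \<le> 1 \<and> q - (\<phi> u + t *\<^sub>R (\<phi> v - \<phi> u)) \<in> span {1})"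
proof -
  have "(1 - t) *\<^sub>R \<phi> u + t *\<^sub>R \<phi> v = \<phi> u + t *\<^sub>R (\<phi> v - \<phi> u)" for t by (simp add: algebra_simps)
  then show ?thesis unfolding cell_segment by simp
qed

lemma cell_saturated: "q - p \<in> span {1} \<Longrightarrow> q \<in> cell \<phi> s \<longleftrightarrow> p \<in> cell \<phi> s"
proof -
  assume qp: "q - p \<in> span {1}"
  have "q - x \<in> span {1} \<longleftrightarrow> p - x \<in> span {1}" for x
    using span_shift[OF qp, of "p - x"] by simp
  then show ?thesis unfolding cell_iff by simp
qed

context
  fixes e :: "nat set" and u v :: nat and p :: "real ^ 'n" and Q :: "(real ^ 'n) set"
  assumes e: "e = {u, v}" "e \<in> internal_edges T" and p: "p \<in> cell \<phi> e" "p \<notin> cell \<phi> {u}" "p \<notin> cell \<phi> {v}"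
    and Q: "Q = P - {q. q - p \<in> span {1}}"
begin

lemma cell_off: assumes s: "s \<in> cells" "s \<noteq> e" shows "cell \<phi> s \<subseteq> Q"
proof
  fix q assume q: "q \<in> cell \<phi> s"
  have "p \<notin> cell \<phi> s"
  proof
    assume "p \<in> cell \<phi> s"
    then have "p \<in> cell \<phi> (s \<inter> e)" using p(1) cell_Int[OF s(1) cells_edge[OF e(2)]] by blast
    moreover have "s \<inter> e \<subseteq> {u} \<or> s \<inter> e \<subseteq> {v}"
    proof (rule ccontr)
      assume n: "\<not> ?thesis"
      then have sub: "{u, v} \<subseteq> s" unfolding e(1) by auto
      have uv: "u \<noteq> v" using inner_edge(3)[of u v] e by simp
      from s(1) have "s = {u, v}"
        by (rule cells_cases) (use sub uv in auto)
      then show False using s(2) e(1) by simp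
    qed
    ultimately show False using p(2,3) cell_subset_mono[of "s \<inter> e" "{u}" \<phi>] cell_subset_mono[of "s \<inter> e" "{v}" \<phi>] by blast
  qed
  then have "q - p \<notin> span {1}" using q cell_saturated by blast
  moreover have "q \<in> P" unfolding cover using s(1) q by blast
  ultimately show "q \<in> Q" unfolding Q by simp
qed

lemma vertex_off: assumes "x \<in> inner_verts T" shows "cell \<phi> {x} \<subseteq> Q"
proof (rule cell_off[OF cells_vertex[OF assms]])
  show "{x} \<noteq> e" using inner_edge(3)[of u v] e by auto
qed

text \<open>Leaves have no position under the embedding; they are put where their label is located,
  so that leaf edges become connections inside a cell.\<close>

definition place :: "nat \<Rightarrow> real ^ 'n" where
  "place x = (if x \<in> range (leaf T) then loc (inv (leaf T) x) else \<phi> x)"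

lemma place_leaf: "place (leaf T l) = loc l"
proof -
  have "inj (leaf T)" using leaf_eq_iff by (simp add: inj_def)
  then show ?thesis unfolding place_def by simp
qed

lemma place_inner: "x \<in> inner_verts T \<Longrightarrow> place x = \<phi> x"
  unfolding place_def inner_verts_def by simp

lemma loc_cell: assumes "{leaf T l, x} \<in> edges T" shows "loc l \<in> cell \<phi> {x}"
  using loc[OF assms] span_neg[of "\<phi> x - loc l" "{1}"] unfolding cell_single by simp

lemma connected_component_cell:
  assumes "x \<in> cell \<phi> s" "y \<in> cell \<phi> s" "cell \<phi> s \<subseteq> Q" shows "connected_component Q x y"
  unfolding connected_component_def using assms connected_cell by blast

lemma vertex_in_cell: "x \<in> s \<Longrightarrow> \<phi> x \<in> cell \<phi> s"
  unfolding cell_iff by (rule bexI[of _ "\<phi> x"]) (simp_all add: span_zero hull_inc)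

lemma leaf_neighbour_inner: assumes x: "{leaf T l, x} \<in> edges T" shows "x \<in> inner_verts T"
proof -
  obtain y where y: "{leaf T l, y} \<in> edges T" "y \<in> inner_verts T" using leaf_neighbour by blast
  have "x = y" by (rule leaf_edge_unique[OF x y(1)])
  then show ?thesis using y(2) by simp
qed

lemma step_connected:
  assumes xy: "{x, y} \<in> edges T" "{x, y} \<noteq> e" shows "connected_component Q (place x) (place y)"
proof -
  have leafcase: "connected_component Q (loc l) (place z)" if "{leaf T l, z} \<in> edges T" for l z
  proof -
    have z: "z \<in> inner_verts T" by (rule leaf_neighbour_inner[OF that])
    show ?thesis unfolding place_inner[OF z]
      by (rule connected_component_cell[OF loc_cell[OF that] vertex_in_cell vertex_off[OF z]]) simp
  qed
  have xyV: "x \<in> verts T" "y \<in> verts T" using edge_verts[OF xy(1)] by simp_all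
  show ?thesis
  proof (cases "x \<in> range (leaf T) \<or> y \<in> range (leaf T)")
    case True
    then consider l where "x = leaf T l" | l where "y = leaf T l" by blast
    then show ?thesis
    proof cases
      case (1 l)
      show ?thesis using leafcase[of l y] xy(1) unfolding 1 place_leaf .
    next
      case (2 l)
      have "connected_component Q (place y) (place x)" using leafcase[of l x] xy(1) unfolding 2 place_leaf by (simp add: insert_commute)
      then show ?thesis by (rule connected_component_sym)
    qed
  next
    case False
    then have i: "x \<in> inner_verts T" "y \<in> inner_verts T" using xyV unfolding inner_verts_def by simp_all
    then have E: "{x, y} \<in> internal_edges T" using xy(1) unfolding internal_edges_def by simp
    show ?thesis unfolding place_inner[OF i(1)] place_inner[OF i(2)]
      by (rule connected_component_cell[OF vertex_in_cell vertex_in_cell cell_off[OF cells_edge[OF E] xy(2)]]) simp_all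
  qed
qed

lemma same_component_connected:
  assumes "(k, l) \<in> same_component T e" shows "connected_component Q (loc k) (loc l)"
proof -
  have "(leaf T k, leaf T l) \<in> (adj (edges T - {e}))\<^sup>*" using assms unfolding same_component_def adj_def by simp
  then have "connected_component Q (place (leaf T k)) (place (leaf T l))"
  proof (induction rule: rtrancl_induct)
    case base
    obtain x where x: "{leaf T k, x} \<in> edges T" "x \<in> inner_verts T" using leaf_neighbour by blast
    show ?case unfolding place_leaf
      by (rule connected_component_cell[OF loc_cell[OF x(1)] loc_cell[OF x(1)] vertex_off[OF x(2)]])
  next
    case (step x y)
    then have "{x, y} \<in> edges T" "{x, y} \<noteq> e" by (simp_all add: adj_def)
    from step.IH step_connected[OF this] show ?case by (rule connected_component_trans)
  qed
  then show ?thesis unfolding place_leaf .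
qed

lemma leaf_side_cell:
  assumes "a \<in> {u, v}" "leaf T l \<in> side (edges T) e a"
  shows "\<exists>s\<in>cells. s \<subseteq> side (edges T) e a \<and> loc l \<in> cell \<phi> s"
proof -
  obtain x where x: "{leaf T l, x} \<in> edges T" "x \<in> inner_verts T" using leaf_neighbour by blast
  have "leaf T l \<notin> inner_verts T" unfolding inner_verts_def by simp
  then have "{leaf T l, x} \<noteq> e" using e(2) unfolding internal_edges_def by auto
  then have "x \<in> side (edges T) e a" using side_step[OF x(1)] assms(2) by blast
  then show ?thesis by (intro bexI[of _ "{x}"] conjI loc_cell[OF x(1)] cells_vertex[OF x(2)]) simp
qed

text \<open>Cut the hull at \<open>p\<close> into two closed sets, each consisting of the cells on
  one side of \<open>e\<close> and of the adjacent part of \<open>e\<close>. They overlap only in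
  \<open>p\<close> modulo the all-ones vector, which has been removed, so a connected subset of
  \<open>Q\<close> cannot meet both.\<close>

lemma separated:
  assumes k: "leaf T k \<in> side (edges T) e u" and l: "leaf T l \<in> side (edges T) e v"
  shows "\<not> connected_component Q (loc k) (loc l)"
proof
  assume "connected_component Q (loc k) (loc l)"
  then obtain C where C: "connected C" "C \<subseteq> Q" "loc k \<in> C" "loc l \<in> C" unfolding connected_component_def by blast
  have E: "{u, v} \<in> internal_edges T" and Ee: "{u, v} \<in> edges T" using e internal_edge_edge by simp_all
  have uv: "u \<noteq> v" by (rule inner_edge(3)[OF E])
  obtain \<tau> where \<tau>: "0 \<le> \<tau>" "\<tau> \<le> 1" "p - (\<phi> u + \<tau> *\<^sub>R (\<phi> v - \<phi> u)) \<in> span {1}"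
    using p(1) unfolding e(1) cell_edge_iff by blast
  have "\<tau> \<noteq> 0" "\<tau> \<noteq> 1" using \<tau>(3) p(2,3) unfolding cell_single by auto
  then have \<tau>01: "0 < \<tau>" "\<tau> < 1" using \<tau> by simp_all
  \<comment> \<open>\<open>H a b\<close> is the part of \<open>e\<close> with parameters between
    \<open>a\<close> and \<open>b\<close>, and \<open>B a\<close> below collects the cells on the
    side of the vertex \<open>a\<close>; \<tau> is the parameter of \<open>p\<close>.\<close>
  define H where "H = (\<lambda>a b. {q. \<exists>t. a \<le> t \<and> t \<le> b \<and> q - (\<phi> u + t *\<^sub>R (\<phi> v - \<phi> u)) \<in> span {1 :: real ^ 'n}})"
  define S where "S = (\<lambda>a. {s \<in> cells. s \<subseteq> side (edges T) e a})"
  define B where "B = (\<lambda>a. \<Union>s\<in>S a. cell \<phi> s)"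
  have finS: "finite (S a)" for a
  proof (rule finite_subset)
    show "S a \<subseteq> Pow (verts T)"
    proof
      fix s assume "s \<in> S a"
      then have "s \<in> cells" unfolding S_def by simp
      then show "s \<in> Pow (verts T)"
        by (rule cells_cases) (use inner_edge in \<open>auto simp: inner_verts_def\<close>)
    qed
  qed (simp add: finite_V)
  have fincell: "finite s" if "s \<in> cells" for s using that by (rule cells_cases) simp_all
  have clB: "closed (B a)" for a
    unfolding B_def
  proof (rule closed_UN[OF finS], rule ballI)
    fix s assume "s \<in> S a"
    then have "s \<in> cells" unfolding S_def by simp
    then show "closed (cell \<phi> s)" by (rule closed_cell_finite[OF fincell])
  qed
  have clH: "closed (H a b)" for a b unfolding H_def by (rule closed_segment_strip)
  have HE: "q \<in> cell \<phi> e" if q: "q \<in> H a b" and ab: "0 \<le> a" "b \<le> 1" for q a b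
  proof -
    obtain t where "a \<le> t" "t \<le> b" "q - (\<phi> u + t *\<^sub>R (\<phi> v - \<phi> u)) \<in> span {1}" using q unfolding H_def by blast
    then show ?thesis unfolding e(1) cell_edge_iff using ab by (intro exI[of _ t]) simp
  qed
  have vH: "t = 0" if "q \<in> cell \<phi> {u}" "q - (\<phi> u + t *\<^sub>R (\<phi> v - \<phi> u)) \<in> span {1}" for q t
    by (rule edge_parameter[OF E that(2)]) (use that(1) in \<open>simp add: cell_single\<close>)
  have vH1: "t = 1" if "q \<in> cell \<phi> {v}" "q - (\<phi> u + t *\<^sub>R (\<phi> v - \<phi> u)) \<in> span {1}" for q t
    by (rule edge_parameter[OF E that(2)]) (use that(1) in \<open>simp add: cell_single\<close>)
  have disj: "side (edges T) e u \<inter> side (edges T) e v = {}" unfolding e(1) by (rule side_disjoint[OF Ee])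
  have nv: "v \<notin> side (edges T) e u" "u \<notin> side (edges T) e v"
    using disj side_self[of u e] side_self[of v e] by blast+
  have BB: "q \<notin> B v" if qu: "q \<in> B u" for q
  proof
    assume "q \<in> B v"
    then obtain s' where s': "s' \<in> cells" "s' \<subseteq> side (edges T) e v" "q \<in> cell \<phi> s'" unfolding B_def S_def by blast
    obtain s where s: "s \<in> cells" "s \<subseteq> side (edges T) e u" "q \<in> cell \<phi> s" using qu unfolding B_def S_def by blast
    have "q \<in> cell \<phi> (s \<inter> s')" using cell_Int[OF s(1) s'(1)] s(3) s'(3) by blast
    moreover have "s \<inter> s' = {}" using s(2) s'(2) disj by blast
    ultimately show False by simp
  qed
  have BH: False if qu: "q \<in> B u" and q: "q \<in> H \<tau> 1" for q
  proof -
    obtain s where s: "s \<in> cells" "s \<subseteq> side (edges T) e u" "q \<in> cell \<phi> s" using qu unfolding B_def S_def by blast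
    have "q \<in> cell \<phi> e" by (rule HE[OF q]) (use \<tau> in simp_all)
    then have "q \<in> cell \<phi> (s \<inter> e)" using cell_Int[OF s(1) cells_edge[OF e(2)]] s(3) by blast
    moreover have "s \<inter> e \<subseteq> {u}" using s(2) nv(1) unfolding e(1) by blast
    ultimately have qu: "q \<in> cell \<phi> {u}" using cell_subset_mono[of "s \<inter> e" "{u}" \<phi>] by blast
    obtain t where t: "\<tau> \<le> t" "q - (\<phi> u + t *\<^sub>R (\<phi> v - \<phi> u)) \<in> span {1}" using q unfolding H_def by blast
    show False using vH[OF qu t(2)] t(1) \<tau>01 by simp
  qed
  have BH': False if qu: "q \<in> B v" and q: "q \<in> H 0 \<tau>" for q
  proof -
    obtain s where s: "s \<in> cells" "s \<subseteq> side (edges T) e v" "q \<in> cell \<phi> s" using qu unfolding B_def S_def by blast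
    have "q \<in> cell \<phi> e" by (rule HE[OF q]) (use \<tau> in simp_all)
    then have "q \<in> cell \<phi> (s \<inter> e)" using cell_Int[OF s(1) cells_edge[OF e(2)]] s(3) by blast
    moreover have "s \<inter> e \<subseteq> {v}" using s(2) nv(2) unfolding e(1) by blast
    ultimately have qu: "q \<in> cell \<phi> {v}" using cell_subset_mono[of "s \<inter> e" "{v}" \<phi>] by blast
    obtain t where t: "t \<le> \<tau>" "q - (\<phi> u + t *\<^sub>R (\<phi> v - \<phi> u)) \<in> span {1}" using q unfolding H_def by blast
    show False using vH1[OF qu t(2)] t(1) \<tau>01 by simp
  qed
  have HH: "q - p \<in> span {1}" if q: "q \<in> H 0 \<tau>" "q \<in> H \<tau> 1" for q
  proof -
    obtain s where s: "s \<le> \<tau>" "q - (\<phi> u + s *\<^sub>R (\<phi> v - \<phi> u)) \<in> span {1}" using q(1) unfolding H_def by blast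
    obtain t where t: "\<tau> \<le> t" "q - (\<phi> u + t *\<^sub>R (\<phi> v - \<phi> u)) \<in> span {1}" using q(2) unfolding H_def by blast
    have "s = t" by (rule edge_parameter[OF E s(2) t(2)])
    then have "s = \<tau>" using s(1) t(1) by simp
    then show ?thesis using span_diff[OF s(2) \<tau>(3)] by simp
  qed
  have "C \<subseteq> (B u \<union> H 0 \<tau>) \<union> (B v \<union> H \<tau> 1)"
  proof
    fix q assume "q \<in> C"
    then have "q \<in> P" using C(2) unfolding Q by blast
    then obtain s where s: "s \<in> cells" "q \<in> cell \<phi> s" unfolding cover by blast
    show "q \<in> (B u \<union> H 0 \<tau>) \<union> (B v \<union> H \<tau> 1)"
    proof (cases "s = e")
      case True
      then obtain t where "0 \<le> t" "t \<le> 1" "q - (\<phi> u + t *\<^sub>R (\<phi> v - \<phi> u)) \<in> span {1}"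
        using s(2) unfolding e(1) True cell_edge_iff by blast
      then have "q \<in> H 0 \<tau> \<or> q \<in> H \<tau> 1" unfolding H_def by (cases "t \<le> \<tau>") auto
      then show ?thesis by blast
    next
      case False
      from s(1) have "s \<subseteq> side (edges T) e u \<or> s \<subseteq> side (edges T) e v"
      proof (rule cells_cases)
        fix x assume x: "x \<in> inner_verts T" "s = {x}"
        then have "x \<in> verts T" unfolding inner_verts_def by simp
        from side_cover[OF Ee this] show ?thesis unfolding x(2) e(1) by simp
      next
        fix x y assume xy: "{x, y} \<in> internal_edges T" "s = {x, y}"
        have "x \<in> verts T" using inner_edge(1)[OF xy(1)] unfolding inner_verts_def by simp
        from side_cover[OF Ee this] have "x \<in> side (edges T) e u \<or> x \<in> side (edges T) e v" unfolding e(1) .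
        moreover have "x \<in> side (edges T) e a \<longleftrightarrow> y \<in> side (edges T) e a" for a
          by (rule side_step[OF inner_edge(4)[OF xy(1)]]) (use False xy(2) in simp)
        ultimately show ?thesis unfolding xy(2) by simp
      qed
      then show ?thesis using s unfolding B_def S_def by blast
    qed
  qed
  moreover have "(B u \<union> H 0 \<tau>) \<inter> (B v \<union> H \<tau> 1) \<inter> C = {}"
  proof (rule ccontr)
    assume "\<not> ?thesis"
    then obtain q where q: "q \<in> B u \<or> q \<in> H 0 \<tau>" "q \<in> B v \<or> q \<in> H \<tau> 1" "q \<in> C" by blast
    have "q - p \<in> span {1}" using q(1,2) BB[of q] BH[of q] BH'[of q] HH[of q] by blast
    then show False using q(3) C(2) unfolding Q by blast
  qed
  moreover have "loc k \<in> B u" using leaf_side_cell[of u k] k unfolding B_def S_def by blast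
  moreover have "loc l \<in> B v" using leaf_side_cell[of v l] l unfolding B_def S_def by blast
  moreover have "closed (B u \<union> H 0 \<tau>)" "closed (B v \<union> H \<tau> 1)" by (intro closed_Un clB clH)+
  ultimately show False
    using connected_closedD[OF C(1), of "B u \<union> H 0 \<tau>" "B v \<union> H \<tau> 1"] C(3,4) by blast
qed

lemma same_component_iff: "(k, l) \<in> same_component T e \<longleftrightarrow> connected_component Q (loc k) (loc l)"
proof
  show "connected_component Q (loc k) (loc l) \<Longrightarrow> (k, l) \<in> same_component T e"
  proof (rule ccontr)
    assume cc: "connected_component Q (loc k) (loc l)" and "(k, l) \<notin> same_component T e"
    have Ee: "{u, v} \<in> edges T" using e internal_edge_edge by simp
    have n: "\<not> (leaf T k \<in> side (edges T) {u, v} u \<longleftrightarrow> leaf T l \<in> side (edges T) {u, v} u)"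
      using \<open>(k, l) \<notin> same_component T e\<close> unfolding e(1) same_component_side[OF Ee] label_side_def by simp
    have c: "leaf T m \<in> side (edges T) e v" if "leaf T m \<notin> side (edges T) {u, v} u" for m
      using that side_compl[OF Ee leaf_verts(1)] unfolding e(1) by blast
    from n consider "leaf T k \<in> side (edges T) e u" "leaf T l \<in> side (edges T) e v" |
      "leaf T l \<in> side (edges T) e u" "leaf T k \<in> side (edges T) e v" using c unfolding e(1) by blast
    then show False
    proof cases
      case 1
      from separated[OF this] cc show False by blast
    next
      case 2
      from separated[OF this] connected_component_sym[OF cc] show False by blast
    qed
  qed
qed (rule same_component_connected)

text \<open>The right hand side mentions neither the tree nor its embedding, only the hull, the
  point removed and the positions of the labels.\<close>

lemma split_of_component: "split_of T e = UNIV // {(k, l). connected_component Q (loc k) (loc l)}"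
proof -
  have "same_component T e = {(k, l). connected_component Q (loc k) (loc l)}" using same_component_iff by auto
  then show ?thesis unfolding split_of_def by simp
qed

end

end

text \<open>Only finitely many points of an edge of \<open>T1\<close> are vertices of
  \<open>T2\<close>. Any other interior point is also interior to an edge of \<open>T2\<close>, and
  both edges have the split given by the components left when that point is removed.\<close>

lemma splits_mono:
  assumes T1: "embedded_tree T1 \<phi>1 P loc" and T2: "embedded_tree T2 \<phi>2 P loc"
  shows "splits T1 \<subseteq> splits T2"
proof
  interpret T1: embedded_tree T1 \<phi>1 P loc by (rule T1)
  interpret T2: embedded_tree T2 \<phi>2 P loc by (rule T2)
  fix S assume "S \<in> splits T1"
  then obtain e where e: "e \<in> internal_edges T1" "S = split_of T1 e" unfolding splits_def by blast
  obtain u v where uv: "e = {u, v}" using T1.edge_obtain[OF T1.internal_edge_edge[OF e(1)]] by blast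
  have E: "{u, v} \<in> internal_edges T1" using e(1) unfolding uv .
  let ?q = "\<lambda>t. \<phi>1 u + t *\<^sub>R (\<phi>1 v - \<phi>1 u)"
  have one: "t = t'" if "?q t \<in> cell \<phi>2 {x}" "?q t' \<in> cell \<phi>2 {x}" for t t' x
  proof (rule T1.edge_parameter[OF E])
    show "?q t - ?q t \<in> span {1}" by (simp add: span_zero)
    show "?q t - ?q t' \<in> span {1}" using span_diff[OF that[unfolded cell_single]] by simp
  qed
  have "finite {t. ?q t \<in> cell \<phi>2 {x}}" for x
  proof (rule finite_subset)
    show "{t. ?q t \<in> cell \<phi>2 {x}} \<subseteq> {SOME t. ?q t \<in> cell \<phi>2 {x}}"
    proof
      fix t assume t: "t \<in> {t. ?q t \<in> cell \<phi>2 {x}}"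
      then have "?q (SOME t. ?q t \<in> cell \<phi>2 {x}) \<in> cell \<phi>2 {x}" by (intro someI[of "\<lambda>t. ?q t \<in> cell \<phi>2 {x}" t]) simp
      from one[OF _ this, of t] t show "t \<in> {SOME t. ?q t \<in> cell \<phi>2 {x}}" by simp
    qed
  qed simp
  moreover have "finite (inner_verts T2)" unfolding inner_verts_def using T2.finite_V by simp
  ultimately have fin: "finite (\<Union>x\<in>inner_verts T2. {t. ?q t \<in> cell \<phi>2 {x}})" by (intro finite_UN_I)
  have "infinite {0<..<1 :: real}" by simp
  then have "\<not> {0<..<1} \<subseteq> (\<Union>x\<in>inner_verts T2. {t. ?q t \<in> cell \<phi>2 {x}})" using fin finite_subset by blast
  then obtain t where t0: "t \<in> {0<..<1}" and t1: "t \<notin> (\<Union>x\<in>inner_verts T2. {t. ?q t \<in> cell \<phi>2 {x}})" by blast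
  have t: "0 < t" "t < 1" using t0 by simp_all
  have nt: "?q t \<notin> cell \<phi>2 {x}" if "x \<in> inner_verts T2" for x using t1 that by simp
  define p where "p = ?q t"
  have pe: "p \<in> cell \<phi>1 e" unfolding uv T1.cell_edge_iff p_def by (rule exI[of _ t]) (use t in \<open>simp add: span_zero\<close>)
  have pu: "p \<notin> cell \<phi>1 {u}"
  proof
    assume "p \<in> cell \<phi>1 {u}"
    then have "t = 0" by (intro T1.edge_parameter[OF E, of p]) (simp_all add: p_def cell_single span_zero)
    then show False using t by simp
  qed
  have pv: "p \<notin> cell \<phi>1 {v}"
  proof
    assume "p \<in> cell \<phi>1 {v}"
    then have "t = 1" by (intro T1.edge_parameter[OF E, of p]) (simp_all add: p_def cell_single span_zero)
    then show False using t by simp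
  qed
  have "p \<in> P" unfolding T1.cover using T1.cells_edge[OF e(1)] pe by blast
  then obtain s where s: "s \<in> T2.cells" "p \<in> cell \<phi>2 s" unfolding T2.cover by blast
  from s(1) show "S \<in> splits T2"
  proof (rule T2.cells_cases)
    fix x assume "x \<in> inner_verts T2" "s = {x}"
    then show ?thesis using nt[of x] s(2) unfolding p_def by simp
  next
    fix a b assume ab: "{a, b} \<in> internal_edges T2" "s = {a, b}"
    have n: "p \<notin> cell \<phi>2 {a}" "p \<notin> cell \<phi>2 {b}"
      using nt[OF T2.inner_edge(1)[OF ab(1)]] nt[OF T2.inner_edge(2)[OF ab(1)]] unfolding p_def by simp_all
    have "split_of T2 s = split_of T1 e"
      using T1.split_of_component[OF uv e(1) pe pu pv refl]
        T2.split_of_component[OF ab(2) ab(1)[folded ab(2)] s(2) n refl] by simp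
    then show ?thesis unfolding splits_def e(2) using ab by (metis image_eqI)
  qed
qed

context weighted_tree
begin

theorem splits_unique: assumes T': "is_tree_of A T'" shows "splits T' = (\<lambda>X. {X, - X}) ` U"
proof -
  let ?loc = "case_sum (\<lambda>i. column i A) \<rho>"
  have emb: "\<exists>\<phi>'. embedded_tree T'' \<phi>' (trop_hull A) ?loc" if T'': "is_tree_of A T''" for T''
  proof -
    obtain \<phi>' \<rho>' where lt: "labelled_tree T''" and em: "embeds_onto T'' \<phi>' (trop_hull A)"
      and \<rho>': "balanced_rays (trop_hull A) \<rho>'"
      and l1: "\<forall>i v. {leaf T'' (Inl i), v} \<in> edges T'' \<longrightarrow> \<phi>' v - column i A \<in> span {1}"
      and l2: "\<forall>j v. {leaf T'' (Inr j), v} \<in> edges T'' \<longrightarrow> \<phi>' v - \<rho>' j \<in> span {1}"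
      using T'' unfolding is_tree_of_def by blast
    have "\<phi>' v - ?loc l \<in> span {1}" if lv: "{leaf T'' l, v} \<in> edges T''" for l v
    proof (cases l)
      case (Inl i) then show ?thesis using l1 lv by simp
    next
      case (Inr j)
      then have "\<phi>' v - \<rho>' j \<in> span {1}" using l2 lv by simp
      from span_add[OF this rays_unique[OF \<rho>', of j]] show ?thesis unfolding Inr by simp
    qed
    then have "embedded_tree T'' \<phi>' (trop_hull A) ?loc" by unfold_locales (use lt em card2 in simp_all)
    then show ?thesis by blast
  qed
  obtain \<phi>1 where 1: "embedded_tree T' \<phi>1 (trop_hull A) ?loc" using emb[OF T'] by blast
  obtain \<phi>2 where 2: "embedded_tree (T edge_len) \<phi>2 (trop_hull A) ?loc" using emb[OF is_tree_of_T] by blast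
  show ?thesis unfolding splits_T[of edge_len, symmetric] by (rule equalityI[OF splits_mono[OF 1 2] splits_mono[OF 2 1]])
qed

end

section \<open>The fan\<close>

definition orbit :: "('n + 'n) set \<Rightarrow> 'n split set" where
  "orbit X = symmetry_class {X, - X}"

lemma swap_split_pair: "swap_split {X, - X} = {swap_label ` X, - (swap_label ` X)}"
  unfolding swap_split_def by simp

lemma Union_orbit: "\<Union> (orbit X) = {X, - X, swap_label ` X, - (swap_label ` X)}"
  unfolding orbit_def symmetry_class_def swap_split_pair by auto

lemma orbit_compl [simp]: "orbit (- X) = orbit X"
  unfolding orbit_def by (simp add: insert_commute)

lemma orbit_swap [simp]: "orbit (swap_label ` X) = orbit X"
  unfolding orbit_def symmetry_class_def swap_split_pair by (simp add: insert_commute)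

lemma mem_orbit_iff: "Y \<in> \<Union> (orbit X) \<longleftrightarrow> orbit Y = orbit X"
proof
  assume "Y \<in> \<Union> (orbit X)"
  then consider "Y = X" | "Y = - X" | "Y = swap_label ` X" | "Y = - (swap_label ` X)" unfolding Union_orbit by blast
  then show "orbit Y = orbit X" by cases simp_all
next
  assume "orbit Y = orbit X"
  then show "Y \<in> \<Union> (orbit X)" unfolding Union_orbit[symmetric] using Union_orbit[of Y] by simp
qed

lemma Delta_face_pairs: "Delta_face ((\<lambda>X. {X, - X}) ` U) = orbit ` U"
  unfolding Delta_face_def image_image orbit_def ..

lemma symbic_systemD:
  assumes "symbic_system U"
  shows "side_system U" "X \<in> U \<Longrightarrow> - X \<in> U" "X \<in> U \<Longrightarrow> swap_label ` X \<in> U"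
proof -
  show U: "side_system U" using assms unfolding symbic_system_def by simp
  show "X \<in> U \<Longrightarrow> - X \<in> U" by (rule side_systemD(1)[OF U])
  show "X \<in> U \<Longrightarrow> swap_label ` X \<in> U" using assms unfolding symbic_system_def by simp
qed

lemma orbit_mem_iff:
  assumes "symbic_system U" shows "orbit X \<in> orbit ` U \<longleftrightarrow> X \<in> U"
proof
  assume "orbit X \<in> orbit ` U"
  then obtain Y where Y: "Y \<in> U" "orbit X = orbit Y" by (rule imageE)
  then have "X \<in> {Y, - Y, swap_label ` Y, - (swap_label ` Y)}" using mem_orbit_iff[of X Y] unfolding Union_orbit by simp
  then show "X \<in> U" using Y(1) symbic_systemD(2,3)[OF assms] by blast
qed (rule imageI)

lemma orbit_image_inject:
  assumes "symbic_system U" "symbic_system V" "orbit ` U = orbit ` V" shows "U = V"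
  by (rule set_eqI) (simp only: orbit_mem_iff[OF assms(1), symmetric] orbit_mem_iff[OF assms(2), symmetric] assms(3))

text \<open>Compatibility and the absence of tripods pass to subsets, and keeping whole orbits
  preserves the closure under complement and swap.\<close>

lemma symbic_subsystem:
  assumes U: "symbic_system U" and s: "s \<subseteq> orbit ` U"
  shows "symbic_system {X. orbit X \<in> s}" "orbit ` {X. orbit X \<in> s} = s"
proof -
  have sub: "{X. orbit X \<in> s} \<subseteq> U" using s orbit_mem_iff[OF U] by blast
  have "side_system {X. orbit X \<in> s}"
    using symbic_systemD(1)[OF U] subsetD[OF sub] unfolding side_system_def by simp
  moreover have "no_tripod {X. orbit X \<in> s}"
    unfolding no_tripod_def
  proof (intro ballI impI)
    fix X Y Z assume X: "X \<in> {X. orbit X \<in> s}" and Y: "Y \<in> {X. orbit X \<in> s}" and Z: "Z \<in> {X. orbit X \<in> s}"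
      and f: "swap_label ` X = X" "swap_label ` Y = Y" "swap_label ` Z = Z"
    have t: "no_tripod U" using U unfolding symbic_system_def by simp
    show "\<not> (X \<inter> Y = {} \<and> X \<inter> Z = {} \<and> Y \<inter> Z = {})"
      by (rule t[unfolded no_tripod_def, THEN bspec, THEN bspec, THEN bspec, THEN mp, THEN mp, THEN mp,
            OF subsetD[OF sub X] subsetD[OF sub Y] subsetD[OF sub Z] f])
  qed
  ultimately show "symbic_system {X. orbit X \<in> s}" unfolding symbic_system_def by simp
  show "orbit ` {X. orbit X \<in> s} = s" using s by auto
qed

text \<open>The ray generator of a vertex of the complex: the matrix of the system consisting of one
  orbit of sides, all of weight 1.\<close>

definition orbit_matrix :: "'n split set \<Rightarrow> real ^ 'n::finite ^ 'n" where
  "orbit_matrix o' = (\<chi> i j. (\<Sum>X\<in>\<Union> o'. of_bool (Inl i \<in> X) * of_bool (Inr j \<in> X)) / 2)"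

lemma orbit_matrix_sum:
  fixes U :: "('n::finite + 'n) set set"
  assumes U: "symbic_system U"
  shows "(\<Sum>o'\<in>orbit ` U. c o' *\<^sub>R orbit_matrix o') $ i $ j = gram U (\<lambda>X. c (orbit X)) i j"
proof -
  let ?g = "\<lambda>X :: ('n + 'n) set. of_bool (Inl i \<in> X) * of_bool (Inr j \<in> X) :: real"
  have fin: "finite U" by (rule finite_subset[of _ UNIV]) auto
  have "(\<Sum>X\<in>U. c (orbit X) * ?g X) = (\<Sum>o'\<in>orbit ` U. \<Sum>X\<in>{X \<in> U. orbit X = o'}. c (orbit X) * ?g X)"
    by (rule sum.image_gen[OF fin])
  also have "\<dots> = (\<Sum>o'\<in>orbit ` U. c o' * (\<Sum>X\<in>\<Union> o'. ?g X))"
  proof (rule sum.cong[OF refl])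
    fix o' assume "o' \<in> orbit ` U"
    then obtain Y where Y: "Y \<in> U" "o' = orbit Y" by blast
    have "{X \<in> U. orbit X = o'} = \<Union> o'"
    proof (rule set_eqI)
      fix X
      have "X \<in> U" if "orbit X = o'" using orbit_mem_iff[OF U, of X] Y that by blast
      then show "X \<in> {X \<in> U. orbit X = o'} \<longleftrightarrow> X \<in> \<Union> o'" using mem_orbit_iff[of X Y] Y(2) by blast
    qed
    then show "(\<Sum>X\<in>{X \<in> U. orbit X = o'}. c (orbit X) * ?g X) = c o' * (\<Sum>X\<in>\<Union> o'. ?g X)"
      unfolding sum_distrib_left by (intro sum.cong) auto
  qed
  finally have "(\<Sum>o'\<in>orbit ` U. c o' * (\<Sum>X\<in>\<Union> o'. ?g X)) / 2 = gram U (\<lambda>X. c (orbit X)) i j"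
    unfolding gram_def by (simp add: mult.assoc)
  then show ?thesis by (simp add: orbit_matrix_def sum_divide_distrib)
qed

lemma gram_symmetric:
  fixes U :: "('n::finite + 'n) set set"
  assumes U: "symbic_system U" and w: "\<And>X. X \<in> U \<Longrightarrow> w (swap_label ` X) = w X"
  shows "gram U w i j = gram U w j i"
proof -
  have "(\<Sum>X\<in>U. w X * of_bool (Inl i \<in> X) * of_bool (Inr j \<in> X)) = (\<Sum>X\<in>U. w X * of_bool (Inl j \<in> X) * of_bool (Inr i \<in> X))"
    by (rule sum.reindex_bij_witness[of _ "(`) swap_label" "(`) swap_label"]) (simp_all add: symbic_systemD(3)[OF U] w)
  then show ?thesis unfolding gram_def by simp
qed

section \<open>The linear space, cross differences and open cones\<close>

lemma subspace_lineality: "subspace (lineality :: (real ^ 'n ^ 'n) set)"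
  unfolding subspace_def
proof (intro conjI ballI allI)
  show "0 \<in> (lineality :: (real ^ 'n ^ 'n) set)" unfolding lineality_def by (intro CollectI exI[of _ 0]) simp
  fix A :: "real ^ 'n ^ 'n" and c :: real assume "A \<in> lineality"
  then obtain X :: "real ^ 'n" where X: "\<forall>i j. A $ i $ j = X $ i + X $ j" unfolding lineality_def by auto
  show "c *\<^sub>R A \<in> lineality" unfolding lineality_def
    by (intro CollectI exI[of _ "c *\<^sub>R X"]) (simp add: X algebra_simps)
  fix B :: "real ^ 'n ^ 'n" assume "B \<in> lineality"
  then obtain Y :: "real ^ 'n" where Y: "\<forall>i j. B $ i $ j = Y $ i + Y $ j" unfolding lineality_def by auto
  show "A + B \<in> lineality" unfolding lineality_def
    by (intro CollectI exI[of _ "X + Y"]) (simp add: X Y)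
qed

lemma lineality_cross:
  fixes A B :: "real ^ 'n ^ 'n"
  assumes "A - B \<in> lineality"
  shows "cross (\<lambda>i j. A $ i $ j) i j k l = cross (\<lambda>i j. B $ i $ j) i j k l"
proof -
  obtain X :: "real ^ 'n" where "\<forall>i j. (A - B) $ i $ j = X $ i + X $ j" using assms unfolding lineality_def by auto
  then have "A $ i $ j = B $ i $ j + X $ i + X $ j" for i j by (simp add: algebra_simps)
  then show ?thesis unfolding cross_def by simp
qed

text \<open>The cross difference at \<open>i\<close>, \<open>j\<close>, \<open>j\<close>,
  \<open>i\<close> compares twice an off-diagonal entry with two diagonal ones, so half the diagonal
  of \<open>A - B\<close> is the required vector.\<close>

lemma lineality_iff_cross:
  fixes A B :: "real ^ 'n ^ 'n"
  assumes "\<And>i j. A $ i $ j = A $ j $ i" "\<And>i j. B $ i $ j = B $ j $ i"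
    and c: "\<And>i j k l. cross (\<lambda>i j. A $ i $ j) i j k l = cross (\<lambda>i j. B $ i $ j) i j k l"
  shows "A - B \<in> lineality"
proof -
  have "(A - B) $ i $ j = (\<chi> i. (A - B) $ i $ i / 2) $ i + (\<chi> i. (A - B) $ i $ i / 2) $ j" for i j
    using c[of i j j i] assms(1)[of i j] assms(2)[of i j] unfolding cross_def by (simp add: field_simps)
  then show ?thesis unfolding lineality_def by blast
qed

lemma Delta_faces_eq: "Delta_faces = (\<lambda>U. orbit ` U) ` {U :: ('n::finite + 'n) set set. symbic_system U}"
  unfolding Delta_faces_def combinatorial_symbic_trees_eq image_image Delta_face_pairs ..

lemma orbit_weighting:
  assumes U: "symbic_system U" and c: "\<forall>o'\<in>orbit ` U. c o' > 0"
  shows "weighting U (\<lambda>X. c (orbit X))"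
  using c unfolding weighting_def by simp

interpretation orbits: unique_cone_family "lineality :: (real ^ 'n::finite ^ 'n) set" orbit_matrix Delta_faces
proof
  show "subspace (lineality :: (real ^ 'n ^ 'n) set)" by (rule subspace_lineality)
  show "finite (Delta_faces :: 'n split set set set)" by simp
  show "finite s" for s :: "'n split set set" by simp
  show "t \<in> Delta_faces" if s: "s \<in> Delta_faces" and ts: "t \<subseteq> s" for s t :: "'n split set set"
  proof -
    obtain U where U: "symbic_system U" "s = orbit ` U" using s unfolding Delta_faces_eq by blast
    have "symbic_system {X. orbit X \<in> t}" "orbit ` {X. orbit X \<in> t} = t"
      using symbic_subsystem[OF U(1), of t] ts unfolding U(2) by simp_all
    then show ?thesis unfolding Delta_faces_eq by blast
  qed
  fix s t :: "'n split set set" and c d :: "'n split set \<Rightarrow> real"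
  assume s: "s \<in> Delta_faces" and t: "t \<in> Delta_faces" and c: "\<forall>i\<in>s. 0 < c i" and d: "\<forall>i\<in>t. 0 < d i"
    and L: "(\<Sum>i\<in>s. c i *\<^sub>R orbit_matrix i) - (\<Sum>i\<in>t. d i *\<^sub>R orbit_matrix i) \<in> lineality"
  obtain U where U: "symbic_system U" "s = orbit ` U" using s unfolding Delta_faces_eq by blast
  obtain V where V: "symbic_system V" "t = orbit ` V" using t unfolding Delta_faces_eq by blast
  have eq: "cross (gram U (\<lambda>X. c (orbit X))) i j k l = cross (gram V (\<lambda>X. d (orbit X))) i j k l" for i j k l
    using lineality_cross[OF L, of i j k l] unfolding U(2) V(2) orbit_matrix_sum[OF U(1)] orbit_matrix_sum[OF V(1)] .
  note wU = orbit_weighting[OF U(1) c[unfolded U(2)]] and wV = orbit_weighting[OF V(1) d[unfolded V(2)]]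
  note un = gram_unique[OF symbic_systemD(1)[OF U(1)] wU symbic_systemD(1)[OF V(1)] wV eq]
  show "s = t \<and> (\<forall>i\<in>s. c i = d i)"
    unfolding U(2) V(2) un(1)[symmetric] ball_simps(9) by (intro conjI refl ballI un(2))
qed

lemma open_cone_iff:
  fixes A :: "real ^ 'n::finite ^ 'n"
  assumes U: "symbic_system U"
  shows "A \<in> orbits.open_cone (orbit ` U) \<longleftrightarrow> (\<forall>i j. A $ i $ j = A $ j $ i) \<and>
    (\<exists>w. weighting U w \<and> (\<forall>X\<in>U. w (swap_label ` X) = w X) \<and>
      (\<forall>i j k l. cross (\<lambda>i j. A $ i $ j) i j k l = cross (gram U w) i j k l))" (is "_ \<longleftrightarrow> ?R")
proof
  assume "A \<in> orbits.open_cone (orbit ` U)"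
  then obtain l c where A: "A = l + (\<Sum>o'\<in>orbit ` U. c o' *\<^sub>R orbit_matrix o')" and l: "l \<in> lineality" and c: "\<forall>o'\<in>orbit ` U. 0 < c o'"
    unfolding orbits.open_cone_def by blast
  obtain X :: "real ^ 'n" where X: "\<forall>i j. l $ i $ j = X $ i + X $ j" using l unfolding lineality_def by auto
  let ?w = "\<lambda>X. c (orbit X)"
  have Ag: "A $ i $ j = X $ i + X $ j + gram U ?w i j" for i j
    unfolding A vector_add_component orbit_matrix_sum[OF U] using X by simp
  have "A $ i $ j = A $ j $ i" for i j unfolding Ag using gram_symmetric[OF U, of ?w i j] by simp
  moreover have "cross (\<lambda>i j. A $ i $ j) i j k l = cross (gram U ?w) i j k l" for i j k l unfolding cross_def Ag by simp
  moreover have "weighting U ?w" by (rule orbit_weighting[OF U c])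
  ultimately show ?R by (intro conjI allI exI[of _ ?w] ballI) simp_all
next
  assume ?R
  then obtain w where sym: "\<And>i j. A $ i $ j = A $ j $ i" and w: "weighting U w" "\<And>X. X \<in> U \<Longrightarrow> w (swap_label ` X) = w X"
    and eq: "\<And>i j k l. cross (\<lambda>i j. A $ i $ j) i j k l = cross (gram U w) i j k l" by blast
  \<comment> \<open>The weights are constant on orbits, so the weight of any representative will
    do.\<close>
  define c where "c = (\<lambda>o'. w (SOME X. orbit X = o'))"
  have c: "c (orbit X) = w X" if X: "X \<in> U" for X
  proof -
    have "orbit (SOME Y. orbit Y = orbit X) = orbit X" by (rule someI[of "\<lambda>Y. orbit Y = orbit X" X]) simp
    then have "(SOME Y. orbit Y = orbit X) \<in> {X, - X, swap_label ` X, - (swap_label ` X)}"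
      unfolding Union_orbit[symmetric] mem_orbit_iff .
    moreover have "w (- X) = w X" "w (swap_label ` X) = w X" "w (- (swap_label ` X)) = w X"
      using w(2)[OF X] weightingD(2)[OF w(1)] X symbic_systemD(3)[OF U X] by simp_all
    ultimately show ?thesis unfolding c_def by auto
  qed
  let ?B = "\<Sum>o'\<in>orbit ` U. c o' *\<^sub>R orbit_matrix o'"
  have B: "?B $ i $ j = gram U w i j" for i j
    unfolding orbit_matrix_sum[OF U] gram_def by (simp add: c cong: sum.cong)
  have "A - ?B \<in> lineality"
  proof (rule lineality_iff_cross[OF sym])
    show "?B $ i $ j = ?B $ j $ i" for i j unfolding B by (rule gram_symmetric[OF U]) (rule w(2))
    show "cross (\<lambda>i j. A $ i $ j) i j k l = cross (\<lambda>i j. ?B $ i $ j) i j k l" for i j k l unfolding B eq ..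
  qed
  moreover have "A = (A - ?B) + ?B" by simp
  moreover have "\<forall>o'\<in>orbit ` U. 0 < c o'"
  proof
    fix o' assume "o' \<in> orbit ` U"
    then obtain X where "X \<in> U" "o' = orbit X" by blast
    then show "0 < c o'" using c weightingD(1)[OF w(1)] by simp
  qed
  ultimately show "A \<in> orbits.open_cone (orbit ` U)" by (intro orbits.open_coneI)
qed

lemma sym_trop_rank2_open_cones:
  "(sym_trop_rank2 :: (real ^ 'n::finite ^ 'n) set) = (\<Union>s\<in>Delta_faces. orbits.open_cone s)"
proof (rule set_eqI)
  fix A :: "real ^ 'n ^ 'n"
  have "A \<in> (\<Union>s\<in>Delta_faces. orbits.open_cone s) \<longleftrightarrow> (\<exists>U. symbic_system U \<and> A \<in> orbits.open_cone (orbit ` U))"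
    unfolding Delta_faces_eq by simp
  also have "\<dots> \<longleftrightarrow> A \<in> sym_trop_rank2"
  proof
    assume "\<exists>U. symbic_system U \<and> A \<in> orbits.open_cone (orbit ` U)"
    then obtain U where U: "symbic_system U" "A \<in> orbits.open_cone (orbit ` U)" by blast
    from U(2)[unfolded open_cone_iff[OF U(1)]] U(1) show "A \<in> sym_trop_rank2" unfolding sym_trop_rank2_iff by blast
  next
    assume "A \<in> sym_trop_rank2"
    then obtain U w where sym: "\<forall>i j. A $ i $ j = A $ j $ i" and U: "symbic_system U"
      and w: "weighting U w" "\<forall>X\<in>U. w (swap_label ` X) = w X"
        "\<forall>i j k l. cross (\<lambda>i j. A $ i $ j) i j k l = cross (gram U w) i j k l"
      unfolding sym_trop_rank2_iff by blast
    have "A \<in> orbits.open_cone (orbit ` U)"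
      unfolding open_cone_iff[OF U] by (rule conjI[OF sym exI[of _ w]]) (intro conjI w)
    then show "\<exists>U. symbic_system U \<and> A \<in> orbits.open_cone (orbit ` U)" using U by blast
  qed
  finally show "A \<in> sym_trop_rank2 \<longleftrightarrow> A \<in> (\<Union>s\<in>Delta_faces. orbits.open_cone s)" ..
qed

lemma tree_of_weighting:
  fixes A :: "real ^ 'n::finite ^ 'n"
  assumes n: "CARD('n) \<ge> 2" and U: "side_system U" and w: "weighting U w" and sym: "\<And>i j. A $ i $ j = A $ j $ i"
    and eq: "\<And>i j k l. cross (\<lambda>i j. A $ i $ j) i j k l = cross (gram U w) i j k l"
  shows "\<exists>T. is_tree_of A T" "is_tree_of A T \<Longrightarrow> splits T = (\<lambda>X. {X, - X}) ` U"
proof -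
  obtain enc :: "('n + 'n) set set \<Rightarrow> nat" where enc: "inj enc" using ex_inj_nat by blast
  obtain k :: 'n where True by blast
  \<comment> \<open>The matrix minus \<open>gram U w\<close> has vanishing cross differences, so it
    is a function of the row plus a function of the column; these are read off from column
    \<open>k\<close> and row \<open>k\<close>, with the entry at \<open>k\<close>, \<open>k\<close>
    counted once.\<close>
  define f where "f = (\<lambda>i. A $ i $ k - gram U w i k)"
  define g where "g = (\<lambda>j. A $ k $ j - gram U w k j - A $ k $ k + gram U w k k)"
  have "A $ i $ j = f i + g j + gram U w i j" for i j
    using eq[of i j k k] unfolding f_def g_def cross_def by simp
  then interpret weighted_tree U enc w A f g
    by unfold_locales (use U enc w sym n in simp_all)
  show "\<exists>T. is_tree_of A T" using is_tree_of_T by blast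
  show "is_tree_of A T \<Longrightarrow> splits T = (\<lambda>X. {X, - X}) ` U" by (rule splits_unique)
qed

text \<open>A matrix in the first set lies in the open cone of its own system \<open>V\<close>. All
  its trees have the splits of \<open>V\<close>, and one of them has those of \<open>U\<close>, so
  the two systems span the same face.\<close>

lemma C_cone_eq:
  assumes n: "CARD('n::finite) \<ge> 2" and U: "symbic_system (U :: ('n + 'n) set set)"
  shows "C_cone ((\<lambda>X. {X, - X}) ` U) = orbits.open_cone (orbit ` U)"
proof (intro equalityI subsetI)
  fix A :: "real ^ 'n ^ 'n" assume "A \<in> C_cone ((\<lambda>X. {X, - X}) ` U)"
  then obtain T where A: "A \<in> sym_trop_rank2" and T: "is_tree_of A T" "splits T = (\<lambda>X. {X, - X}) ` U"
    unfolding C_cone_def by blast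
  obtain s where "s \<in> Delta_faces" "A \<in> orbits.open_cone s" using A unfolding sym_trop_rank2_open_cones by blast
  then obtain V where V: "symbic_system V" and AV: "A \<in> orbits.open_cone (orbit ` V)" unfolding Delta_faces_eq by blast
  from AV[unfolded open_cone_iff[OF V]] obtain w where sym: "\<And>i j. A $ i $ j = A $ j $ i" and w: "weighting V w"
    "\<And>i j k l. cross (\<lambda>i j. A $ i $ j) i j k l = cross (gram V w) i j k l" by blast
  have "(\<lambda>X. {X, - X}) ` V = (\<lambda>X. {X, - X}) ` U"
    using tree_of_weighting(2)[OF n symbic_systemD(1)[OF V] w(1) sym w(2) T(1)] T(2) by simp
  then have "orbit ` V = orbit ` U" unfolding Delta_face_pairs[symmetric] by simp
  then show "A \<in> orbits.open_cone (orbit ` U)" using AV by simp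
next
  fix A :: "real ^ 'n ^ 'n" assume AU: "A \<in> orbits.open_cone (orbit ` U)"
  from AU[unfolded open_cone_iff[OF U]] obtain w where sym: "\<And>i j. A $ i $ j = A $ j $ i" and w: "weighting U w"
    "\<And>i j k l. cross (\<lambda>i j. A $ i $ j) i j k l = cross (gram U w) i j k l" by blast
  note T = tree_of_weighting[OF n symbic_systemD(1)[OF U] w(1) sym w(2)]
  obtain T where "is_tree_of A T" using T(1) by blast
  moreover from T(2)[OF this] have "splits T = (\<lambda>X. {X, - X}) ` U" .
  moreover have "A \<in> sym_trop_rank2" unfolding sym_trop_rank2_open_cones Delta_faces_eq using AU U by blast
  ultimately show "A \<in> C_cone ((\<lambda>X. {X, - X}) ` U)" unfolding C_cone_def by blast
qed

lemma closure_C_cone: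
  assumes n: "CARD('n::finite) \<ge> 2" and T: "\<T> \<in> (combinatorial_symbic_trees :: 'n split set set)"
  shows "closure (C_cone \<T>) = orbits.cone (Delta_face \<T>)"
proof -
  obtain U where U: "symbic_system U" "\<T> = (\<lambda>X. {X, - X}) ` U" using T unfolding combinatorial_symbic_trees_eq by blast
  have "orbit ` U \<in> Delta_faces" unfolding Delta_faces_eq using U(1) by blast
  then show ?thesis unfolding U(2) Delta_face_pairs C_cone_eq[OF n U(1)] by (rule orbits.closure_open_cone)
qed

lemma inj_on_Delta_face: "inj_on Delta_face (combinatorial_symbic_trees :: 'n::finite split set set)"
proof (rule inj_onI)
  fix \<T> \<T>' :: "'n split set" assume T: "\<T> \<in> combinatorial_symbic_trees" "\<T>' \<in> combinatorial_symbic_trees" "Delta_face \<T> = Delta_face \<T>'"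
  obtain U where U: "symbic_system U" "\<T> = (\<lambda>X. {X, - X}) ` U" using T(1) unfolding combinatorial_symbic_trees_eq by blast
  obtain V where V: "symbic_system V" "\<T>' = (\<lambda>X. {X, - X}) ` V" using T(2) unfolding combinatorial_symbic_trees_eq by blast
  have "U = V" by (rule orbit_image_inject[OF U(1) V(1)]) (use T(3) in \<open>simp only: U(2) V(2) Delta_face_pairs\<close>)
  then show "\<T> = \<T>'" unfolding U(2) V(2) by simp
qed

lemma Delta_complex: "abstract_simplicial_complex (Delta_vertices :: 'n::finite split set set) Delta_faces"
  unfolding abstract_simplicial_complex_def
proof (intro conjI ballI allI impI)
  fix s :: "'n split set set" assume "s \<in> Delta_faces"
  then show "s \<subseteq> Delta_vertices" unfolding Delta_faces_def Delta_vertices_def Delta_face_def by blast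
next
  have "(\<lambda>X. {X, - X}) ` {} \<in> (combinatorial_symbic_trees :: 'n split set set)"
    unfolding combinatorial_symbic_trees_eq symbic_system_def side_system_def no_tripod_def by (intro imageI) simp
  then show "{} \<in> (Delta_faces :: 'n split set set set)" unfolding Delta_faces_def Delta_face_def by force
next
  fix v :: "'n split set" assume "v \<in> Delta_vertices"
  then obtain s where "s \<in> Delta_faces" "v \<in> s" unfolding Delta_vertices_def Delta_faces_def Delta_face_def by blast
  then show "{v} \<in> Delta_faces" using orbits.down_closed[of s "{v}"] by simp
qed (simp_all add: orbits.down_closed)

theorem proposition3p4:
  assumes "CARD('n::finite) \<ge> 2"
  shows "abstract_simplicial_complex (Delta_vertices :: 'n split set set) Delta_faces \<and>
    (\<exists>\<F> :: (real ^ 'n ^ 'n) set set.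
       simplicial_fan_mod lineality \<F> \<and>
       \<Union>\<F> = sym_trop_rank2 \<and>
       bij_betw (\<lambda>\<T>. closure (C_cone \<T>)) (combinatorial_symbic_trees :: 'n split set set) \<F> \<and>
       (\<forall>\<T>\<in>combinatorial_symbic_trees. \<forall>\<T>'\<in>combinatorial_symbic_trees :: 'n split set set.
          Delta_face \<T> \<subseteq> Delta_face \<T>' \<longleftrightarrow> closure (C_cone \<T>) face_of closure (C_cone \<T>')))"
proof (intro conjI Delta_complex exI[of _ "orbits.cone ` (Delta_faces :: 'n split set set set)"] ballI)
  show "simplicial_fan_mod lineality (orbits.cone ` (Delta_faces :: 'n split set set set))" by (rule orbits.simplicial_fan)
  show "\<Union> (orbits.cone ` (Delta_faces :: 'n split set set set)) = sym_trop_rank2"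
    unfolding sym_trop_rank2_open_cones by (rule orbits.union_open_cones)
  have "bij_betw (\<lambda>\<T>. orbits.cone (Delta_face \<T>)) (combinatorial_symbic_trees :: 'n split set set) (orbits.cone ` Delta_faces)"
  proof (rule bij_betw_trans[unfolded comp_def, where f = Delta_face and g = orbits.cone])
    show "bij_betw Delta_face (combinatorial_symbic_trees :: 'n split set set) Delta_faces"
      unfolding Delta_faces_def by (rule inj_on_imp_bij_betw[OF inj_on_Delta_face])
    show "bij_betw orbits.cone (Delta_faces :: 'n split set set set) (orbits.cone ` Delta_faces)"
      by (rule inj_on_imp_bij_betw[OF orbits.inj_on_cone])
  qed
  then show "bij_betw (\<lambda>\<T>. closure (C_cone \<T>)) (combinatorial_symbic_trees :: 'n split set set) (orbits.cone ` Delta_faces)"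
    by (simp add: closure_C_cone[OF assms] cong: bij_betw_cong)
next
  fix \<T> \<T>' :: "'n split set" assume T: "\<T> \<in> combinatorial_symbic_trees" "\<T>' \<in> combinatorial_symbic_trees"
  then have "Delta_face \<T> \<in> Delta_faces" "Delta_face \<T>' \<in> Delta_faces" unfolding Delta_faces_def by simp_all
  from orbits.cone_face_of_iff[OF this]
  show "Delta_face \<T> \<subseteq> Delta_face \<T>' \<longleftrightarrow> closure (C_cone \<T>) face_of closure (C_cone \<T>')"
    unfolding closure_C_cone[OF assms T(1)] closure_C_cone[OF assms T(2)] by simp
qed

end
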